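(* Let $\Gamma$, $v$, $\Lambda=(\lambda_n)_{n\ge n_0}$ be as in the context, let $w$ be the Bessel weight sequence for $\Lambda$ with respect to $(\Gamma,v)$, and suppose $v_n/|\gamma_n|^2=o(P_n)$ as $n\to\infty$. Then $H_{(\Gamma,v);(\Lambda,w)}$ is invertible if and only if $\sup_nW_nP_n<\infty$ and one of the following holds: (0) $\Lambda$ is an exact $v$-perturbation of $\Gamma$ and there are positive constants $C,\delta$ such that $\varrho_m/\varrho_n\ge C(P_m/P_n)^{1-\delta}$ whenever $m>n$; (1) $\Lambda$ is a $v$-perturbation of $\Gamma$ of excess $1$ and there are positive constants $C,\delta$ such that $\varrho_m/\varrho_n\le C(P_m/P_n)^{1+\delta}$ whenever $m>n$.
   Context: $\Gamma=(\gamma_n)_{n\ge1}$ are distinct complex numbers with $\inf_n|\gamma_{n+1}|/|\gamma_n|>1$; $v=(v_n)$ positive with $\sum_nv_n/(1+|\gamma_n|^2)<\infty$. $\ell^2_u=\{(a_k):\sum|a_k|^2u_k<\infty\}$; $H_{(\Gamma,v)}a(z)=\sum_na_nv_n/(z-\gamma_n)$; $H_{(\Gamma,v);(\Lambda,w)}a=(H_{(\Gamma,v)}a(\lambda_n))_n$ from $\ell^2_v$ to $\ell^2_w$; invertible means bijective with bounded inverse. Bessel weight: $w_n=(\sum_kv_k/|\lambda_n-\gamma_k|^2)^{-1}$. $V_1=1$, $V_n=\sum_{j<n}v_j$; $P_n=\sum_{j>n}v_j/|\gamma_j|^2$; $W_n=\sum_{m=n_0}^{n-1}w_m$; $\varrho_n=\prod_{m=\max(1,n_0)}^n|\gamma_m|^2/|\lambda_m|^2$.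 $\Omega_1=\{|z|<(|\gamma_1|+|\gamma_2|)/2\}$, $\Omega_n=\{(|\gamma_{n-1}|+|\gamma_n|)/2\le|z|<(|\gamma_n|+|\gamma_{n+1}|)/2\}$ ($n\ge2$); $D_n(v;M)=\{\lambda\in\Omega_n: Mv_n/|\lambda-\gamma_n|^2\ge\max(V_n/|\lambda|^2,P_n)\}$. $\Lambda$ is a sequence of distinct nonzero complex numbers disjoint from $\Gamma$, indexed $(\lambda_n)_{n\ge n_0}$ by consecutive integers with $|\lambda_n|$ increasing. $\Lambda$ is a $v$-perturbation of $\Gamma$ if $n_0$ can be chosen so that for some sufficiently large $M$, $\lambda_n\in D_n(v;M)$ for all but finitely many $n$ (and the indexing uses this $n_0$); it is exact if $n_0=1$, of deficiency $n_0-1$ if $n_0>1$, of excess $1-n_0$ if $n_0<1$. *)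

theory Defs
  imports "HOL-Analysis.Analysis" "HOL-Library.Landau_Symbols"
begin

(* Gamma = (gamma_n)_{n>=1} : nat => complex (value at 0 irrelevant),
   v = (v_n)_{n>=1} : nat => real,
   Lambda = (lambda_n)_{n>=n0} : int => complex (values below n0 irrelevant). *)

definition V :: "(nat \<Rightarrow> real) \<Rightarrow> nat \<Rightarrow> real" where
  "V v n = (if n \<le> 1 then 1 else (\<Sum>j\<in>{1..<n}. v j))"

definition P :: "(nat \<Rightarrow> complex) \<Rightarrow> (nat \<Rightarrow> real) \<Rightarrow> nat \<Rightarrow> real" where
  "P \<gamma> v n = infsum (\<lambda>j. v j / (cmod (\<gamma> j))\<^sup>2) {n<..}"

definition Omega :: "(nat \<Rightarrow> complex) \<Rightarrow> nat \<Rightarrow> complex set" where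
  "Omega \<gamma> n = (if n = 1 then {z. cmod z < (cmod (\<gamma> 1) + cmod (\<gamma> 2)) / 2}
     else {z. (cmod (\<gamma> (n - 1)) + cmod (\<gamma> n)) / 2 \<le> cmod z \<and>
              cmod z < (cmod (\<gamma> n) + cmod (\<gamma> (n + 1))) / 2})"

definition D :: "(nat \<Rightarrow> complex) \<Rightarrow> (nat \<Rightarrow> real) \<Rightarrow> real \<Rightarrow> nat \<Rightarrow> complex set" where
  "D \<gamma> v M n = {z \<in> Omega \<gamma> n.
      M * v n / (cmod (z - \<gamma> n))\<^sup>2 \<ge> max (V v n / (cmod z)\<^sup>2) (P \<gamma> v n)}"

definition bessel_weight :: "(nat \<Rightarrow> complex) \<Rightarrow> (nat \<Rightarrow> real) \<Rightarrow> complex \<Rightarrow> real" where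
  "bessel_weight \<gamma> v z = inverse (infsum (\<lambda>k. v k / (cmod (z - \<gamma> k))\<^sup>2) {1..})"

definition W :: "(nat \<Rightarrow> complex) \<Rightarrow> (nat \<Rightarrow> real) \<Rightarrow> (int \<Rightarrow> complex) \<Rightarrow> int \<Rightarrow> int \<Rightarrow> real" where
  "W \<gamma> v lam n0 n = (\<Sum>m\<in>{n0..<n}. bessel_weight \<gamma> v (lam m))"

definition rho :: "(nat \<Rightarrow> complex) \<Rightarrow> (int \<Rightarrow> complex) \<Rightarrow> int \<Rightarrow> int \<Rightarrow> real" where
  "rho \<gamma> lam n0 n = (\<Prod>m\<in>{max 1 n0..n}. (cmod (\<gamma> (nat m)))\<^sup>2 / (cmod (lam m))\<^sup>2)"

definition is_indexing :: "complex set \<Rightarrow> (int \<Rightarrow> complex) \<Rightarrow> int \<Rightarrow> bool" where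
  "is_indexing L lam n0 \<longleftrightarrow> inj_on lam {n0..} \<and> lam ` {n0..} = L \<and>
     (\<forall>n m. n0 \<le> n \<longrightarrow> n \<le> m \<longrightarrow> cmod (lam n) \<le> cmod (lam m))"

definition v_perturbation :: "(nat \<Rightarrow> complex) \<Rightarrow> (nat \<Rightarrow> real) \<Rightarrow> (int \<Rightarrow> complex) \<Rightarrow> int \<Rightarrow> bool" where
  "v_perturbation \<gamma> v lam n0 \<longleftrightarrow>
     (\<exists>M. \<forall>\<^sub>F n in at_top. 1 \<le> n \<and> lam n \<in> D \<gamma> v M (nat n))"

definition l2w_nat :: "(nat \<Rightarrow> real) \<Rightarrow> (nat \<Rightarrow> complex) set" where
  "l2w_nat u = {a. (\<forall>k. k < 1 \<longrightarrow> a k = 0) \<and> (\<lambda>k. (cmod (a k))\<^sup>2 * u k) summable_on {1..}}"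

definition l2norm_nat :: "(nat \<Rightarrow> real) \<Rightarrow> (nat \<Rightarrow> complex) \<Rightarrow> real" where
  "l2norm_nat u a = sqrt (infsum (\<lambda>k. (cmod (a k))\<^sup>2 * u k) {1..})"

definition l2w_int :: "int \<Rightarrow> (int \<Rightarrow> real) \<Rightarrow> (int \<Rightarrow> complex) set" where
  "l2w_int n0 u = {b. (\<forall>n. n < n0 \<longrightarrow> b n = 0) \<and> (\<lambda>n. (cmod (b n))\<^sup>2 * u n) summable_on {n0..}}"

definition l2norm_int :: "int \<Rightarrow> (int \<Rightarrow> real) \<Rightarrow> (int \<Rightarrow> complex) \<Rightarrow> real" where
  "l2norm_int n0 u b = sqrt (infsum (\<lambda>n. (cmod (b n))\<^sup>2 * u n) {n0..})"

definition Hilb :: "(nat \<Rightarrow> complex) \<Rightarrow> (nat \<Rightarrow> real) \<Rightarrow> (nat \<Rightarrow> complex) \<Rightarrow> complex \<Rightarrow> complex" where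
  "Hilb \<gamma> v a z = infsum (\<lambda>k. a k * of_real (v k) / (z - \<gamma> k)) {1..}"

definition Hdisc :: "(nat \<Rightarrow> complex) \<Rightarrow> (nat \<Rightarrow> real) \<Rightarrow> (int \<Rightarrow> complex) \<Rightarrow> int \<Rightarrow>
    (nat \<Rightarrow> complex) \<Rightarrow> int \<Rightarrow> complex" where
  "Hdisc \<gamma> v lam n0 a = (\<lambda>n. if n0 \<le> n then Hilb \<gamma> v a (lam n) else 0)"

definition Hdisc_invertible :: "(nat \<Rightarrow> complex) \<Rightarrow> (nat \<Rightarrow> real) \<Rightarrow> (int \<Rightarrow> complex) \<Rightarrow> int \<Rightarrow>
    (int \<Rightarrow> real) \<Rightarrow> bool" where
  "Hdisc_invertible \<gamma> v lam n0 w \<longleftrightarrow>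
     bij_betw (Hdisc \<gamma> v lam n0) (l2w_nat v) (l2w_int n0 w) \<and>
     (\<exists>C. \<forall>a\<in>l2w_nat v. l2norm_nat v a \<le> C * l2norm_int n0 w (Hdisc \<gamma> v lam n0 a))"

end

theory Submission
  imports Defs "HOL-Complex_Analysis.Great_Picard"
begin

text \<open>The hypothesis \<open>v\<^sub>n/|\<gamma>\<^sub>n|\<^sup>2 = o(P\<^sub>n)\<close> makes \<open>P\<^sub>n\<close> vary subexponentially, while \<open>|\<gamma>\<^sub>n|\<close> grows
  geometrically; this isolates the diagonal terms of all sums involved.

  Necessity. If the transform is invertible, the principle of uniform boundedness, applied to the truncations of
  \<open>(1/\<gamma>\<^sub>k)\<close>, bounds \<open>W\<^sub>nP\<^sub>n\<close>. Solving small homogeneous linear systems one sees that the disc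
  through the gap between \<open>|\<gamma>\<^sub>N|\<close> and \<open>|\<gamma>\<^sub>N\<^sub>+\<^sub>1|\<close> contains \<open>N\<close> or \<open>N + 1\<close> points of
  \<open>\<Lambda>\<close>, and testing with unit vectors puts one of them in \<open>D\<^sub>N\<close>. Hence \<open>\<Lambda>\<close> is a perturbation of excess
  0 or 1. Testing the lower bound with the partial fractions of \<open>\<Prod>(z - \<lambda>\<^sub>n)/(z - \<gamma>\<^sub>n)\<close> gives
  \<open>\<Sum>\<^bsub>N<k\<le>M\<^esub> \<rho>\<^sub>k u\<^sub>k \<le> C(\<rho>\<^sub>M/P\<^sub>M + \<rho>\<^sub>N/P\<^sub>N)\<close>, where \<open>u\<^sub>k = |\<lambda>\<^sub>k - \<gamma>\<^sub>k|\<^sup>2/v\<^sub>k\<close> is comparable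
  to \<open>w\<^sub>k\<close>; summation by parts and a discrete Gronwall argument turn it into the power laws.

  Sufficiency. The finite sections of the transform are Cauchy matrices with explicit inverses. Their entries are
  dominated by a geometrically decaying kernel plus a kernel in \<open>P\<close> and \<open>w\<close> alone, both bounded by Schur's
  test; a diagonal subsequence of the solutions of the finite systems converges to a solution.\<close>

section \<open>Sums, Schur's test and partial fractions\<close>

text \<open>Write \<rho> for \<open>h^2\<close>. One step changes \<rho> by at most a relative
  amount \<open>sqrt (u p)\<close>, so Cauchy-Schwarz turns a bound on the sum of \<rho> u into
  control of the sum of \<rho> p / P^2, which is what the increments of \<rho> / P would be if
  \<rho> stood still. That sum and \<rho> / P bound each other, and Gronwall with ln P as time makes
  them powers of P; the gap \<delta> is the reciprocal of the Gronwall constant. The two cases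
  differ at the ends of the summation. In the exact case no point of \<Lambda> precedes level 1, so
  the inequality is summed from the start. For excess 1 it is summed to infinity, which needs \<rho>
  / P to tend to 0; this is extracted from the solvability of one interpolation problem at the extra
  point. Dually, the finite systems for excess 1 have N + 1 equations in N unknowns and are solved
  only up to an additive constant, which the power law forces to 0. The hypothesis on P is
  asymptotic while the conclusions are uniform, so comparisons are proved eventually and then
  extended to all indices at the price of a constant.\<close>

lemma geometric_bound:
  fixes y :: "nat \<Rightarrow> real"
  assumes pos: "\<And>n. y n > 0" and th: "\<theta> > 0"
    and ev: "\<forall>\<^sub>F n in sequentially. y (Suc n) \<le> \<theta> * y n"
  obtains C where "C > 0" "\<And>m n. m \<le> n \<Longrightarrow> y n \<le> C * \<theta> ^ (n - m) * y m"
proof -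
  obtain N0 where N0: "\<And>n. n \<ge> N0 \<Longrightarrow> y (Suc n) \<le> \<theta> * y n"
    using ev by (auto simp: eventually_sequentially)
  \<comment> \<open>Rescaling by \<theta>^n turns the eventual contraction into monotonicity from
    \<open>N0\<close> on; the ratio of the extreme values of \<open>z\<close> on the initial segment
    then serves all pairs of indices.\<close>
  define z where "z n = y n / \<theta> ^ n" for n
  have zpos: "z n > 0" for n using pos th by (simp add: z_def)
  have zdec: "z (Suc n) \<le> z n" if "n \<ge> N0" for n
    using N0[OF that] th by (simp add: z_def field_simps)
  have zdec': "z n \<le> z m" if "N0 \<le> m" "m \<le> n" for m n
    using that(2)
  proof (induction n rule: dec_induct)
    case (step n)
    thus ?case using zdec[of n] that(1) by linarith
  qed simp
  define b where "b = Max (z ` {..N0})"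
  define a where "a = Min (z ` {..N0})"
  have bz: "z i \<le> b" and az: "a \<le> z i" if "i \<le> N0" for i
    using that by (auto simp: a_def b_def)
  have apos: "a > 0" unfolding a_def using zpos by (subst Min_gr_iff) auto
  have "a \<le> b" using bz[of 0] az[of 0] by simp
  hence bpos: "b > 0" using apos by linarith
  have key: "z n \<le> b / a * z m" if "m \<le> n" for m n
  proof (cases "m \<ge> N0")
    case True
    have "z n \<le> z m" using zdec' True that by blast
    also have "\<dots> \<le> b / a * z m" using \<open>a \<le> b\<close> apos zpos[of m] by (simp add: mult_right_mono field_simps)
    finally show ?thesis .
  next
    case False
    have "z n \<le> b" using bz[of n] zdec'[of N0 n] bz[of N0] by (cases "n \<le> N0") auto
    also have "b = b / a * a" using apos by simp
    also have "\<dots> \<le> b / a * z m" using False az[of m] apos bpos by (intro mult_left_mono) auto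
    finally show ?thesis .
  qed
  show thesis
  proof (rule that[of "b / a"])
    show "b / a > 0" using apos bpos by simp
    show "y n \<le> b / a * \<theta> ^ (n - m) * y m" if "m \<le> n" for m n
    proof -
      have "\<theta> ^ n = \<theta> ^ (n - m) * \<theta> ^ m" using that by (simp flip: power_add)
      moreover have "y n / \<theta> ^ n \<le> b / a * (y m / \<theta> ^ m)" using key[OF that] by (simp add: z_def)
      hence "y n / \<theta> ^ n * \<theta> ^ n \<le> b / a * (y m / \<theta> ^ m) * \<theta> ^ n"
        using th by (intro mult_right_mono) auto
      ultimately show ?thesis using th by (simp add: field_simps)
    qed
  qed
qed

text \<open>Writing \<open>T x\<close> as \<open>sqrt (T \<beta>)\<close> times
  \<open>sqrt (T / \<beta>) x\<close> and applying Cauchy-Schwarz in each row spends the row bound;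
  after exchanging the sums the column bound does the rest. The free test functions \<alpha>,
  \<beta> will absorb square roots of weights and powers of \<open>P\<close>.\<close>

lemma schur_test:
  fixes T :: "'i \<Rightarrow> 'j \<Rightarrow> real"
  assumes T: "\<And>i j. i \<in> I \<Longrightarrow> j \<in> J \<Longrightarrow> T i j \<ge> 0"
    and \<alpha>: "\<And>i. i \<in> I \<Longrightarrow> \<alpha> i > 0" and \<beta>: "\<And>j. j \<in> J \<Longrightarrow> \<beta> j > 0"
    and A: "A \<ge> 0" and row: "\<And>i. i \<in> I \<Longrightarrow> (\<Sum>j\<in>J. T i j * \<beta> j) \<le> A * \<alpha> i"
    and col: "\<And>j. j \<in> J \<Longrightarrow> (\<Sum>i\<in>I. T i j * \<alpha> i) \<le> B * \<beta> j"
  shows "(\<Sum>i\<in>I. (\<Sum>j\<in>J. T i j * x j)\<^sup>2) \<le> A * B * (\<Sum>j\<in>J. (x j)\<^sup>2)"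
proof -
  have "(\<Sum>j\<in>J. T i j * x j)\<^sup>2 \<le> A * (\<Sum>j\<in>J. T i j * \<alpha> i * ((x j)\<^sup>2 / \<beta> j))" if i: "i \<in> I" for i
  proof -
    have "(\<Sum>j\<in>J. T i j * x j) = (\<Sum>j\<in>J. sqrt (T i j * \<beta> j) * (sqrt (T i j / \<beta> j) * x j))"
    proof (rule sum.cong[OF refl])
      fix j assume "j \<in> J"
      hence "sqrt (T i j * \<beta> j) * sqrt (T i j / \<beta> j) = T i j"
        using T[OF i] \<beta> by (simp flip: real_sqrt_mult add: less_imp_neq[symmetric])
      thus "T i j * x j = sqrt (T i j * \<beta> j) * (sqrt (T i j / \<beta> j) * x j)"
        by (simp flip: mult.assoc)
    qed
    hence "(\<Sum>j\<in>J. T i j * x j)\<^sup>2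
        \<le> (\<Sum>j\<in>J. (sqrt (T i j * \<beta> j))\<^sup>2) * (\<Sum>j\<in>J. (sqrt (T i j / \<beta> j) * x j)\<^sup>2)"
      by (simp only: Cauchy_Schwarz_ineq_sum)
    also have "(\<Sum>j\<in>J. (sqrt (T i j * \<beta> j))\<^sup>2) = (\<Sum>j\<in>J. T i j * \<beta> j)"
      using T[OF i] \<beta> by (intro sum.cong refl real_sqrt_pow2) (simp add: less_imp_le)
    also have "(\<Sum>j\<in>J. (sqrt (T i j / \<beta> j) * x j)\<^sup>2) = (\<Sum>j\<in>J. T i j / \<beta> j * (x j)\<^sup>2)"
      unfolding power_mult_distrib
      using T[OF i] \<beta> by (intro sum.cong refl arg_cong2[where f = "(*)"] real_sqrt_pow2) (simp add: less_imp_le)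
    also have "(\<Sum>j\<in>J. T i j * \<beta> j) * \<dots> \<le> A * \<alpha> i * \<dots>"
      by (intro mult_right_mono row i sum_nonneg) (use T[OF i] \<beta> in \<open>auto simp: less_imp_le\<close>)
    also have "\<dots> = A * (\<Sum>j\<in>J. T i j * \<alpha> i * ((x j)\<^sup>2 / \<beta> j))"
      by (simp add: sum_distrib_left mult_ac)
    finally show ?thesis .
  qed
  hence "(\<Sum>i\<in>I. (\<Sum>j\<in>J. T i j * x j)\<^sup>2) \<le> (\<Sum>i\<in>I. A * (\<Sum>j\<in>J. T i j * \<alpha> i * ((x j)\<^sup>2 / \<beta> j)))"
    by (intro sum_mono)
  also have "\<dots> = A * (\<Sum>j\<in>J. (\<Sum>i\<in>I. T i j * \<alpha> i) * ((x j)\<^sup>2 / \<beta> j))"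
    by (subst sum_distrib_left[symmetric], subst sum.swap) (simp add: sum_distrib_right sum_divide_distrib)
  also have "\<dots> \<le> A * (\<Sum>j\<in>J. B * \<beta> j * ((x j)\<^sup>2 / \<beta> j))"
    by (intro mult_left_mono sum_mono mult_right_mono col A) (use \<beta> in \<open>auto simp: less_imp_le\<close>)
  also have "(\<Sum>j\<in>J. B * \<beta> j * ((x j)\<^sup>2 / \<beta> j)) = B * (\<Sum>j\<in>J. (x j)\<^sup>2)"
    unfolding sum_distrib_left using \<beta> by (intro sum.cong) (auto simp: less_imp_neq[symmetric])
  finally show ?thesis by (simp add: mult_ac)
qed

text \<open>Two polynomials of degree below \<open>card I\<close> that agree at the nodes
  \<open>x i\<close> coincide. With as many zeros as poles the quotient tends to 1 at infinity,
  whence the additive 1. The test functions and both inverse formulas for Cauchy matrices come from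
  this identity.\<close>

lemma partial_fractions:
  fixes x :: "'i \<Rightarrow> 'a::field" and y :: "'j \<Rightarrow> 'a"
  assumes fin: "finite I" "finite J" and inj: "inj_on x I" and card: "card J \<le> card I"
    and z: "z \<notin> x ` I"
  shows "(\<Prod>j\<in>J. z - y j) / (\<Prod>i\<in>I. z - x i) =
    (if card J = card I then 1 else 0) +
    (\<Sum>i\<in>I. ((\<Prod>j\<in>J. x i - y j) / (\<Prod>k\<in>I - {i}. x i - x k)) / (z - x i))"
proof (cases "I = {}")
  case True
  thus ?thesis using card fin by simp
next
  case False
  define \<epsilon> :: 'a where "\<epsilon> = (if card J = card I then 1 else 0)"
  define c where "c i = (\<Prod>j\<in>J. x i - y j) / (\<Prod>k\<in>I - {i}. x i - x k)" for i
  \<comment> \<open>Subtracting \<epsilon> times the denominator cancels the leading terms when the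
    degrees are equal, so that \<open>p\<close> has degree below \<open>card I\<close>;
    \<open>q\<close> is its Lagrange interpolant at the nodes.\<close>
  define p where "p = (\<Prod>j\<in>J. [:- y j, 1:]) - smult \<epsilon> (\<Prod>i\<in>I. [:- x i, 1:])"
  define q where "q = (\<Sum>i\<in>I. smult (c i) (\<Prod>k\<in>I - {i}. [:- x k, 1:]))"
  have cI: "card I > 0" using False fin by (simp add: card_gt_0_iff)
  have monic: "degree (\<Prod>i\<in>K. [:- f i, 1:]) = card K \<and> lead_coeff (\<Prod>i\<in>K. [:- f i, 1:]) = 1"
    for K and f :: "'k \<Rightarrow> 'a"
  proof -
    have "degree (\<Prod>i\<in>K. [:- f i, 1:]) = (\<Sum>i\<in>K. degree [:- f i, 1:])"
      by (rule degree_prod_eq_sum_degree) auto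
    moreover have "lead_coeff (\<Prod>i\<in>K. [:- f i, 1:]) = (\<Prod>i\<in>K. lead_coeff [:- f i, 1:])"
      by (rule lead_coeff_prod)
    ultimately show ?thesis by simp
  qed
  have dp: "degree p < card I"
  proof (cases "card J = card I")
    case True
    have "coeff (\<Prod>j\<in>J. [:- y j, 1:]) (card I) = 1" "coeff (\<Prod>i\<in>I. [:- x i, 1:]) (card I) = 1"
      using monic[of y J] monic[of x I] True by metis+
    hence cf: "coeff p (card I) = 0" using True by (simp add: p_def \<epsilon>_def)
    have "degree p \<le> card I"
      unfolding p_def using monic[of y J] monic[of x I] True
      by (intro degree_diff_le) (auto intro: order_trans[OF degree_smult_le])
    moreover have "degree p \<noteq> card I"
      using cf cI by (metis degree_0 leading_coeff_0_iff less_irrefl)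
    ultimately show ?thesis by simp
  next
    case False
    thus ?thesis using card monic[of y J] by (simp add: p_def \<epsilon>_def)
  qed
  have dq: "degree q < card I"
  proof -
    have "degree q \<le> card I - 1" unfolding q_def
    proof (rule degree_sum_le)
      fix i assume "i \<in> I"
      thus "degree (smult (c i) (\<Prod>k\<in>I - {i}. [:- x k, 1:])) \<le> card I - 1"
        using monic[of x "I - {i}"] by (intro order_trans[OF degree_smult_le]) simp
    qed (rule fin)
    thus ?thesis using cI by simp
  qed
  have "p = q"
  proof (rule poly_eqI_degree[of "x ` I"])
    fix t assume "t \<in> x ` I"
    then obtain i where i: "i \<in> I" "t = x i" by auto
    have nz: "(\<Prod>k\<in>I - {i}. x i - x k) \<noteq> 0"
      using fin i inj by (auto simp: inj_on_def)
    have "poly q t = (\<Sum>j\<in>I. c j * (\<Prod>k\<in>I - {j}. x i - x k))"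
      by (simp add: q_def poly_sum poly_prod i)
    also have "\<dots> = (\<Sum>j\<in>{i}. c j * (\<Prod>k\<in>I - {j}. x i - x k))"
    proof (rule sum.mono_neutral_right)
      show "\<forall>j\<in>I - {i}. c j * (\<Prod>k\<in>I - {j}. x i - x k) = 0"
        using fin i by (auto intro!: prod_zero)
    qed (use fin i in auto)
    also have "\<dots> = (\<Prod>j\<in>J. x i - y j)" using nz by (simp add: c_def)
    also have "\<dots> = poly p t"
    proof -
      have "(\<Prod>k\<in>I. x i - x k) = 0" using fin i by (intro prod_zero) auto
      thus ?thesis by (simp add: p_def poly_prod i)
    qed
    finally show "poly p t = poly q t" by simp
  qed (use dp dq inj in \<open>auto simp: card_image\<close>)
  have nz: "(\<Prod>i\<in>I. z - x i) \<noteq> 0" using fin z by auto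
  have "(\<Prod>j\<in>J. z - y j) = \<epsilon> * (\<Prod>i\<in>I. z - x i) + poly q z"
    unfolding \<open>p = q\<close>[symmetric] by (simp add: p_def poly_prod)
  hence "(\<Prod>j\<in>J. z - y j) / (\<Prod>i\<in>I. z - x i) = \<epsilon> + poly q z / (\<Prod>i\<in>I. z - x i)"
    using nz by (simp add: field_simps)
  also have "poly q z / (\<Prod>i\<in>I. z - x i) = (\<Sum>i\<in>I. c i * (\<Prod>k\<in>I - {i}. z - x k) / (\<Prod>i\<in>I. z - x i))"
    by (simp add: q_def poly_sum poly_prod sum_divide_distrib)
  also have "\<dots> = (\<Sum>i\<in>I. c i / (z - x i))"
  proof (rule sum.cong[OF refl])
    fix i assume i: "i \<in> I"
    have "(\<Prod>i\<in>I. z - x i) = (z - x i) * (\<Prod>k\<in>I - {i}. z - x k)"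
      using fin i by (simp add: prod.remove)
    thus "c i * (\<Prod>k\<in>I - {i}. z - x k) / (\<Prod>i\<in>I. z - x i) = c i / (z - x i)"
      using nz by simp
  qed
  finally show ?thesis unfolding \<epsilon>_def c_def .
qed

text \<open>Gaussian elimination: a nonzero pivot removes one equation and one unknown, so a surplus
  of unknowns survives. Arbitrary finite index sets are allowed because the systems are indexed both
  by points of \<Lambda> and by indices of \<Gamma>.\<close>

lemma homogeneous_system:
  fixes A :: "'i \<Rightarrow> 'j \<Rightarrow> 'a::field"
  assumes "finite I" "finite J" "card I < card J"
  shows "\<exists>x. (\<exists>j\<in>J. x j \<noteq> 0) \<and> (\<forall>i\<in>I. (\<Sum>j\<in>J. A i j * x j) = 0)"
  using assms
proof (induction I arbitrary: J A rule: finite_induct)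
  case empty
  hence "J \<noteq> {}" by auto
  thus ?case by (intro exI[of _ "\<lambda>_. 1"]) auto
next
  case (insert r I)
  show ?case
  proof (cases "\<forall>j\<in>J. A r j = 0")
    case True
    obtain x where "\<exists>j\<in>J. x j \<noteq> 0" "\<forall>i\<in>I. (\<Sum>j\<in>J. A i j * x j) = 0"
      using insert.IH[of J A] insert.prems insert.hyps by (auto simp: card_insert_if)
    thus ?thesis using True by (intro exI[of _ x]) auto
  next
    case False
    then obtain s where s: "s \<in> J" "A r s \<noteq> 0" by auto
    \<comment> \<open>The coefficients that remain after the unknown \<open>s\<close> has been
      eliminated with equation \<open>r\<close>.\<close>
    define A' where "A' i j = A i j - A i s / A r s * A r j" for i j
    have "card I < card (J - {s})" using insert.prems insert.hyps s by simp
    then obtain x where x: "\<exists>j\<in>J - {s}. x j \<noteq> 0"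
      "\<And>i. i \<in> I \<Longrightarrow> (\<Sum>j\<in>J - {s}. A' i j * x j) = 0"
      using insert.IH[of "J - {s}" A'] insert.prems by auto
    define t where "t = - (\<Sum>j\<in>J - {s}. A r j * x j) / A r s"
    have split: "(\<Sum>j\<in>J. A i j * (x(s := t)) j) = A i s * t + (\<Sum>j\<in>J - {s}. A i j * x j)" for i
    proof -
      have "(\<Sum>j\<in>J. A i j * (x(s := t)) j) = A i s * (x(s := t)) s + (\<Sum>j\<in>J - {s}. A i j * (x(s := t)) j)"
        by (rule sum.remove) (use insert.prems s in auto)
      also have "(\<Sum>j\<in>J - {s}. A i j * (x(s := t)) j) = (\<Sum>j\<in>J - {s}. A i j * x j)"
        by (rule sum.cong) auto
      finally show ?thesis by simp
    qed
    have "A i s * t + (\<Sum>j\<in>J - {s}. A i j * x j) = 0" if "i \<in> I" for i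
    proof -
      have "0 = (\<Sum>j\<in>J - {s}. A i j * x j) - (\<Sum>j\<in>J - {s}. A i s / A r s * (A r j * x j))"
        using x(2)[OF that] by (simp add: A'_def algebra_simps sum_subtractf)
      thus ?thesis by (simp add: t_def sum_distrib_left sum_divide_distrib)
    qed
    moreover have "A r s * t + (\<Sum>j\<in>J - {s}. A r j * x j) = 0" using s by (simp add: t_def)
    ultimately show ?thesis using x(1) split by (intro exI[of _ "x(s := t)"]) auto
  qed
qed

section \<open>Unordered infinite sums and Cauchy-Schwarz\<close>

lemma sum_tendsto_infsum:
  fixes f :: "nat \<Rightarrow> 'a::{topological_comm_monoid_add,t2_space}"
  assumes "f summable_on {1..}"
  shows "(\<lambda>n. \<Sum>k\<in>{1..n}. f k) \<longlonglongrightarrow> infsum f {1..}"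
proof -
  have "((\<lambda>F. sum f F) \<longlongrightarrow> infsum f {1..}) (finite_subsets_at_top {1..})"
    using has_sum_infsum[OF assms] by (simp add: has_sum_def)
  moreover have "filterlim (\<lambda>n. {1..n}) (finite_subsets_at_top {1..}) sequentially"
    unfolding filterlim_finite_subsets_at_top
  proof (intro allI impI)
    fix X :: "nat set" assume X: "finite X \<and> X \<subseteq> {1..}"
    show "\<forall>\<^sub>F n in sequentially. finite {1..n} \<and> X \<subseteq> {1..n} \<and> {1..n} \<subseteq> {1..}"
      using eventually_ge_at_top[of "Max (insert 0 X)"]
      by eventually_elim (use X in auto)
  qed
  ultimately show ?thesis by (rule filterlim_compose)
qed

lemma sum_le_bound_summable:
  fixes f :: "'a \<Rightarrow> real"
  assumes "\<And>x. x \<in> A \<Longrightarrow> f x \<ge> 0" "\<And>F. finite F \<Longrightarrow> F \<subseteq> A \<Longrightarrow> sum f F \<le> C"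
  shows "f summable_on A" "infsum f A \<le> C"
proof -
  show "f summable_on A"
    by (rule nonneg_bdd_above_summable_on) (use assms in \<open>auto simp: bdd_above_def\<close>)
  thus "infsum f A \<le> C" by (rule infsum_le_finite_sums) (use assms in auto)
qed

lemma cauchy_schwarz_finite:
  fixes x y :: "'a \<Rightarrow> real"
  shows "(\<Sum>i\<in>F. \<bar>x i * y i\<bar>) \<le> sqrt (\<Sum>i\<in>F. (x i)\<^sup>2) * sqrt (\<Sum>i\<in>F. (y i)\<^sup>2)"
  using L2_set_mult_ineq[of x y F] by (simp add: L2_set_def abs_mult)

lemma cauchy_schwarz_infsum:
  fixes x y :: "'a \<Rightarrow> complex"
  assumes x: "(\<lambda>i. (cmod (x i))\<^sup>2) summable_on A" and y: "(\<lambda>i. (cmod (y i))\<^sup>2) summable_on A"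
  shows "(\<lambda>i. cmod (x i * y i)) summable_on A"
    and "(cmod (\<Sum>\<^sub>\<infinity>i\<in>A. x i * y i))\<^sup>2 \<le> (\<Sum>\<^sub>\<infinity>i\<in>A. (cmod (x i))\<^sup>2) * (\<Sum>\<^sub>\<infinity>i\<in>A. (cmod (y i))\<^sup>2)"
proof -
  define X where "X = (\<Sum>\<^sub>\<infinity>i\<in>A. (cmod (x i))\<^sup>2)"
  define Y where "Y = (\<Sum>\<^sub>\<infinity>i\<in>A. (cmod (y i))\<^sup>2)"
  have XY: "X \<ge> 0" "Y \<ge> 0" unfolding X_def Y_def by (auto intro!: infsum_nonneg)
  have bd: "(\<Sum>i\<in>F. cmod (x i * y i)) \<le> sqrt X * sqrt Y" if F: "finite F" "F \<subseteq> A" for F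
  proof -
    have "(\<Sum>i\<in>F. cmod (x i * y i)) \<le> sqrt (\<Sum>i\<in>F. (cmod (x i))\<^sup>2) * sqrt (\<Sum>i\<in>F. (cmod (y i))\<^sup>2)"
      using cauchy_schwarz_finite[of "\<lambda>i. cmod (x i)" "\<lambda>i. cmod (y i)" F] by (simp add: norm_mult)
    also have "\<dots> \<le> sqrt X * sqrt Y"
      unfolding X_def Y_def
      by (intro mult_mono real_sqrt_le_mono finite_sum_le_infsum x y F real_sqrt_ge_zero sum_nonneg infsum_nonneg) auto
    finally show ?thesis .
  qed
  show sm: "(\<lambda>i. cmod (x i * y i)) summable_on A"
    by (rule sum_le_bound_summable(1)[OF _ bd]) auto
  have "cmod (\<Sum>\<^sub>\<infinity>i\<in>A. x i * y i) \<le> (\<Sum>\<^sub>\<infinity>i\<in>A. cmod (x i * y i))"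
    by (rule norm_infsum_bound[OF sm])
  also have "\<dots> \<le> sqrt X * sqrt Y" by (rule sum_le_bound_summable(2)[OF _ bd]) auto
  finally have "(cmod (\<Sum>\<^sub>\<infinity>i\<in>A. x i * y i))\<^sup>2 \<le> (sqrt X * sqrt Y)\<^sup>2"
    by (intro power_mono) auto
  also have "\<dots> = X * Y" using XY by (simp add: power_mult_distrib)
  finally show "(cmod (\<Sum>\<^sub>\<infinity>i\<in>A. x i * y i))\<^sup>2 \<le> (\<Sum>\<^sub>\<infinity>i\<in>A. (cmod (x i))\<^sup>2) * (\<Sum>\<^sub>\<infinity>i\<in>A. (cmod (y i))\<^sup>2)"
    unfolding X_def Y_def .
qed

text \<open>With truncated subtraction \<open>(j - k) + (k - j)\<close> is the distance of
  \<open>j\<close> and \<open>k\<close>; each side of \<open>k\<close> contributes at most one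
  geometric series.\<close>

lemma sum_power_distance_le:
  fixes \<theta> :: real
  assumes "0 \<le> \<theta>" "\<theta> < 1" "finite J"
  shows "(\<Sum>j\<in>J. \<theta> ^ ((j - k) + (k - j))) \<le> 2 / (1 - \<theta>)"
proof -
  have geo: "(\<Sum>i\<in>K. \<theta> ^ i) \<le> 1 / (1 - \<theta>)" if "finite K" for K :: "nat set"
  proof -
    have "summable (\<lambda>i. \<theta> ^ i)" using assms by (intro summable_geometric) auto
    hence "(\<Sum>i\<in>K. \<theta> ^ i) \<le> (\<Sum>i. \<theta> ^ i)"
      using assms that by (intro sum_le_suminf) auto
    thus ?thesis using assms by (simp add: suminf_geometric)
  qed
  define J1 where "J1 = {j \<in> J. j < k}"
  define J2 where "J2 = {j \<in> J. \<not> j < k}"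
  have "J = J1 \<union> J2" "J1 \<inter> J2 = {}" "finite J1" "finite J2"
    using assms by (auto simp: J1_def J2_def)
  hence "(\<Sum>j\<in>J. \<theta> ^ ((j - k) + (k - j)))
      = (\<Sum>j\<in>J1. \<theta> ^ ((j - k) + (k - j))) + (\<Sum>j\<in>J2. \<theta> ^ ((j - k) + (k - j)))"
    by (simp add: sum.union_disjoint)
  also have "(\<Sum>j\<in>J1. \<theta> ^ ((j - k) + (k - j))) = (\<Sum>i\<in>(\<lambda>j. k - j) ` J1. \<theta> ^ i)"
    by (subst sum.reindex) (auto simp: J1_def inj_on_def)
  also have "(\<Sum>j\<in>J2. \<theta> ^ ((j - k) + (k - j))) = (\<Sum>i\<in>(\<lambda>j. j - k) ` J2. \<theta> ^ i)"
    by (subst sum.reindex) (auto simp: J2_def inj_on_def)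
  finally show ?thesis
    using geo[of "(\<lambda>j. k - j) ` J1"] geo[of "(\<lambda>j. j - k) ` J2"] \<open>finite J1\<close> \<open>finite J2\<close>
    by simp
qed

lemma prod_le_exp_sum:
  fixes f x :: "'a \<Rightarrow> real"
  assumes "\<And>i. i \<in> J \<Longrightarrow> 0 \<le> f i" "\<And>i. i \<in> J \<Longrightarrow> f i \<le> 1 + x i"
  shows "prod f J \<le> exp (sum x J)"
proof (cases "finite J")
  case True
  have "prod f J \<le> (\<Prod>i\<in>J. exp (x i))"
    by (intro prod_mono conjI assms order_trans[OF assms(2) exp_ge_add_one_self])
  thus ?thesis by (simp add: exp_sum True)
qed simp

section \<open>Slowly decaying sequences and Gronwall inequalities\<close>

text \<open>On [1, \<kappa>] the number x - 1 is at most \<kappa> ln x, and t ln x is at most x^t -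
  1. In the applications x is the ratio of consecutive values of \<open>P\<close>, and the
  right-hand side telescopes.\<close>

lemma diff_one_le_powr:
  fixes x :: real
  assumes "1 \<le> x" "x \<le> \<kappa>" "0 < t"
  shows "x - 1 \<le> \<kappa> / t * (x powr t - 1)"
proof -
  have "(x - 1) / \<kappa> \<le> (x - 1) / x" using assms by (intro divide_left_mono) auto
  also have "\<dots> \<le> ln x" using ln_add_one_self_le_self2[of "1 / x - 1"] assms by (simp add: ln_div field_simps)
  finally have "t * ((x - 1) / \<kappa>) \<le> t * ln x" using assms by (intro mult_left_mono) auto
  also have "\<dots> \<le> x powr t - 1"
  proof -
    have "x powr t = exp (t * ln x)" using assms by (simp add: powr_def)
    thus ?thesis using exp_ge_add_one_self[of "t * ln x"] by linarith
  qed
  finally have "\<kappa> / t * (t * ((x - 1) / \<kappa>)) \<le> \<kappa> / t * (x powr t - 1)"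
    using assms by (intro mult_left_mono) auto
  thus ?thesis using assms by simp
qed

text \<open>The preceding bound for the opposite sign of the exponent, at the price of the factor
  x^t \<le> \<kappa>^t.\<close>

lemma diff_one_le_powr_neg:
  fixes x :: real
  assumes "1 \<le> x" "x \<le> \<kappa>" "0 < t"
  shows "x - 1 \<le> \<kappa> / t * \<kappa> powr t * (1 - x powr (- t))"
proof -
  have "x powr t - 1 = x powr t * (1 - x powr (- t))"
    using assms by (simp add: powr_minus field_simps)
  also have "\<dots> \<le> \<kappa> powr t * (1 - x powr (- t))"
  proof (rule mult_right_mono)
    show "x powr t \<le> \<kappa> powr t" using assms by (intro powr_mono2) auto
    show "0 \<le> 1 - x powr (- t)" using assms powr_mono[of "- t" 0 x] by simp
  qed
  finally have "\<kappa> / t * (x powr t - 1) \<le> \<kappa> / t * (\<kappa> powr t * (1 - x powr (- t)))"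
    using assms by (intro mult_left_mono) auto
  thus ?thesis using diff_one_le_powr[OF assms] by (simp add: mult.assoc)
qed

lemma mult_le_square_mean: "b * a \<le> (a / 2 + b / 2)\<^sup>2" for a b :: real
  using sum_squares_bound[of a b] by (simp add: power2_eq_square field_simps)

text \<open>Discrete form of the change of variable from n to \<open>P n\<close>: \<open>p\<close>
  is the decrement of \<open>P\<close>, and \<open>P_slow\<close> keeps the values of an integrand
  at the two ends of a step comparable. Sums of \<open>p\<close> times a power of \<open>P\<close>
  then behave like integrals of that power.\<close>

locale slow_decay =
  fixes P p :: "nat \<Rightarrow> real" and \<kappa> :: real
  assumes P_gt0: "P n > 0" and p_gt0: "n \<ge> 1 \<Longrightarrow> p n > 0"
    and P_step: "P n = p (Suc n) + P (Suc n)" and P_slow: "P n \<le> \<kappa> * P (Suc n)"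
begin

lemma P_antimono: "m \<le> n \<Longrightarrow> P n \<le> P m"
proof (rule lift_Suc_antimono_le)
  show "P (Suc k) \<le> P k" for k using P_step[of k] p_gt0[of "Suc k"] by simp
qed

lemma kappa_ge1: "\<kappa> \<ge> 1"
proof (rule ccontr)
  assume "\<not> \<kappa> \<ge> 1"
  hence "\<kappa> * P 1 < 1 * P 1" using P_gt0[of 1] by (intro mult_strict_right_mono) auto
  thus False using P_slow[of 0] P_antimono[of 0 1] by simp
qed

text \<open>Normal form of one step: whatever has to be shown for a step becomes an inequality in a
  single ratio x ranging over [1, \<kappa>].\<close>

lemma step_ratio:
  obtains x where "1 \<le> x" "x \<le> \<kappa>" "P n = x * P (Suc n)" "p (Suc n) = (x - 1) * P (Suc n)"
proof (rule that[of "P n / P (Suc n)"])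
  show "1 \<le> P n / P (Suc n)" using P_antimono[of n "Suc n"] P_gt0 by simp
  show "P n / P (Suc n) \<le> \<kappa>" using P_slow[of n] P_gt0[of "Suc n"] by (simp add: field_simps)
qed (use P_gt0[of "Suc n"] P_step[of n] in \<open>auto simp: field_simps\<close>)

lemma powr_step: "1 \<le> x \<Longrightarrow> P n = x * P (Suc n) \<Longrightarrow> P n powr s = x powr s * P (Suc n) powr s"
  using P_gt0[of "Suc n"] by (simp add: powr_mult)

text \<open>Rewrites in exactly the shapes produced by the one-step bounds, so that
  \<open>simp only\<close> exhibits a telescoping difference without expanding the powers.\<close>

lemma factor_diffs:
  fixes a b c z :: real
  shows "c * (a - 1) * z = c * (a * z) - c * z" "c * (1 - a) * z = c * z - c * (a * z)"
    "b * (c * (a - 1)) * z = b * c * (a * z) - b * c * z" "b * (c * (1 - a)) * z = b * c * z - b * c * (a * z)"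
  by (simp_all add: algebra_simps)

text \<open>Counterpart of the integral of y^(t - 1) from 0 to \<open>P k\<close>.\<close>

lemma sum_p_powr_tail:
  assumes t: "0 < t" and "k \<le> N"
  shows "(\<Sum>n\<in>{k<..N}. p n * P n powr (t - 1)) \<le> \<kappa> / t * P k powr t"
proof -
  \<comment> \<open>The term at \<open>N\<close> on the left makes the induction telescope; being
    nonnegative, it is dropped at the end.\<close>
  have "(\<Sum>n\<in>{k<..N}. p n * P n powr (t - 1)) + \<kappa> / t * P N powr t \<le> \<kappa> / t * P k powr t"
    using \<open>k \<le> N\<close>
  proof (induction N rule: dec_induct)
    case (step N)
    have *: "{k<..Suc N} = insert (Suc N) {k<..N}" using step by auto
    obtain x where x: "1 \<le> x" "x \<le> \<kappa>" "P N = x * P (Suc N)" "p (Suc N) = (x - 1) * P (Suc N)"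
      by (rule step_ratio)
    have "p (Suc N) * P (Suc N) powr (t - 1) = (x - 1) * P (Suc N) powr t"
      unfolding x(4) using P_gt0[of "Suc N"] by (simp add: powr_diff)
    also have "\<dots> \<le> \<kappa> / t * (x powr t - 1) * P (Suc N) powr t"
      using diff_one_le_powr[OF x(1,2) t] by (intro mult_right_mono) auto
    also have "\<dots> = \<kappa> / t * P N powr t - \<kappa> / t * P (Suc N) powr t"
      by (simp only: powr_step[OF x(1,3)] factor_diffs)
    finally show ?case using step.IH unfolding * by simp
  qed simp
  moreover have "\<kappa> / t * P N powr t \<ge> 0" using t kappa_ge1 by simp
  ultimately show ?thesis by linarith
qed

text \<open>Counterpart of the integral of y^(- 1 - t) from \<open>P N\<close> to infinity. The
  integrand decreases in y, and evaluating it at the lower end of each step costs powers of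
  \<kappa>.\<close>

lemma sum_p_powr_init:
  assumes t: "0 < t"
  shows "(\<Sum>n\<in>{0<..N}. p n * P n powr (- 1 - t)) \<le> \<kappa> / t * \<kappa> powr t * P N powr (- t)"
proof (induction N)
  case (Suc N)
  have *: "{0<..Suc N} = insert (Suc N) {0<..N}" by auto
  obtain x where x: "1 \<le> x" "x \<le> \<kappa>" "P N = x * P (Suc N)" "p (Suc N) = (x - 1) * P (Suc N)"
    by (rule step_ratio)
  have "p (Suc N) * P (Suc N) powr (- 1 - t) = (x - 1) * P (Suc N) powr (- t)"
    unfolding x(4) using P_gt0[of "Suc N"] by (simp add: powr_diff powr_minus field_simps)
  also have "\<dots> \<le> \<kappa> / t * \<kappa> powr t * (1 - x powr (- t)) * P (Suc N) powr (- t)"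
    using diff_one_le_powr_neg[OF x(1,2) t] by (intro mult_right_mono) auto
  also have "\<dots> = \<kappa> / t * \<kappa> powr t * P (Suc N) powr (- t) - \<kappa> / t * \<kappa> powr t * P N powr (- t)"
    by (simp only: powr_step[OF x(1,3)] factor_diffs)
  finally show ?case using Suc.IH unfolding * by simp
qed (use t kappa_ge1 in simp)

section \<open>Abel summation against weights with bounded \<open>W P\<close>\<close>

context
  fixes w :: "nat \<Rightarrow> real" and B :: real
  assumes w: "\<And>k. w k \<ge> 0" and W: "\<And>n. (\<Sum>k<n. w k) * P n \<le> B"
begin

lemma W_bound_nonneg: "B \<ge> 0"
  using W[of 0] by simp

lemma W_le: "(\<Sum>k<n. w k) \<le> B / P n"
  using W[of n] P_gt0[of n] by (simp add: field_simps)

text \<open>Nothing is known about a single \<open>w k\<close>; only partial sums are controlled, by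
  \<open>B / P n\<close>. Summation by parts therefore moves the differences onto the powers of
  \<open>P\<close>.\<close>

lemma sum_w_powr_init:
  assumes t: "0 < t" "t < 1"
  shows "(\<Sum>k<n. w k * P k powr (1 - t)) \<le> (B + B * (\<kappa> / t * \<kappa> powr t)) * P n powr (- t)"
proof -
  define C where "C = B * (\<kappa> / t * \<kappa> powr t)"
  have C: "C \<ge> 0" unfolding C_def using W_bound_nonneg t kappa_ge1 by simp
  \<comment> \<open>The first term on the right is the boundary term of the summation by parts; each
    induction step moves it from \<open>P n\<close> to \<open>P (Suc n)\<close>.\<close>
  have "(\<Sum>k<n. w k * P k powr (1 - t)) \<le> (\<Sum>k<n. w k) * P n powr (1 - t) + C * P n powr (- t)"
  proof (induction n)
    case (Suc n)
    obtain x where x: "1 \<le> x" "x \<le> \<kappa>" "P n = x * P (Suc n)" "p (Suc n) = (x - 1) * P (Suc n)"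
      by (rule step_ratio)
    have mono: "P n powr (1 - t) \<ge> P (Suc n) powr (1 - t)"
      using P_antimono[of n "Suc n"] P_gt0[of "Suc n"] t by (intro powr_mono2) auto
    have "(\<Sum>k<Suc n. w k) * (P n powr (1 - t) - P (Suc n) powr (1 - t))
        \<le> B / P (Suc n) * (P n powr (1 - t) - P (Suc n) powr (1 - t))"
      by (intro mult_right_mono W_le) (use mono in simp)
    also have "\<dots> = B * (x powr (1 - t) - 1) * P (Suc n) powr (- t)"
      unfolding x(3) using x P_gt0[of "Suc n"] by (simp add: powr_mult powr_diff powr_minus field_simps)
    also have "\<dots> \<le> B * (\<kappa> / t * \<kappa> powr t * (1 - x powr (- t))) * P (Suc n) powr (- t)"
    proof (intro mult_right_mono mult_left_mono W_bound_nonneg)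
      have "x powr (1 - t) \<le> x powr 1" using x t by (intro powr_mono) auto
      thus "x powr (1 - t) - 1 \<le> \<kappa> / t * \<kappa> powr t * (1 - x powr (- t))"
        using diff_one_le_powr_neg[OF x(1,2) t(1)] x by simp
    qed auto
    also have "\<dots> = C * P (Suc n) powr (- t) - C * P n powr (- t)"
      unfolding C_def by (simp only: powr_step[OF x(1,3)] factor_diffs)
    finally show ?case using Suc.IH by (simp add: algebra_simps)
  qed (use C in simp)
  also have "(\<Sum>k<n. w k) * P n powr (1 - t) \<le> B / P n * P n powr (1 - t)"
    by (intro mult_right_mono W_le) auto
  also have "\<dots> = B * P n powr (- t)" using P_gt0[of n] by (simp add: powr_diff powr_minus field_simps)
  finally show ?thesis by (simp add: C_def algebra_simps)
qed

lemma sum_w_powr_tail: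
  assumes t: "0 < t" "n \<le> N"
  shows "(\<Sum>k\<in>{n<..N}. w k * P k powr (1 + t)) \<le> B * (2 * \<kappa> + \<kappa> * \<kappa> / t) * P n powr t"
proof -
  define C where "C = B * (2 * \<kappa> + \<kappa> * \<kappa> / t)"
  have kt: "\<kappa> / t \<le> \<kappa> * \<kappa> / t" using kappa_ge1 t by (simp add: divide_right_mono)
  have C: "C \<ge> B * \<kappa>" unfolding C_def
    using W_bound_nonneg t kappa_ge1 by (intro mult_left_mono) auto
  have *: "a \<le> d" if "a + c \<le> w' + d" "w' \<le> e'" "e' \<le> f" "f \<le> c" for a c d w' e' f :: real
    using that by linarith
  \<comment> \<open>Here the boundary term is a partial sum of \<open>w\<close> times
    \<open>P N powr (1 + t)\<close>. Slow decay bounds it by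
    \<open>B * \<kappa> * P N powr t\<close>, and \<open>C\<close> is large enough for the term
    \<open>C * P N powr t\<close> on the left to absorb it.\<close>
  have "(\<Sum>k\<in>{n<..N}. w k * P k powr (1 + t)) + C * P N powr t
      \<le> (\<Sum>k<Suc N. w k) * P N powr (1 + t) + C * P n powr t"
    using t(2)
  proof (induction N rule: dec_induct)
    case base
    thus ?case using w by (simp add: sum_nonneg)
  next
    case (step N)
    have *: "{n<..Suc N} = insert (Suc N) {n<..N}" using step by auto
    obtain x where x: "1 \<le> x" "x \<le> \<kappa>" "P N = x * P (Suc N)" "p (Suc N) = (x - 1) * P (Suc N)"
      by (rule step_ratio)
    have mono: "P N powr (1 + t) \<ge> P (Suc N) powr (1 + t)"
      using P_antimono[of N "Suc N"] P_gt0[of "Suc N"] t by (intro powr_mono2) auto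
    have "(\<Sum>k<Suc N. w k) * (P N powr (1 + t) - P (Suc N) powr (1 + t))
        \<le> B / P (Suc N) * (P N powr (1 + t) - P (Suc N) powr (1 + t))"
      by (intro mult_right_mono W_le) (use mono in simp)
    also have "\<dots> = B * (x powr (1 + t) - 1) * P (Suc N) powr t"
      unfolding x(3) using x P_gt0[of "Suc N"] by (simp add: powr_mult powr_add field_simps)
    also have "\<dots> \<le> B * ((2 * \<kappa> + \<kappa> * \<kappa> / t) * (x powr t - 1)) * P (Suc N) powr t"
    proof (intro mult_right_mono mult_left_mono W_bound_nonneg)
      have xt: "x powr t \<ge> 1" using x t by (simp add: ge_one_powr_ge_zero)
      have "x powr (1 + t) - 1 = x * (x powr t - 1) + (x - 1)"
        using x by (simp add: powr_add algebra_simps)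
      also have "\<dots> \<le> \<kappa> * (x powr t - 1) + \<kappa> / t * (x powr t - 1)"
        using x xt diff_one_le_powr[OF x(1,2) t(1)] by (intro add_mono mult_right_mono) auto
      also have "\<dots> = (\<kappa> + \<kappa> / t) * (x powr t - 1)" by (simp add: algebra_simps)
      also have "\<dots> \<le> (2 * \<kappa> + \<kappa> * \<kappa> / t) * (x powr t - 1)"
        using kt kappa_ge1 xt by (intro mult_right_mono) auto
      finally show "x powr (1 + t) - 1 \<le> (2 * \<kappa> + \<kappa> * \<kappa> / t) * (x powr t - 1)" .
    qed auto
    also have "\<dots> = C * P N powr t - C * P (Suc N) powr t"
      unfolding C_def by (simp only: powr_step[OF x(1,3)] factor_diffs)
    finally show ?case using step.IH unfolding * by (simp add: algebra_simps)
  qed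
  moreover have "(\<Sum>k<Suc N. w k) * P N powr (1 + t) \<le> B / P (Suc N) * P N powr (1 + t)"
    by (intro mult_right_mono W_le) auto
  moreover have "B / P (Suc N) * P N powr (1 + t) \<le> B * \<kappa> * P N powr t"
  proof -
    have "B * (P N * P N powr t) \<le> B * ((\<kappa> * P (Suc N)) * P N powr t)"
      by (intro mult_left_mono mult_right_mono P_slow W_bound_nonneg) auto
    thus ?thesis using P_gt0[of "Suc N"] P_gt0[of N] by (simp add: powr_add field_simps)
  qed
  moreover have "B * \<kappa> * P N powr t \<le> C * P N powr t" by (rule mult_right_mono[OF C]) simp
  ultimately have "(\<Sum>k\<in>{n<..N}. w k * P k powr (1 + t)) \<le> C * P n powr t" by (rule *)
  thus ?thesis by (simp add: C_def)
qed

end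

text \<open>From 1 - y \<le> exp (- y) and ln x \<le> x - 1. It converts the relative decrement of
  \<open>P\<close> into a factor that is a power of \<open>P\<close>, which is one step of
  Gronwall.\<close>

lemma one_minus_le_powr:
  assumes "K > 0"
  shows "1 - p (Suc n) / P (Suc n) / K \<le> (P (Suc n) / P n) powr (1 / K)"
proof -
  obtain x where x: "1 \<le> x" "x \<le> \<kappa>" "P n = x * P (Suc n)" "p (Suc n) = (x - 1) * P (Suc n)"
    by (rule step_ratio)
  have "1 - (x - 1) / K \<le> exp (- ((x - 1) / K))" using exp_ge_add_one_self[of "- ((x - 1) / K)"] by simp
  also have "\<dots> \<le> exp (- (ln x / K))"
    using ln_le_minus_one[of x] x assms by (simp add: divide_right_mono)
  also have "\<dots> = (1 / x) powr (1 / K)" using x by (simp add: powr_def ln_div)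
  finally show ?thesis using P_gt0[of "Suc n"] x by simp
qed

text \<open>Discrete Gronwall inequality with - ln \<open>P\<close> as time: a relative loss of
  \<open>p / P / K\<close> per step accumulates to the power 1 / K of \<open>P\<close>.\<close>

lemma gronwall_decreasing:
  assumes "K > 0" "\<And>n. Z n \<ge> 0" "\<And>n. Z (Suc n) \<le> Z n * (1 - p (Suc n) / P (Suc n) / K)" "n \<le> m"
  shows "Z m \<le> Z n * (P m / P n) powr (1 / K)"
  using \<open>n \<le> m\<close>
proof (induction m rule: dec_induct)
  case (step m)
  have "Z (Suc m) \<le> Z m * (1 - p (Suc m) / P (Suc m) / K)" by (rule assms)
  also have "\<dots> \<le> Z m * (P (Suc m) / P m) powr (1 / K)"
    by (intro mult_left_mono one_minus_le_powr assms)
  also have "\<dots> \<le> Z n * (P m / P n) powr (1 / K) * (P (Suc m) / P m) powr (1 / K)"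
    by (intro mult_right_mono step) auto
  also have "\<dots> = Z n * (P (Suc m) / P n) powr (1 / K)"
    using P_gt0[of m] P_gt0[of n] P_gt0[of "Suc m"] by (simp flip: powr_mult add: mult.assoc)
  finally show ?case .
qed (use P_gt0[of n] in simp)

text \<open>The same with time reversed: here \<open>Z\<close> gains in every step, and its earlier
  values are bounded by later ones.\<close>

lemma gronwall_increasing:
  assumes "K > 0" "\<And>n. Z n \<ge> 0" "\<And>n. Z n \<le> Z (Suc n) * (1 - p (Suc n) / P (Suc n) / K)" "n \<le> m"
  shows "Z n \<le> Z m * (P m / P n) powr (1 / K)"
  using \<open>n \<le> m\<close>
proof (induction m rule: dec_induct)
  case (step m)
  have "Z m \<le> Z (Suc m) * (1 - p (Suc m) / P (Suc m) / K)" by (rule assms)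
  also have "\<dots> \<le> Z (Suc m) * (P (Suc m) / P m) powr (1 / K)"
    by (intro mult_left_mono one_minus_le_powr assms)
  finally have "Z m * (P m / P n) powr (1 / K) \<le> Z (Suc m) * (P (Suc m) / P m) powr (1 / K) * (P m / P n) powr (1 / K)"
    by (intro mult_right_mono) auto
  also have "\<dots> = Z (Suc m) * (P (Suc m) / P n) powr (1 / K)"
    using P_gt0[of m] P_gt0[of n] P_gt0[of "Suc m"] by (simp flip: powr_mult add: mult.assoc)
  finally show ?case using step.IH by linarith
qed (use P_gt0[of n] in simp)

section \<open>From a weighted test inequality to power laws\<close>

context
  fixes r u :: "nat \<Rightarrow> real" and C1 :: real
  assumes r_pos: "\<And>n. r n > 0" and u: "\<And>n. u n \<ge> 0" and C1: "C1 \<ge> 0"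
    and r_diff: "\<And>n. \<bar>r (Suc n) - r n\<bar> \<le> C1 * r (Suc n) * sqrt (u (Suc n) * p (Suc n))"
begin

text \<open>Up to the factor \<kappa>, \<open>X\<close> sums the increments that \<open>e\<close>
  would have if \<open>r\<close> stood still. \<open>R\<close> is the quantity in the test
  inequality. The motion of \<open>r\<close> contributes to \<open>e\<close>, by
  \<open>r_diff\<close>, the geometric mean of the summands of \<open>R\<close> and
  \<open>X\<close>.\<close>

abbreviation (input) "e n \<equiv> r n / P n"
abbreviation (input) "X N M \<equiv> (\<Sum>k\<in>{N<..M}. r k * p k / (P k)\<^sup>2)"
abbreviation (input) "R N M \<equiv> (\<Sum>k\<in>{N<..M}. r k * u k)"

lemma X_nonneg: "X N M \<ge> 0"
  by (intro sum_nonneg divide_nonneg_nonneg mult_nonneg_nonneg) (auto intro!: less_imp_le[OF r_pos] less_imp_le[OF p_gt0])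

lemma R_nonneg: "R N M \<ge> 0"
  by (intro sum_nonneg mult_nonneg_nonneg) (auto intro: less_imp_le r_pos u)

text \<open>One step of \<open>e\<close> is \<open>r p / (P P')\<close> plus the increment of
  \<open>r\<close> over \<open>P'\<close>, where \<open>P'\<close> is the preceding value of
  \<open>P\<close>. The first parts sum to \<open>Y\<close>, which lies between
  \<open>X / \<kappa>\<close> and \<open>X\<close>; the second are controlled by
  \<open>r_diff\<close> and Cauchy-Schwarz.\<close>

lemma summation_by_parts:
  assumes "N \<le> M"
  shows "X N M / \<kappa> \<le> e M - e N + C1 * sqrt (R N M) * sqrt (X N M)"
    and "e M - e N \<le> X N M + C1 * sqrt (R N M) * sqrt (X N M)"
    and "e N - e M \<le> C1 * sqrt (R N M) * sqrt (X N M)"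
proof -
  define x where "x k = r k * p k / (P k)\<^sup>2" for k
  define E where "E k = r k * u k" for k
  define Y where "Y = (\<Sum>k\<in>{N<..M}. r k * p k / (P k * P (k - 1)))"
  define S where "S = (\<Sum>k\<in>{N<..M}. \<bar>sqrt (E k) * sqrt (x k)\<bar>)"
  have main: "\<bar>e M - e N - Y\<bar> \<le> C1 * S"
    unfolding Y_def S_def using assms
  proof (induction M rule: dec_induct)
    case (step M)
    have *: "{N<..Suc M} = insert (Suc M) {N<..M}" using step by auto
    have pos: "r (Suc M) > 0" "p (Suc M) > 0" "P (Suc M) > 0" "P M > 0" "u (Suc M) \<ge> 0"
      using r_pos p_gt0 P_gt0 u by auto
    have "r (Suc M) / P (Suc M) - r M / P M - r (Suc M) * p (Suc M) / (P (Suc M) * P M)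
        = (r (Suc M) - r M) / P M"
    proof -
      have "r (Suc M) / P (Suc M) - r (Suc M) * p (Suc M) / (P (Suc M) * P M)
          = r (Suc M) * (P M - p (Suc M)) / (P (Suc M) * P M)"
        using pos by (simp add: field_simps)
      also have "\<dots> = r (Suc M) / P M" using P_step[of M] pos by simp
      finally show ?thesis by (simp add: diff_divide_distrib)
    qed
    moreover have "\<bar>(r (Suc M) - r M) / P M\<bar> \<le> C1 * (sqrt (E (Suc M)) * sqrt (x (Suc M)))"
    proof -
      have "\<bar>(r (Suc M) - r M) / P M\<bar> = \<bar>r (Suc M) - r M\<bar> / P M" using pos by simp
      also have "\<dots> \<le> C1 * r (Suc M) * sqrt (u (Suc M) * p (Suc M)) / P M"
        using pos by (intro divide_right_mono r_diff) auto
      also have "\<dots> \<le> C1 * r (Suc M) * sqrt (u (Suc M) * p (Suc M)) / P (Suc M)"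
        using pos C1 P_antimono[of M "Suc M"] by (intro divide_left_mono mult_nonneg_nonneg) auto
      also have "r (Suc M) * sqrt (u (Suc M) * p (Suc M)) / P (Suc M) = sqrt (E (Suc M)) * sqrt (x (Suc M))"
      proof -
        have "E (Suc M) * x (Suc M) = (r (Suc M) / P (Suc M))\<^sup>2 * (u (Suc M) * p (Suc M))"
          by (simp add: E_def x_def power2_eq_square)
        hence "sqrt (E (Suc M)) * sqrt (x (Suc M)) = sqrt ((r (Suc M) / P (Suc M))\<^sup>2 * (u (Suc M) * p (Suc M)))"
          by (simp flip: real_sqrt_mult)
        thus ?thesis using pos by (simp add: real_sqrt_mult)
      qed
      hence "C1 * r (Suc M) * sqrt (u (Suc M) * p (Suc M)) / P (Suc M) = C1 * (sqrt (E (Suc M)) * sqrt (x (Suc M)))"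
        by (metis mult.assoc times_divide_eq_right)
      finally show ?thesis .
    qed
    moreover have "0 \<le> sqrt (E (Suc M)) * sqrt (x (Suc M))" using pos by (simp add: E_def x_def)
    ultimately have "\<bar>e (Suc M) - e N - (r (Suc M) * p (Suc M) / (P (Suc M) * P M) +
        (\<Sum>k\<in>{N<..M}. r k * p k / (P k * P (k - 1))))\<bar>
      \<le> C1 * \<bar>sqrt (E (Suc M)) * sqrt (x (Suc M))\<bar> + C1 * (\<Sum>k\<in>{N<..M}. \<bar>sqrt (E k) * sqrt (x k)\<bar>)"
      using step.IH by (simp only: abs_of_nonneg)
    thus ?case unfolding * by (simp add: distrib_left)
  qed simp
  have S: "C1 * S \<le> C1 * sqrt (R N M) * sqrt (X N M)"
  proof -
    have "S \<le> sqrt (\<Sum>k\<in>{N<..M}. (sqrt (E k))\<^sup>2) * sqrt (\<Sum>k\<in>{N<..M}. (sqrt (x k))\<^sup>2)"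
      unfolding S_def by (rule cauchy_schwarz_finite)
    also have "(\<Sum>k\<in>{N<..M}. (sqrt (E k))\<^sup>2) = R N M"
      using r_pos u by (intro sum.cong refl) (simp add: E_def less_imp_le)
    also have "(\<Sum>k\<in>{N<..M}. (sqrt (x k))\<^sup>2) = X N M"
      using r_pos p_gt0 by (intro sum.cong refl) (simp add: x_def less_imp_le)
    finally show ?thesis using C1 by (simp add: mult_left_mono mult.assoc)
  qed
  have Y1: "Y \<le> X N M" unfolding Y_def
  proof (rule sum_mono)
    fix k assume k: "k \<in> {N<..M}"
    have "P k * P k \<le> P k * P (k - 1)"
      using P_gt0 P_antimono[of "k - 1" k] by (intro mult_left_mono) (auto intro: less_imp_le)
    thus "r k * p k / (P k * P (k - 1)) \<le> r k * p k / (P k)\<^sup>2"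
      unfolding power2_eq_square using k r_pos p_gt0 P_gt0
      by (intro divide_left_mono mult_nonneg_nonneg mult_pos_pos) (auto intro: less_imp_le)
  qed
  have Y2: "X N M / \<kappa> \<le> Y" unfolding Y_def sum_divide_distrib
  proof (rule sum_mono)
    fix k assume k: "k \<in> {N<..M}"
    have "P k * P (k - 1) \<le> (P k)\<^sup>2 * \<kappa>"
      using P_gt0[of k] P_slow[of "k - 1"] k by (simp add: power2_eq_square mult_ac)
    hence "r k * p k / ((P k)\<^sup>2 * \<kappa>) \<le> r k * p k / (P k * P (k - 1))"
      using k r_pos[of k] p_gt0[of k] P_gt0[of k] P_gt0[of "k - 1"] kappa_ge1
      by (intro divide_left_mono mult_nonneg_nonneg mult_pos_pos) auto
    thus "r k * p k / (P k)\<^sup>2 / \<kappa> \<le> r k * p k / (P k * P (k - 1))" by simp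
  qed
  have "Y \<ge> 0" using Y2 X_nonneg kappa_ge1 by (meson divide_nonneg_nonneg order_trans zero_le_one)
  thus "X N M / \<kappa> \<le> e M - e N + C1 * sqrt (R N M) * sqrt (X N M)"
    "e M - e N \<le> X N M + C1 * sqrt (R N M) * sqrt (X N M)"
    "e N - e M \<le> C1 * sqrt (R N M) * sqrt (X N M)"
    using main S Y1 Y2 by linarith+
qed

text \<open>The mixed term \<open>sqrt R * sqrt X\<close> is absorbed into \<open>X\<close> by the
  inequality of the means, at the price of a multiple of \<open>R\<close>.\<close>

lemma X_upper:
  assumes "N \<le> M"
  shows "X N M \<le> 2 * \<kappa> * (e M - e N) + \<kappa>\<^sup>2 * C1\<^sup>2 * R N M"
proof -
  define s where "s = sqrt (X N M)"
  define q where "q = \<kappa> * C1 * sqrt (R N M)"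
  define d where "d = e M - e N"
  define x where "x = X N M"
  have "x / \<kappa> \<le> d + C1 * sqrt (R N M) * s"
    using summation_by_parts(1)[OF assms] unfolding s_def d_def x_def .
  hence "x \<le> (d + C1 * sqrt (R N M) * s) * \<kappa>"
    using kappa_ge1 by (simp add: pos_divide_le_eq)
  also have "\<dots> = \<kappa> * d + q * s" by (simp add: q_def algebra_simps)
  finally have "x \<le> \<kappa> * d + q * s" .
  moreover have "2 * (q * s) \<le> q\<^sup>2 + s\<^sup>2" using sum_squares_bound[of q s] by simp
  moreover have "s\<^sup>2 = x" using X_nonneg by (simp add: s_def x_def)
  ultimately have "x \<le> 2 * (\<kappa> * d) + q\<^sup>2" by linarith
  moreover have "q\<^sup>2 = \<kappa>\<^sup>2 * C1\<^sup>2 * R N M"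
    using R_nonneg by (simp add: q_def power_mult_distrib)
  ultimately show ?thesis by (simp add: d_def x_def mult.assoc)
qed

text \<open>The hypothesis makes \<open>X 0 M\<close> and \<open>e M\<close> comparable both ways.
  The upper comparison is a Gronwall inequality for \<open>X\<close>, the lower one returns from
  \<open>X\<close> to \<open>e\<close>; multiplying by \<open>P\<close> gives the exponent 1 -
  \<delta> with \<delta> = 1 / K1.\<close>

lemma powr_lower_bound:
  assumes K: "\<And>M. M \<ge> 1 \<Longrightarrow> R 0 M \<le> K * e M"
  shows "\<exists>C>0. \<exists>\<delta>>0. \<forall>m n. 1 \<le> n \<longrightarrow> n < m \<longrightarrow> r m / r n \<ge> C * (P m / P n) powr (1 - \<delta>)"
proof -
  have epos: "e n > 0" for n using r_pos P_gt0 by simp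
  have K0: "K \<ge> 0"
  proof (rule ccontr)
    assume "\<not> K \<ge> 0"
    hence "K * e 1 < 0" using epos[of 1] by (intro mult_neg_pos) auto
    thus False using K[of 1] R_nonneg[of 0 1] by linarith
  qed
  define K1 where "K1 = 2 * \<kappa> + \<kappa>\<^sup>2 * C1\<^sup>2 * K"
  have K1: "K1 > 0" unfolding K1_def using kappa_ge1 K0 by (intro add_pos_nonneg) auto
  have up: "X 0 M \<le> K1 * e M" if "M \<ge> 1" for M
  proof -
    have "X 0 M \<le> 2 * \<kappa> * (e M - e 0) + \<kappa>\<^sup>2 * C1\<^sup>2 * R 0 M" by (rule X_upper) simp
    also have "\<dots> \<le> 2 * \<kappa> * e M + \<kappa>\<^sup>2 * C1\<^sup>2 * (K * e M)"
      using epos[of 0] kappa_ge1 by (intro add_mono mult_left_mono K that) auto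
    finally show ?thesis by (simp add: K1_def algebra_simps)
  qed
  define x1 where "x1 = r 1 * p 1 / (P 1)\<^sup>2"
  have x1: "x1 > 0" using r_pos p_gt0[of 1] P_gt0[of 1] by (simp add: x1_def)
  \<comment> \<open>The starting value \<open>e 0\<close> is bounded through the first summand
    \<open>x1\<close> of \<open>X 0 M\<close>; this is why \<open>low\<close> requires M \<ge>
    1.\<close>
  define K2 where "K2 = 2 * (e 0 / x1) + 2 + C1\<^sup>2 * K"
  have K2: "K2 > 0" unfolding K2_def
  proof (rule add_pos_nonneg)
    show "0 < 2 * (e 0 / x1) + 2"
      using divide_pos_pos[OF epos[of 0] x1] by linarith
  qed (use K0 in simp)
  have low: "e M \<le> K2 * X 0 M" if "M \<ge> 1" for M
  proof -
    define s where "s = sqrt (X 0 M)"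
    define q where "q = C1 * sqrt (R 0 M)"
    have "0 < (2::real)" "s\<^sup>2 = X 0 M" using X_nonneg by (simp_all add: s_def)
    have q2: "q\<^sup>2 \<le> C1\<^sup>2 * (K * e M)"
    proof -
      have "q\<^sup>2 = C1\<^sup>2 * R 0 M" using R_nonneg[of 0 M] by (simp add: q_def power_mult_distrib)
      also have "\<dots> \<le> C1\<^sup>2 * (K * e M)" by (rule mult_left_mono[OF K[OF that]]) simp
      finally show ?thesis .
    qed
    have "q * s \<le> e M / 2 + C1\<^sup>2 * K * X 0 M / 2"
    proof -
      have "(q * s)\<^sup>2 \<le> (C1\<^sup>2 * K * X 0 M) * e M"
        using mult_right_mono[OF q2, of "X 0 M"] X_nonneg[of 0 M] \<open>s\<^sup>2 = _\<close> by (simp add: power_mult_distrib mult_ac)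
      also have "\<dots> \<le> (e M / 2 + C1\<^sup>2 * K * X 0 M / 2)\<^sup>2"
        by (rule mult_le_square_mean)
      finally show ?thesis
        by (rule power2_le_imp_le) (use epos[of M] X_nonneg[of 0 M] K0 in auto)
    qed
    moreover have "e M - e 0 \<le> X 0 M + q * s"
      unfolding q_def s_def using summation_by_parts(2)[of 0 M] by simp
    moreover have "e 0 \<le> e 0 / x1 * X 0 M"
    proof -
      have "x1 = (\<Sum>k\<in>{1}. r k * p k / (P k)\<^sup>2)" by (simp add: x1_def)
      also have "\<dots> \<le> X 0 M"
        using that by (intro sum_mono2)
          (auto intro!: divide_nonneg_nonneg mult_nonneg_nonneg less_imp_le[OF r_pos] less_imp_le[OF p_gt0])
      finally have "e 0 / x1 * x1 \<le> e 0 / x1 * X 0 M"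
        using less_imp_le[OF divide_pos_pos[OF epos[of 0] x1]] by (rule mult_left_mono)
      thus ?thesis using x1 by simp
    qed
    moreover have "a \<le> 2 * y + 2 * x + c" if "s \<le> a / 2 + c / 2" "a - b \<le> x + s" "b \<le> y" for a b c x y s :: real
      using that by linarith
    ultimately have "e M \<le> 2 * (e 0 / x1 * X 0 M) + 2 * X 0 M + C1\<^sup>2 * K * X 0 M" by blast
    thus ?thesis by (simp add: K2_def algebra_simps)
  qed
  have gron: "X 0 n \<le> X 0 m * (P m / P n) powr (1 / K1)" if "n \<le> m" for n m
  proof (rule gronwall_increasing[OF K1 X_nonneg _ that])
    fix n
    have *: "{0<..Suc n} = insert (Suc n) {0<..n}" by auto
    have "p (Suc n) / P (Suc n) * (X 0 (Suc n) / K1) \<le> p (Suc n) / P (Suc n) * e (Suc n)"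
      using up[of "Suc n"] K1 p_gt0[of "Suc n"] P_gt0[of "Suc n"]
      by (intro mult_left_mono) (auto simp: field_simps)
    also have "\<dots> = X 0 (Suc n) - X 0 n" unfolding * by (simp add: power2_eq_square)
    finally show "X 0 n \<le> X 0 (Suc n) * (1 - p (Suc n) / P (Suc n) / K1)"
      by (simp add: algebra_simps)
  qed
  show ?thesis
  proof (intro exI conjI allI impI)
    show "1 / (K1 * K2) > 0" "1 / K1 > 0" using K1 K2 by auto
    fix m n :: nat assume mn: "1 \<le> n" "n < m"
    have pw: "(P m / P n) powr (1 / K1) > 0" using P_gt0[of m] P_gt0[of n] by simp
    have "e n \<le> K2 * X 0 n" by (rule low) (use mn in auto)
    also have "\<dots> \<le> K2 * (X 0 m * (P m / P n) powr (1 / K1))"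
      using K2 mn by (intro mult_left_mono gron) auto
    also have "\<dots> \<le> K2 * (K1 * e m * (P m / P n) powr (1 / K1))"
      using K2 mn by (intro mult_left_mono mult_right_mono up) auto
    finally have "r n * (P m / P n) \<le> K1 * K2 * r m * (P m / P n) powr (1 / K1)"
      using P_gt0[of m] P_gt0[of n] by (simp add: field_simps)
    moreover have "s / y \<le> c * (b / a)" if "a * s \<le> c * b * y" "a > 0" "y > 0" for a b c s y :: real
      using that by (simp add: field_simps)
    ultimately have "P m / P n / (P m / P n) powr (1 / K1) \<le> K1 * K2 * (r m / r n)"
      using r_pos[of n] pw by blast
    moreover have "(P m / P n) powr (1 - 1 / K1) = P m / P n / (P m / P n) powr (1 / K1)"
      using P_gt0[of m] P_gt0[of n] by (simp add: powr_diff)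
    moreover have "1 / (K1 * K2) * y \<le> x" if "y \<le> K1 * K2 * x" for x y :: real
      using that K1 K2 by (simp add: field_simps)
    ultimately show "r m / r n \<ge> 1 / (K1 * K2) * (P m / P n) powr (1 - 1 / K1)" by presburger
  qed
qed

text \<open>Since \<open>e\<close> tends to 0, the inequalities on {N<..M} survive the limit in M
  and control the tail \<open>Z N\<close> of the sum. \<open>Z\<close> is comparable with
  \<open>e\<close> both ways and obeys the decreasing Gronwall inequality.\<close>

lemma powr_upper_bound:
  assumes K: "\<And>N M. N \<le> M \<Longrightarrow> R N M \<le> K * (e M + e N)"
    and lim: "e \<longlonglongrightarrow> 0" and r_slow: "\<And>n. r n \<le> \<kappa>' * r (Suc n)"
  shows "\<exists>C>0. \<exists>\<delta>>0. \<forall>m n. n < m \<longrightarrow> r m / r n \<le> C * (P m / P n) powr (1 + \<delta>)"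
proof -
  have epos: "e n > 0" for n using r_pos P_gt0 by simp
  define K' where "K' = max K 1"
  have K': "K' > 0" "R N M \<le> K' * (e M + e N)" if "N \<le> M" for N M
  proof -
    have "K * (e M + e N) \<le> K' * (e M + e N)"
      using epos[of M] epos[of N] by (intro mult_right_mono) (auto simp: K'_def)
    thus "R N M \<le> K' * (e M + e N)" using K[OF that] by linarith
  qed (simp add: K'_def)
  define x where "x k = r k * p k / (P k)\<^sup>2" for k
  define Z where "Z N = (\<Sum>i. x (Suc N + i))" for N
  have x0: "x (Suc k) > 0" for k using r_pos p_gt0 P_gt0[of "Suc k"] by (simp add: x_def)
  have XI: "X N (N + k) = (\<Sum>i<k. x (Suc N + i))" for N k
  proof (induction k)
    case (Suc k)
    have "{N<..N + Suc k} = insert (Suc (N + k)) {N<..N + k}" by auto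
    thus ?case using Suc by (simp add: x_def)
  qed simp
  have XU: "X N M \<le> 2 * \<kappa> * (e M - e N) + \<kappa>\<^sup>2 * C1\<^sup>2 * (K' * (e M + e N))" if "N \<le> M" for N M
    using X_upper[OF that] mult_left_mono[OF K'(2)[OF that], of "\<kappa>\<^sup>2 * C1\<^sup>2"] by (simp add: mult.assoc)
  have lim': "(\<lambda>k. e (N + k)) \<longlonglongrightarrow> 0" for N
    using LIMSEQ_ignore_initial_segment[OF lim, of N] by (simp add: add.commute)
  have sm: "summable (\<lambda>i. x (Suc N + i))" for N
  proof -
    have "(\<lambda>k. 2 * \<kappa> * (e (N + k) - e N) + \<kappa>\<^sup>2 * C1\<^sup>2 * (K' * (e (N + k) + e N)))
          \<longlonglongrightarrow> 2 * \<kappa> * (0 - e N) + \<kappa>\<^sup>2 * C1\<^sup>2 * (K' * (0 + e N))"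
      by (intro tendsto_intros lim')
    hence "convergent (\<lambda>k. 2 * \<kappa> * (e (N + k) - e N) + \<kappa>\<^sup>2 * C1\<^sup>2 * (K' * (e (N + k) + e N)))"
      by (rule convergentI)
    hence "Bseq (\<lambda>k. 2 * \<kappa> * (e (N + k) - e N) + \<kappa>\<^sup>2 * C1\<^sup>2 * (K' * (e (N + k) + e N)))"
      by (rule convergent_imp_Bseq)
    then obtain D where D: "\<And>k. norm (2 * \<kappa> * (e (N + k) - e N) + \<kappa>\<^sup>2 * C1\<^sup>2 * (K' * (e (N + k) + e N))) \<le> D"
      unfolding Bseq_def by blast
    show ?thesis
    proof (rule summableI_nonneg_bounded)
      fix k show "(\<Sum>i<k. x (Suc N + i)) \<le> D"
        using XI[of N k] XU[of N "N + k"] D[of k] by simp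
    qed (use x0 in \<open>auto simp: less_imp_le\<close>)
  qed
  have limX: "(\<lambda>k. X N (N + k)) \<longlonglongrightarrow> Z N" for N
    unfolding XI Z_def using summable_LIMSEQ[OF sm] .
  have Z0: "Z N \<ge> 0" for N unfolding Z_def using x0 by (intro suminf_nonneg sm) (simp add: less_imp_le)
  \<comment> \<open>In the limit the boundary term of \<open>X_upper\<close> becomes - 2 \<kappa>
    \<open>e N\<close> and is discarded; the 1 keeps \<open>K1\<close> positive.\<close>
  define K1 where "K1 = \<kappa>\<^sup>2 * C1\<^sup>2 * K' + 1"
  have K1: "K1 > 0" using K'(1)[of 0 0] by (simp add: K1_def add_nonneg_pos)
  have up: "Z N \<le> K1 * e N" for N
  proof -
    have ZU: "Z N \<le> 2 * \<kappa> * (0 - e N) + \<kappa>\<^sup>2 * C1\<^sup>2 * (K' * (0 + e N))"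
    proof (rule LIMSEQ_le[OF limX])
      show "(\<lambda>k. 2 * \<kappa> * (e (N + k) - e N) + \<kappa>\<^sup>2 * C1\<^sup>2 * (K' * (e (N + k) + e N)))
          \<longlonglongrightarrow> 2 * \<kappa> * (0 - e N) + \<kappa>\<^sup>2 * C1\<^sup>2 * (K' * (0 + e N))"
        by (intro tendsto_intros lim')
    qed (use XU in auto)
    have "2 * \<kappa> * (0 - a) + \<kappa>\<^sup>2 * C1\<^sup>2 * (K' * (0 + a)) \<le> K1 * a" if "a \<ge> 0" for a
      using mult_nonneg_nonneg[of \<kappa> a] kappa_ge1 that by (simp add: K1_def algebra_simps)
    from this[of "e N"] have "2 * \<kappa> * (0 - e N) + \<kappa>\<^sup>2 * C1\<^sup>2 * (K' * (0 + e N)) \<le> K1 * e N"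
      using less_imp_le[OF epos[of N]] by blast
    with ZU show ?thesis by (rule order_trans)
  qed
  define K2 where "K2 = C1\<^sup>2 * K' + 1"
  have K2: "K2 > 0" using K'(1)[of 0 0] by (simp add: K2_def add_nonneg_pos)
  have low: "e N \<le> K2 * Z N" for N
  proof -
    have "e N - 0 \<le> C1 * sqrt (K' * (0 + e N)) * sqrt (Z N)"
    proof (rule LIMSEQ_le)
      show "(\<lambda>k. e N - e (N + k)) \<longlonglongrightarrow> e N - 0" by (intro tendsto_intros lim')
      show "(\<lambda>k. C1 * sqrt (K' * (e (N + k) + e N)) * sqrt (X N (N + k)))
          \<longlonglongrightarrow> C1 * sqrt (K' * (0 + e N)) * sqrt (Z N)"
        by (intro tendsto_intros lim' limX)
      have "e N - e (N + k) \<le> C1 * sqrt (K' * (e (N + k) + e N)) * sqrt (X N (N + k))" for k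
      proof -
        have "e N - e (N + k) \<le> C1 * sqrt (R N (N + k)) * sqrt (X N (N + k))"
          by (rule summation_by_parts) simp
        also have "\<dots> \<le> C1 * sqrt (K' * (e (N + k) + e N)) * sqrt (X N (N + k))"
          using C1 X_nonneg by (intro mult_right_mono mult_left_mono real_sqrt_le_mono K'(2)) auto
        finally show ?thesis .
      qed
      thus "\<exists>M. \<forall>k\<ge>M. e N - e (N + k) \<le> C1 * sqrt (K' * (e (N + k) + e N)) * sqrt (X N (N + k))" by blast
    qed
    hence "(e N)\<^sup>2 \<le> (C1 * sqrt (K' * e N) * sqrt (Z N))\<^sup>2" using epos[of N] by (intro power_mono) auto
    also have "\<dots> = e N * (C1\<^sup>2 * K' * Z N)"
    proof -
      have "(sqrt (K' * e N))\<^sup>2 = K' * e N" by (intro real_sqrt_pow2 mult_nonneg_nonneg less_imp_le[OF epos] less_imp_le[OF K'(1)[of 0 0]]) simp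
      moreover have "(sqrt (Z N))\<^sup>2 = Z N" by (rule real_sqrt_pow2[OF Z0])
      ultimately show ?thesis unfolding power_mult_distrib by (simp only: mult_ac)
    qed
    finally have "e N \<le> C1\<^sup>2 * K' * Z N" using epos[of N] unfolding power2_eq_square by (rule mult_left_le_imp_le)
    also have "\<dots> \<le> K2 * Z N" using Z0[of N] by (simp add: K2_def algebra_simps)
    finally show ?thesis .
  qed
  have \<kappa>': "\<kappa>' > 0"
  proof (rule ccontr)
    assume "\<not> \<kappa>' > 0"
    hence "\<kappa>' * r 1 \<le> 0" using r_pos[of 1] by (intro mult_nonpos_nonneg) auto
    thus False using r_slow[of 0] r_pos[of 0] by simp
  qed
  \<comment> \<open>The Gronwall step compares \<open>Z n\<close> with the summand at
    \<open>Suc n\<close>, whereas \<open>up\<close> gives \<open>e n\<close>; \<open>r_slow\<close>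
    bridges the one step and brings in \<kappa>'.\<close>
  define K3 where "K3 = K1 * \<kappa>'"
  have K3: "K3 > 0" using K1 \<kappa>' by (simp add: K3_def)
  have gron: "Z m \<le> Z n * (P m / P n) powr (1 / K3)" if "n \<le> m" for n m
  proof (rule gronwall_decreasing[OF K3 Z0 _ that])
    fix n
    have "e n \<le> \<kappa>' * r (Suc n) / P n" using r_slow[of n] P_gt0[of n] by (simp add: divide_right_mono)
    also have "\<dots> \<le> \<kappa>' * r (Suc n) / P (Suc n)"
      using P_antimono[of n "Suc n"] P_gt0 \<kappa>' r_pos by (intro divide_left_mono mult_nonneg_nonneg mult_pos_pos) (auto intro: less_imp_le)
    finally have "Z n \<le> K3 * e (Suc n)"
      using up[of n] mult_left_mono[of "e n" "\<kappa>' * e (Suc n)" K1] K1 by (simp add: K3_def mult.assoc)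
    hence "p (Suc n) / P (Suc n) * (Z n / K3) \<le> p (Suc n) / P (Suc n) * e (Suc n)"
      using K3 p_gt0[of "Suc n"] P_gt0[of "Suc n"]
      by (intro mult_left_mono) (auto simp: field_simps)
    also have "\<dots> = x (Suc n)" by (simp add: x_def power2_eq_square)
    also have "\<dots> = Z n - Z (Suc n)"
      using suminf_split_head[OF sm[of n]] by (simp add: Z_def)
    finally show "Z (Suc n) \<le> Z n * (1 - p (Suc n) / P (Suc n) / K3)"
      by (simp add: algebra_simps)
  qed
  show ?thesis
  proof (intro exI conjI allI impI)
    show "K1 * K2 > 0" "1 / K3 > 0" using K1 K2 K3 by auto
    fix m n :: nat assume mn: "n < m"
    have "e m \<le> K2 * Z m" by (rule low)
    also have "\<dots> \<le> K2 * (Z n * (P m / P n) powr (1 / K3))"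
      using K2 mn by (intro mult_left_mono gron) auto
    also have "\<dots> \<le> K2 * (K1 * e n * (P m / P n) powr (1 / K3))"
      using K2 mn by (intro mult_left_mono mult_right_mono up) auto
    finally have "r m \<le> K1 * K2 * r n * ((P m / P n) * (P m / P n) powr (1 / K3))"
      using P_gt0[of m] P_gt0[of n] by (simp add: field_simps)
    moreover have "(P m / P n) powr (1 + 1 / K3) = P m / P n * (P m / P n) powr (1 / K3)"
      using P_gt0[of m] P_gt0[of n] by (simp add: powr_add)
    ultimately show "r m / r n \<le> K1 * K2 * (P m / P n) powr (1 + 1 / K3)"
      using r_pos[of n] by (simp add: field_simps)
  qed
qed

end

end

section \<open>Lacunary sequences with slowly decaying tails\<close>

definition nsq :: "(nat \<Rightarrow> real) \<Rightarrow> (nat \<Rightarrow> complex) \<Rightarrow> real" where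
  "nsq v a = (\<Sum>\<^sub>\<infinity>k\<in>{1..}. (cmod (a k))\<^sup>2 * v k)"

definition kernel_sq :: "(nat \<Rightarrow> complex) \<Rightarrow> (nat \<Rightarrow> real) \<Rightarrow> complex \<Rightarrow> real" where
  "kernel_sq \<gamma> v z = (\<Sum>\<^sub>\<infinity>k\<in>{1..}. v k / (cmod (z - \<gamma> k))\<^sup>2)"

text \<open>The value 1 at index 0, where \<Gamma> has no point, lets a point of \<Lambda> carrying
  that index enter the same estimates as the others.\<close>

definition scale :: "(nat \<Rightarrow> complex) \<Rightarrow> nat \<Rightarrow> real" where
  "scale \<gamma> n = (if n = 0 then 1 else cmod (\<gamma> n))"

locale sparse_weights =
  fixes \<gamma> :: "nat \<Rightarrow> complex" and v :: "nat \<Rightarrow> real" and q :: real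
  assumes gamma_inj: "inj_on \<gamma> {1..}"
    and gamma_nz: "n \<ge> 1 \<Longrightarrow> \<gamma> n \<noteq> 0"
    and q: "q > 1" and lac: "n \<ge> 1 \<Longrightarrow> q * cmod (\<gamma> n) \<le> cmod (\<gamma> (Suc n))"
    and v_pos: "n \<ge> 1 \<Longrightarrow> v n > 0"
    and v_sum: "(\<lambda>n. v n / (1 + (cmod (\<gamma> n))\<^sup>2)) summable_on {1..}"
    and small: "(\<lambda>n. v n / (cmod (\<gamma> n))\<^sup>2) \<in> o(\<lambda>n. P \<gamma> v n)"
begin

abbreviation "g n \<equiv> cmod (\<gamma> n)"
abbreviation "p n \<equiv> v n / (cmod (\<gamma> n))\<^sup>2"
abbreviation "Pt \<equiv> P \<gamma> v"
abbreviation "s \<equiv> scale \<gamma>"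
abbreviation "w \<equiv> bessel_weight \<gamma> v"
abbreviation "f \<equiv> Hilb \<gamma> v"
abbreviation "\<H> \<equiv> l2w_nat v"

lemma g_pos: "n \<ge> 1 \<Longrightarrow> g n > 0"
  using gamma_nz by simp

lemma s_pos: "s n > 0"
  using g_pos by (simp add: scale_def)

lemma s_eq: "n \<ge> 1 \<Longrightarrow> s n = g n"
  by (simp add: scale_def)

lemma g_geometric:
  assumes "1 \<le> j" "j \<le> k"
  shows "q ^ (k - j) * g j \<le> g k"
  using assms(2)
proof (induction k rule: dec_induct)
  case (step k)
  have "q ^ (Suc k - j) * g j = q * (q ^ (k - j) * g j)" using step by (simp add: Suc_diff_le)
  also have "\<dots> \<le> q * g k" using step q by (intro mult_left_mono) auto
  also have "\<dots> \<le> g (Suc k)" using lac[of k] step assms by simp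
  finally show ?case .
qed simp

lemma g_mono: "1 \<le> j \<Longrightarrow> j \<le> k \<Longrightarrow> g j \<le> g k"
  using g_geometric[of j k] q mult_right_mono[of 1 "q ^ (k - j)" "g j"] by simp

lemma g_less: assumes "1 \<le> j" "j < k" shows "q * g j \<le> g k"
proof -
  have "q * g j \<le> g (Suc j)" using lac assms by simp
  also have "\<dots> \<le> g k" using assms by (intro g_mono) auto
  finally show ?thesis .
qed

lemma p_pos: "n \<ge> 1 \<Longrightarrow> p n > 0"
  using v_pos g_pos by simp

lemma p_summable: "p summable_on {1..}"
proof (rule summable_on_comparison_test)
  show "(\<lambda>n. (1 + 1 / (g 1)\<^sup>2) * (v n / (1 + (g n)\<^sup>2))) summable_on {1..}"
    by (rule summable_on_cmult_right[OF v_sum])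
  fix n :: nat assume "n \<in> {1..}"
  hence n: "n \<ge> 1" by simp
  have "(g 1)\<^sup>2 \<le> (g n)\<^sup>2" using n by (intro power_mono g_mono) auto
  hence "1 + (g n)\<^sup>2 \<le> (1 + 1 / (g 1)\<^sup>2) * (g n)\<^sup>2"
    using g_pos[of 1] by (simp add: field_simps)
  hence *: "1 / (g n)\<^sup>2 \<le> (1 + 1 / (g 1)\<^sup>2) / (1 + (g n)\<^sup>2)"
    using g_pos[OF n] by (simp add: field_simps add_pos_pos)
  thus "p n \<le> (1 + 1 / (g 1)\<^sup>2) * (v n / (1 + (g n)\<^sup>2))"
    using mult_left_mono[OF * less_imp_le[OF v_pos[OF n]]] by (simp add: mult_ac)
qed (use p_pos in \<open>auto intro: less_imp_le\<close>)

lemma p_summable': "p summable_on {n<..}"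
  by (rule summable_on_subset[OF p_summable]) auto

lemma Pt_step: "Pt n = p (Suc n) + Pt (Suc n)"
proof -
  have "{n<..} = insert (Suc n) {Suc n<..}" by auto
  thus ?thesis using p_summable'[of "Suc n"] by (simp add: P_def infsum_insert)
qed

lemma Pt_pos: "Pt n > 0"
proof -
  have "Pt (Suc n) \<ge> 0" unfolding P_def by (rule infsum_nonneg) (use p_pos in \<open>auto intro: less_imp_le\<close>)
  thus ?thesis using Pt_step[of n] p_pos[of "Suc n"] by linarith
qed

lemma p_small: assumes "\<epsilon> > 0" shows "\<forall>\<^sub>F n in sequentially. p n \<le> \<epsilon> * Pt n"
  using landau_o.smallD[OF small assms] eventually_ge_at_top[of 1]
proof eventually_elim
  case (elim n)
  have "p n \<le> \<bar>p n\<bar>" by (rule abs_ge_self)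
  also have "\<dots> \<le> \<epsilon> * Pt n" using elim(1) Pt_pos[of n] by simp
  finally show ?case .
qed

lemma Pt_ratio: assumes "\<eta> > 1" shows "\<forall>\<^sub>F n in sequentially. Pt n \<le> \<eta> * Pt (Suc n)"
proof -
  have "\<forall>\<^sub>F n in sequentially. p (Suc n) \<le> (\<eta> - 1) * Pt (Suc n)"
    using p_small[of "\<eta> - 1"] assms by (subst eventually_sequentially_Suc) auto
  thus ?thesis
  proof eventually_elim
    case (elim n)
    thus ?case using Pt_step[of n] by (simp add: algebra_simps)
  qed
qed

lemma ex_slow: "\<exists>\<kappa>. slow_decay Pt p \<kappa>"
proof -
  obtain N where N: "\<And>n. n \<ge> N \<Longrightarrow> Pt n \<le> 2 * Pt (Suc n)"
    using Pt_ratio[of 2] by (auto simp: eventually_sequentially)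
  \<comment> \<open>Beyond \<open>N\<close> consecutive values have ratio at most 2; the added sum
    dominates each of the finitely many earlier ratios.\<close>
  define \<kappa> where "\<kappa> = 2 + (\<Sum>n<N. Pt n / Pt (Suc n))"
  have "Pt n \<le> \<kappa> * Pt (Suc n)" for n
  proof (cases "n < N")
    case True
    have "Pt n / Pt (Suc n) \<le> (\<Sum>n<N. Pt n / Pt (Suc n))"
      using True Pt_pos by (intro member_le_sum) (auto intro: less_imp_le)
    hence "Pt n / Pt (Suc n) \<le> \<kappa>" by (simp add: \<kappa>_def)
    thus ?thesis using Pt_pos[of "Suc n"] by (simp add: pos_divide_le_eq)
  next
    case False
    have "(\<Sum>n<N. Pt n / Pt (Suc n)) \<ge> 0" using Pt_pos by (intro sum_nonneg) (auto intro: less_imp_le)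
    hence "2 * Pt (Suc n) \<le> \<kappa> * Pt (Suc n)" using Pt_pos[of "Suc n"] by (intro mult_right_mono) (auto simp: \<kappa>_def)
    thus ?thesis using N[of n] False by simp
  qed
  hence "slow_decay Pt p \<kappa>" by unfold_locales (use Pt_pos p_pos Pt_step in blast)+
  thus ?thesis by blast
qed

text \<open>A choice fixes one admissible constant, so that \<open>slow_decay\<close> becomes a
  sublocale and its lemmas are available without a further parameter.\<close>

definition "\<kappa> = (SOME \<kappa>. slow_decay Pt p \<kappa>)"

sublocale slow: slow_decay Pt p \<kappa>
  unfolding \<kappa>_def by (rule someI_ex[OF ex_slow])

lemma Pt_tendsto_0: "Pt \<longlonglongrightarrow> 0"
proof -
  have eq: "Pt n = Pt 0 - (\<Sum>k\<in>{1..n}. p k)" for n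
  proof (induction n)
    case (Suc n)
    thus ?case using Pt_step[of n] by simp
  qed simp
  have "(\<lambda>n. Pt 0 - (\<Sum>k\<in>{1..n}. p k)) \<longlonglongrightarrow> Pt 0 - infsum p {1..}"
    by (intro tendsto_intros sum_tendsto_infsum p_summable)
  moreover have "{0::nat<..} = {1..}" by auto
  hence "Pt 0 = infsum p {1..}" by (simp only: P_def)
  ultimately have "(\<lambda>n. Pt 0 - (\<Sum>k\<in>{1..n}. p k)) \<longlonglongrightarrow> 0" by simp
  thus ?thesis unfolding eq[symmetric] .
qed

text \<open>Each step multiplies \<open>s^2\<close> by at least q^2 and, eventually,
  \<open>Pt\<close> by at least 1 / q, so \<open>Pt s^2\<close> grows at least like q^n. Sums of
  such terms, or of their reciprocals, are dominated by one end.\<close>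

lemma geometric_Ps:
  obtains C where "C > 0" "\<And>m n. m \<le> n \<Longrightarrow> 1 / (Pt n * (s n)\<^sup>2) \<le> C * (1 / q) ^ (n - m) * (1 / (Pt m * (s m)\<^sup>2))"
proof (rule geometric_bound[of "\<lambda>n. 1 / (Pt n * (s n)\<^sup>2)" "1 / q"])
  show "\<forall>\<^sub>F n in sequentially. 1 / (Pt (Suc n) * (s (Suc n))\<^sup>2) \<le> 1 / q * (1 / (Pt n * (s n)\<^sup>2))"
    using Pt_ratio[OF q] eventually_ge_at_top[of 1]
  proof eventually_elim
    case (elim n)
    have pos: "Pt n > 0" "Pt (Suc n) > 0" "s n > 0" "s (Suc n) > 0" using Pt_pos s_pos by auto
    have "q * s n \<le> s (Suc n)" using lac elim by (simp add: s_eq)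
    hence "(q * s n)\<^sup>2 \<le> (s (Suc n))\<^sup>2" using q pos by (intro power_mono) auto
    hence "Pt (Suc n) * (q * s n)\<^sup>2 \<le> Pt (Suc n) * (s (Suc n))\<^sup>2" using pos by (intro mult_left_mono) auto
    moreover have "q * (Pt n * (s n)\<^sup>2) \<le> q * (q * Pt (Suc n) * (s n)\<^sup>2)"
      using elim q by (intro mult_left_mono mult_right_mono) auto
    ultimately have "q * (Pt n * (s n)\<^sup>2) \<le> Pt (Suc n) * (s (Suc n))\<^sup>2"
      by (simp add: power2_eq_square mult_ac)
    hence "1 / (Pt (Suc n) * (s (Suc n))\<^sup>2) \<le> 1 / (q * (Pt n * (s n)\<^sup>2))"
      using pos q by (intro divide_left_mono mult_pos_pos zero_less_power) auto
    thus ?case by simp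
  qed
qed (use q that in \<open>auto intro!: divide_pos_pos mult_pos_pos zero_less_power Pt_pos s_pos\<close>)

text \<open>For large k the hypothesis gives v_k \<le> \<epsilon>' P_k g_k^2, and the right-hand
  side grows geometrically, so its sum up to N is a multiple of the last term. The earlier v_k have
  a fixed sum, which is overtaken because P_N g_N^2 tends to infinity.\<close>

lemma sum_v_small:
  assumes "\<epsilon> > 0"
  shows "\<forall>\<^sub>F N in sequentially. (\<Sum>k\<in>{1..N}. v k) \<le> \<epsilon> * (Pt N * (g N)\<^sup>2)"
proof -
  obtain C where C: "C > 0" "\<And>m n. m \<le> n \<Longrightarrow> 1 / (Pt n * (s n)\<^sup>2) \<le> C * (1 / q) ^ (n - m) * (1 / (Pt m * (s m)\<^sup>2))"
    using geometric_Ps by blast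
  define y where "y n = Pt n * (s n)\<^sup>2" for n
  have y: "y n > 0" for n unfolding y_def by (intro mult_pos_pos zero_less_power Pt_pos s_pos)
  have yC: "y m \<le> C * (1 / q) ^ (n - m) * y n" if "m \<le> n" for m n
  proof -
    have "1 / y n \<le> C * (1 / q) ^ (n - m) * (1 / y m)" using C(2)[OF that] by (simp add: y_def)
    hence "1 / y n * (y n * y m) \<le> C * (1 / q) ^ (n - m) * (1 / y m) * (y n * y m)"
      using y[of m] y[of n] by (intro mult_right_mono) auto
    thus ?thesis using y[of m] y[of n] by (simp add: mult_ac)
  qed
  define D where "D = C * (2 / (1 - 1 / q))"
  have D: "D > 0" using C q by (simp add: D_def)
  have geo: "(\<Sum>k\<in>J. y k) \<le> D * y N" if J: "J \<subseteq> {..N}" for J N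
  proof -
    have fin: "finite J" using J finite_subset by blast
    have "(\<Sum>k\<in>J. y k) \<le> (\<Sum>k\<in>J. C * (1 / q) ^ ((k - N) + (N - k)) * y N)"
      using J yC by (intro sum_mono) (auto dest!: subsetD)
    also have "\<dots> = C * (\<Sum>k\<in>J. (1 / q) ^ ((k - N) + (N - k))) * y N"
      by (simp add: sum_distrib_left sum_distrib_right)
    also have "\<dots> \<le> C * (2 / (1 - 1 / q)) * y N"
      using C y[of N] q fin by (intro mult_right_mono mult_left_mono sum_power_distance_le) auto
    finally show ?thesis by (simp add: D_def)
  qed
  \<comment> \<open>\<open>D\<close> is the constant of the geometric sum; half of \<epsilon> goes
    to the large indices and half to the initial segment.\<close>
  define \<epsilon>' where "\<epsilon>' = \<epsilon> / (2 * D)"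
  have \<epsilon>': "\<epsilon>' > 0" using assms D by (simp add: \<epsilon>'_def)
  obtain K where K: "\<And>n. n \<ge> K \<Longrightarrow> p n \<le> \<epsilon>' * Pt n"
    using p_small[OF \<epsilon>'] by (auto simp: eventually_sequentially)
  define S where "S = (\<Sum>k\<in>{1..<K}. v k)"
  have "\<forall>\<^sub>F N in sequentially. (1 / q) ^ N < \<epsilon> / 2 * y 0 / (C * (\<bar>S\<bar> + 1))"
  proof (rule order_tendstoD)
    show "(\<lambda>N. (1 / q) ^ N) \<longlonglongrightarrow> 0" using q by (intro LIMSEQ_realpow_zero) auto
    show "0 < \<epsilon> / 2 * y 0 / (C * (\<bar>S\<bar> + 1))" using assms y[of 0] C by (intro divide_pos_pos mult_pos_pos) auto
  qed
  moreover have "\<forall>\<^sub>F N in sequentially. N \<ge> max 1 K" by (rule eventually_ge_at_top)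
  ultimately show ?thesis
  proof eventually_elim
    case (elim N)
    have "S \<le> \<epsilon> / 2 * y N"
    proof -
      have "y 0 \<le> C * (1 / q) ^ N * y N" using yC[of 0 N] by simp
      also have "\<dots> \<le> C * (\<epsilon> / 2 * y 0 / (C * (\<bar>S\<bar> + 1))) * y N"
        using elim C y[of N] by (intro mult_left_mono mult_right_mono) auto
      also have "\<dots> = y 0 * (\<epsilon> / 2 * y N / (\<bar>S\<bar> + 1))"
      proof -
        have "c * (e * b / (c * t)) * x = b * (e * x / t)" if "c > 0" for c e b t x :: real
          using that by (cases "t = 0") (simp_all add: field_simps)
        thus ?thesis using C(1) by blast
      qed
      finally have "y 0 * 1 \<le> y 0 * (\<epsilon> / 2 * y N / (\<bar>S\<bar> + 1))" unfolding mult_1_right .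
      hence "1 \<le> \<epsilon> / 2 * y N / (\<bar>S\<bar> + 1)" using y[of 0] by (rule mult_left_le_imp_le)
      hence "\<bar>S\<bar> + 1 \<le> \<epsilon> / 2 * y N" by (simp add: pos_le_divide_eq)
      thus ?thesis by linarith
    qed
    moreover have "(\<Sum>k\<in>{K..N} - {0}. v k) \<le> \<epsilon> / 2 * y N"
    proof -
      have "(\<Sum>k\<in>{K..N} - {0}. v k) \<le> (\<Sum>k\<in>{K..N} - {0}. \<epsilon>' * y k)"
      proof (rule sum_mono)
        fix k assume k: "k \<in> {K..N} - {0}"
        hence "v k = p k * (s k)\<^sup>2" using g_pos[of k] by (simp add: s_eq)
        also have "\<dots> \<le> \<epsilon>' * Pt k * (s k)\<^sup>2" using k K by (intro mult_right_mono) auto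
        finally show "v k \<le> \<epsilon>' * y k" by (simp add: y_def mult.assoc)
      qed
      also have "\<dots> = \<epsilon>' * (\<Sum>k\<in>{K..N} - {0}. y k)" by (simp add: sum_distrib_left)
      also have "\<dots> \<le> \<epsilon>' * (D * y N)" using \<epsilon>' by (intro mult_left_mono geo) auto
      finally show ?thesis using D by (simp add: \<epsilon>'_def)
    qed
    moreover have "(\<Sum>k\<in>{1..N}. v k) = S + (\<Sum>k\<in>{K..N} - {0}. v k)"
    proof -
      have "{1..N} = {1..<K} \<union> ({K..N} - {0})" using elim by auto
      thus ?thesis unfolding S_def by (simp only:) (rule sum.union_disjoint, auto)
    qed
    ultimately show ?case using elim by (simp add: y_def s_eq)
  qed
qed

section \<open>Distance to \<Gamma> and the Bessel kernel\<close>

lemma gamma_neq: "1 \<le> j \<Longrightarrow> 1 \<le> k \<Longrightarrow> j \<noteq> k \<Longrightarrow> \<gamma> j \<noteq> \<gamma> k"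
  using gamma_inj by (auto simp: inj_on_def)

lemma g_ge_power: "n \<ge> 1 \<Longrightarrow> g n \<ge> g 1 * q ^ (n - 1)"
  using g_geometric[of 1 n] by (simp add: mult.commute)

lemma g_unbounded: "\<forall>\<^sub>F n in sequentially. g n \<ge> c"
proof -
  have "filterlim (\<lambda>n. g 1 / q * q ^ n) at_top sequentially"
  proof (rule filterlim_tendsto_pos_mult_at_top[OF tendsto_const])
    show "filterlim (\<lambda>n. q ^ n) at_top sequentially"
      using q by (intro filterlim_at_infinity_imp_filterlim_at_top filterlim_realpow_sequentially_gt1) auto
  qed (use q g_pos[of 1] in simp)
  hence "\<forall>\<^sub>F n in sequentially. g 1 / q * q ^ n \<ge> c" by (simp add: filterlim_at_top)
  thus ?thesis using eventually_ge_at_top[of 1]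
  proof eventually_elim
    case (elim n)
    then obtain m where "n = Suc m" by (cases n) auto
    thus ?case using elim g_ge_power[of n] q by simp
  qed
qed

text \<open>All but finitely many \<gamma>_k have at least twice the modulus of z and so lie at
  distance at least half their own modulus; the others contribute a positive minimum.\<close>

lemma dist_gamma_lower:
  assumes "z \<notin> \<gamma> ` {1..}"
  obtains c where "c > 0" "\<And>k. k \<ge> 1 \<Longrightarrow> c * g k \<le> cmod (z - \<gamma> k)"
proof -
  obtain N where N: "\<And>n. n \<ge> N \<Longrightarrow> g n \<ge> 2 * cmod z"
    using g_unbounded[of "2 * cmod z"] by (auto simp: eventually_sequentially)
  define c where "c = Min (insert (1 / 2) ((\<lambda>k. cmod (z - \<gamma> k) / g k) ` {1..<N}))"
  show thesis
  proof (rule that[of c])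
    show "c > 0" unfolding c_def using assms gamma_nz
      by (subst Min_gr_iff) (auto intro!: divide_pos_pos)
    fix k :: nat assume k: "k \<ge> 1"
    show "c * g k \<le> cmod (z - \<gamma> k)"
    proof (cases "k < N")
      case True
      hence "c \<le> cmod (z - \<gamma> k) / g k" unfolding c_def using k by (intro Min_le) auto
      thus ?thesis using g_pos[OF k] by (simp add: field_simps)
    next
      case False
      have "c \<le> 1 / 2" unfolding c_def by (intro Min_le) auto
      hence "c * g k \<le> 1 / 2 * g k" by (intro mult_right_mono) auto
      also have "\<dots> \<le> g k - cmod z" using N[of k] False by simp
      also have "\<dots> \<le> cmod (z - \<gamma> k)" using norm_triangle_ineq2[of "\<gamma> k" z] by (simp add: norm_minus_commute)
      finally show ?thesis .
    qed
  qed
qed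

lemma kernel_summable:
  assumes "z \<notin> \<gamma> ` {1..}"
  shows "(\<lambda>k. v k / (cmod (z - \<gamma> k))\<^sup>2) summable_on {1..}"
proof -
  obtain c where c: "c > 0" "\<And>k. k \<ge> 1 \<Longrightarrow> c * g k \<le> cmod (z - \<gamma> k)"
    using dist_gamma_lower[OF assms] by blast
  show ?thesis
  proof (rule summable_on_comparison_test)
    show "(\<lambda>k. 1 / c\<^sup>2 * p k) summable_on {1..}" by (rule summable_on_cmult_right[OF p_summable])
    fix k :: nat assume "k \<in> {1..}"
    hence k: "k \<ge> 1" by simp
    have "(c * g k)\<^sup>2 \<le> (cmod (z - \<gamma> k))\<^sup>2" using c(1) c(2)[OF k] by (intro power_mono) auto
    hence "v k / (cmod (z - \<gamma> k))\<^sup>2 \<le> v k / (c * g k)\<^sup>2"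
      using c(1) c(2)[OF k] g_pos[OF k] v_pos[OF k] mult_pos_pos[OF c(1) g_pos[OF k]]
      by (intro divide_left_mono mult_pos_pos zero_less_power) linarith+
    thus "v k / (cmod (z - \<gamma> k))\<^sup>2 \<le> 1 / c\<^sup>2 * p k" by (simp add: power_mult_distrib)
  qed (auto intro!: divide_nonneg_nonneg less_imp_le[OF v_pos])
qed

lemma kernel_ge_sum:
  assumes "z \<notin> \<gamma> ` {1..}" "finite F" "F \<subseteq> {1..}"
  shows "(\<Sum>k\<in>F. v k / (cmod (z - \<gamma> k))\<^sup>2) \<le> kernel_sq \<gamma> v z"
  unfolding kernel_sq_def
  using assms by (intro finite_sum_le_infsum kernel_summable)
    (auto intro!: divide_nonneg_nonneg less_imp_le[OF v_pos])

lemma kernel_pos: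
  assumes "z \<notin> \<gamma> ` {1..}"
  shows "kernel_sq \<gamma> v z > 0"
proof -
  have "z \<noteq> \<gamma> 1" using assms by auto
  hence "v 1 / (cmod (z - \<gamma> 1))\<^sup>2 > 0" using v_pos[of 1] by (intro divide_pos_pos) auto
  thus ?thesis using kernel_ge_sum[OF assms, of "{1}"] by simp
qed

lemma w_pos: "z \<notin> \<gamma> ` {1..} \<Longrightarrow> w z > 0"
  using kernel_pos by (simp add: bessel_weight_def kernel_sq_def)

lemma w_eq: "w z = inverse (kernel_sq \<gamma> v z)"
  by (simp add: bessel_weight_def kernel_sq_def)

lemma w_le_term:
  assumes "z \<notin> \<gamma> ` {1..}" "k \<ge> 1"
  shows "w z * v k \<le> (cmod (z - \<gamma> k))\<^sup>2"
proof -
  have "v k / (cmod (z - \<gamma> k))\<^sup>2 \<le> kernel_sq \<gamma> v z"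
    using kernel_ge_sum[OF assms(1), of "{k}"] assms by simp
  moreover have "cmod (z - \<gamma> k) > 0" using assms by auto
  ultimately show ?thesis using kernel_pos[OF assms(1)] by (simp add: w_eq field_simps)
qed

end

section \<open>The weighted sequence space\<close>

text \<open>Invertibility for a bare point set, free of indexing, since \<Lambda> has to be
  renumbered later. Injectivity is contained in the lower bound.\<close>

definition hilb_invertible_on :: "(nat \<Rightarrow> complex) \<Rightarrow> (nat \<Rightarrow> real) \<Rightarrow> complex set \<Rightarrow> bool" where
  "hilb_invertible_on \<gamma> v L \<longleftrightarrow>
     (\<forall>a\<in>l2w_nat v. (\<lambda>z. (cmod (Hilb \<gamma> v a z))\<^sup>2 * bessel_weight \<gamma> v z) summable_on L) \<and>
     (\<forall>b. (\<lambda>z. (cmod (b z))\<^sup>2 * bessel_weight \<gamma> v z) summable_on L \<longrightarrow>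
        (\<exists>a\<in>l2w_nat v. \<forall>z\<in>L. Hilb \<gamma> v a z = b z)) \<and>
     (\<exists>C. \<forall>a\<in>l2w_nat v. nsq v a \<le> C * (\<Sum>\<^sub>\<infinity>z\<in>L. (cmod (Hilb \<gamma> v a z))\<^sup>2 * bessel_weight \<gamma> v z))"

context sparse_weights
begin

abbreviation "nrm a \<equiv> sqrt (nsq v a)"

lemma l2_iff: "a \<in> \<H> \<longleftrightarrow> a 0 = 0 \<and> (\<lambda>k. (cmod (a k))\<^sup>2 * v k) summable_on {1..}"
  by (auto simp: l2w_nat_def)

lemma l2_term_nonneg: "k \<in> {1..} \<Longrightarrow> 0 \<le> (cmod (a k))\<^sup>2 * v k"
  using v_pos by (intro mult_nonneg_nonneg) (auto intro: less_imp_le)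

lemma nsq_nonneg: "nsq v a \<ge> 0"
  unfolding nsq_def by (rule infsum_nonneg) (rule l2_term_nonneg)

lemma nsq_ge_sum:
  assumes "a \<in> \<H>" "finite F" "F \<subseteq> {1..}"
  shows "(\<Sum>k\<in>F. (cmod (a k))\<^sup>2 * v k) \<le> nsq v a"
  unfolding nsq_def using assms l2_term_nonneg by (intro finite_sum_le_infsum) (auto simp: l2_iff)

lemma nsq_leI:
  assumes "a 0 = 0" "\<And>N. (\<Sum>k\<in>{1..N}. (cmod (a k))\<^sup>2 * v k) \<le> C"
  shows "a \<in> \<H>" "nsq v a \<le> C"
proof -
  have "(\<Sum>k\<in>F. (cmod (a k))\<^sup>2 * v k) \<le> C" if F: "finite F" "F \<subseteq> {1..}" for F
  proof -
    have "(\<Sum>k\<in>F. (cmod (a k))\<^sup>2 * v k) \<le> (\<Sum>k\<in>{1..Max (insert 0 F)}. (cmod (a k))\<^sup>2 * v k)"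
      using F l2_term_nonneg by (intro sum_mono2) auto
    thus ?thesis using assms(2) order_trans by blast
  qed
  hence "(\<lambda>k. (cmod (a k))\<^sup>2 * v k) summable_on {1..}" "(\<Sum>\<^sub>\<infinity>k\<in>{1..}. (cmod (a k))\<^sup>2 * v k) \<le> C"
    using sum_le_bound_summable[of "{1..}" "\<lambda>k. (cmod (a k))\<^sup>2 * v k" C] l2_term_nonneg by blast+
  thus "a \<in> \<H>" "nsq v a \<le> C" using assms(1) by (auto simp: l2_iff nsq_def)
qed

lemma sqrt_sum_le_nrm:
  assumes "a \<in> \<H>"
  shows "L2_set (\<lambda>k. cmod (a k) * sqrt (v k)) {1..N} \<le> nrm a"
proof -
  have "(\<Sum>k\<in>{1..N}. (cmod (a k) * sqrt (v k))\<^sup>2) = (\<Sum>k\<in>{1..N}. (cmod (a k))\<^sup>2 * v k)"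
    using v_pos by (intro sum.cong) (auto simp: power_mult_distrib less_imp_le)
  thus ?thesis using nsq_ge_sum[OF assms, of "{1..N}"] by (simp add: L2_set_def)
qed

lemma nrm_leI:
  assumes "a 0 = 0" "\<And>N. L2_set (\<lambda>k. cmod (a k) * sqrt (v k)) {1..N} \<le> C"
  shows "a \<in> \<H>" "nrm a \<le> C"
proof -
  have C: "C \<ge> 0" using assms(2)[of 0] by simp
  have "(\<Sum>k\<in>{1..N}. (cmod (a k))\<^sup>2 * v k) \<le> C\<^sup>2" for N
  proof -
    have "(\<Sum>k\<in>{1..N}. (cmod (a k) * sqrt (v k))\<^sup>2) = (\<Sum>k\<in>{1..N}. (cmod (a k))\<^sup>2 * v k)"
      using v_pos by (intro sum.cong) (auto simp: power_mult_distrib less_imp_le)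
    thus ?thesis using assms(2)[of N] C by (auto simp: L2_set_def real_le_lsqrt dest: sqrt_le_D)
  qed
  note * = nsq_leI[OF assms(1) this]
  show "a \<in> \<H>" by (rule *)
  show "nrm a \<le> C" using *(2) C by (simp add: real_le_lsqrt nsq_nonneg)
qed

lemma nrm_triangle:
  assumes "a \<in> \<H>" "b \<in> \<H>"
  shows "(\<lambda>k. a k + b k) \<in> \<H>" "nrm (\<lambda>k. a k + b k) \<le> nrm a + nrm b"
proof -
  have "L2_set (\<lambda>k. cmod (a k + b k) * sqrt (v k)) {1..N} \<le> nrm a + nrm b" for N
  proof -
    have "L2_set (\<lambda>k. cmod (a k + b k) * sqrt (v k)) {1..N}
        \<le> L2_set (\<lambda>k. cmod (a k) * sqrt (v k) + cmod (b k) * sqrt (v k)) {1..N}"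
      using v_pos by (intro L2_set_mono)
        (auto simp flip: distrib_right intro!: mult_right_mono mult_nonneg_nonneg norm_triangle_ineq intro: less_imp_le)
    also have "\<dots> \<le> L2_set (\<lambda>k. cmod (a k) * sqrt (v k)) {1..N} + L2_set (\<lambda>k. cmod (b k) * sqrt (v k)) {1..N}"
      by (rule L2_set_triangle_ineq)
    also have "\<dots> \<le> nrm a + nrm b" by (intro add_mono sqrt_sum_le_nrm assms)
    finally show ?thesis .
  qed
  note * = nrm_leI[of "\<lambda>k. a k + b k", OF _ this]
  show "(\<lambda>k. a k + b k) \<in> \<H>" "nrm (\<lambda>k. a k + b k) \<le> nrm a + nrm b"
    using * assms by (auto simp: l2_iff)
qed

lemma nrm_scale:
  assumes "a \<in> \<H>"
  shows "(\<lambda>k. c * a k) \<in> \<H>" "nrm (\<lambda>k. c * a k) = cmod c * nrm a"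
proof -
  have eq: "(\<lambda>k. (cmod (c * a k))\<^sup>2 * v k) = (\<lambda>k. (cmod c)\<^sup>2 * ((cmod (a k))\<^sup>2 * v k))"
    by (auto simp: norm_mult power_mult_distrib)
  show "(\<lambda>k. c * a k) \<in> \<H>"
    using assms unfolding l2_iff eq by (auto intro: summable_on_cmult_right)
  have "nsq v (\<lambda>k. c * a k) = (cmod c)\<^sup>2 * nsq v a"
    unfolding nsq_def eq using assms by (intro infsum_cmult_right) (auto simp: l2_iff)
  thus "nrm (\<lambda>k. c * a k) = cmod c * nrm a" by (simp add: real_sqrt_mult)
qed

lemma l2_diff:
  assumes "a \<in> \<H>" "b \<in> \<H>"
  shows "(\<lambda>k. a k - b k) \<in> \<H>"
  using nrm_triangle(1)[OF assms(1) nrm_scale(1)[OF assms(2), of "-1"]] by simp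

text \<open>Limits are taken in each coordinate, and the norm estimate passes to the limit on finite
  sections. Increments of size (1/3)^n are those of the gliding hump below; 3/2 (1/3)^n is their sum
  from n on.\<close>

lemma l2_complete:
  assumes X: "\<And>n. X n \<in> \<H>" and step: "\<And>n. nrm (\<lambda>k. X (Suc n) k - X n k) \<le> (1 / 3) ^ n"
  obtains x where "x \<in> \<H>" "\<And>n. nrm (\<lambda>k. x k - X n k) \<le> 3 / 2 * (1 / 3) ^ n"
proof -
  have dist: "nrm (\<lambda>k. X m k - X n k) \<le> 3 / 2 * ((1 / 3) ^ n - (1 / 3) ^ m)" if "n \<le> m" for m n
    using that
  proof (induction m rule: dec_induct)
    case base
    thus ?case by (simp add: nsq_def)
  next
    case (step m)
    have "nrm (\<lambda>k. (X (Suc m) k - X m k) + (X m k - X n k))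
        \<le> nrm (\<lambda>k. X (Suc m) k - X m k) + nrm (\<lambda>k. X m k - X n k)"
      by (intro nrm_triangle l2_diff X)
    also have "\<dots> \<le> (1 / 3) ^ m + 3 / 2 * ((1 / 3) ^ n - (1 / 3) ^ m)"
      by (intro add_mono step assms)
    finally show ?case by (simp add: algebra_simps)
  qed
  have dist': "nrm (\<lambda>k. X m k - X n k) \<le> 3 / 2 * (1 / 3) ^ n" if "n \<le> m" for m n
  proof -
    have "3 / 2 * ((1 / 3) ^ n - (1 / 3) ^ m) \<le> (3 / 2 * (1 / 3) ^ n :: real)" by simp
    thus ?thesis using dist[OF that] by (rule order_trans[rotated])
  qed
  have ptw: "cmod (X m k - X n k) \<le> 3 / 2 * (1 / 3) ^ n / sqrt (v k)" if "n \<le> m" "k \<ge> 1" for m n k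
  proof -
    have "cmod (X m k - X n k) * sqrt (v k) \<le> L2_set (\<lambda>k. cmod (X m k - X n k) * sqrt (v k)) {1..k}"
      using that v_pos by (intro member_le_L2_set) auto
    also have "\<dots> \<le> nrm (\<lambda>k. X m k - X n k)" by (rule sqrt_sum_le_nrm[OF l2_diff[OF X X]])
    also have "\<dots> \<le> 3 / 2 * (1 / 3) ^ n" by (rule dist'[OF that(1)])
    finally show ?thesis using v_pos[OF that(2)] by (simp add: pos_le_divide_eq)
  qed
  have conv: "convergent (\<lambda>n. X n k)" for k
  proof (cases "k \<ge> 1")
    case True
    have "Cauchy (\<lambda>n. X n k)"
    proof (rule metric_CauchyI)
      fix e :: real assume "e > 0"
      have "(\<lambda>n. 3 / 2 * (1 / 3) ^ n / sqrt (v k)) \<longlonglongrightarrow> 3 / 2 * 0 / sqrt (v k)"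
        using v_pos[OF True] by (intro tendsto_intros LIMSEQ_realpow_zero) auto
      hence "\<forall>\<^sub>F n in sequentially. 3 / 2 * (1 / 3) ^ n / sqrt (v k) < e / 2"
        using \<open>e > 0\<close> by (intro order_tendstoD) auto
      then obtain N where N: "3 / 2 * (1 / 3) ^ N / sqrt (v k) < e / 2"
        by (auto simp: eventually_sequentially)
      show "\<exists>M. \<forall>m\<ge>M. \<forall>n\<ge>M. dist (X m k) (X n k) < e"
      proof (intro exI allI impI)
        fix m n assume mn: "m \<ge> N" "n \<ge> N"
        have "dist (X m k) (X n k) \<le> dist (X m k) (X N k) + dist (X n k) (X N k)"
          by (rule dist_triangle2)
        thus "dist (X m k) (X n k) < e"
          using ptw[OF mn(1) True] ptw[OF mn(2) True] N by (simp add: dist_norm)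
      qed
    qed
    thus ?thesis by (simp add: Cauchy_convergent_iff)
  next
    case False
    hence "k = 0" by simp
    hence "(\<lambda>n. X n k) = (\<lambda>_. 0)" using X by (auto simp: l2_iff)
    thus ?thesis by (simp add: convergent_const)
  qed
  define x where "x k = lim (\<lambda>n. X n k)" for k
  have lim: "(\<lambda>n. X n k) \<longlonglongrightarrow> x k" for k
    using conv[of k] by (simp add: x_def convergent_LIMSEQ_iff)
  have x0: "x 0 = 0" using X by (simp add: x_def l2_iff)
  have diff: "(\<lambda>k. x k - X n k) \<in> \<H> \<and> nrm (\<lambda>k. x k - X n k) \<le> 3 / 2 * (1 / 3) ^ n" for n
  proof -
    have "L2_set (\<lambda>k. cmod (x k - X n k) * sqrt (v k)) {1..N} \<le> 3 / 2 * (1 / 3) ^ n" for N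
    proof (rule LIMSEQ_le_const2)
      show "(\<lambda>m. L2_set (\<lambda>k. cmod (X m k - X n k) * sqrt (v k)) {1..N})
          \<longlonglongrightarrow> L2_set (\<lambda>k. cmod (x k - X n k) * sqrt (v k)) {1..N}"
        unfolding L2_set_def by (intro tendsto_intros lim)
      show "\<exists>M. \<forall>m\<ge>M. L2_set (\<lambda>k. cmod (X m k - X n k) * sqrt (v k)) {1..N} \<le> 3 / 2 * (1 / 3) ^ n"
        using order_trans[OF sqrt_sum_le_nrm[OF l2_diff[OF X X]] dist'] by blast
    qed
    moreover have "x 0 - X n 0 = 0" using x0 X by (simp add: l2_iff)
    ultimately show ?thesis using nrm_leI[of "\<lambda>k. x k - X n k"] by blast
  qed
  have "x \<in> \<H>" using nrm_triangle(1)[OF conjunct1[OF diff[of 0]] X[of 0]] by simp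
  thus thesis using that diff by blast
qed

text \<open>Sokal's gliding-hump argument: the signs are chosen so that no step destroys the previous gain.\<close>

lemma uniform_boundedness:
  fixes Q :: "'i \<Rightarrow> (nat \<Rightarrow> complex) \<Rightarrow> real"
  assumes bnd: "\<And>i. \<exists>D. \<forall>a\<in>\<H>. Q i a \<le> D * nrm a"
    and sub: "\<And>i a b. a \<in> \<H> \<Longrightarrow> b \<in> \<H> \<Longrightarrow> Q i (\<lambda>k. a k + b k) \<le> Q i a + Q i b"
    and scl: "\<And>i a c. a \<in> \<H> \<Longrightarrow> Q i (\<lambda>k. of_real c * a k) = \<bar>c\<bar> * Q i a"
    and ptw: "\<And>a. a \<in> \<H> \<Longrightarrow> \<exists>B. \<forall>i. Q i a \<le> B"
  shows "\<exists>C\<ge>0. \<forall>i. \<forall>a\<in>\<H>. Q i a \<le> C * nrm a"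
proof (rule ccontr)
  assume neg: "\<not> ?thesis"
  \<comment> \<open>\<open>D\<close> is the exact norm of \<open>Q i\<close>, so the loss from later
    steps is measured by the same number as the gain: of D / 3^n, the share 3/4 - 1/2 = 1/4 remains,
    and 4^n \<le> D beats 3^n.\<close>
  have "\<exists>i u D. u \<in> \<H> \<and> nrm u \<le> 1 \<and> 4 ^ n \<le> D \<and> 3 / 4 * D \<le> Q i u \<and> (\<forall>a\<in>\<H>. Q i a \<le> D * nrm a)" for n
  proof -
    have "(4::real) ^ n \<ge> 0" by simp
    with neg obtain i a where a: "a \<in> \<H>" "Q i a > 4 ^ n * nrm a" by (metis not_le)
    obtain D' where D': "\<And>b. b \<in> \<H> \<Longrightarrow> Q i b \<le> D' * nrm b" using bnd by blast
    have nz: "nrm a > 0"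
    proof (rule ccontr)
      assume "\<not> nrm a > 0"
      hence "nrm a = 0" using nsq_nonneg[of a] by simp
      thus False using a D'[OF a(1)] by simp
    qed
    define S where "S = {Q i b | b. b \<in> \<H> \<and> nrm b \<le> 1}"
    have normalize: "Q i b / nrm b \<in> S" if "b \<in> \<H>" "nrm b > 0" for b
    proof -
      have "Q i (\<lambda>k. of_real (1 / nrm b) * b k) = \<bar>1 / nrm b\<bar> * Q i b" by (rule scl[OF that(1)])
      moreover have "nrm (\<lambda>k. of_real (1 / nrm b) * b k) = cmod (of_real (1 / nrm b)) * nrm b"
        by (rule nrm_scale[OF that(1)])
      moreover have "(\<lambda>k. of_real (1 / nrm b) * b k) \<in> \<H>" by (rule nrm_scale[OF that(1)])
      ultimately show ?thesis unfolding S_def using that(2)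
        by (intro CollectI exI[of _ "\<lambda>k. of_real (1 / nrm b) * b k"]) (auto simp: norm_divide)
    qed
    have bdd: "bdd_above S"
    proof (rule bdd_aboveI)
      fix y assume "y \<in> S"
      then obtain b where b: "b \<in> \<H>" "nrm b \<le> 1" "y = Q i b" by (auto simp: S_def)
      have "y \<le> D' * nrm b" using D' b by simp
      also have "\<dots> \<le> \<bar>D'\<bar> * 1" using b nsq_nonneg by (intro mult_mono) auto
      finally show "y \<le> \<bar>D'\<bar>" by simp
    qed
    have aS: "Q i a / nrm a \<in> S" by (rule normalize[OF a(1) nz])
    have "4 ^ n < Q i a / nrm a" using a(2) nz by (simp add: pos_less_divide_eq)
    also have "\<dots> \<le> Sup S" by (rule cSup_upper[OF aS bdd])
    finally have D4: "4 ^ n < Sup S" .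
    have "Sup S > 0" using D4 zero_less_power[of "4::real" n] by linarith
    hence "3 / 4 * Sup S < Sup S" by simp
    then obtain y where "y \<in> S" "3 / 4 * Sup S < y" using less_cSupE[of "3 / 4 * Sup S" S] aS by blast
    then obtain u where u: "u \<in> \<H>" "nrm u \<le> 1" "3 / 4 * Sup S < Q i u" by (auto simp: S_def)
    have "Q i b \<le> Sup S * nrm b" if "b \<in> \<H>" for b
    proof (cases "nrm b > 0")
      case True
      have "Q i b / nrm b \<le> Sup S" by (rule cSup_upper[OF normalize[OF that True] bdd])
      thus ?thesis using True by (simp add: pos_divide_le_eq)
    next
      case False
      hence "nrm b = 0" using nsq_nonneg[of b] by simp
      thus ?thesis using D'[OF that] by simp
    qed
    thus ?thesis using u D4 by (intro exI[of _ i] exI[of _ u] exI[of _ "Sup S"]) auto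
  qed
  then obtain i u D where
    u: "\<And>n::nat. u n \<in> \<H>" and u1: "\<And>n::nat. nrm (u n) \<le> 1" and D: "\<And>n::nat. 4 ^ n \<le> D n"
    and Qu: "\<And>n::nat. 3 / 4 * D n \<le> Q (i n) (u n)" and QD: "\<And>n a. a \<in> \<H> \<Longrightarrow> Q (i n) a \<le> D n * nrm a"
    by metis
  define y where "y n k = of_real ((1 / 3) ^ n) * u n k" for n k
  define X where "X = rec_nat (\<lambda>_. 0) (\<lambda>n x. if Q (i n) (y n) \<le> Q (i n) (\<lambda>k. x k + y n k)
      then (\<lambda>k. x k + y n k) else (\<lambda>k. x k - y n k))"
  have X0: "X 0 = (\<lambda>_. 0)" and XS: "X (Suc n) = (if Q (i n) (y n) \<le> Q (i n) (\<lambda>k. X n k + y n k)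
      then (\<lambda>k. X n k + y n k) else (\<lambda>k. X n k - y n k))" for n
    by (simp_all add: X_def)
  have y: "y n \<in> \<H>" for n unfolding y_def by (rule nrm_scale[OF u])
  have ny: "nrm (y n) \<le> (1 / 3) ^ n" for n
  proof -
    have "nrm (y n) = (1 / 3) ^ n * nrm (u n)" unfolding y_def by (subst nrm_scale[OF u]) (simp add: norm_power norm_divide)
    also have "\<dots> \<le> (1 / 3) ^ n * 1" by (intro mult_left_mono u1) simp
    finally show ?thesis by simp
  qed
  have X: "X n \<in> \<H>" for n
  proof (induction n)
    case 0
    thus ?case by (simp add: X0 l2_iff)
  next
    case (Suc n)
    thus ?case using nrm_triangle(1)[OF Suc y[of n]] l2_diff[OF Suc y[of n]] by (simp add: XS)
  qed
  have step: "nrm (\<lambda>k. X (Suc n) k - X n k) \<le> (1 / 3) ^ n" for n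
  proof -
    have "nrm (\<lambda>k. - y n k) = nrm (y n)" using nrm_scale(2)[OF y[of n], of "-1"] by simp
    thus ?thesis using ny[of n] by (simp add: XS)
  qed
  \<comment> \<open>Twice \<open>y n\<close> is the difference of \<open>X n + y n\<close> and
    \<open>X n - y n\<close>, so at least one of these has seminorm no smaller than that of
    \<open>y n\<close>; the recursion takes that one.\<close>
  have gain: "Q (i n) (y n) \<le> Q (i n) (X (Suc n))" for n
  proof (cases "Q (i n) (y n) \<le> Q (i n) (\<lambda>k. X n k + y n k)")
    case False
    have XSn: "X (Suc n) = (\<lambda>k. X n k - y n k)" using False by (simp add: XS)
    have neg: "Q (i n) (\<lambda>k. of_real (-1) * (X n k - y n k)) = \<bar>-1\<bar> * Q (i n) (\<lambda>k. X n k - y n k)"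
      by (rule scl[OF l2_diff[OF X y]])
    have two: "Q (i n) (\<lambda>k. of_real 2 * y n k) = \<bar>2\<bar> * Q (i n) (y n)"
      by (rule scl[OF y])
    have "Q (i n) (\<lambda>k. (X n k + y n k) + of_real (-1) * (X n k - y n k))
        \<le> Q (i n) (\<lambda>k. X n k + y n k) + Q (i n) (\<lambda>k. of_real (-1) * (X n k - y n k))"
      using nrm_scale(1)[OF l2_diff[OF X y], of "of_real (-1)"]
      by (intro sub nrm_triangle X y) simp
    moreover have "(\<lambda>k. (X n k + y n k) + of_real (-1) * (X n k - y n k)) = (\<lambda>k. of_real 2 * y n k)"
      by auto
    ultimately show ?thesis using False two neg by (simp add: XSn)
  qed (simp add: XS)
  obtain x where x: "x \<in> \<H>" "\<And>n. nrm (\<lambda>k. x k - X n k) \<le> 3 / 2 * (1 / 3) ^ n"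
    using l2_complete[OF X step] by blast
  obtain B where B: "\<And>i. Q i x \<le> B" using ptw[OF x(1)] by blast
  have "(4 / 3) ^ n / 4 \<le> B" for n :: nat
  proof -
    have Dn: "D n \<ge> 0" using D[of n] zero_le_power[of "4::real" n] by linarith
    have "(4 / 3) ^ n / 4 = (1 / 3) ^ n * (4 ^ n / 4 :: real)" by (simp add: power_divide)
    also have "\<dots> \<le> (1 / 3) ^ n * (D n / 4)" by (intro mult_left_mono divide_right_mono D) auto
    also have "\<dots> = (1 / 3) ^ n * (3 / 4 * D n) - D n * (3 / 2 * (1 / 3) ^ Suc n)" by simp
    also have "(1 / 3) ^ n * (3 / 4 * D n) \<le> (1 / 3) ^ n * Q (i n) (u n)" by (intro mult_left_mono Qu) auto
    also have "\<dots> = Q (i n) (y n)" unfolding y_def by (subst scl[OF u]) simp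
    also have "\<dots> \<le> Q (i n) (X (Suc n))" by (rule gain)
    also have "X (Suc n) = (\<lambda>k. x k + (-1) * (x k - X (Suc n) k))" by auto
    also have "Q (i n) \<dots> \<le> Q (i n) x + Q (i n) (\<lambda>k. (-1) * (x k - X (Suc n) k))"
      by (intro sub x nrm_scale l2_diff X)
    also have "Q (i n) (\<lambda>k. (-1) * (x k - X (Suc n) k)) \<le> D n * nrm (\<lambda>k. (-1) * (x k - X (Suc n) k))"
      by (intro QD nrm_scale l2_diff X x)
    also have "nrm (\<lambda>k. (-1) * (x k - X (Suc n) k)) = nrm (\<lambda>k. x k - X (Suc n) k)"
      by (subst nrm_scale[OF l2_diff[OF x(1) X]]) simp
    also have "D n * \<dots> \<le> D n * (3 / 2 * (1 / 3) ^ Suc n)" by (intro mult_left_mono x Dn)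
    finally have "(4 / 3) ^ n / 4 \<le> Q (i n) x" by simp
    thus ?thesis using B[of "i n"] by linarith
  qed
  moreover obtain n :: nat where "4 * B < (4 / 3) ^ n" using real_arch_pow[of "4 / 3" "4 * B"] by auto
  ultimately show False by (metis divide_right_mono leD mult.commute nonzero_mult_div_cancel_left pos_divide_le_eq zero_less_numeral)
qed

end

section \<open>The discrete Hilbert transform\<close>

context sparse_weights
begin

lemma cauchy_schwarz_H:
  assumes a: "a \<in> \<H>" and c: "(\<lambda>k. (cmod (c k))\<^sup>2 * v k) summable_on {1..}"
  shows "(\<lambda>k. a k * of_real (v k) * c k) summable_on {1..}"
    and "(cmod (\<Sum>\<^sub>\<infinity>k\<in>{1..}. a k * of_real (v k) * c k))\<^sup>2
      \<le> nsq v a * (\<Sum>\<^sub>\<infinity>k\<in>{1..}. (cmod (c k))\<^sup>2 * v k)"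
proof -
  define x where "x k = a k * of_real (sqrt (v k))" for k
  define y where "y k = of_real (sqrt (v k)) * c k" for k
  have x2: "(cmod (x k))\<^sup>2 = (cmod (a k))\<^sup>2 * v k" and y2: "(cmod (y k))\<^sup>2 = (cmod (c k))\<^sup>2 * v k"
    and xy: "x k * y k = a k * of_real (v k) * c k" if "k \<in> {1..}" for k
  proof -
    have "v k > 0" using that v_pos by simp
    thus "(cmod (x k))\<^sup>2 = (cmod (a k))\<^sup>2 * v k" "(cmod (y k))\<^sup>2 = (cmod (c k))\<^sup>2 * v k"
      by (simp_all add: x_def y_def norm_mult power_mult_distrib)
    have "complex_of_real (sqrt (v k)) * of_real (sqrt (v k)) = of_real (v k)"
      using \<open>v k > 0\<close> by (simp flip: of_real_mult)
    thus "x k * y k = a k * of_real (v k) * c k" by (simp add: x_def y_def mult_ac)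
  qed
  have sx: "(\<lambda>k. (cmod (x k))\<^sup>2) summable_on {1..}"
    using a by (subst summable_on_cong[OF x2]) (auto simp: l2_iff)
  have sy: "(\<lambda>k. (cmod (y k))\<^sup>2) summable_on {1..}"
    using c by (subst summable_on_cong[OF y2]) auto
  have "(\<lambda>k. x k * y k) summable_on {1..}"
    using cauchy_schwarz_infsum(1)[OF sx sy] by (rule abs_summable_summable)
  thus "(\<lambda>k. a k * of_real (v k) * c k) summable_on {1..}"
    by (subst summable_on_cong[OF xy, symmetric])
  have "(\<Sum>\<^sub>\<infinity>k\<in>{1..}. x k * y k) = (\<Sum>\<^sub>\<infinity>k\<in>{1..}. a k * of_real (v k) * c k)"
    by (rule infsum_cong[OF xy])
  moreover have "(\<Sum>\<^sub>\<infinity>k\<in>{1..}. (cmod (x k))\<^sup>2) = nsq v a"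
    unfolding nsq_def by (rule infsum_cong[OF x2])
  moreover have "(\<Sum>\<^sub>\<infinity>k\<in>{1..}. (cmod (y k))\<^sup>2) = (\<Sum>\<^sub>\<infinity>k\<in>{1..}. (cmod (c k))\<^sup>2 * v k)"
    by (rule infsum_cong[OF y2])
  ultimately show "(cmod (\<Sum>\<^sub>\<infinity>k\<in>{1..}. a k * of_real (v k) * c k))\<^sup>2
      \<le> nsq v a * (\<Sum>\<^sub>\<infinity>k\<in>{1..}. (cmod (c k))\<^sup>2 * v k)"
    using cauchy_schwarz_infsum(2)[OF sx sy] by simp
qed

lemma kernel_term: "(cmod (1 / (z - \<gamma> k)))\<^sup>2 * v k = v k / (cmod (z - \<gamma> k))\<^sup>2"
  by (simp add: norm_divide power_divide)

lemma hilb_summable: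
  assumes "a \<in> \<H>" "z \<notin> \<gamma> ` {1..}"
  shows "(\<lambda>k. a k * of_real (v k) / (z - \<gamma> k)) summable_on {1..}"
  using cauchy_schwarz_H(1)[OF assms(1), of "\<lambda>k. 1 / (z - \<gamma> k)", unfolded kernel_term, OF kernel_summable[OF assms(2)]]
  by simp

text \<open>Cauchy-Schwarz against the kernel: the Bessel weight is the normalization under which
  every single evaluation is a contraction.\<close>

lemma hilb_sq_le: 
  assumes "a \<in> \<H>" "z \<notin> \<gamma> ` {1..}"
  shows "(cmod (f a z))\<^sup>2 * w z \<le> nsq v a"
proof -
  have "(cmod (f a z))\<^sup>2 \<le> nsq v a * kernel_sq \<gamma> v z"
    using cauchy_schwarz_H(2)[OF assms(1), of "\<lambda>k. 1 / (z - \<gamma> k)", unfolded kernel_term, OF kernel_summable[OF assms(2)]]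
    by (simp add: Hilb_def kernel_sq_def)
  thus ?thesis using kernel_pos[OF assms(2)] by (simp add: w_eq field_simps)
qed

lemma hilb_add:
  assumes "a \<in> \<H>" "b \<in> \<H>" "z \<notin> \<gamma> ` {1..}"
  shows "f (\<lambda>k. a k + b k) z = f a z + f b z"
  unfolding Hilb_def using infsum_add[OF hilb_summable[OF assms(1,3)] hilb_summable[OF assms(2,3)]]
  by (simp add: distrib_right add_divide_distrib)

lemma hilb_scale:
  assumes "a \<in> \<H>" "z \<notin> \<gamma> ` {1..}"
  shows "f (\<lambda>k. c * a k) z = c * f a z"
  unfolding Hilb_def using infsum_cmult_right[of c, OF hilb_summable[OF assms]]
  by (simp add: mult.assoc)

lemma hilb_diff:
  assumes "a \<in> \<H>" "b \<in> \<H>" "z \<notin> \<gamma> ` {1..}"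
  shows "f (\<lambda>k. a k - b k) z = f a z - f b z"
  using hilb_add[OF assms(1) nrm_scale(1)[OF assms(2), of "-1"] assms(3)] hilb_scale[OF assms(2,3), of "-1"]
  by simp

text \<open>Duality: a combination of values of the transform is the pairing of \<open>a\<close>
  with the same combination of Cauchy kernels. Coefficients for which the kernels cancel at many
  \<gamma>_k drive the counting of points and the decay of \<open>h^2 / Pt\<close>.\<close>

lemma hilb_finite_combination:
  assumes "a \<in> \<H>" "finite F" "F \<inter> \<gamma> ` {1..} = {}"
  shows "((\<lambda>k. a k * of_real (v k) * (\<Sum>z\<in>F. c z / (z - \<gamma> k))) has_sum (\<Sum>z\<in>F. c z * f a z)) {1..}"
  using assms(2,3)
proof (induction F rule: finite_induct)
  case (insert z F)
  have "z \<notin> \<gamma> ` {1..}" using insert.prems by auto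
  hence "((\<lambda>k. a k * of_real (v k) / (z - \<gamma> k)) has_sum f a z) {1..}"
    unfolding Hilb_def by (intro has_sum_infsum hilb_summable assms)
  hence "((\<lambda>k. c z * (a k * of_real (v k) / (z - \<gamma> k))) has_sum c z * f a z) {1..}"
    by (rule has_sum_cmult_right)
  moreover have "((\<lambda>k. a k * of_real (v k) * (\<Sum>z\<in>F. c z / (z - \<gamma> k))) has_sum (\<Sum>z\<in>F. c z * f a z)) {1..}"
    using insert by auto
  ultimately have "((\<lambda>k. c z * (a k * of_real (v k) / (z - \<gamma> k)) + a k * of_real (v k) * (\<Sum>z\<in>F. c z / (z - \<gamma> k)))
      has_sum (c z * f a z + (\<Sum>z\<in>F. c z * f a z))) {1..}"
    by (rule has_sum_add)
  thus ?case using insert.hyps by (simp add: distrib_left mult_ac)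
qed simp

lemma finite_support:
  assumes a: "\<And>k. k \<notin> {1..N} \<Longrightarrow> a k = 0"
  shows "a \<in> \<H>" "nsq v a = (\<Sum>k\<in>{1..N}. (cmod (a k))\<^sup>2 * v k)"
    "f a z = (\<Sum>k\<in>{1..N}. a k * of_real (v k) / (z - \<gamma> k))"
proof -
  have "(\<lambda>k. (cmod (a k))\<^sup>2 * v k) summable_on {1..} \<longleftrightarrow> (\<lambda>k. (cmod (a k))\<^sup>2 * v k) summable_on {1..N}"
    using a by (intro summable_on_cong_neutral) auto
  thus "a \<in> \<H>" using a[of 0] by (auto simp: l2_iff)
  have "nsq v a = infsum (\<lambda>k. (cmod (a k))\<^sup>2 * v k) {1..N}"
    unfolding nsq_def using a by (intro infsum_cong_neutral) auto
  thus "nsq v a = (\<Sum>k\<in>{1..N}. (cmod (a k))\<^sup>2 * v k)" by simp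
  have "f a z = infsum (\<lambda>k. a k * of_real (v k) / (z - \<gamma> k)) {1..N}"
    unfolding Hilb_def using a by (intro infsum_cong_neutral) auto
  thus "f a z = (\<Sum>k\<in>{1..N}. a k * of_real (v k) / (z - \<gamma> k))" by simp
qed

text \<open>Reindexing along the injective \<open>lam\<close> identifies the two image spaces, and
  padding with 0 below \<open>n0\<close> matches the encoding of sequences. One side bounds norms
  and the other squared norms, so the constants are squared or rooted.\<close>

lemma Hdisc_invertible_iff:
  assumes inj: "inj_on lam {n0..}" and disj: "lam ` {n0..} \<inter> \<gamma> ` {1..} = {}"
  shows "Hdisc_invertible \<gamma> v lam n0 (\<lambda>n. w (lam n)) \<longleftrightarrow> hilb_invertible_on \<gamma> v (lam ` {n0..})"
proof -
  define L where "L = lam ` {n0..}"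
  define T where "T = Hdisc \<gamma> v lam n0"
  define E where "E = l2w_int n0 (\<lambda>n. w (lam n))"
  have nL: "lam n \<notin> \<gamma> ` {1..}" if "n \<ge> n0" for n using disj that by blast
  have T: "T a n = f a (lam n)" if "n \<ge> n0" for a n using that by (simp add: T_def Hdisc_def)
  have T0: "T a n = 0" if "n < n0" for a n using that by (simp add: T_def Hdisc_def)
  have sm: "(\<lambda>n. (cmod (b (lam n)))\<^sup>2 * w (lam n)) summable_on {n0..} \<longleftrightarrow> (\<lambda>z. (cmod (b z))\<^sup>2 * w z) summable_on L" for b
    unfolding L_def by (subst summable_on_reindex[OF inj]) (simp add: o_def)
  have TE: "T a \<in> E \<longleftrightarrow> (\<lambda>z. (cmod (f a z))\<^sup>2 * w z) summable_on L" for a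
  proof -
    have "T a \<in> E \<longleftrightarrow> (\<lambda>n. (cmod (T a n))\<^sup>2 * w (lam n)) summable_on {n0..}"
      by (auto simp: E_def l2w_int_def T0)
    also have "\<dots> \<longleftrightarrow> (\<lambda>n. (cmod (f a (lam n)))\<^sup>2 * w (lam n)) summable_on {n0..}"
      by (intro summable_on_cong) (simp add: T)
    finally show ?thesis using sm[of "f a"] by simp
  qed
  have TN: "(l2norm_int n0 (\<lambda>n. w (lam n)) (T a))\<^sup>2 = (\<Sum>\<^sub>\<infinity>z\<in>L. (cmod (f a z))\<^sup>2 * w z)" for a
  proof -
    have "(\<Sum>\<^sub>\<infinity>n\<in>{n0..}. (cmod (T a n))\<^sup>2 * w (lam n)) = (\<Sum>\<^sub>\<infinity>n\<in>{n0..}. (cmod (f a (lam n)))\<^sup>2 * w (lam n))"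
      by (intro infsum_cong) (simp add: T)
    also have "\<dots> = (\<Sum>\<^sub>\<infinity>z\<in>L. (cmod (f a z))\<^sup>2 * w z)"
      unfolding L_def by (subst infsum_reindex[OF inj]) (simp add: o_def)
    finally have eq: "(\<Sum>\<^sub>\<infinity>n\<in>{n0..}. (cmod (T a n))\<^sup>2 * w (lam n)) = (\<Sum>\<^sub>\<infinity>z\<in>L. (cmod (f a z))\<^sup>2 * w z)" .
    have "\<dots> \<ge> 0" using w_pos nL by (intro infsum_nonneg mult_nonneg_nonneg) (auto simp: L_def intro: less_imp_le)
    thus ?thesis unfolding l2norm_int_def eq by simp
  qed
  have Nn: "l2norm_nat v a = nrm a" for a by (simp add: l2norm_nat_def nsq_def)
  have Np: "l2norm_int n0 (\<lambda>n. w (lam n)) b \<ge> 0" for b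
    unfolding l2norm_int_def using w_pos nL
    by (intro real_sqrt_ge_zero infsum_nonneg mult_nonneg_nonneg) (auto intro: less_imp_le)
  show ?thesis
  proof
    assume "Hdisc_invertible \<gamma> v lam n0 (\<lambda>n. w (lam n))"
    then obtain C where bij: "bij_betw T \<H> E" and C: "\<And>a. a \<in> \<H> \<Longrightarrow> nrm a \<le> C * l2norm_int n0 (\<lambda>n. w (lam n)) (T a)"
      unfolding Hdisc_invertible_def T_def[symmetric] E_def[symmetric] Nn by blast
    show "hilb_invertible_on \<gamma> v (lam ` {n0..})"
      unfolding hilb_invertible_on_def L_def[symmetric]
    proof (intro conjI ballI allI impI exI)
      fix a assume "a \<in> \<H>"
      thus "(\<lambda>z. (cmod (f a z))\<^sup>2 * w z) summable_on L" using bij TE by (auto simp: bij_betw_def)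
    next
      fix b assume b: "(\<lambda>z. (cmod (b z))\<^sup>2 * w z) summable_on L"
      define b' where "b' n = (if n0 \<le> n then b (lam n) else 0)" for n
      have "(\<lambda>n. (cmod (b' n))\<^sup>2 * w (lam n)) summable_on {n0..} \<longleftrightarrow>
          (\<lambda>n. (cmod (b (lam n)))\<^sup>2 * w (lam n)) summable_on {n0..}"
        by (intro summable_on_cong) (simp add: b'_def)
      hence "b' \<in> E" using sm[of b] b by (auto simp: E_def l2w_int_def b'_def)
      then obtain a where a: "a \<in> \<H>" "T a = b'" using bij by (auto simp: bij_betw_def)
      have "f a z = b z" if "z \<in> L" for z
      proof -
        obtain n where n: "n \<ge> n0" "z = lam n" using \<open>z \<in> L\<close> by (auto simp: L_def)
        have "T a n = b' n" using a(2) by simp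
        thus ?thesis using T[OF n(1)] n by (simp add: b'_def)
      qed
      thus "\<exists>a\<in>\<H>. \<forall>z\<in>L. f a z = b z" using a(1) by blast
    next
      fix a assume "a \<in> \<H>"
      hence "(nrm a)\<^sup>2 \<le> (C * l2norm_int n0 (\<lambda>n. w (lam n)) (T a))\<^sup>2"
        using C nsq_nonneg by (intro power_mono) auto
      thus "nsq v a \<le> C\<^sup>2 * (\<Sum>\<^sub>\<infinity>z\<in>L. (cmod (f a z))\<^sup>2 * w z)"
        by (simp add: power_mult_distrib TN nsq_nonneg)
    qed
  next
    assume H: "hilb_invertible_on \<gamma> v (lam ` {n0..})"
    then obtain C where C: "\<And>a. a \<in> \<H> \<Longrightarrow> nsq v a \<le> C * (\<Sum>\<^sub>\<infinity>z\<in>L. (cmod (f a z))\<^sup>2 * w z)"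
      unfolding hilb_invertible_on_def L_def[symmetric] by blast
    have A: "\<And>a. a \<in> \<H> \<Longrightarrow> T a \<in> E"
      using H unfolding hilb_invertible_on_def L_def[symmetric] TE by blast
    have S: "\<And>b. (\<lambda>z. (cmod (b z))\<^sup>2 * w z) summable_on L \<Longrightarrow> \<exists>a\<in>\<H>. \<forall>z\<in>L. f a z = b z"
      using H unfolding hilb_invertible_on_def L_def[symmetric] by blast
    have "inj_on T \<H>"
    proof (rule inj_onI)
      fix a b assume ab: "a \<in> \<H>" "b \<in> \<H>" "T a = T b"
      define d where "d k = a k - b k" for k
      have d: "d \<in> \<H>" unfolding d_def by (rule l2_diff[OF ab(1,2)])
      have "f d z = 0" if "z \<in> L" for z
      proof -
        obtain n where n: "n \<ge> n0" "z = lam n" using \<open>z \<in> L\<close> by (auto simp: L_def)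
        have "f a z = f b z" using fun_cong[OF ab(3), of n] T[OF n(1)] n by simp
        thus ?thesis unfolding d_def using hilb_diff[OF ab(1,2)] nL n by simp
      qed
      hence "(\<Sum>\<^sub>\<infinity>z\<in>L. (cmod (f d z))\<^sup>2 * w z) = (\<Sum>\<^sub>\<infinity>z\<in>L. 0)" by (intro infsum_cong) simp
      hence "nsq v d \<le> 0" using C[OF d] by simp
      have "d k = 0" for k
      proof (cases "k \<ge> 1")
        case True
        have "(cmod (d k))\<^sup>2 * v k \<le> 0" using nsq_ge_sum[OF d, of "{k}"] True \<open>nsq v d \<le> 0\<close> by simp
        hence "(cmod (d k))\<^sup>2 \<le> 0" using v_pos[OF True] by (simp add: mult_le_0_iff)
        thus ?thesis by simp
      next
        case False
        hence "k = 0" by simp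
        thus ?thesis using d by (simp add: l2_iff)
      qed
      thus "a = b" by (auto simp: d_def)
    qed
    moreover have "T ` \<H> = E"
    proof (intro equalityI subsetI)
      fix b' assume b': "b' \<in> E"
      define b where "b z = b' (the_inv_into {n0..} lam z)" for z
      have bl: "b (lam n) = b' n" if "n \<ge> n0" for n
        using that by (simp add: b_def the_inv_into_f_f[OF inj])
      have "(\<lambda>n. (cmod (b (lam n)))\<^sup>2 * w (lam n)) summable_on {n0..} \<longleftrightarrow> (\<lambda>n. (cmod (b' n))\<^sup>2 * w (lam n)) summable_on {n0..}"
        by (intro summable_on_cong) (simp add: bl)
      hence "(\<lambda>z. (cmod (b z))\<^sup>2 * w z) summable_on L" using b' sm[of b] by (simp add: E_def l2w_int_def)
      then obtain a where a: "a \<in> \<H>" "\<And>z. z \<in> L \<Longrightarrow> f a z = b z" using S by blast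
      have "T a n = b' n" for n
        using T[of n a] T0[of n a] a(2)[of "lam n"] bl[of n] b' by (cases "n \<ge> n0") (auto simp: L_def E_def l2w_int_def)
      hence "T a = b'" by (simp add: fun_eq_iff)
      thus "b' \<in> T ` \<H>" using a(1) by blast
    qed (use A in auto)
    ultimately have "bij_betw T \<H> E" by (simp add: bij_betw_def)
    moreover have "nrm a \<le> sqrt \<bar>C\<bar> * l2norm_int n0 (\<lambda>n. w (lam n)) (T a)" if "a \<in> \<H>" for a
    proof -
      have "nsq v a \<le> C * (l2norm_int n0 (\<lambda>n. w (lam n)) (T a))\<^sup>2" using C[OF that] by (simp add: TN)
      also have "\<dots> \<le> \<bar>C\<bar> * (l2norm_int n0 (\<lambda>n. w (lam n)) (T a))\<^sup>2" by (intro mult_right_mono) auto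
      finally have "nrm a \<le> sqrt (\<bar>C\<bar> * (l2norm_int n0 (\<lambda>n. w (lam n)) (T a))\<^sup>2)" by (rule real_sqrt_le_mono)
      thus ?thesis using Np[of "T a"] by (simp add: real_sqrt_mult)
    qed
    ultimately show "Hdisc_invertible \<gamma> v lam n0 (\<lambda>n. w (lam n))"
      unfolding Hdisc_invertible_def T_def[symmetric] E_def[symmetric] Nn by blast
  qed
qed

text \<open>With G = |\<gamma>'|^2 the number \<zeta> = G - cnj \<gamma>' z lies in the closed disc
  of radius G about G, and inversion maps that disc, punctured at 0, into the half plane where the
  real part is at least 1 / (2 G).\<close>

lemma Re_inverse_ge_half:
  assumes "\<gamma>' \<noteq> 0" "cmod z \<le> cmod \<gamma>'" "z \<noteq> \<gamma>'"
  shows "Re (- (1 / cnj \<gamma>' / (z - \<gamma>'))) \<ge> 1 / (2 * (cmod \<gamma>')\<^sup>2)"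
proof -
  define G where "G = (cmod \<gamma>')\<^sup>2"
  define \<zeta> where "\<zeta> = of_real G - cnj \<gamma>' * z"
  have G: "G > 0" using assms by (simp add: G_def)
  have \<zeta>: "\<zeta> = - (cnj \<gamma>' * (z - \<gamma>'))"
    by (simp add: \<zeta>_def G_def algebra_simps complex_norm_square[symmetric] mult.commute[of \<gamma>'] flip: complex_norm_square)
  have nz: "\<zeta> \<noteq> 0" unfolding \<zeta> using assms by simp
  have "cmod (cnj \<gamma>' * z) \<le> G" using assms by (simp add: norm_mult G_def power2_eq_square mult_left_mono)
  hence t: "(cmod (cnj \<gamma>' * z))\<^sup>2 \<le> G\<^sup>2" by (intro power_mono) auto
  have "(cmod \<zeta>)\<^sup>2 = G\<^sup>2 - 2 * G * Re (cnj \<gamma>' * z) + (cmod (cnj \<gamma>' * z))\<^sup>2"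
    unfolding \<zeta>_def cmod_power2 by (simp add: power2_eq_square algebra_simps)
  also have "\<dots> \<le> 2 * G * Re \<zeta>" using t by (simp add: \<zeta>_def algebra_simps power2_eq_square)
  finally have "1 / (2 * G) \<le> Re \<zeta> / (cmod \<zeta>)\<^sup>2" using G nz by (simp add: field_simps)
  also have "\<dots> = Re (1 / \<zeta>)" by (simp add: Re_divide cmod_power2)
  also have "1 / \<zeta> = - (1 / cnj \<gamma>' / (z - \<gamma>'))" unfolding \<zeta> by (simp add: divide_inverse)
  finally show ?thesis by (simp add: G_def)
qed

text \<open>Invertibility as encoded places the values of the transform in the weighted space
  without bounding them, so uniform boundedness is applied to the seminorms over finite subsets of
  \<open>L\<close>. The test sequence has squared norm \<open>Pt N\<close> and a transform of
  modulus at least \<open>Pt N / 2\<close> on the disc.\<close>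

lemma w_sum_bound:
  assumes disj: "L \<inter> \<gamma> ` {1..} = {}" and inv: "hilb_invertible_on \<gamma> v L"
  obtains C where "C > 0" "\<And>N F. finite F \<Longrightarrow> F \<subseteq> L \<Longrightarrow> (\<And>z. z \<in> F \<Longrightarrow> cmod z \<le> g (Suc N)) \<Longrightarrow> (\<Sum>z\<in>F. w z) \<le> C / Pt N"
proof -
  have nL: "z \<notin> \<gamma> ` {1..}" if "z \<in> L" for z using that disj by blast
  define ok where "ok F \<longleftrightarrow> finite F \<and> F \<subseteq> L" for F
  define Q where "Q F a = (if ok F then L2_set (\<lambda>z. cmod (f a z) * sqrt (w z)) F else 0)" for F a
  have "\<exists>C\<ge>0. \<forall>F. \<forall>a\<in>\<H>. Q F a \<le> C * nrm a"
  proof (rule uniform_boundedness)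
    fix F
    have "Q F a \<le> real (card F) * nrm a" if a: "a \<in> \<H>" for a
    proof (cases "ok F")
      case True
      have "Q F a \<le> (\<Sum>z\<in>F. cmod (f a z) * sqrt (w z))"
      proof -
        have "cmod (f a z) * sqrt (w z) \<ge> 0" if "z \<in> F" for z
          using less_imp_le[OF w_pos[OF nL[of z]]] True that by (auto simp: ok_def)
        thus ?thesis using True by (simp add: Q_def L2_set_le_sum)
      qed
      also have "\<dots> \<le> (\<Sum>z\<in>F. nrm a)"
      proof (rule sum_mono)
        fix z assume "z \<in> F"
        hence z: "z \<notin> \<gamma> ` {1..}" using True nL by (auto simp: ok_def)
        have "sqrt ((cmod (f a z))\<^sup>2 * w z) \<le> nrm a" by (intro real_sqrt_le_mono hilb_sq_le a z)
        thus "cmod (f a z) * sqrt (w z) \<le> nrm a" by (simp add: real_sqrt_mult)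
      qed
      finally show ?thesis by simp
    qed (use nsq_nonneg in \<open>simp add: Q_def\<close>)
    thus "\<exists>D. \<forall>a\<in>\<H>. Q F a \<le> D * nrm a" by blast
  next
    fix F a b assume ab: "a \<in> \<H>" "b \<in> \<H>"
    show "Q F (\<lambda>k. a k + b k) \<le> Q F a + Q F b"
    proof (cases "ok F")
      case True
      have "Q F (\<lambda>k. a k + b k) \<le> L2_set (\<lambda>z. cmod (f a z) * sqrt (w z) + cmod (f b z) * sqrt (w z)) F"
        unfolding Q_def using True
      proof (simp, intro L2_set_mono)
        fix z assume "z \<in> F"
        hence z: "z \<notin> \<gamma> ` {1..}" using True nL by (auto simp: ok_def)
        show "cmod (f (\<lambda>k. a k + b k) z) * sqrt (w z) \<le> cmod (f a z) * sqrt (w z) + cmod (f b z) * sqrt (w z)"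
          unfolding hilb_add[OF ab z] distrib_right[symmetric]
          using w_pos[OF z] by (intro mult_right_mono norm_triangle_ineq) auto
        show "0 \<le> cmod (f (\<lambda>k. a k + b k) z) * sqrt (w z)" using w_pos[OF z] by simp
      qed
      also have "\<dots> \<le> Q F a + Q F b" using True by (simp add: Q_def L2_set_triangle_ineq)
      finally show ?thesis .
    qed (simp add: Q_def)
  next
    fix F a c assume a: "a \<in> \<H>"
    show "Q F (\<lambda>k. of_real c * a k) = \<bar>c\<bar> * Q F a"
    proof (cases "ok F")
      case True
      have "L2_set (\<lambda>z. cmod (f (\<lambda>k. of_real c * a k) z) * sqrt (w z)) F
          = L2_set (\<lambda>z. \<bar>c\<bar> * (cmod (f a z) * sqrt (w z))) F"
      proof (rule L2_set_cong[OF refl])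
        fix z assume "z \<in> F"
        hence z: "z \<notin> \<gamma> ` {1..}" using True nL by (auto simp: ok_def)
        show "cmod (f (\<lambda>k. of_real c * a k) z) * sqrt (w z) = \<bar>c\<bar> * (cmod (f a z) * sqrt (w z))"
          by (subst hilb_scale[OF a z]) (simp add: norm_mult)
      qed
      thus ?thesis using True by (simp add: Q_def L2_set_right_distrib)
    qed (simp add: Q_def)
  next
    fix a assume "a \<in> \<H>"
    hence sm: "(\<lambda>z. (cmod (f a z))\<^sup>2 * w z) summable_on L" using inv by (auto simp: hilb_invertible_on_def)
    have nonneg: "(cmod (f a z))\<^sup>2 * w z \<ge> 0" if "z \<in> L" for z using w_pos[OF nL[OF that]] by simp
    have "Q F a \<le> sqrt (\<Sum>\<^sub>\<infinity>z\<in>L. (cmod (f a z))\<^sup>2 * w z)" for F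
    proof (cases "ok F")
      case True
      have "(\<Sum>z\<in>F. (cmod (f a z) * sqrt (w z))\<^sup>2) = (\<Sum>z\<in>F. (cmod (f a z))\<^sup>2 * w z)"
      proof (rule sum.cong[OF refl])
        fix z assume "z \<in> F"
        hence "w z > 0" using True nL w_pos by (auto simp: ok_def)
        thus "(cmod (f a z) * sqrt (w z))\<^sup>2 = (cmod (f a z))\<^sup>2 * w z" by (simp add: power_mult_distrib)
      qed
      also have "\<dots> \<le> (\<Sum>\<^sub>\<infinity>z\<in>L. (cmod (f a z))\<^sup>2 * w z)"
        using True nonneg by (intro finite_sum_le_infsum sm) (auto simp: ok_def)
      finally show ?thesis using True by (simp add: Q_def L2_set_def)
    qed (use nonneg in \<open>auto simp: Q_def intro: infsum_nonneg\<close>)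
    thus "\<exists>B. \<forall>F. Q F a \<le> B" by blast
  qed
  then obtain C where C: "C \<ge> 0" "\<And>F a. a \<in> \<H> \<Longrightarrow> Q F a \<le> C * nrm a" by blast
  show thesis
  proof (rule that[of "4 * C\<^sup>2 + 1"])
    show "4 * C\<^sup>2 + 1 > 0" by (intro add_nonneg_pos) auto
    fix N F assume F: "finite F" "F \<subseteq> L" and Fb: "\<And>z. z \<in> F \<Longrightarrow> cmod z \<le> g (Suc N)"
    \<comment> \<open>The conjugates give all summands of the transform a real part of the same sign
      on the disc, so nothing cancels.\<close>
    define a where "a k = (if k > N then 1 / cnj (\<gamma> k) else 0)" for k
    have a2: "(\<Sum>\<^sub>\<infinity>k\<in>{1..}. (cmod (a k))\<^sup>2 * v k) = Pt N" "(\<lambda>k. (cmod (a k))\<^sup>2 * v k) summable_on {1..}"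
    proof -
      have "(\<Sum>\<^sub>\<infinity>k\<in>{1..}. (cmod (a k))\<^sup>2 * v k) = infsum p {N<..}"
        by (rule infsum_cong_neutral) (auto simp: a_def norm_divide power_divide)
      thus "(\<Sum>\<^sub>\<infinity>k\<in>{1..}. (cmod (a k))\<^sup>2 * v k) = Pt N" by (simp add: P_def)
      have "(\<lambda>k. (cmod (a k))\<^sup>2 * v k) summable_on {1..} \<longleftrightarrow> p summable_on {N<..}"
        by (rule summable_on_cong_neutral) (auto simp: a_def norm_divide power_divide)
      thus "(\<lambda>k. (cmod (a k))\<^sup>2 * v k) summable_on {1..}" using p_summable' by simp
    qed
    have a: "a \<in> \<H>" "nsq v a = Pt N" using a2 by (auto simp: l2_iff nsq_def a_def)
    have big: "cmod (f a z) \<ge> Pt N / 2" if z: "z \<in> F" for z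
    proof -
      have nz: "z \<notin> \<gamma> ` {1..}" using z F nL by blast
      have "((\<lambda>k. a k * of_real (v k) / (z - \<gamma> k)) has_sum f a z) {1..}"
        unfolding Hilb_def by (intro has_sum_infsum hilb_summable a nz)
      hence hs1: "((\<lambda>k. - Re (a k * of_real (v k) / (z - \<gamma> k))) has_sum - Re (f a z)) {1..}"
        by (intro has_sum_uminusI has_sum_Re)
      have hs2: "((\<lambda>k. 1 / 2 * ((cmod (a k))\<^sup>2 * v k)) has_sum 1 / 2 * Pt N) {1..}"
        using has_sum_infsum[OF a2(2)] unfolding a2(1) by (rule has_sum_cmult_right)
      have "1 / 2 * Pt N \<le> - Re (f a z)"
      proof (rule has_sum_mono[OF hs2 hs1])
        fix k :: nat assume "k \<in> {1..}"
        hence k: "k \<ge> 1" by simp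
        show "1 / 2 * ((cmod (a k))\<^sup>2 * v k) \<le> - Re (a k * of_real (v k) / (z - \<gamma> k))"
        proof (cases "k > N")
          case True
          have "cmod z \<le> g k" using Fb[OF z] g_mono[of "Suc N" k] True by simp
          moreover have "z \<noteq> \<gamma> k" using nz k by auto
          ultimately have "1 / (2 * (g k)\<^sup>2) \<le> Re (- (1 / cnj (\<gamma> k) / (z - \<gamma> k)))"
            by (intro Re_inverse_ge_half gamma_nz k)
          hence "v k * (1 / (2 * (g k)\<^sup>2)) \<le> v k * Re (- (1 / cnj (\<gamma> k) / (z - \<gamma> k)))"
            using v_pos[OF k] by (intro mult_left_mono) auto
          also have "\<dots> = - Re (of_real (v k) * (1 / cnj (\<gamma> k) / (z - \<gamma> k)))" 
          proof -
            have "v k * Re (- x) = - Re (of_real (v k) * x)" for x by simp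
            thus ?thesis by blast
          qed
          finally show ?thesis using True by (simp add: a_def norm_divide power_divide mult.commute)
        qed (simp add: a_def)
      qed
      also have "- Re (f a z) \<le> cmod (f a z)" using abs_Re_le_cmod[of "f a z"] by linarith
      finally show ?thesis by simp
    qed
    have "Q F a \<le> C * sqrt (Pt N)" using C(2)[OF a(1), of F] a(2) by simp
    moreover have "Q F a \<ge> 0" by (simp add: Q_def)
    ultimately have "(Q F a)\<^sup>2 \<le> (C * sqrt (Pt N))\<^sup>2" by (intro power_mono)
    hence 1: "(Q F a)\<^sup>2 \<le> C\<^sup>2 * Pt N" using Pt_pos[of N] by (simp add: power_mult_distrib)
    have "(\<Sum>z\<in>F. w z) * (Pt N / 2)\<^sup>2 = (\<Sum>z\<in>F. (Pt N / 2)\<^sup>2 * w z)" by (simp add: sum_distrib_right mult.commute)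
    also have "\<dots> \<le> (\<Sum>z\<in>F. (cmod (f a z))\<^sup>2 * w z)"
      using less_imp_le[OF w_pos[OF nL[OF subsetD[OF F(2)]]]] Pt_pos[of N]
      by (intro sum_mono mult_right_mono power_mono big) auto
    also have "\<dots> = (\<Sum>z\<in>F. (cmod (f a z) * sqrt (w z))\<^sup>2)"
    proof (rule sum.cong[OF refl])
      fix z assume "z \<in> F"
      hence "w z > 0" using F nL w_pos by auto
      thus "(cmod (f a z))\<^sup>2 * w z = (cmod (f a z) * sqrt (w z))\<^sup>2" by (simp add: power_mult_distrib)
    qed
    also have "\<dots> = (Q F a)\<^sup>2"
      using F by (simp add: Q_def ok_def L2_set_def sum_nonneg)
    finally have "(\<Sum>z\<in>F. w z) * (Pt N / 2)\<^sup>2 \<le> C\<^sup>2 * Pt N" using 1 by linarith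
    hence "(\<Sum>z\<in>F. w z) * Pt N * Pt N \<le> 4 * C\<^sup>2 * Pt N" by (simp add: power2_eq_square)
    hence "(\<Sum>z\<in>F. w z) * Pt N \<le> 4 * C\<^sup>2" using Pt_pos[of N] by (rule mult_right_le_imp_le)
    hence "(\<Sum>z\<in>F. w z) * Pt N \<le> 4 * C\<^sup>2 + 1" by linarith
    thus "(\<Sum>z\<in>F. w z) \<le> (4 * C\<^sup>2 + 1) / Pt N" using Pt_pos[of N] by (simp only: pos_le_divide_eq)
  qed
qed

end

section \<open>Counting the points of \<open>\<Lambda>\<close>\<close>

context sparse_weights
begin

text \<open>The outer radius of \<open>Omega \<gamma> N\<close>. Lying midway between consecutive
  moduli, it stays away from every point of \<Gamma> by a fixed proportion.\<close>

definition radius :: "nat \<Rightarrow> real" where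
  "radius N = (g N + g (Suc N)) / 2"

lemma radius_bounds:
  assumes "N \<ge> 1"
  shows "g N < radius N" "radius N < g (Suc N)" "radius N > 0"
proof -
  have "1 * g N < q * g N" using q g_pos[OF assms] by (intro mult_strict_right_mono) auto
  hence "g N < g (Suc N)" using lac[OF assms] by simp
  moreover have "g N > 0" by (rule g_pos[OF assms])
  ultimately show *: "g N < radius N" "radius N < g (Suc N)" by (auto simp: radius_def)
  show "radius N > 0" by (rule order_less_trans[OF g_pos[OF assms] *(1)])
qed

lemma radius_mono: assumes "1 \<le> M" "M \<le> N" shows "radius M \<le> radius N"
  using g_mono[of M N] g_mono[of "Suc M" "Suc N"] assms by (simp add: radius_def)

lemma sep_above:
  assumes "1 \<le> N" "N < k" "cmod z < radius N"
  shows "(1 - 1 / q) / 2 * g k \<le> cmod (z - \<gamma> k)"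
proof -
  have gk: "g (Suc N) \<le> g k" using assms by (intro g_mono) auto
  have "g N \<le> g (Suc N) / q" using lac[OF assms(1)] q by (simp add: field_simps)
  also have "\<dots> \<le> g k / q" using gk q by (intro divide_right_mono) auto
  finally have "cmod z \<le> (g k / q + g k) / 2" using assms gk by (simp add: radius_def)
  hence "(1 - 1 / q) / 2 * g k \<le> g k - cmod z" using q by (simp add: field_simps)
  also have "\<dots> \<le> cmod (z - \<gamma> k)" using norm_triangle_ineq2[of "\<gamma> k" z] by (simp add: norm_minus_commute)
  finally show ?thesis .
qed

lemma sep_below:
  assumes "1 \<le> k" "k \<le> N" "radius N \<le> cmod z"
  shows "(q - 1) / (q + 1) * cmod z \<le> cmod (z - \<gamma> k)"
proof -
  have "(1 + q) / 2 * g k \<le> (1 + q) / 2 * g N" using assms q by (intro mult_left_mono g_mono) auto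
  also have "\<dots> \<le> radius N" using lac[of N] assms by (simp add: radius_def field_simps)
  finally have "(1 + q) / 2 * g k \<le> cmod z" using assms by simp
  hence "g k \<le> 2 / (1 + q) * cmod z" using q by (simp add: field_simps)
  hence "(1 - 2 / (1 + q)) * cmod z \<le> cmod z - g k" by (simp add: algebra_simps)
  also have "\<dots> \<le> cmod (z - \<gamma> k)" by (rule norm_triangle_ineq2)
  also have "1 - 2 / (1 + q) = (q - 1) / (q + 1)" using q by (simp add: field_simps)
  finally show ?thesis .
qed

text \<open>The bare sum of the p_k could be as large as \<open>Pt N\<close>. The factors
  \<open>(g (Suc N) / g k)^2\<close> concentrate it near k = N + 1, where p_k is at most \<epsilon>
  P_N; the gained \<epsilon> is what excludes too many points.\<close>

lemma sum_p_weighted: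
  assumes "\<epsilon> \<ge> 0" "\<And>k. k > N \<Longrightarrow> p k \<le> \<epsilon> * Pt k" "finite K" "K \<subseteq> {N<..}"
  shows "(\<Sum>k\<in>K. (g (Suc N) / g k)\<^sup>2 * p k) \<le> \<epsilon> * (2 / (1 - 1 / q)) * Pt N"
proof -
  have "(\<Sum>k\<in>K. (g (Suc N) / g k)\<^sup>2 * p k)
      \<le> (\<Sum>k\<in>K. (1 / q) ^ ((k - Suc N) + (Suc N - k)) * (\<epsilon> * Pt N))"
  proof (rule sum_mono)
    fix k assume "k \<in> K"
    hence k: "k > N" using assms by auto
    have "q ^ (k - Suc N) * g (Suc N) \<le> g k" using k by (intro g_geometric) auto
    hence r: "g (Suc N) / g k \<le> (1 / q) ^ (k - Suc N)"
      using g_pos[of k] k q by (simp add: power_divide field_simps)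
    have "(g (Suc N) / g k)\<^sup>2 \<le> g (Suc N) / g k"
      unfolding power2_eq_square using g_mono[of "Suc N" k] g_pos[of k] k by (intro mult_left_le) (auto simp: divide_le_eq)
    hence "(g (Suc N) / g k)\<^sup>2 \<le> (1 / q) ^ (k - Suc N)" using r by linarith
    moreover have "p k \<le> \<epsilon> * Pt N"
      using assms(2)[OF k] mult_left_mono[OF slow.P_antimono[of N k] assms(1)] k by linarith
    ultimately show "(g (Suc N) / g k)\<^sup>2 * p k \<le> (1 / q) ^ ((k - Suc N) + (Suc N - k)) * (\<epsilon> * Pt N)"
      using k p_pos[of k] q by (intro mult_mono) (auto intro: less_imp_le)
  qed
  also have "\<dots> = (\<Sum>k\<in>K. (1 / q) ^ ((k - Suc N) + (Suc N - k))) * (\<epsilon> * Pt N)"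
    by (simp add: sum_distrib_right)
  also have "\<dots> \<le> 2 / (1 - 1 / q) * (\<epsilon> * Pt N)"
    using assms Pt_pos[of N] q by (intro mult_right_mono sum_power_distance_le) auto
  finally show ?thesis by (simp add: mult_ac)
qed

end

lemma divide_sq_mono: "x / b\<^sup>2 \<le> x / a\<^sup>2" if "a \<le> b" "0 < a" "0 \<le> x" for x a b :: real
  using that by (intro divide_left_mono power_mono mult_pos_pos zero_less_power) auto

section \<open>Consequences of invertibility for the position of the points\<close>

locale invertible_on = sparse_weights +
  fixes L :: "complex set"
  assumes disj: "L \<inter> \<gamma> ` {1..} = {}" and inv: "hilb_invertible_on \<gamma> v L"
begin

lemma notin_gamma: "z \<in> L \<Longrightarrow> z \<notin> \<gamma> ` {1..}"
  using disj by blast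

lemma w_pos': "z \<in> L \<Longrightarrow> w z > 0"
  using w_pos notin_gamma by blast

lemma w_nonneg: "z \<in> L \<Longrightarrow> w z \<ge> 0"
  using w_pos' by (rule less_imp_le)

lemma lower_bound:
  obtains C where "C > 0" "\<And>a. a \<in> \<H> \<Longrightarrow> nsq v a \<le> C * (\<Sum>\<^sub>\<infinity>z\<in>L. (cmod (f a z))\<^sup>2 * w z)"
proof -
  obtain C where C: "\<And>a. a \<in> \<H> \<Longrightarrow> nsq v a \<le> C * (\<Sum>\<^sub>\<infinity>z\<in>L. (cmod (f a z))\<^sup>2 * w z)"
    using inv unfolding hilb_invertible_on_def by blast
  show thesis
  proof (rule that[of "max C 1"])
    fix a assume "a \<in> \<H>"
    have "(\<Sum>\<^sub>\<infinity>z\<in>L. (cmod (f a z))\<^sup>2 * w z) \<ge> 0"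
      using w_nonneg by (intro infsum_nonneg mult_nonneg_nonneg) auto
    hence "C * (\<Sum>\<^sub>\<infinity>z\<in>L. (cmod (f a z))\<^sup>2 * w z) \<le> max C 1 * (\<Sum>\<^sub>\<infinity>z\<in>L. (cmod (f a z))\<^sup>2 * w z)"
      by (intro mult_right_mono) auto
    thus "nsq v a \<le> max C 1 * (\<Sum>\<^sub>\<infinity>z\<in>L. (cmod (f a z))\<^sup>2 * w z)" using C[OF \<open>a \<in> \<H>\<close>] by linarith
  qed simp
qed

text \<open>A form of the lower bound that asks for estimates of finite sums only.\<close>

lemma lower_bound_le:
  obtains C where "C > 0" "\<And>a B. a \<in> \<H> \<Longrightarrow> (\<And>F. finite F \<Longrightarrow> F \<subseteq> L \<Longrightarrow> (\<Sum>z\<in>F. (cmod (f a z))\<^sup>2 * w z) \<le> B)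
      \<Longrightarrow> nsq v a \<le> C * B"
proof -
  obtain C where C: "C > 0" "\<And>a. a \<in> \<H> \<Longrightarrow> nsq v a \<le> C * (\<Sum>\<^sub>\<infinity>z\<in>L. (cmod (f a z))\<^sup>2 * w z)"
    using lower_bound by blast
  show thesis
  proof (rule that[OF C(1)])
    fix a B assume a: "a \<in> \<H>" and B: "\<And>F. finite F \<Longrightarrow> F \<subseteq> L \<Longrightarrow> (\<Sum>z\<in>F. (cmod (f a z))\<^sup>2 * w z) \<le> B"
    have "(\<Sum>\<^sub>\<infinity>z\<in>L. (cmod (f a z))\<^sup>2 * w z) \<le> B"
      by (rule sum_le_bound_summable(2)[OF _ B]) (use w_nonneg in auto)
    hence "C * (\<Sum>\<^sub>\<infinity>z\<in>L. (cmod (f a z))\<^sup>2 * w z) \<le> C * B" using C(1) by (intro mult_left_mono) auto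
    thus "nsq v a \<le> C * B" using C(2)[OF a] by linarith
  qed
qed

lemma interpolate:
  assumes "finite S" "S \<subseteq> L"
  obtains a where "a \<in> \<H>" "\<And>z. z \<in> S \<Longrightarrow> f a z = b z" "\<And>z. z \<in> L - S \<Longrightarrow> f a z = 0"
proof -
  define b' where "b' z = (if z \<in> S then b z else 0)" for z
  have "(\<lambda>z. (cmod (b' z))\<^sup>2 * w z) summable_on L \<longleftrightarrow> (\<lambda>z. (cmod (b' z))\<^sup>2 * w z) summable_on S"
    using assms by (intro summable_on_cong_neutral) (auto simp: b'_def)
  hence "(\<lambda>z. (cmod (b' z))\<^sup>2 * w z) summable_on L" using assms by simp
  then obtain a where a: "a \<in> \<H>" "\<And>z. z \<in> L \<Longrightarrow> f a z = b' z"
    using inv unfolding hilb_invertible_on_def by blast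
  show thesis
    by (rule that[OF a(1)]) (use a(2) assms in \<open>auto simp: b'_def\<close>)
qed

text \<open>The points are sorted into shells between consecutive moduli \<open>g m\<close>. A shell
  contributes at most \<open>C1 / Pt m / (g m)^2\<close> by \<open>w_sum_bound\<close>; these bounds
  decay geometrically, so the innermost shell dominates.\<close>

lemma w_over_sq_bound:
  obtains C where "C > 0" "\<And>N F. 1 \<le> N \<Longrightarrow> finite F \<Longrightarrow> F \<subseteq> L \<Longrightarrow> (\<And>z. z \<in> F \<Longrightarrow> radius N \<le> cmod z)
      \<Longrightarrow> (\<Sum>z\<in>F. w z / (cmod z)\<^sup>2) \<le> C / (Pt N * (g N)\<^sup>2)"
proof -
  obtain C1 where C1: "C1 > 0" "\<And>N F. finite F \<Longrightarrow> F \<subseteq> L \<Longrightarrow> (\<And>z. z \<in> F \<Longrightarrow> cmod z \<le> g (Suc N)) \<Longrightarrow> (\<Sum>z\<in>F. w z) \<le> C1 / Pt N"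
    using w_sum_bound[OF disj inv] by blast
  obtain C2 where C2: "C2 > 0" "\<And>m n. m \<le> n \<Longrightarrow> 1 / (Pt n * (s n)\<^sup>2) \<le> C2 * (1 / q) ^ (n - m) * (1 / (Pt m * (s m)\<^sup>2))"
    using geometric_Ps by blast
  define D where "D = 2 / (1 - 1 / q)"
  have D: "D > 0" using q by (simp add: D_def)
  show thesis
  proof (rule that[of "C1 * C2 * D"])
    show "C1 * C2 * D > 0" using C1 C2 D by simp
    fix N F assume N: "1 \<le> N" and F: "finite F" "F \<subseteq> L" and Fb: "\<And>z. z \<in> F \<Longrightarrow> radius N \<le> cmod z"
    obtain M where M: "\<And>z. z \<in> F \<Longrightarrow> cmod z \<le> g (Suc M)" "N \<le> M"
    proof -
      have "\<forall>\<^sub>F n in sequentially. g n \<ge> (\<Sum>z\<in>F. cmod z)" by (rule g_unbounded)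
      then obtain M where M: "\<And>n. n \<ge> M \<Longrightarrow> g n \<ge> (\<Sum>z\<in>F. cmod z)" by (auto simp: eventually_sequentially)
      have "cmod z \<le> g (Suc (max M N))" if "z \<in> F" for z
      proof -
        have "cmod z \<le> (\<Sum>z\<in>F. cmod z)" using F that by (intro member_le_sum) auto
        also have "\<dots> \<le> g (Suc (max M N))" by (rule M) simp
        finally show ?thesis .
      qed
      thus thesis using that[of "max M N"] by simp
    qed
    have ptw: "w z / (cmod z)\<^sup>2 \<le> (\<Sum>m\<in>{N..M}. (if cmod z \<le> g (Suc m) then w z else 0) / (g m)\<^sup>2)" if z: "z \<in> F" for z
    proof -
      \<comment> \<open>The shell of \<open>z\<close>. Minimality gives
        \<open>g m \<le> cmod z\<close> when m > N; for m = N this is the assumption on the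
        radius.\<close>
      define m where "m = (LEAST m. N \<le> m \<and> cmod z \<le> g (Suc m))"
      have ex: "N \<le> M \<and> cmod z \<le> g (Suc M)" using M z by auto
      have m: "N \<le> m" "cmod z \<le> g (Suc m)" using LeastI[of "\<lambda>m. N \<le> m \<and> cmod z \<le> g (Suc m)", OF ex] by (auto simp: m_def)
      have mM: "m \<le> M" unfolding m_def using Least_le[of "\<lambda>m. N \<le> m \<and> cmod z \<le> g (Suc m)" M] ex by blast
      have gm: "g m \<le> cmod z"
      proof (cases "m = N")
        case True
        thus ?thesis using Fb[OF z] radius_bounds(1)[OF N] by simp
      next
        case False
        hence "N \<le> m - 1" "m - 1 < m" using m(1) by auto
        hence "\<not> cmod z \<le> g (Suc (m - 1))" using not_less_Least[of "m - 1" "\<lambda>m. N \<le> m \<and> cmod z \<le> g (Suc m)"] by (auto simp: m_def)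
        thus ?thesis using False m(1) by simp
      qed
      have wz: "w z \<ge> 0" using w_nonneg z F by blast
      have "w z / (cmod z)\<^sup>2 \<le> w z / (g m)\<^sup>2"
        using gm g_pos[of m] N m wz by (intro divide_left_mono power_mono mult_pos_pos zero_less_power) linarith+
      also have "\<dots> = (\<Sum>m\<in>{m}. (if cmod z \<le> g (Suc m) then w z else 0) / (g m)\<^sup>2)" using m by simp
      also have "\<dots> \<le> (\<Sum>m\<in>{N..M}. (if cmod z \<le> g (Suc m) then w z else 0) / (g m)\<^sup>2)"
        using m mM wz by (intro sum_mono2) auto
      finally show ?thesis .
    qed
    have "(\<Sum>z\<in>F. w z / (cmod z)\<^sup>2) \<le> (\<Sum>z\<in>F. \<Sum>m\<in>{N..M}. (if cmod z \<le> g (Suc m) then w z else 0) / (g m)\<^sup>2)"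
      by (intro sum_mono ptw)
    also have "\<dots> = (\<Sum>m\<in>{N..M}. (\<Sum>z\<in>{z\<in>F. cmod z \<le> g (Suc m)}. w z) / (g m)\<^sup>2)"
      by (subst sum.swap) (simp add: sum_divide_distrib[symmetric] sum.inter_filter F)
    also have "\<dots> \<le> (\<Sum>m\<in>{N..M}. (C1 / Pt m) / (g m)\<^sup>2)"
      using F by (intro sum_mono divide_right_mono C1) auto
    also have "\<dots> = C1 * (\<Sum>m\<in>{N..M}. 1 / (Pt m * (s m)\<^sup>2))"
      using N by (simp add: sum_distrib_left s_eq)
    also have "\<dots> \<le> C1 * (\<Sum>m\<in>{N..M}. C2 * (1 / q) ^ ((m - N) + (N - m)) * (1 / (Pt N * (s N)\<^sup>2)))"
      using C1 C2(2)[of N] by (intro mult_left_mono sum_mono) auto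
    also have "\<dots> = C1 * C2 * (\<Sum>m\<in>{N..M}. (1 / q) ^ ((m - N) + (N - m))) * (1 / (Pt N * (s N)\<^sup>2))"
      by (simp add: sum_distrib_left sum_distrib_right sum_divide_distrib mult_ac)
    also have "\<dots> \<le> C1 * C2 * D * (1 / (Pt N * (s N)\<^sup>2))"
      unfolding D_def using C1 C2 q Pt_pos[of N] by (intro mult_right_mono mult_left_mono sum_power_distance_le) auto
    also have "\<dots> = C1 * C2 * D / (Pt N * (g N)\<^sup>2)" using N by (simp add: s_eq)
    finally show "(\<Sum>z\<in>F. w z / (cmod z)\<^sup>2) \<le> C1 * C2 * D / (Pt N * (g N)\<^sup>2)" .
  qed
qed

text \<open>If the disc held N + 2 points, their Cauchy kernels would have a nontrivial combination
  with coefficient sum 0 vanishing at \<gamma>_1, ..., \<gamma>_N. Pairing it with a suitable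
  interpolating sequence returns the full energy \<open>X\<close>. But for k > N the vanishing sum
  gains a factor |z| / |\<gamma>_k|, and the weight bound together with p = o(P) makes the pairing
  too small.\<close>

lemma card_upper:
  "\<forall>\<^sub>F N in sequentially. \<forall>F. finite F \<and> F \<subseteq> L \<and> (\<forall>z\<in>F. cmod z < radius N) \<longrightarrow> card F \<le> Suc N"
proof -
  obtain C1 where C1: "C1 > 0" "\<And>N F. finite F \<Longrightarrow> F \<subseteq> L \<Longrightarrow> (\<And>z. z \<in> F \<Longrightarrow> cmod z \<le> g (Suc N)) \<Longrightarrow> (\<Sum>z\<in>F. w z) \<le> C1 / Pt N"
    using w_sum_bound[OF disj inv] by blast
  obtain C2 where C2: "C2 > 0" "\<And>a B. a \<in> \<H> \<Longrightarrow> (\<And>F. finite F \<Longrightarrow> F \<subseteq> L \<Longrightarrow> (\<Sum>z\<in>F. (cmod (f a z))\<^sup>2 * w z) \<le> B)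
      \<Longrightarrow> nsq v a \<le> C2 * B" using lower_bound_le by blast
  define c where "c = (1 - 1 / q) / 2"
  have c: "c > 0" using q by (simp add: c_def)
  define D where "D = 2 / (1 - 1 / q)"
  have D: "D > 0" using q by (simp add: D_def)
  \<comment> \<open>Chosen so that the constants of the final estimate multiply to 1/2.\<close>
  define \<epsilon> where "\<epsilon> = 1 / (2 * C2 * (C1 / c\<^sup>2) * D)"
  have \<epsilon>: "\<epsilon> > 0" using c D C1 C2 by (simp add: \<epsilon>_def)
  obtain N0 where N0: "\<And>n. n \<ge> N0 \<Longrightarrow> p n \<le> \<epsilon> * Pt n"
    using p_small[OF \<epsilon>] by (auto simp: eventually_sequentially)
  show ?thesis
    using eventually_ge_at_top[of "max 1 N0"]
  proof eventually_elim
    case (elim N)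
    hence N: "N \<ge> 1" "N \<ge> N0" by auto
    show ?case
    proof (rule allI, rule impI, rule ccontr)
      fix F assume F: "finite F \<and> F \<subseteq> L \<and> (\<forall>z\<in>F. cmod z < radius N)" and "\<not> card F \<le> Suc N"
      hence "Suc (Suc N) \<le> card F" by simp
      then obtain S where S: "S \<subseteq> F" "card S = Suc (Suc N)" "finite S" by (rule obtain_subset_with_card_n)
      have SL: "S \<subseteq> L" and Sr: "\<And>z. z \<in> S \<Longrightarrow> cmod z < radius N" using S F by auto
      have wS: "w z > 0" if "z \<in> S" for z using w_pos' SL that by blast
      \<comment> \<open>Row 0 makes the coefficients \<open>y\<close> sum to 0; row i \<ge> 1 makes
        the combination vanish at \<open>\<gamma> i\<close>. The factor \<open>sqrt (w z)\<close>
        normalizes the unknowns.\<close>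
      define A where "A i z = (if i = 0 then of_real (sqrt (w z)) else of_real (sqrt (w z)) / (z - \<gamma> i))" for i z
      obtain x where x: "\<exists>z\<in>S. x z \<noteq> 0" "\<And>i. i \<in> {0..N} \<Longrightarrow> (\<Sum>z\<in>S. A i z * x z) = 0"
      proof -
        have "card {0..N} < card S" using S by simp
        thus thesis using homogeneous_system[OF finite_atLeastAtMost S(3), of 0 N A] that by blast
      qed
      define X where "X = (\<Sum>z\<in>S. (cmod (x z))\<^sup>2)"
      have X: "X > 0" unfolding X_def
      proof -
        obtain z where "z \<in> S" "x z \<noteq> 0" using x by blast
        thus "0 < (\<Sum>z\<in>S. (cmod (x z))\<^sup>2)" using S by (intro sum_pos2[of S z]) auto
      qed
      obtain a where a: "a \<in> \<H>" "\<And>z. z \<in> S \<Longrightarrow> f a z = cnj (x z) / of_real (sqrt (w z))"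
        "\<And>z. z \<in> L - S \<Longrightarrow> f a z = 0"
        using interpolate[OF S(3) SL, of "\<lambda>z. cnj (x z) / of_real (sqrt (w z))"] by blast
      have na: "nsq v a \<le> C2 * X"
      proof (rule C2(2)[OF a(1)])
        fix F' assume F': "finite F'" "F' \<subseteq> L"
        have "(\<Sum>z\<in>F'. (cmod (f a z))\<^sup>2 * w z) \<le> (\<Sum>z\<in>F' \<inter> S. (cmod (f a z))\<^sup>2 * w z)"
          using F' a(3) by (subst sum.mono_neutral_right[of F' "F' \<inter> S"]) auto
        also have "\<dots> \<le> (\<Sum>z\<in>S. (cmod (f a z))\<^sup>2 * w z)"
          using S w_nonneg SL by (intro sum_mono2) (auto intro!: mult_nonneg_nonneg)
        also have "\<dots> = X" unfolding X_def
        proof (rule sum.cong[OF refl])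
          fix z assume z: "z \<in> S"
          show "(cmod (f a z))\<^sup>2 * w z = (cmod (x z))\<^sup>2"
            using wS[OF z] by (simp add: a(2)[OF z] norm_divide power_divide)
        qed
        finally show "(\<Sum>z\<in>F'. (cmod (f a z))\<^sup>2 * w z) \<le> X" .
      qed
      define y where "y z = x z * of_real (sqrt (w z))" for z
      define T where "T k = (\<Sum>z\<in>S. y z / (z - \<gamma> k))" for k
      have sumX: "(\<Sum>z\<in>S. y z * f a z) = of_real X"
      proof -
        have "(\<Sum>z\<in>S. y z * f a z) = (\<Sum>z\<in>S. of_real ((cmod (x z))\<^sup>2))"
        proof (rule sum.cong[OF refl])
          fix z assume z: "z \<in> S"
          show "y z * f a z = of_real ((cmod (x z))\<^sup>2)"
          proof -
            have "y z * f a z = x z * cnj (x z)" using wS[OF z] by (simp add: a(2)[OF z] y_def)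
            thus ?thesis by (simp only: complex_norm_square)
          qed
        qed
        thus ?thesis by (simp add: X_def)
      qed
      have hs: "((\<lambda>k. a k * of_real (v k) * T k) has_sum of_real X) {1..}"
        using hilb_finite_combination[OF a(1) S(3), of y] SL disj unfolding T_def sumX by blast
      have y0: "(\<Sum>z\<in>S. y z) = 0" using x(2)[of 0] by (simp add: A_def y_def mult.commute)
      have T0: "T k = 0" if "1 \<le> k" "k \<le> N" for k
        using x(2)[of k] that by (simp add: A_def y_def T_def mult.commute)
      define E where "E = X * (C1 / Pt N) / c\<^sup>2"
      have Tb: "(cmod (T k))\<^sup>2 * v k \<le> E * ((g (Suc N) / g k)\<^sup>2 * p k)" if k: "k > N" for k
      proof -
        have gk: "g k > 0" using g_pos k by simp
        \<comment> \<open>Adding the zero sum divided by \<open>\<gamma> k\<close> replaces the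
          kernel 1 / (z - \<gamma>_k) by z / (\<gamma>_k (z - \<gamma>_k)).\<close>
        have "T k = (\<Sum>z\<in>S. y z / (z - \<gamma> k)) + (\<Sum>z\<in>S. y z) / \<gamma> k" by (simp add: T_def y0)
        also have "\<dots> = (\<Sum>z\<in>S. x z * (of_real (sqrt (w z)) * z / (\<gamma> k * (z - \<gamma> k))))"
          unfolding sum_divide_distrib sum.distrib[symmetric]
        proof (rule sum.cong[OF refl])
          fix z assume "z \<in> S"
          hence "z \<noteq> \<gamma> k" using SL notin_gamma[of z] k by auto
          thus "y z / (z - \<gamma> k) + y z / \<gamma> k = x z * (of_real (sqrt (w z)) * z / (\<gamma> k * (z - \<gamma> k)))"
            using gamma_nz[of k] k by (simp add: y_def field_simps)
        qed
        finally have "cmod (T k) \<le> (\<Sum>z\<in>S. \<bar>cmod (x z) * cmod (of_real (sqrt (w z)) * z / (\<gamma> k * (z - \<gamma> k)))\<bar>)"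
          by (simp only: norm_mult[symmetric] abs_norm_cancel sum_norm_le order_refl)
        also have "\<dots> \<le> sqrt (\<Sum>z\<in>S. (cmod (x z))\<^sup>2) * sqrt (\<Sum>z\<in>S. (cmod (of_real (sqrt (w z)) * z / (\<gamma> k * (z - \<gamma> k))))\<^sup>2)"
          by (rule cauchy_schwarz_finite)
        finally have "(cmod (T k))\<^sup>2 \<le> (sqrt X * sqrt (\<Sum>z\<in>S. (cmod (of_real (sqrt (w z)) * z / (\<gamma> k * (z - \<gamma> k))))\<^sup>2))\<^sup>2"
          unfolding X_def by (intro power_mono) auto
        also have "\<dots> = X * (\<Sum>z\<in>S. (cmod (of_real (sqrt (w z)) * z / (\<gamma> k * (z - \<gamma> k))))\<^sup>2)"
          using X by (simp add: power_mult_distrib sum_nonneg)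
        also have "(\<Sum>z\<in>S. (cmod (of_real (sqrt (w z)) * z / (\<gamma> k * (z - \<gamma> k))))\<^sup>2)
            \<le> (\<Sum>z\<in>S. w z * ((g (Suc N))\<^sup>2 / (c\<^sup>2 * g k ^ 4)))"
        proof (rule sum_mono)
          fix z assume z: "z \<in> S"
          have zg: "cmod z \<le> g (Suc N)" using Sr[OF z] radius_bounds(2)[OF N(1)] by simp
          have d: "c * g k \<le> cmod (z - \<gamma> k)" unfolding c_def by (rule sep_above[OF N(1) k Sr[OF z]])
          have cg: "c * g k > 0" using c gk by simp
          have "(cmod (of_real (sqrt (w z)) * z / (\<gamma> k * (z - \<gamma> k))))\<^sup>2
              = w z * ((cmod z)\<^sup>2 / ((g k)\<^sup>2 * (cmod (z - \<gamma> k))\<^sup>2))"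
            using wS[OF z] by (simp add: norm_mult norm_divide power_divide power_mult_distrib)
          also have "\<dots> \<le> w z * ((g (Suc N))\<^sup>2 / ((g k)\<^sup>2 * (c * g k)\<^sup>2))"
            using wS[OF z] zg d cg gk c
            by (intro mult_left_mono frac_le mult_left_mono power_mono mult_pos_pos zero_less_power) auto
          also have "(g k)\<^sup>2 * (c * g k)\<^sup>2 = c\<^sup>2 * g k ^ 4" by (simp add: power_mult_distrib power2_eq_square power4_eq_xxxx)
          finally show "(cmod (of_real (sqrt (w z)) * z / (\<gamma> k * (z - \<gamma> k))))\<^sup>2 \<le> w z * ((g (Suc N))\<^sup>2 / (c\<^sup>2 * g k ^ 4))" .
        qed
        also have "\<dots> = (\<Sum>z\<in>S. w z) * ((g (Suc N))\<^sup>2 / (c\<^sup>2 * g k ^ 4))"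
          by (rule sum_distrib_right[symmetric])
        also have "\<dots> \<le> C1 / Pt N * ((g (Suc N))\<^sup>2 / (c\<^sup>2 * g k ^ 4))"
          using c gk Sr radius_bounds(2)[OF N(1)] by (intro mult_right_mono C1(2) S SL) (auto intro: less_imp_le order_less_trans)
        finally have "(cmod (T k))\<^sup>2 \<le> X * (C1 / Pt N * ((g (Suc N))\<^sup>2 / (c\<^sup>2 * g k ^ 4)))"
          using X by (simp add: mult_left_mono)
        hence "(cmod (T k))\<^sup>2 * v k \<le> X * (C1 / Pt N * ((g (Suc N))\<^sup>2 / (c\<^sup>2 * g k ^ 4))) * v k"
          using v_pos[of k] k by (intro mult_right_mono) auto
        also have "\<dots> = E * ((g (Suc N) / g k)\<^sup>2 * p k)"
          by (simp add: E_def power_divide power2_eq_square power4_eq_xxxx)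
        finally show ?thesis .
      qed
      have E: "E \<ge> 0" unfolding E_def using X C1 Pt_pos[of N] by simp
      have Tfin: "(\<Sum>k\<in>K. (cmod (T k))\<^sup>2 * v k) \<le> E * (\<epsilon> * D * Pt N)" if K: "finite K" "K \<subseteq> {1..}" for K
      proof -
        have "(\<Sum>k\<in>K. (cmod (T k))\<^sup>2 * v k) = (\<Sum>k\<in>K \<inter> {N<..}. (cmod (T k))\<^sup>2 * v k)"
        proof (rule sum.mono_neutral_right)
          show "\<forall>i\<in>K - K \<inter> {N<..}. (cmod (T i))\<^sup>2 * v i = 0"
          proof
            fix i assume "i \<in> K - K \<inter> {N<..}"
            hence "1 \<le> i" "i \<le> N" using K(2) by auto
            thus "(cmod (T i))\<^sup>2 * v i = 0" using T0 by simp
          qed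
        qed (use K in auto)
        also have "\<dots> \<le> (\<Sum>k\<in>K \<inter> {N<..}. E * ((g (Suc N) / g k)\<^sup>2 * p k))" by (intro sum_mono Tb) auto
        also have "\<dots> = E * (\<Sum>k\<in>K \<inter> {N<..}. (g (Suc N) / g k)\<^sup>2 * p k)" by (simp add: sum_distrib_left)
        also have "\<dots> \<le> E * (\<epsilon> * D * Pt N)" unfolding D_def
          using \<epsilon> N0 N K E by (intro mult_left_mono sum_p_weighted) auto
        finally show ?thesis .
      qed
      have Tsm: "(\<lambda>k. (cmod (T k))\<^sup>2 * v k) summable_on {1..}" "(\<Sum>\<^sub>\<infinity>k\<in>{1..}. (cmod (T k))\<^sup>2 * v k) \<le> E * (\<epsilon> * D * Pt N)"
        using sum_le_bound_summable[of "{1..}" "\<lambda>k. (cmod (T k))\<^sup>2 * v k" "E * (\<epsilon> * D * Pt N)"]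
          l2_term_nonneg[of _ T] Tfin by blast+
      have "X\<^sup>2 = (cmod (\<Sum>\<^sub>\<infinity>k\<in>{1..}. a k * of_real (v k) * T k))\<^sup>2"
        using infsumI[OF hs] by (simp add: norm_of_real)
      also have "\<dots> \<le> nsq v a * (\<Sum>\<^sub>\<infinity>k\<in>{1..}. (cmod (T k))\<^sup>2 * v k)"
        by (rule cauchy_schwarz_H(2)[OF a(1) Tsm(1)])
      also have "\<dots> \<le> C2 * X * (E * (\<epsilon> * D * Pt N))"
        using na Tsm(2) nsq_nonneg C2 X by (intro mult_mono infsum_nonneg l2_term_nonneg) auto
      also have "\<dots> = X\<^sup>2 * (C2 * (C1 / c\<^sup>2) * D * \<epsilon>)"
        using Pt_pos[of N] by (simp add: E_def power2_eq_square)
      also have "C2 * (C1 / c\<^sup>2) * D * \<epsilon> = 1 / 2" using C1 C2 c D by (simp add: \<epsilon>_def)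
      finally show False using X by simp
    qed
  qed
qed

text \<open>With fewer than N points in the disc, some nonzero \<open>a\<close> supported on {1..N}
  has a transform vanishing at all of them. Outside the disc the transform is at most of order 1 /
  |z| times the root of v_1 + ... + v_N, and \<open>sum_v_small\<close> makes its energy too small
  for the lower bound. Finiteness is a premise because it comes from the upper count.\<close>

lemma card_lower:
  "\<forall>\<^sub>F N in sequentially. finite {z\<in>L. cmod z < radius N} \<longrightarrow> N \<le> card {z\<in>L. cmod z < radius N}"
proof -
  obtain C1 where C1: "C1 > 0" "\<And>N F. 1 \<le> N \<Longrightarrow> finite F \<Longrightarrow> F \<subseteq> L \<Longrightarrow> (\<And>z. z \<in> F \<Longrightarrow> radius N \<le> cmod z)
      \<Longrightarrow> (\<Sum>z\<in>F. w z / (cmod z)\<^sup>2) \<le> C1 / (Pt N * (g N)\<^sup>2)" using w_over_sq_bound by blast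
  obtain C2 where C2: "C2 > 0" "\<And>a B. a \<in> \<H> \<Longrightarrow> (\<And>F. finite F \<Longrightarrow> F \<subseteq> L \<Longrightarrow> (\<Sum>z\<in>F. (cmod (f a z))\<^sup>2 * w z) \<le> B)
      \<Longrightarrow> nsq v a \<le> C2 * B" using lower_bound_le by blast
  define c where "c = (q - 1) / (q + 1)"
  have c: "c > 0" using q by (simp add: c_def)
  define \<epsilon> where "\<epsilon> = 1 / (2 * C2 * C1 / c\<^sup>2)"
  have \<epsilon>: "\<epsilon> > 0" using c C1 C2 by (simp add: \<epsilon>_def)
  show ?thesis
    using eventually_ge_at_top[of 1] sum_v_small[OF \<epsilon>]
  proof eventually_elim
    case (elim N)
    define L' where "L' = {z\<in>L. cmod z < radius N}"
    have "N \<le> card L'" if fin: "finite L'"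
    proof (rule ccontr)
      assume "\<not> N \<le> card L'"
      hence "card L' < card {1..N}" by simp
      then obtain x where x: "\<exists>k\<in>{1..N}. x k \<noteq> 0" "\<And>z. z \<in> L' \<Longrightarrow> (\<Sum>k\<in>{1..N}. of_real (v k) / (z - \<gamma> k) * x k) = 0"
        using homogeneous_system[OF fin, of "{1..N}" "\<lambda>z k. of_real (v k) / (z - \<gamma> k)"] by auto
      define a where "a k = (if k \<in> {1..N} then x k else 0)" for k
      have a0: "a k = 0" if "k \<notin> {1..N}" for k unfolding a_def using that by (rule if_not_P)
      have fs: "a \<in> \<H>" "nsq v a = (\<Sum>k\<in>{1..N}. (cmod (a k))\<^sup>2 * v k)"
        "f a u = (\<Sum>k\<in>{1..N}. a k * of_real (v k) / (u - \<gamma> k))" for u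
        by (rule finite_support, rule a0, assumption)+
      have a: "a \<in> \<H>" by (rule fs)
      have pos: "nsq v a > 0"
      proof -
        obtain k where k: "k \<in> {1..N}" "x k \<noteq> 0" using x by blast
        have "0 < (cmod (a k))\<^sup>2 * v k" using k v_pos[of k] by (simp add: a_def)
        also have "\<dots> \<le> nsq v a" using nsq_ge_sum[OF a, of "{k}"] k by simp
        finally show ?thesis .
      qed
      have z0: "f a z = 0" if "z \<in> L'" for z
      proof -
        have "f a z = (\<Sum>k\<in>{1..N}. of_real (v k) / (z - \<gamma> k) * x k)"
          using fs(3)[of z] by (simp add: a_def mult.commute)
        thus ?thesis using x(2)[OF that] by simp
      qed
      have big: "(cmod (f a z))\<^sup>2 * w z \<le> nsq v a * (\<epsilon> * (Pt N * (g N)\<^sup>2) / c\<^sup>2) * (w z / (cmod z)\<^sup>2)" if z: "z \<in> L" "z \<notin> L'" for z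
      proof -
        have zr: "radius N \<le> cmod z" using z by (auto simp: L'_def)
        have z0: "cmod z > 0" using zr radius_bounds(3)[of N] elim by linarith
        define b where "b k = (if k \<in> {1..N} then 1 / (z - \<gamma> k) else 0)" for k
        have b: "b k = 0" if "k \<notin> {1..N}" for k unfolding b_def using that by (rule if_not_P)
        have fb: "b \<in> \<H>" "nsq v b = (\<Sum>k\<in>{1..N}. (cmod (b k))\<^sup>2 * v k)"
        "f b u = (\<Sum>k\<in>{1..N}. b k * of_real (v k) / (u - \<gamma> k))" for u
        by (rule finite_support, rule b, assumption)+
        have "f a z = (\<Sum>\<^sub>\<infinity>k\<in>{1..}. a k * of_real (v k) * b k)"
          unfolding Hilb_def by (intro infsum_cong) (auto simp: a_def b_def)
        hence "(cmod (f a z))\<^sup>2 \<le> nsq v a * nsq v b"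
          using cauchy_schwarz_H(2)[OF a, of b] fb(1) by (simp add: nsq_def l2_iff)
        also have "nsq v b \<le> (\<Sum>k\<in>{1..N}. v k / (c * cmod z)\<^sup>2)"
          unfolding fb(2)
        proof (rule sum_mono)
          fix k assume k: "k \<in> {1..N}"
          have "c * cmod z \<le> cmod (z - \<gamma> k)" unfolding c_def using k zr by (intro sep_below[of k N]) auto
          moreover have "0 < c * cmod z" using c z0 by simp
          ultimately have "v k / (cmod (z - \<gamma> k))\<^sup>2 \<le> v k / (c * cmod z)\<^sup>2"
            using v_pos[of k] k c by (intro divide_left_mono power_mono mult_pos_pos zero_less_power) auto
          thus "(cmod (b k))\<^sup>2 * v k \<le> v k / (c * cmod z)\<^sup>2" using k by (simp add: b_def norm_divide power_divide)
        qed
        also have "\<dots> = (\<Sum>k\<in>{1..N}. v k) / (c * cmod z)\<^sup>2" by (simp add: sum_divide_distrib)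
        also have "\<dots> \<le> \<epsilon> * (Pt N * (g N)\<^sup>2) / (c * cmod z)\<^sup>2" using elim by (intro divide_right_mono) auto
        finally have "(cmod (f a z))\<^sup>2 \<le> nsq v a * (\<epsilon> * (Pt N * (g N)\<^sup>2) / (c * cmod z)\<^sup>2)"
          using nsq_nonneg[of a] by (simp add: mult_left_mono)
        hence "(cmod (f a z))\<^sup>2 * w z \<le> nsq v a * (\<epsilon> * (Pt N * (g N)\<^sup>2) / (c * cmod z)\<^sup>2) * w z"
          using w_pos'[OF z(1)] by (intro mult_right_mono) auto
        thus ?thesis by (simp add: power_mult_distrib)
      qed
      have "nsq v a \<le> C2 * (nsq v a * (\<epsilon> * (Pt N * (g N)\<^sup>2) / c\<^sup>2) * (C1 / (Pt N * (g N)\<^sup>2)))"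
      proof (rule C2(2)[OF a])
        fix F assume F: "finite F" "F \<subseteq> L"
        have "(\<Sum>z\<in>F. (cmod (f a z))\<^sup>2 * w z) = (\<Sum>z\<in>F - L'. (cmod (f a z))\<^sup>2 * w z)"
          using F z0 by (intro sum.mono_neutral_right) auto
        also have "\<dots> \<le> (\<Sum>z\<in>F - L'. nsq v a * (\<epsilon> * (Pt N * (g N)\<^sup>2) / c\<^sup>2) * (w z / (cmod z)\<^sup>2))"
          using F by (intro sum_mono big) auto
        also have "\<dots> = nsq v a * (\<epsilon> * (Pt N * (g N)\<^sup>2) / c\<^sup>2) * (\<Sum>z\<in>F - L'. w z / (cmod z)\<^sup>2)"
          by (simp add: sum_distrib_left)
        also have "\<dots> \<le> nsq v a * (\<epsilon> * (Pt N * (g N)\<^sup>2) / c\<^sup>2) * (C1 / (Pt N * (g N)\<^sup>2))"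
          using F elim nsq_nonneg[of a] \<epsilon> Pt_pos[of N] by (intro mult_left_mono C1(2)) (auto simp: L'_def)
        finally show "(\<Sum>z\<in>F. (cmod (f a z))\<^sup>2 * w z) \<le> \<dots>" .
      qed
      also have "\<dots> = nsq v a * (C2 * C1 / c\<^sup>2 * \<epsilon>)"
        using Pt_pos[of N] g_pos[of N] elim by simp
      also have "C2 * C1 / c\<^sup>2 * \<epsilon> = 1 / 2" using C1 C2 c by (simp add: \<epsilon>_def)
      finally show False using pos by simp
    qed
    thus ?case by (simp add: L'_def)
  qed
qed

lemma count_facts:
  "\<forall>\<^sub>F N in sequentially. finite {z\<in>L. cmod z < radius N} \<and> N \<le> card {z\<in>L. cmod z < radius N}
     \<and> card {z\<in>L. cmod z < radius N} \<le> Suc N"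
  using card_upper card_lower
proof eventually_elim
  case (elim N)
  have "finite {z\<in>L. cmod z < radius N}"
  proof (rule ccontr)
    assume "infinite {z\<in>L. cmod z < radius N}"
    then obtain F where "F \<subseteq> {z\<in>L. cmod z < radius N}" "finite F" "card F = Suc (Suc N)"
      using infinite_arbitrarily_large by blast
    moreover from this have "card F \<le> Suc N" using elim(1) by blast
    ultimately show False by simp
  qed
  thus ?case using elim by auto
qed

text \<open>The transform of the N-th unit vector is v_N / (z - \<gamma>_N). Its energy off the N-th
  annulus is of the relative order p_N / P_N, hence small, and the annulus holds at most two points,
  so one of them carries a fixed share.\<close>

lemma column_lower:
  obtains c where "c > 0" "\<forall>\<^sub>F N in sequentially. \<exists>z\<in>L. radius (N - 1) \<le> cmod z \<and> cmod z < radius N \<and> c \<le> w z * v N / (cmod (z - \<gamma> N))\<^sup>2"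
proof -
  obtain C0 where C0: "C0 > 0" "\<And>N F. finite F \<Longrightarrow> F \<subseteq> L \<Longrightarrow> (\<And>z. z \<in> F \<Longrightarrow> cmod z \<le> g (Suc N)) \<Longrightarrow> (\<Sum>z\<in>F. w z) \<le> C0 / Pt N"
    using w_sum_bound[OF disj inv] by blast
  obtain C1 where C1: "C1 > 0" "\<And>N F. 1 \<le> N \<Longrightarrow> finite F \<Longrightarrow> F \<subseteq> L \<Longrightarrow> (\<And>z. z \<in> F \<Longrightarrow> radius N \<le> cmod z)
      \<Longrightarrow> (\<Sum>z\<in>F. w z / (cmod z)\<^sup>2) \<le> C1 / (Pt N * (g N)\<^sup>2)" using w_over_sq_bound by blast
  obtain C2 where C2: "C2 > 0" "\<And>a B. a \<in> \<H> \<Longrightarrow> (\<And>F. finite F \<Longrightarrow> F \<subseteq> L \<Longrightarrow> (\<Sum>z\<in>F. (cmod (f a z))\<^sup>2 * w z) \<le> B)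
      \<Longrightarrow> nsq v a \<le> C2 * B" using lower_bound_le by blast
  define c1 where "c1 = (1 - 1 / q) / 2"
  have c1: "c1 > 0" using q by (simp add: c1_def)
  define c2 where "c2 = (q - 1) / (q + 1)"
  have c2: "c2 > 0" using q by (simp add: c2_def)
  \<comment> \<open>If both points stayed below \<open>c\<close>, the total would fail the lower
    bound: with these constants \<open>C2 * (2 * c)\<close> and \<open>C2 * (D * \<epsilon>)\<close>
    are both 1/4.\<close>
  define c where "c = 1 / (8 * C2)"
  have c: "c > 0" using C2 by (simp add: c_def)
  define D where "D = C0 / c1\<^sup>2 + C1 / c2\<^sup>2"
  have D: "D > 0" unfolding D_def using C0 C1 c1 c2 by (intro add_pos_pos divide_pos_pos) auto
  define \<epsilon> where "\<epsilon> = 1 / (4 * C2 * D)"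
  have \<epsilon>: "\<epsilon> > 0" using D C2 by (simp add: \<epsilon>_def)
  obtain N1 where N1: "\<And>N. N \<ge> N1 \<Longrightarrow> finite {z\<in>L. cmod z < radius N} \<and> N \<le> card {z\<in>L. cmod z < radius N}
     \<and> card {z\<in>L. cmod z < radius N} \<le> Suc N"
    using count_facts by (auto simp: eventually_sequentially)
  have "\<forall>\<^sub>F N in sequentially. \<exists>z\<in>L. radius (N - 1) \<le> cmod z \<and> cmod z < radius N \<and> c \<le> w z * v N / (cmod (z - \<gamma> N))\<^sup>2"
    using eventually_ge_at_top[of "N1 + 2"] p_small[OF \<epsilon>]
  proof eventually_elim
    case (elim N)
    hence N: "N \<ge> 2" "N - 1 \<ge> N1" "N \<ge> N1" by auto
    have vN: "v N > 0" and gN: "g N > 0" and PN: "Pt N > 0" using v_pos[of N] g_pos[of N] Pt_pos N by auto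
    have pr: "p N / Pt N \<le> \<epsilon>" using elim(2) PN by (simp only: pos_divide_le_eq)
    have rr: "radius (N - 1) \<le> radius N" using N by (intro radius_mono) auto
    show ?case
    proof (rule ccontr)
      assume neg: "\<not> ?case"
      define h where "h z = w z * v N / (cmod (z - \<gamma> N))\<^sup>2" for z
      define O' where "O' = {z\<in>L. radius (N - 1) \<le> cmod z \<and> cmod z < radius N}"
      have O': "finite O'" "card O' \<le> 2"
      proof -
        have eq: "{z\<in>L. cmod z < radius N} = {z\<in>L. cmod z < radius (N - 1)} \<union> O'"
          using rr by (auto simp: O'_def)
        show fin: "finite O'" using N1[OF N(3)] eq by (metis finite_Un)
        have "card {z\<in>L. cmod z < radius N} = card {z\<in>L. cmod z < radius (N - 1)} + card O'"
          unfolding eq using N1[OF N(2)] fin by (intro card_Un_disjoint) (auto simp: O'_def)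
        \<comment> \<open>The count is at least N - 1 in the inner disc and at most N + 1 in the
          outer one.\<close>
        thus "card O' \<le> 2" using N1[OF N(2)] N1[OF N(3)] N(1) by linarith
      qed
      have bound: "(\<Sum>z\<in>F. h z) \<le> 2 * c + D * \<epsilon>" if F: "finite F" "F \<subseteq> L" for F
      proof -
        define F1 where "F1 = {z\<in>F. cmod z < radius (N - 1)}"
        define F2 where "F2 = F \<inter> O'"
        define F3 where "F3 = {z\<in>F. radius N \<le> cmod z}"
        have "F = F1 \<union> F2 \<union> F3" using F by (auto simp: F1_def F2_def F3_def O'_def)
        moreover have "(F1 \<union> F2) \<inter> F3 = {}" "F1 \<inter> F2 = {}" using rr by (auto simp: F1_def F2_def F3_def O'_def)
        moreover have fin: "finite F1" "finite F2" "finite F3" using F by (auto simp: F1_def F2_def F3_def)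
        ultimately have split: "(\<Sum>z\<in>F. h z) = (\<Sum>z\<in>F1. h z) + (\<Sum>z\<in>F2. h z) + (\<Sum>z\<in>F3. h z)"
          by (simp add: sum.union_disjoint)
        have s1: "(\<Sum>z\<in>F1. h z) \<le> C0 / c1\<^sup>2 * \<epsilon>"
        proof -
          have "(\<Sum>z\<in>F1. h z) \<le> (\<Sum>z\<in>F1. w z * (v N / (c1 * g N)\<^sup>2))"
          proof (rule sum_mono)
            fix z assume z: "z \<in> F1"
            have "c1 * g N \<le> cmod (z - \<gamma> N)" unfolding c1_def
              using z N by (intro sep_above[of "N - 1"]) (auto simp: F1_def)
            hence "v N / (cmod (z - \<gamma> N))\<^sup>2 \<le> v N / (c1 * g N)\<^sup>2"
              using vN gN c1 mult_pos_pos[OF c1 gN]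
              by (intro divide_left_mono power_mono mult_pos_pos zero_less_power) linarith+
            moreover have "w z \<ge> 0" using w_nonneg z F by (auto simp: F1_def)
            ultimately show "h z \<le> w z * (v N / (c1 * g N)\<^sup>2)"
              unfolding h_def times_divide_eq_right[symmetric] by (rule mult_left_mono)
          qed
          also have "\<dots> = (\<Sum>z\<in>F1. w z) * (v N / (c1 * g N)\<^sup>2)"
            by (rule sum_distrib_right[symmetric])
          also have "\<dots> \<le> C0 / Pt (N - 1) * (v N / (c1 * g N)\<^sup>2)"
          proof (intro mult_right_mono C0(2) fin)
            fix z assume "z \<in> F1"
            moreover have "1 \<le> N - 1" using N by simp
            ultimately show "cmod z \<le> g (Suc (N - 1))"
              using radius_bounds(2)[of "N - 1"] by (auto simp: F1_def)
          qed (use F vN in \<open>auto simp: F1_def\<close>)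
          also have "\<dots> \<le> C0 / Pt N * (v N / (c1 * g N)\<^sup>2)"
            using slow.P_antimono[of "N - 1" N] PN C0 vN
            by (intro mult_right_mono divide_left_mono mult_pos_pos) (auto intro: less_imp_le)
          also have "\<dots> = C0 / c1\<^sup>2 * (p N / Pt N)" by (simp add: power_mult_distrib)
          also have "\<dots> \<le> C0 / c1\<^sup>2 * \<epsilon>"
            using C0 pr by (intro mult_left_mono) auto
          finally show ?thesis .
        qed
        have s3: "(\<Sum>z\<in>F3. h z) \<le> C1 / c2\<^sup>2 * \<epsilon>"
        proof -
          have "(\<Sum>z\<in>F3. h z) \<le> (\<Sum>z\<in>F3. v N / c2\<^sup>2 * (w z / (cmod z)\<^sup>2))"
          proof (rule sum_mono)
            fix z assume z: "z \<in> F3"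
            have "c2 * cmod z \<le> cmod (z - \<gamma> N)" unfolding c2_def
              using z N by (intro sep_below[of N N]) (auto simp: F3_def)
            moreover have "c2 * cmod z > 0"
            proof -
              have "0 < cmod z" using z radius_bounds(3)[of N] N by (auto simp: F3_def)
              thus ?thesis using c2 by (rule mult_pos_pos[rotated])
            qed
            moreover have "w z * v N \<ge> 0" using w_nonneg z F vN by (auto simp: F3_def)
            ultimately have "w z * v N / (cmod (z - \<gamma> N))\<^sup>2 \<le> w z * v N / (c2 * cmod z)\<^sup>2"
              by (rule divide_sq_mono)
            thus "h z \<le> v N / c2\<^sup>2 * (w z / (cmod z)\<^sup>2)" by (simp add: h_def power_mult_distrib mult_ac)
          qed
          also have "\<dots> = v N / c2\<^sup>2 * (\<Sum>z\<in>F3. w z / (cmod z)\<^sup>2)" by (simp add: sum_distrib_left)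
          also have "\<dots> \<le> v N / c2\<^sup>2 * (C1 / (Pt N * (g N)\<^sup>2))"
            using N F vN by (intro mult_left_mono C1(2) fin) (auto simp: F3_def)
          also have "\<dots> = C1 / c2\<^sup>2 * (p N / Pt N)" by (simp add: mult_ac)
          also have "\<dots> \<le> C1 / c2\<^sup>2 * \<epsilon>"
            using C1 pr by (intro mult_left_mono) auto
          finally show ?thesis .
        qed
        have s2: "(\<Sum>z\<in>F2. h z) \<le> 2 * c"
        proof -
          have "(\<Sum>z\<in>F2. h z) \<le> of_nat (card F2) * c"
            using neg by (intro sum_bounded_above) (force simp: F2_def O'_def h_def)
          also have "\<dots> \<le> 2 * c"
            using card_mono[OF O'(1), of F2] O'(2) c by (intro mult_right_mono) (auto simp: F2_def)
          finally show ?thesis .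
        qed
        show ?thesis unfolding split using s1 s2 s3 by (simp add: D_def distrib_right)
      qed
      define a where "a k = (if k = N then 1 else 0 :: complex)" for k
      have a0: "a k = 0" if "k \<notin> {1..N}" for k using that N by (auto simp: a_def)
      have fs: "a \<in> \<H>" "nsq v a = (\<Sum>k\<in>{1..N}. (cmod (a k))\<^sup>2 * v k)"
        "f a u = (\<Sum>k\<in>{1..N}. a k * of_real (v k) / (u - \<gamma> k))" for u
        by (rule finite_support, rule a0, assumption)+
      have na: "nsq v a = v N"
      proof -
        have "nsq v a = (\<Sum>k\<in>{N}. (cmod (a k))\<^sup>2 * v k)" unfolding fs(2) 
          using N by (intro sum.mono_neutral_right) (auto simp: a_def)
        thus ?thesis by (simp add: a_def)
      qed
      have fa: "f a z = of_real (v N) / (z - \<gamma> N)" for z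
      proof -
        have "f a z = (\<Sum>k\<in>{N}. a k * of_real (v k) / (z - \<gamma> k))" unfolding fs(3)
          using N by (intro sum.mono_neutral_right) (auto simp: a_def)
        thus ?thesis by (simp add: a_def)
      qed
      have "nsq v a \<le> C2 * (v N * (2 * c + D * \<epsilon>))"
      proof (rule C2(2)[OF fs(1)])
        fix F assume F: "finite F" "F \<subseteq> L"
        have "(\<Sum>z\<in>F. (cmod (f a z))\<^sup>2 * w z) = v N * (\<Sum>z\<in>F. h z)"
          using vN by (simp add: fa h_def sum_distrib_left norm_divide power_divide power2_eq_square mult_ac)
        also have "\<dots> \<le> v N * (2 * c + D * \<epsilon>)" using vN by (intro mult_left_mono bound F) auto
        finally show "(\<Sum>z\<in>F. (cmod (f a z))\<^sup>2 * w z) \<le> v N * (2 * c + D * \<epsilon>)" .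
      qed
      also have "\<dots> = v N * (C2 * (2 * c) + C2 * (D * \<epsilon>))" by (simp add: algebra_simps)
      also have "C2 * (2 * c) + C2 * (D * \<epsilon>) = 1 / 2" using C2 D by (simp add: c_def \<epsilon>_def)
      finally show False using vN na by simp
    qed
  qed
  thus thesis using that c by blast
qed

text \<open>The count is N or N + 1 and grows by at least one from each disc to the next, so once it
  equals N + 1 it does so forever. The eventual difference \<open>e\<close> is the excess.\<close>

lemma eventually_one_per_annulus:
  obtains e N1 :: nat and c :: real where "e \<le> 1" "c > 0" "N1 \<ge> 2"
    "\<And>N. N \<ge> N1 \<Longrightarrow> finite {z\<in>L. cmod z < radius N}"
    "\<And>N. N \<ge> N1 \<Longrightarrow> card {z\<in>L. cmod z < radius N} = N + e"
    "\<And>N. N \<ge> N1 \<Longrightarrow> \<exists>z\<in>L. radius (N - 1) \<le> cmod z \<and> cmod z < radius N \<and> c \<le> w z * v N / (cmod (z - \<gamma> N))\<^sup>2"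
proof -
  obtain c where c: "c > 0" "\<forall>\<^sub>F N in sequentially. \<exists>z\<in>L. radius (N - 1) \<le> cmod z \<and> cmod z < radius N \<and> c \<le> w z * v N / (cmod (z - \<gamma> N))\<^sup>2"
    using column_lower by blast
  define LN where "LN N = {z\<in>L. cmod z < radius N}" for N
  have "\<forall>\<^sub>F N in sequentially. (finite (LN N) \<and> N \<le> card (LN N) \<and> card (LN N) \<le> Suc N) \<and>
      (\<exists>z\<in>L. radius (N - 1) \<le> cmod z \<and> cmod z < radius N \<and> c \<le> w z * v N / (cmod (z - \<gamma> N))\<^sup>2)"
    unfolding LN_def using count_facts c(2) by (rule eventually_conj)
  then obtain N0 where N0: "\<And>N. N \<ge> N0 \<Longrightarrow> finite (LN N) \<and> N \<le> card (LN N) \<and> card (LN N) \<le> Suc N"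
      "\<And>N. N \<ge> N0 \<Longrightarrow> \<exists>z\<in>L. radius (N - 1) \<le> cmod z \<and> cmod z < radius N \<and> c \<le> w z * v N / (cmod (z - \<gamma> N))\<^sup>2"
    unfolding eventually_sequentially by blast
  have step: "Suc (card (LN N)) \<le> card (LN (Suc N))" if N: "N \<ge> max 1 N0" for N
  proof -
    obtain z where z: "z \<in> L" "radius N \<le> cmod z" "cmod z < radius (Suc N)" 
    proof -
      have "N0 \<le> Suc N" using N by simp
      from N0(2)[OF this] show thesis using that by auto
    qed
    have "insert z (LN N) \<subseteq> LN (Suc N)" using z radius_mono[of N "Suc N"] N by (auto simp: LN_def)
    moreover have "z \<notin> LN N" using z by (simp add: LN_def)
    ultimately show ?thesis using card_mono[of "LN (Suc N)" "insert z (LN N)"] N0(1)[of N] N0(1)[of "Suc N"] N by simp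
  qed
  show thesis
  proof (cases "\<exists>M\<ge>max 2 N0. card (LN M) = Suc M")
    case True
    then obtain M where M: "M \<ge> max 2 N0" "card (LN M) = Suc M" by blast
    have "card (LN N) = N + 1" if "N \<ge> M" for N
      using that
    proof (induction N rule: dec_induct)
      case (step n)
      thus ?case using \<open>\<And>N. N \<ge> max 1 N0 \<Longrightarrow> Suc (card (LN N)) \<le> card (LN (Suc N))\<close>[of n] N0(1)[of "Suc n"] M by simp
    qed (use M in simp)
    thus thesis using that[of 1 c M] c(1) M N0 by (auto simp: LN_def)
  next
    case False
    hence "card (LN N) = N + 0" if "N \<ge> max 2 N0" for N using N0(1)[of N] that by (metis add_0_right le_SucE le_antisym max.boundedE)
    thus thesis using that[of 0 c "max 2 N0"] c(1) N0 by (auto simp: LN_def)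
  qed
qed

end

section \<open>From a share of the Bessel kernel to membership in \<open>D\<close>\<close>

context sparse_weights
begin

lemma kernel_ge_tail:
  assumes "z \<notin> \<gamma> ` {1..}" "cmod z \<le> g (Suc N)"
  shows "Pt N / 4 \<le> kernel_sq \<gamma> v z"
proof -
  have "(\<Sum>\<^sub>\<infinity>k\<in>{N<..}. 1 / 4 * p k) \<le> kernel_sq \<gamma> v z"
  proof (rule sum_le_bound_summable(2))
    fix F assume F: "finite F" "F \<subseteq> {N<..}"
    have "(\<Sum>k\<in>F. 1 / 4 * p k) \<le> (\<Sum>k\<in>F. v k / (cmod (z - \<gamma> k))\<^sup>2)"
    proof (rule sum_mono)
      fix k assume "k \<in> F"
      hence k: "k > N" using F by auto
      hence "cmod z \<le> g k" using assms(2) g_mono[of "Suc N" k] by simp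
      hence "cmod (z - \<gamma> k) \<le> 2 * g k" using norm_triangle_ineq4[of z "\<gamma> k"] by simp
      moreover have "cmod (z - \<gamma> k) > 0" using assms(1) k by auto
      ultimately have "v k / (2 * g k)\<^sup>2 \<le> v k / (cmod (z - \<gamma> k))\<^sup>2"
        using v_pos[of k] k by (intro divide_sq_mono) auto
      thus "1 / 4 * p k \<le> v k / (cmod (z - \<gamma> k))\<^sup>2" by (simp add: power_mult_distrib)
    qed
    also have "\<dots> \<le> kernel_sq \<gamma> v z" using F by (intro kernel_ge_sum assms) auto
    finally show "(\<Sum>k\<in>F. 1 / 4 * p k) \<le> kernel_sq \<gamma> v z" .
  next
    fix k assume "k \<in> {N<..}"
    thus "0 \<le> 1 / 4 * p k" using p_pos[of k] by simp
  qed
  moreover have "(\<Sum>\<^sub>\<infinity>k\<in>{N<..}. 1 / 4 * p k) = 1 / 4 * Pt N"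
    unfolding P_def by (intro infsum_cmult_right p_summable')
  ultimately show ?thesis by simp
qed

text \<open>The last hypothesis says that the N-th term is at least the share c of the kernel at z.
  The kernel is at least \<open>Pt N / 4\<close> through the indices above N and at least
  \<open>V v N / (4 |z|^2)\<close> through those below, whence the constant 4 / c.\<close>

lemma in_D:
  assumes N: "N \<ge> 2" and z: "z \<notin> \<gamma> ` {1..}" "radius (N - 1) \<le> cmod z" "cmod z < radius N"
    and c: "c > 0" "c \<le> w z * v N / (cmod (z - \<gamma> N))\<^sup>2"
  shows "z \<in> D \<gamma> v (4 / c) N"
proof -
  define K where "K = kernel_sq \<gamma> v z"
  have K: "K > 0" unfolding K_def by (rule kernel_pos[OF z(1)])
  have N1: "1 \<le> N - 1" using N by simp
  have "cmod z \<le> g (Suc N)" using z(3) radius_bounds(2)[of N] N by simp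
  hence 1: "Pt N \<le> 4 * K" using kernel_ge_tail[OF z(1), of N] by (simp add: K_def)
  have 2: "V v N / (cmod z)\<^sup>2 \<le> 4 * K"
  proof -
    have "V v N / (2 * cmod z)\<^sup>2 = (\<Sum>k\<in>{1..<N}. v k / (2 * cmod z)\<^sup>2)"
      using N by (simp add: V_def sum_divide_distrib)
    also have "\<dots> \<le> (\<Sum>k\<in>{1..<N}. v k / (cmod (z - \<gamma> k))\<^sup>2)"
    proof (rule sum_mono)
      fix k assume k: "k \<in> {1..<N}"
      have "g k \<le> g (N - 1)" using k by (intro g_mono) auto
      also have "\<dots> \<le> cmod z" using z(2) radius_bounds(1)[OF N1] by simp
      finally have "cmod (z - \<gamma> k) \<le> 2 * cmod z" using norm_triangle_ineq4[of z "\<gamma> k"] by simp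
      moreover have "cmod (z - \<gamma> k) > 0" using z(1) k by auto
      ultimately show "v k / (2 * cmod z)\<^sup>2 \<le> v k / (cmod (z - \<gamma> k))\<^sup>2"
        using v_pos[of k] k by (intro divide_sq_mono) auto
    qed
    also have "\<dots> \<le> K" unfolding K_def by (intro kernel_ge_sum z) auto
    finally show ?thesis by (simp add: power_mult_distrib)
  qed
  have "c \<le> v N / (cmod (z - \<gamma> N))\<^sup>2 / K" using c(2) by (simp add: w_eq K_def divide_inverse mult_ac)
  hence "c * K \<le> v N / (cmod (z - \<gamma> N))\<^sup>2" using K by (simp only: pos_le_divide_eq)
  hence "4 / c * (c * K) \<le> 4 / c * (v N / (cmod (z - \<gamma> N))\<^sup>2)" using c(1) by (intro mult_left_mono) auto
  hence "4 * K \<le> 4 / c * v N / (cmod (z - \<gamma> N))\<^sup>2" using c(1) by simp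
  moreover have "z \<in> Omega \<gamma> N" using N z by (auto simp: Omega_def radius_def)
  ultimately show ?thesis using 1 2 by (auto simp: D_def)
qed

end

section \<open>Products over perturbed sequences\<close>

lemma eventually_le_imp_bounded:
  fixes x :: "nat \<Rightarrow> real"
  assumes "\<forall>\<^sub>F n in sequentially. x n \<le> B"
  obtains C where "C > 0" "\<And>n. x n \<le> C"
proof -
  obtain N where N: "\<And>n. n \<ge> N \<Longrightarrow> x n \<le> B" using assms by (auto simp: eventually_sequentially)
  show thesis
  proof (rule that[of "\<bar>B\<bar> + 1 + (\<Sum>n<N. \<bar>x n\<bar>)"])
    have "(\<Sum>n<N. \<bar>x n\<bar>) \<ge> 0" by (intro sum_nonneg) auto
    thus "\<bar>B\<bar> + 1 + (\<Sum>n<N. \<bar>x n\<bar>) > 0" by linarith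
    fix n
    show "x n \<le> \<bar>B\<bar> + 1 + (\<Sum>n<N. \<bar>x n\<bar>)"
    proof (cases "n < N")
      case True
      hence "\<bar>x n\<bar> \<le> (\<Sum>n<N. \<bar>x n\<bar>)" by (intro member_le_sum) auto
      thus ?thesis by linarith
    next
      case False
      have "(\<Sum>n<N. \<bar>x n\<bar>) \<ge> 0" by (intro sum_nonneg) auto
      thus ?thesis using N[of n] False by linarith
    qed
  qed
qed

context sparse_weights
begin

lemma s_mono: "1 \<le> j \<Longrightarrow> j \<le> k \<Longrightarrow> s j \<le> s k"
  using g_mono by (simp add: s_eq)

lemma s_ratio:
  obtains C where "C > 0" "\<And>j k. j \<le> k \<Longrightarrow> s j / s k \<le> C * (1 / q) ^ (k - j)"
proof -
  have ev: "\<forall>\<^sub>F n in sequentially. 1 / s (Suc n) \<le> 1 / q * (1 / s n)"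
    using eventually_ge_at_top[of 1]
  proof eventually_elim
    case (elim n)
    have "q * s n \<le> s (Suc n)" using lac elim by (simp add: s_eq)
    hence "1 / s (Suc n) \<le> 1 / (q * s n)" using q s_pos by (intro divide_left_mono) auto
    thus ?case by simp
  qed
  obtain C where C: "C > 0" "\<And>m n. m \<le> n \<Longrightarrow> 1 / s n \<le> C * (1 / q) ^ (n - m) * (1 / s m)"
    using geometric_bound[of "\<lambda>n. 1 / s n" "1 / q", OF _ _ ev] s_pos q by auto
  show thesis
  proof (rule that[OF C(1)])
    fix j k :: nat assume "j \<le> k"
    hence "s j * (1 / s k) \<le> s j * (C * (1 / q) ^ (k - j) * (1 / s j))"
      using s_pos[of j] by (intro mult_left_mono C) auto
    thus "s j / s k \<le> C * (1 / q) ^ (k - j)" using s_pos[of j] by simp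
  qed
qed

text \<open>For large k the modulus of x_k is close to that of \<gamma>_k, while y_j with j < k
  stays below a fixed proportion of it: either y_j is close to \<gamma>_j, or it is one of finitely
  many fixed points. Only the larger index has to be large.\<close>

lemma near_sep_eventually:
  assumes x: "\<And>\<epsilon>. \<epsilon> > 0 \<Longrightarrow> \<forall>\<^sub>F n in sequentially. cmod (x n - \<gamma> n) \<le> \<epsilon> * g n"
    and y: "\<And>\<epsilon>. \<epsilon> > 0 \<Longrightarrow> \<forall>\<^sub>F n in sequentially. cmod (y n - \<gamma> n) \<le> \<epsilon> * g n"
  obtains c K where "c > 0" "\<And>j k. K \<le> k \<Longrightarrow> j < k \<Longrightarrow> c * max (s k) (s j) \<le> cmod (x k - y j)"
proof -
  \<comment> \<open>Then (1 - \<epsilon>) - (1 + \<epsilon>) / q \<ge> (1 - 1 / q) / 2 remains as a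
    gap; the bound 1/2 serves the finitely many small j.\<close>
  define \<epsilon> where "\<epsilon> = min (1 / 2) ((1 - 1 / q) / 4)"
  have \<epsilon>: "\<epsilon> > 0" "\<epsilon> \<le> 1 / 2" "\<epsilon> \<le> (1 - 1 / q) / 4"
  proof -
    show "\<epsilon> > 0" using q by (simp add: \<epsilon>_def)
    show "\<epsilon> \<le> 1 / 2" unfolding \<epsilon>_def by (rule min.cobounded1)
    show "\<epsilon> \<le> (1 - 1 / q) / 4" unfolding \<epsilon>_def by (rule min.cobounded2)
  qed
  obtain K1 where K1: "\<And>n. n \<ge> K1 \<Longrightarrow> cmod (x n - \<gamma> n) \<le> \<epsilon> * g n" "\<And>n. n \<ge> K1 \<Longrightarrow> cmod (y n - \<gamma> n) \<le> \<epsilon> * g n"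
    using eventually_conj[OF x[OF \<epsilon>(1)] y[OF \<epsilon>(1)]] by (auto simp: eventually_sequentially)
  define K2 where "K2 = max 1 K1"
  define B where "B = (\<Sum>j<K2. cmod (y j))"
  obtain K3 where K3: "\<And>n. n \<ge> K3 \<Longrightarrow> max 1 (4 * B) \<le> g n"
    using g_unbounded[of "max 1 (4 * B)"] by (auto simp: eventually_sequentially)
  define c where "c = min (1 / 4) ((1 - 1 / q) / 2)"
  have c: "c > 0" "c \<le> 1 / 4" "c \<le> (1 - 1 / q) / 2"
  proof -
    show "c > 0" using q by (simp add: c_def)
    show "c \<le> 1 / 4" unfolding c_def by (rule min.cobounded1)
    show "c \<le> (1 - 1 / q) / 2" unfolding c_def by (rule min.cobounded2)
  qed
  show thesis
  proof (rule that[OF c(1)])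
    fix j k :: nat assume k: "max K2 K3 \<le> k" and j: "j < k"
    have k1: "k \<ge> 1" "k \<ge> K1" "k \<ge> K3" using k by (auto simp: K2_def)
    have gk: "g k \<ge> 1" "4 * B \<le> g k" using K3[of k] k1 by auto
    have "s j \<le> s k" using gk(1) k1 j s_mono[of j k] by (cases "j = 0") (auto simp: scale_def)
    hence mx: "max (s k) (s j) = g k" using k1 by (simp add: s_eq)
    have "g k - cmod (x k) \<le> cmod (\<gamma> k - x k)" by (rule norm_triangle_ineq2)
    hence xk: "(1 - \<epsilon>) * g k \<le> cmod (x k)" using K1(1)[OF k1(2)] by (simp add: norm_minus_commute algebra_simps)
    have dist: "cmod (x k) - cmod (y j) \<le> cmod (x k - y j)" by (rule norm_triangle_ineq2)
    show "c * max (s k) (s j) \<le> cmod (x k - y j)"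
    proof (cases "j < K2")
      case True
      have "cmod (y j) \<le> B" unfolding B_def using True by (intro member_le_sum) auto
      moreover have "(1 - 1 / 2) * g k \<le> (1 - \<epsilon>) * g k" using \<epsilon> by (intro mult_right_mono) auto
      moreover have "c * g k \<le> 1 / 4 * g k" using c by (intro mult_right_mono) auto
      moreover have "t \<le> r" if "y \<le> b" "(1 - 1 / 2) * a \<le> e" "t \<le> 1 / 4 * a" "4 * b \<le> a" "e \<le> x" "x - y \<le> r"
        for t a b e x y r :: real using that by (simp add: field_simps)
      ultimately show ?thesis using gk(2) xk dist unfolding mx by blast
    next
      case False
      hence j1: "j \<ge> 1" "j \<ge> K1" by (auto simp: K2_def)
      have "cmod (y j) - g j \<le> cmod (y j - \<gamma> j)" by (rule norm_triangle_ineq2)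
      hence "cmod (y j) \<le> (1 + \<epsilon>) * g j" using K1(2)[OF j1(2)] by (simp add: algebra_simps)
      also have "\<dots> \<le> (1 + \<epsilon>) * (g k / q)"
        using g_less[OF j1(1) j] q \<epsilon> by (intro mult_left_mono) (auto simp: field_simps)
      finally have yj: "cmod (y j) \<le> (1 + \<epsilon>) * (g k / q)" .
      have "\<epsilon> * (1 + 1 / q) \<le> (1 - 1 / q) / 4 * 2" using \<epsilon> q by (intro mult_mono) auto
      moreover have "c' \<le> (1 - e) - (1 + e) * r" if "e * (1 + r) \<le> (1 - r) / 4 * 2" "c' \<le> (1 - r) / 2"
        for c' e r :: real using that by (simp add: algebra_simps)
      ultimately have "c \<le> (1 - \<epsilon>) - (1 + \<epsilon>) * (1 / q)" using c(3) by blast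
      hence "c \<le> (1 - \<epsilon>) - (1 + \<epsilon>) / q" by simp
      hence "c * g k \<le> ((1 - \<epsilon>) - (1 + \<epsilon>) / q) * g k" by (intro mult_right_mono) auto
      also have "\<dots> = (1 - \<epsilon>) * g k - (1 + \<epsilon>) * (g k / q)" by (simp add: algebra_simps)
      finally show ?thesis unfolding mx using xk yj dist by linarith
    qed
  qed
qed

text \<open>Pairs whose larger index is large fall under one of the two one-sided estimates; the
  finitely many others give a positive minimum because their points are distinct. The starts
  \<open>m\<close> and \<open>m'\<close> allow \<Lambda> to begin at 0 and \<Gamma> at 1.\<close>

lemma near_sep:
  assumes x: "\<And>\<epsilon>. \<epsilon> > 0 \<Longrightarrow> \<forall>\<^sub>F n in sequentially. cmod (x n - \<gamma> n) \<le> \<epsilon> * g n"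
    and y: "\<And>\<epsilon>. \<epsilon> > 0 \<Longrightarrow> \<forall>\<^sub>F n in sequentially. cmod (y n - \<gamma> n) \<le> \<epsilon> * g n"
    and ne: "\<And>k j. m \<le> k \<Longrightarrow> m' \<le> j \<Longrightarrow> k \<noteq> j \<Longrightarrow> x k \<noteq> y j"
  obtains c where "c > 0" "\<And>k j. m \<le> k \<Longrightarrow> m' \<le> j \<Longrightarrow> k \<noteq> j \<Longrightarrow> c * max (s k) (s j) \<le> cmod (x k - y j)"
proof -
  obtain c1 K1 where c1: "c1 > 0" "\<And>j k. K1 \<le> k \<Longrightarrow> j < k \<Longrightarrow> c1 * max (s k) (s j) \<le> cmod (x k - y j)"
    using near_sep_eventually[OF x y] by blast
  obtain c2 K2 where c2: "c2 > 0" "\<And>j k. K2 \<le> k \<Longrightarrow> j < k \<Longrightarrow> c2 * max (s k) (s j) \<le> cmod (y k - x j)"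
    using near_sep_eventually[OF y x] by blast
  define K where "K = max K1 K2"
  define I where "I = {(k, j). k < K \<and> j < K \<and> m \<le> k \<and> m' \<le> j \<and> k \<noteq> j}"
  define r where "r = (\<lambda>(k, j). cmod (x k - y j) / max (s k) (s j))"
  have "I \<subseteq> {..<K} \<times> {..<K}" by (auto simp: I_def)
  hence fin: "finite I" using finite_subset by blast
  have mx: "max (s k) (s j) > 0" for k j using s_pos[of k] by simp
  define c where "c = Min (insert c1 (insert c2 (r ` I)))"
  have cle: "c \<le> c1" "c \<le> c2" unfolding c_def using fin by (intro Min_le; simp)+
  show thesis
  proof (rule that[of c])
    have "r i > 0" if "i \<in> I" for i
      using that ne mx by (auto simp: I_def r_def intro!: divide_pos_pos)
    thus "c > 0" unfolding c_def using fin c1 c2 by (subst Min_gr_iff) auto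
    fix k j assume kj: "m \<le> k" "m' \<le> j" "k \<noteq> j"
    consider "k \<ge> K1" "j < k" | "j \<ge> K2" "k < j" | "(k, j) \<in> I"
    proof (cases "(k, j) \<in> I")
      case False
      hence "K \<le> k \<or> K \<le> j" using kj by (auto simp: I_def)
      thus thesis using that kj by (cases "j < k") (auto simp: K_def)
    qed
    thus "c * max (s k) (s j) \<le> cmod (x k - y j)"
    proof cases
      case 1
      have "c * max (s k) (s j) \<le> c1 * max (s k) (s j)" using cle mx[of k j] by (intro mult_right_mono) auto
      thus ?thesis using c1(2)[OF 1] by linarith
    next
      case 2
      have "c * max (s k) (s j) \<le> c2 * max (s k) (s j)" using cle mx[of k j] by (intro mult_right_mono) auto
      thus ?thesis using c2(2)[OF 2] by (simp add: max.commute norm_minus_commute)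
    next
      case 3
      have "c \<le> r (k, j)" unfolding c_def using fin 3 by (intro Min_le) auto
      thus ?thesis using mx[of k j] by (simp add: r_def pos_le_divide_eq)
    qed
  qed
qed

text \<open>In modulus, a factor with j < k exceeds 1, and one with j > k exceeds |x_j| / |y_j|, by
  a relative amount at most geometric in the distance of j and k. So only the factors |x_j| / |y_j|
  with j > k survive, up to a constant.\<close>

lemma prod_ratio_le:
  assumes C: "C > 0" and c: "c > 0"
  obtains A where "A > 0" "\<And>x y z k J. finite J \<Longrightarrow> J \<subseteq> {1..} \<Longrightarrow> k \<notin> J \<Longrightarrow> cmod z \<le> C * s k \<Longrightarrow>
      (\<And>j. j \<in> J \<Longrightarrow> cmod (x j - y j) \<le> C * s j) \<Longrightarrow>
      (\<And>j. j \<in> J \<Longrightarrow> c * s j \<le> cmod (x j)) \<Longrightarrow> (\<And>j. j \<in> J \<Longrightarrow> y j \<noteq> 0) \<Longrightarrow>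
      (\<And>j. j \<in> J \<Longrightarrow> c * max (s k) (s j) \<le> cmod (z - y j)) \<Longrightarrow>
      (\<Prod>j\<in>J. cmod (z - x j) / cmod (z - y j)) \<le> A * (\<Prod>j\<in>{j\<in>J. k < j}. cmod (x j) / cmod (y j))"
proof -
  obtain Cs where Cs: "Cs > 0" "\<And>j k. j \<le> k \<Longrightarrow> s j / s k \<le> Cs * (1 / q) ^ (k - j)"
    using s_ratio by blast
  define D where "D = max (C / c) (C * C / (c * c))"
  have D: "C / c \<le> D" "C * C / (c * c) \<le> D" "D > 0"
    using less_le_trans[OF divide_pos_pos[OF C c] max.cobounded1] by (auto simp: D_def)
  show thesis
  proof (rule that[of "exp (D * Cs * (2 / (1 - 1 / q)))"])
    fix x y z k J
    assume J: "finite J" "J \<subseteq> {1::nat..}" "k \<notin> J" and z: "cmod z \<le> C * s k"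
      and xy: "\<And>j. j \<in> J \<Longrightarrow> cmod (x j - y j) \<le> C * s j"
      and x: "\<And>j. j \<in> J \<Longrightarrow> c * s j \<le> cmod (x j)" and y0: "\<And>j. j \<in> J \<Longrightarrow> y j \<noteq> 0"
      and zy: "\<And>j. j \<in> J \<Longrightarrow> c * max (s k) (s j) \<le> cmod (z - y j)"
    \<comment> \<open>\<open>e\<close> divides out the model value, so that every \<open>r j\<close>
      is at most 1 plus a geometric term.\<close>
    define e where "e j = (if k < j then cmod (y j) / cmod (x j) else 1)" for j
    define r where "r j = cmod (z - x j) / cmod (z - y j) * e j" for j
    have x0: "cmod (x j) > 0" if "j \<in> J" for j
      using x[OF that] mult_pos_pos[OF c s_pos[of j]] by linarith
    have r: "r j \<le> 1 + D * Cs * (1 / q) ^ ((j - k) + (k - j))" if j: "j \<in> J" for j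
    proof -
      have cs: "c * s j > 0" "c * s k > 0" using c s_pos by auto
      have zyj: "c * s j \<le> cmod (z - y j)" "c * s k \<le> cmod (z - y j)"
        using zy[OF j] c by (auto simp: max_def mult_left_mono split: if_splits intro: order_trans[rotated])
      hence zy0: "cmod (z - y j) > 0" using cs by linarith
      show ?thesis
      proof (cases "k < j")
        case True
        \<comment> \<open>The identity behind the case j > k: relative to (z - y_j) x_j the error z
          (y_j - x_j) has size s_k / s_j.\<close>
        have "(z - x j) * y j = (z - y j) * x j + z * (y j - x j)" by (simp add: algebra_simps)
        hence "cmod (z - x j) * cmod (y j) \<le> cmod (z - y j) * cmod (x j) + cmod z * cmod (x j - y j)"
          by (metis norm_minus_commute norm_mult norm_triangle_ineq)
        hence "r j \<le> (cmod (z - y j) * cmod (x j) + cmod z * cmod (x j - y j)) / (cmod (z - y j) * cmod (x j))"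
          using True zy0 x0[OF j] by (simp add: r_def e_def divide_right_mono)
        also have "\<dots> = 1 + cmod z * cmod (x j - y j) / (cmod (z - y j) * cmod (x j))"
          using zy0 x0[OF j] by (simp add: add_divide_distrib)
        also have "\<dots> \<le> 1 + (C * s k) * (C * s j) / ((c * s j) * (c * s j))"
          using z xy[OF j] x[OF j] zyj cs c C s_pos[of k] s_pos[of j]
          by (intro add_left_mono frac_le mult_mono mult_pos_pos mult_nonneg_nonneg) auto
        also have "(C * s k) * (C * s j) / ((c * s j) * (c * s j)) = C * C / (c * c) * (s k / s j)"
          using s_pos[of j] by (simp add: mult_ac)
        also have "\<dots> \<le> D * (Cs * (1 / q) ^ (j - k))"
          using D Cs(1) Cs(2)[of k j] True s_pos[of k] s_pos[of j] by (intro mult_mono) auto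
        finally show ?thesis using True by (simp add: mult_ac)
      next
        case False
        hence jk: "j < k" using J j by (metis linorder_neqE_nat)
        have "cmod (z - x j) \<le> cmod (z - y j) + cmod (x j - y j)"
          using norm_triangle_ineq4[of "z - y j" "x j - y j"] by simp
        hence "r j \<le> (cmod (z - y j) + cmod (x j - y j)) / cmod (z - y j)"
          using False zy0 by (simp add: r_def e_def divide_right_mono)
        also have "\<dots> = 1 + cmod (x j - y j) / cmod (z - y j)" using zy0 by (simp add: add_divide_distrib)
        also have "\<dots> \<le> 1 + (C * s j) / (c * s k)"
          using xy[OF j] zyj cs C s_pos[of j] by (intro add_left_mono frac_le) auto
        also have "(C * s j) / (c * s k) = C / c * (s j / s k)" by simp
        also have "\<dots> \<le> D * (Cs * (1 / q) ^ (k - j))"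
          using D Cs(1) Cs(2)[of j k] jk s_pos[of k] s_pos[of j] by (intro mult_mono) auto
        finally show ?thesis using jk by (simp add: mult_ac)
      qed
    qed
    have r0: "r j \<ge> 0" if "j \<in> J" for j by (simp add: r_def e_def)
    have "prod r J \<le> exp (\<Sum>j\<in>J. D * Cs * (1 / q) ^ ((j - k) + (k - j)))"
      by (rule prod_le_exp_sum[OF r0 r])
    also have "(\<Sum>j\<in>J. D * Cs * (1 / q) ^ ((j - k) + (k - j))) = D * Cs * (\<Sum>j\<in>J. (1 / q) ^ ((j - k) + (k - j)))"
      by (simp add: sum_distrib_left)
    also have "exp \<dots> \<le> exp (D * Cs * (2 / (1 - 1 / q)))"
      using D Cs q J by (subst exp_le_cancel_iff, intro mult_left_mono sum_power_distance_le) auto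
    finally have main: "prod r J \<le> exp (D * Cs * (2 / (1 - 1 / q)))" .
    define E where "E = (\<Prod>j\<in>{j\<in>J. k < j}. cmod (x j) / cmod (y j))"
    have E0: "E \<ge> 0" unfolding E_def by (intro prod_nonneg) auto
    have eE: "prod e J * E = 1"
    proof -
      have "prod e J = (\<Prod>j\<in>{j\<in>J. k < j}. cmod (y j) / cmod (x j))"
        unfolding e_def using J by (simp add: prod.inter_filter)
      hence "prod e J * E = (\<Prod>j\<in>{j\<in>J. k < j}. cmod (y j) / cmod (x j) * (cmod (x j) / cmod (y j)))"
        unfolding E_def by (simp only: prod.distrib)
      also have "\<dots> = (\<Prod>j\<in>{j\<in>J. k < j}. 1)"
        using x0 y0 by (intro prod.cong) force+
      finally show ?thesis by simp
    qed
    have "(\<Prod>j\<in>J. cmod (z - x j) / cmod (z - y j)) = prod r J * E"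
      unfolding r_def prod.distrib using eE by (simp add: mult.assoc)
    also have "\<dots> \<le> exp (D * Cs * (2 / (1 - 1 / q))) * E" by (intro mult_right_mono main E0)
    finally show "(\<Prod>j\<in>J. cmod (z - x j) / cmod (z - y j))
        \<le> exp (D * Cs * (2 / (1 - 1 / q))) * (\<Prod>j\<in>{j\<in>J. k < j}. cmod (x j) / cmod (y j))"
      by (simp add: E_def)
  qed simp
qed

end

text \<open>The start \<open>n0\<close> is 1 for an exact perturbation and 0 for excess 1.
  \<open>M\<close> is taken so large that the closeness holds from index 1 on, although a
  perturbation grants it only eventually.\<close>

locale perturbed = sparse_weights +
  fixes l :: "nat \<Rightarrow> complex" and n0 :: nat and M :: real
  assumes n0: "n0 \<le> 1" and l_inj: "inj_on l {n0..}" and l_nz: "n \<ge> n0 \<Longrightarrow> l n \<noteq> 0"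
    and l_disj: "n \<ge> n0 \<Longrightarrow> k \<ge> 1 \<Longrightarrow> l n \<noteq> \<gamma> k"
    and close: "n \<ge> 1 \<Longrightarrow> (cmod (l n - \<gamma> n))\<^sup>2 * Pt n \<le> M * v n"
begin

text \<open>At index 0, which carries a point of \<open>\<Lambda>\<close> but none of \<open>\<Gamma>\<close> when the excess is 1, all
  data are given the value 1.\<close>

definition d :: "nat \<Rightarrow> real" where "d n = (if n = 0 then 1 else cmod (l n - \<gamma> n))"
definition vh :: "nat \<Rightarrow> real" where "vh n = (if n = 0 then 1 else v n)"
definition u :: "nat \<Rightarrow> real" where "u n = (d n)\<^sup>2 / vh n"
text \<open>The square root of \<rho>_n, which is what occurs in the moduli of products over finite
  sections.\<close>

definition h :: "nat \<Rightarrow> real" where "h n = (\<Prod>m\<in>{1..n}. g m / cmod (l m))"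

lemma l_notin: "n \<ge> n0 \<Longrightarrow> l n \<notin> \<gamma> ` {1..}"
  using l_disj by auto

lemma l_notin': "n \<ge> 1 \<Longrightarrow> l n \<notin> \<gamma> ` {1..}"
  using l_notin n0 by simp

lemma d_pos: "d n > 0"
  using l_disj[of n n] n0 by (auto simp: d_def)

lemma vh_pos: "vh n > 0"
  using v_pos by (simp add: vh_def)

lemma u_pos: "u n > 0"
  using d_pos[of n] vh_pos[of n] by (simp add: u_def)

lemma h_pos: "h n > 0"
  unfolding h_def using gamma_nz l_nz n0 by (intro prod_pos divide_pos_pos) auto

lemma h_Suc: "h (Suc n) = h n * (g (Suc n) / cmod (l (Suc n)))"
  by (simp add: h_def)

lemma u_le: "n \<ge> 1 \<Longrightarrow> u n \<le> M / Pt n"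
  using close[of n] v_pos[of n] Pt_pos[of n] by (simp add: u_def d_def vh_def field_simps)

lemma M_pos: "M > 0"
proof -
  have "0 < M / Pt 1" using u_pos[of 1] u_le[of 1] by linarith
  thus ?thesis using Pt_pos[of 1] by (simp add: zero_less_divide_iff)
qed

text \<open>Up to a constant the closeness bound is v_n / P_n = g_n^2 p_n / P_n, and p_n = o(P_n):
  the perturbed points are asymptotic to the \<gamma>_n.\<close>

lemma d_small: assumes "\<epsilon> > 0" shows "\<forall>\<^sub>F n in sequentially. cmod (l n - \<gamma> n) \<le> \<epsilon> * g n"
proof -
  have "\<epsilon>\<^sup>2 / M > 0" using assms M_pos by simp
  from p_small[OF this] eventually_ge_at_top[of 1] show ?thesis
  proof eventually_elim
    case (elim n)
    have "(cmod (l n - \<gamma> n))\<^sup>2 * Pt n \<le> M * (p n * (g n)\<^sup>2)" using close[OF elim(2)] g_pos[OF elim(2)] by simp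
    also have "\<dots> \<le> M * (\<epsilon>\<^sup>2 / M * Pt n * (g n)\<^sup>2)" using elim M_pos by (intro mult_left_mono mult_right_mono) auto
    also have "\<dots> = (\<epsilon> * g n)\<^sup>2 * Pt n" using M_pos by (simp add: power_mult_distrib)
    finally have "(cmod (l n - \<gamma> n))\<^sup>2 \<le> (\<epsilon> * g n)\<^sup>2" using Pt_pos[of n] by (rule mult_right_le_imp_le)
    thus ?case by (rule power2_le_imp_le) (use assms in auto)
  qed
qed

lemma gamma_small: assumes "\<epsilon> > 0" shows "\<forall>\<^sub>F n in sequentially. cmod (\<gamma> n - \<gamma> n) \<le> \<epsilon> * g n"
  using assms by simp

lemma comparable:
  obtains C c where "C > 0" "c > 0" "\<And>n. n \<ge> 1 \<Longrightarrow> d n \<le> C * s n" "\<And>n. n \<ge> n0 \<Longrightarrow> cmod (l n) \<le> C * s n"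
    "\<And>n. n \<ge> 1 \<Longrightarrow> cmod (\<gamma> n) \<le> C * s n" "\<And>n. n \<ge> n0 \<Longrightarrow> c * s n \<le> cmod (l n)" "\<And>n. n \<ge> 1 \<Longrightarrow> c * s n \<le> cmod (\<gamma> n)"
proof -
  have "\<forall>\<^sub>F n in sequentially. cmod (l n - \<gamma> n) / s n \<le> 1"
    using d_small[OF zero_less_one] eventually_ge_at_top[of 1] by eventually_elim (simp add: s_eq divide_le_eq_1)
  then obtain C1 where C1: "C1 > 0" "\<And>n. cmod (l n - \<gamma> n) / s n \<le> C1"
    using eventually_le_imp_bounded[of "\<lambda>n. cmod (l n - \<gamma> n) / s n" 1] by blast
  \<comment> \<open>The value 0 is a placeholder at index 0 when \<Lambda> starts at 1.\<close>
  define t where "t n = (if n = 0 \<and> n0 = 1 then 0 else s n / cmod (l n))" for n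
  have "\<forall>\<^sub>F n in sequentially. t n \<le> 2"
    using d_small[OF half_gt_zero[OF zero_less_one]] eventually_ge_at_top[of 1]
  proof eventually_elim
    case (elim n)
    have "g n \<le> cmod (l n) + cmod (l n - \<gamma> n)" using norm_triangle_ineq2[of "\<gamma> n" "l n"] by (simp add: norm_minus_commute)
    hence "g n \<le> 2 * cmod (l n)" using elim by simp
    moreover have "cmod (l n) > 0" using l_nz[of n] n0 elim by simp
    ultimately show ?case using elim by (simp add: t_def s_eq pos_divide_le_eq)
  qed
  then obtain C2 where C2: "C2 > 0" "\<And>n. t n \<le> C2"
    using eventually_le_imp_bounded[of t 2] by blast
  define C where "C = C1 + 1 + cmod (l 0)"
  define c where "c = min 1 (1 / C2)"
  show thesis
  proof (rule that[of C c])
    show "C > 0" "c > 0" using C1 C2 by (auto simp: C_def c_def add_pos_nonneg)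
    have dd: "cmod (l n - \<gamma> n) \<le> C1 * s n" for n using C1(2)[of n] s_pos[of n] by (simp add: pos_divide_le_eq)
    have C1C: "C1 * s n \<le> C * s n" "(C1 + 1) * s n \<le> C * s n" "1 * s n \<le> C * s n" for n
      using s_pos[of n] C1 by (auto intro!: mult_right_mono simp: C_def)
    show "d n \<le> C * s n" if "n \<ge> 1" for n using dd[of n] C1C(1)[of n] that by (simp add: d_def)
    show "cmod (l n) \<le> C * s n" if "n \<ge> n0" for n
    proof (cases "n = 0")
      case True
      thus ?thesis using C1 by (simp add: C_def scale_def)
    next
      case False
      have "cmod (l n) \<le> g n + cmod (l n - \<gamma> n)" using norm_triangle_ineq2[of "l n" "\<gamma> n"] by simp
      also have "\<dots> \<le> (C1 + 1) * s n" using dd[of n] False by (simp add: s_eq algebra_simps)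
      finally show ?thesis using C1C(2)[of n] by linarith
    qed
    show "cmod (\<gamma> n) \<le> C * s n" if "n \<ge> 1" for n using C1C(3)[of n] that by (simp add: s_eq)
    show "c * s n \<le> cmod (l n)" if "n \<ge> n0" for n
    proof -
      have ln: "cmod (l n) > 0" using l_nz[OF that] by simp
      have "s n / cmod (l n) \<le> C2" using C2(2)[of n] that by (auto simp: t_def split: if_splits)
      hence "s n \<le> C2 * cmod (l n)" using ln by (simp only: pos_divide_le_eq)
      hence "1 / C2 * s n \<le> cmod (l n)" using C2(1) by (simp add: field_simps)
      moreover have "c * s n \<le> 1 / C2 * s n" using s_pos[of n] by (intro mult_right_mono) (auto simp: c_def)
      ultimately show ?thesis by linarith
    qed
    show "c * s n \<le> cmod (\<gamma> n)" if "n \<ge> 1" for n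
    proof -
      have "c * s n \<le> 1 * s n" using s_pos[of n] by (intro mult_right_mono) (auto simp: c_def)
      thus ?thesis using that by (simp add: s_eq)
    qed
  qed
qed

lemma l_neq: "n0 \<le> j \<Longrightarrow> n0 \<le> k \<Longrightarrow> j \<noteq> k \<Longrightarrow> l j \<noteq> l k"
  using l_inj by (auto simp: inj_on_def)

lemma sep:
  obtains c where "c > 0"
    "\<And>k j. 1 \<le> k \<Longrightarrow> 1 \<le> j \<Longrightarrow> k \<noteq> j \<Longrightarrow> c * max (s k) (s j) \<le> cmod (\<gamma> k - \<gamma> j)"
    "\<And>k j. 1 \<le> k \<Longrightarrow> n0 \<le> j \<Longrightarrow> k \<noteq> j \<Longrightarrow> c * max (s k) (s j) \<le> cmod (\<gamma> k - l j)"
    "\<And>k j. n0 \<le> k \<Longrightarrow> 1 \<le> j \<Longrightarrow> k \<noteq> j \<Longrightarrow> c * max (s k) (s j) \<le> cmod (l k - \<gamma> j)"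
    "\<And>k j. n0 \<le> k \<Longrightarrow> n0 \<le> j \<Longrightarrow> k \<noteq> j \<Longrightarrow> c * max (s k) (s j) \<le> cmod (l k - l j)"
proof -
  have ne: "\<And>k j. 1 \<le> k \<Longrightarrow> 1 \<le> j \<Longrightarrow> k \<noteq> j \<Longrightarrow> \<gamma> k \<noteq> \<gamma> j"
    "\<And>k j. 1 \<le> k \<Longrightarrow> n0 \<le> j \<Longrightarrow> k \<noteq> j \<Longrightarrow> \<gamma> k \<noteq> l j"
    "\<And>k j. n0 \<le> k \<Longrightarrow> n0 \<le> j \<Longrightarrow> k \<noteq> j \<Longrightarrow> l k \<noteq> l j"
    using gamma_neq l_disj l_neq by fastforce+
  obtain c1 where c1: "c1 > 0" "\<And>k j. 1 \<le> k \<Longrightarrow> 1 \<le> j \<Longrightarrow> k \<noteq> j \<Longrightarrow> c1 * max (s k) (s j) \<le> cmod (\<gamma> k - \<gamma> j)"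
    using near_sep[OF gamma_small gamma_small ne(1)] by blast
  obtain c2 where c2: "c2 > 0" "\<And>k j. 1 \<le> k \<Longrightarrow> n0 \<le> j \<Longrightarrow> k \<noteq> j \<Longrightarrow> c2 * max (s k) (s j) \<le> cmod (\<gamma> k - l j)"
    using near_sep[OF gamma_small d_small ne(2)] by blast
  obtain c4 where c4: "c4 > 0" "\<And>k j. n0 \<le> k \<Longrightarrow> n0 \<le> j \<Longrightarrow> k \<noteq> j \<Longrightarrow> c4 * max (s k) (s j) \<le> cmod (l k - l j)"
    using near_sep[OF d_small d_small ne(3)] by blast
  define c where "c = min c1 (min c2 c4)"
  have le: "c * max (s k) (s j) \<le> c1 * max (s k) (s j)" "c * max (s k) (s j) \<le> c2 * max (s k) (s j)"
    "c * max (s k) (s j) \<le> c4 * max (s k) (s j)" for k j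
    using s_pos[of k] by (auto intro!: mult_right_mono simp: c_def)
  show thesis
  proof (rule that[of c])
    show "c > 0" using c1 c2 c4 by (simp add: c_def)
    show "c * max (s k) (s j) \<le> cmod (l k - \<gamma> j)" if "n0 \<le> k" "1 \<le> j" "k \<noteq> j" for k j
      using c2(2)[of j k] le(2)[of j k] that by (simp add: norm_minus_commute max.commute)
    show "c * max (s k) (s j) \<le> cmod (\<gamma> k - \<gamma> j)" if "1 \<le> k" "1 \<le> j" "k \<noteq> j" for k j
      using c1(2)[OF that] le(1)[of k j] by linarith
    show "c * max (s k) (s j) \<le> cmod (\<gamma> k - l j)" if "1 \<le> k" "n0 \<le> j" "k \<noteq> j" for k j
      using c2(2)[OF that] le(2)[of k j] by linarith
    show "c * max (s k) (s j) \<le> cmod (l k - l j)" if "n0 \<le> k" "n0 \<le> j" "k \<noteq> j" for k j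
      using c4(2)[OF that] le(3)[of k j] by linarith
  qed
qed

text \<open>\<open>z\<close> is a point at level \<open>k\<close>: either \<open>\<gamma>\<^sub>k\<close> or \<open>\<lambda>\<^sub>k\<close>.\<close>

lemma prod_estimate:
  obtains A where "A > 0"
    "\<And>z k J. finite J \<Longrightarrow> J \<subseteq> {1..} \<Longrightarrow> k \<notin> J \<Longrightarrow> (z = \<gamma> k \<and> 1 \<le> k) \<or> (z = l k \<and> n0 \<le> k) \<Longrightarrow>
      (\<Prod>j\<in>J. cmod (z - l j) / cmod (z - \<gamma> j)) \<le> A * (\<Prod>j\<in>{j\<in>J. k < j}. cmod (l j) / g j)"
    "\<And>z k J. finite J \<Longrightarrow> J \<subseteq> {1..} \<Longrightarrow> k \<notin> J \<Longrightarrow> (z = \<gamma> k \<and> 1 \<le> k) \<or> (z = l k \<and> n0 \<le> k) \<Longrightarrow>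
      (\<Prod>j\<in>J. cmod (z - \<gamma> j) / cmod (z - l j)) \<le> A * (\<Prod>j\<in>{j\<in>J. k < j}. g j / cmod (l j))"
proof -
  obtain C c where C: "C > 0" "c > 0" "\<And>n. n \<ge> 1 \<Longrightarrow> d n \<le> C * s n" "\<And>n. n \<ge> n0 \<Longrightarrow> cmod (l n) \<le> C * s n"
    "\<And>n. n \<ge> 1 \<Longrightarrow> cmod (\<gamma> n) \<le> C * s n" "\<And>n. n \<ge> n0 \<Longrightarrow> c * s n \<le> cmod (l n)" "\<And>n. n \<ge> 1 \<Longrightarrow> c * s n \<le> cmod (\<gamma> n)"
    using comparable by blast
  obtain c' where c': "c' > 0"
    "\<And>k j. 1 \<le> k \<Longrightarrow> 1 \<le> j \<Longrightarrow> k \<noteq> j \<Longrightarrow> c' * max (s k) (s j) \<le> cmod (\<gamma> k - \<gamma> j)"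
    "\<And>k j. 1 \<le> k \<Longrightarrow> n0 \<le> j \<Longrightarrow> k \<noteq> j \<Longrightarrow> c' * max (s k) (s j) \<le> cmod (\<gamma> k - l j)"
    "\<And>k j. n0 \<le> k \<Longrightarrow> 1 \<le> j \<Longrightarrow> k \<noteq> j \<Longrightarrow> c' * max (s k) (s j) \<le> cmod (l k - \<gamma> j)"
    "\<And>k j. n0 \<le> k \<Longrightarrow> n0 \<le> j \<Longrightarrow> k \<noteq> j \<Longrightarrow> c' * max (s k) (s j) \<le> cmod (l k - l j)"
    using sep by blast
  define c0 where "c0 = min c c'"
  have c0: "c0 > 0" using C c' by (simp add: c0_def)
  have le1: "c0 * s j \<le> c * s j" for j using s_pos[of j] by (intro mult_right_mono) (auto simp: c0_def)
  have le2: "c0 * max (s k) (s j) \<le> c' * max (s k) (s j)" for k j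
    using s_pos[of k] by (intro mult_right_mono) (auto simp: c0_def)
  obtain A where A: "A > 0" "\<And>x y z k J. finite J \<Longrightarrow> J \<subseteq> {1..} \<Longrightarrow> k \<notin> J \<Longrightarrow> cmod z \<le> C * s k \<Longrightarrow>
      (\<And>j. j \<in> J \<Longrightarrow> cmod (x j - y j) \<le> C * s j) \<Longrightarrow>
      (\<And>j. j \<in> J \<Longrightarrow> c0 * s j \<le> cmod (x j)) \<Longrightarrow> (\<And>j. j \<in> J \<Longrightarrow> y j \<noteq> 0) \<Longrightarrow>
      (\<And>j. j \<in> J \<Longrightarrow> c0 * max (s k) (s j) \<le> cmod (z - y j)) \<Longrightarrow>
      (\<Prod>j\<in>J. cmod (z - x j) / cmod (z - y j)) \<le> A * (\<Prod>j\<in>{j\<in>J. k < j}. cmod (x j) / cmod (y j))"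
    using prod_ratio_le[OF C(1) c0] by blast
  show thesis
  proof (rule that[OF A(1)])
    fix z k J assume J: "finite J" "J \<subseteq> {1::nat..}" "k \<notin> J" and z: "(z = \<gamma> k \<and> 1 \<le> k) \<or> (z = l k \<and> n0 \<le> k)"
    have j1: "1 \<le> j" "n0 \<le> j" "k \<noteq> j" if "j \<in> J" for j using that J n0 by auto
    have zb: "cmod z \<le> C * s k" using z C by auto
    have dj: "cmod (l j - \<gamma> j) \<le> C * s j" if "j \<in> J" for j using C(3)[OF j1(1)[OF that]] j1(1)[OF that] by (simp add: d_def)
    have z\<gamma>: "c0 * max (s k) (s j) \<le> cmod (z - \<gamma> j)" if "j \<in> J" for j
      using z c'(2)[of k j] c'(4)[of k j] le2[of k j] j1[OF that] by (elim disjE) auto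
    have zl: "c0 * max (s k) (s j) \<le> cmod (z - l j)" if "j \<in> J" for j
      using z c'(3)[of k j] c'(5)[of k j] le2[of k j] j1[OF that] by (elim disjE) auto
    have xl: "c0 * s j \<le> cmod (l j)" if "j \<in> J" for j
      using order_trans[OF le1 C(6)[OF j1(2)[OF that]]] .
    have xg: "c0 * s j \<le> cmod (\<gamma> j)" if "j \<in> J" for j
      using order_trans[OF le1 C(7)[OF j1(1)[OF that]]] .
    show "(\<Prod>j\<in>J. cmod (z - l j) / cmod (z - \<gamma> j)) \<le> A * (\<Prod>j\<in>{j\<in>J. k < j}. cmod (l j) / g j)"
      by (rule A(2)[OF J zb dj xl gamma_nz[OF j1(1)] z\<gamma>])
    have dj': "cmod (\<gamma> j - l j) \<le> C * s j" if "j \<in> J" for j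
      using dj[OF that] by (simp add: norm_minus_commute)
    show "(\<Prod>j\<in>J. cmod (z - \<gamma> j) / cmod (z - l j)) \<le> A * (\<Prod>j\<in>{j\<in>J. k < j}. g j / cmod (l j))"
      by (rule A(2)[OF J zb dj' xg l_nz[OF j1(2)] zl])
  qed
qed

lemma prod_h:
  assumes "k \<le> N"
  shows "(\<Prod>j\<in>{k<..N}. cmod (l j) / g j) = h k / h N" "(\<Prod>j\<in>{k<..N}. g j / cmod (l j)) = h N / h k"
proof -
  have "{1..N} = {1..k} \<union> {k<..N}" "{1..k} \<inter> {k<..N} = {}" using assms by auto
  hence "h N = h k * (\<Prod>j\<in>{k<..N}. g j / cmod (l j))"
    unfolding h_def by (simp add: prod.union_disjoint)
  thus 2: "(\<Prod>j\<in>{k<..N}. g j / cmod (l j)) = h N / h k" using h_pos[of k] by simp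
  have "(\<Prod>j\<in>{k<..N}. cmod (l j) / g j) = inverse (\<Prod>j\<in>{k<..N}. g j / cmod (l j))"
    by (simp flip: prod_inversef)
  thus "(\<Prod>j\<in>{k<..N}. cmod (l j) / g j) = h k / h N" unfolding 2 by simp
qed

text \<open>A single term of the kernel gives w \<le> u. Conversely the terms with k \<noteq> n sum
  to O(P_n), those below n through \<open>sum_v_small\<close> and those above directly, and
  \<open>Pt n \<le> M / u n\<close> by closeness; so the n-th term is a fixed share of the
  kernel.\<close>

lemma weight_comparable:
  obtains C where "C > 0" "\<And>n. n \<ge> n0 \<Longrightarrow> w (l n) \<le> C * u n" "\<And>n. n \<ge> n0 \<Longrightarrow> u n \<le> C * w (l n)"
proof -
  obtain c where c: "c > 0" "\<And>k j. n0 \<le> k \<Longrightarrow> 1 \<le> j \<Longrightarrow> k \<noteq> j \<Longrightarrow> c * max (s k) (s j) \<le> cmod (l k - \<gamma> j)"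
    using sep by metis
  have "\<forall>\<^sub>F N in sequentially. (\<Sum>k\<in>{1..N}. v k) / (Pt N * (s N)\<^sup>2) \<le> 1"
    using sum_v_small[OF zero_less_one] eventually_ge_at_top[of 1]
  proof eventually_elim
    case (elim N)
    thus ?case using Pt_pos[of N] s_pos[of N] by (simp add: s_eq divide_le_eq_1)
  qed
  then obtain D where D: "D > 0" "\<And>N. (\<Sum>k\<in>{1..N}. v k) / (Pt N * (s N)\<^sup>2) \<le> D"
    using eventually_le_imp_bounded[of "\<lambda>N. (\<Sum>k\<in>{1..N}. v k) / (Pt N * (s N)\<^sup>2)" 1] by blast
  define C where "C = 1 + (D + 1) / c\<^sup>2 * M"
  have C1: "C \<ge> 1" using D M_pos by (simp add: C_def)
  have up: "w (l n) \<le> u n" if "n \<ge> 1" for n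
    using w_le_term[OF l_notin'[OF that] that] v_pos[OF that] that by (simp add: u_def d_def vh_def pos_le_divide_eq)
  have low: "u n \<le> C * w (l n)" if n: "n \<ge> 1" for n
  proof -
    have "kernel_sq \<gamma> v (l n) \<le> C / u n"
      unfolding kernel_sq_def
    proof (rule sum_le_bound_summable(2))
      fix F :: "nat set" assume F: "finite F" "F \<subseteq> {1..}"
      define F' where "F' = insert n F"
      have F': "finite F'" "F' \<subseteq> {1..}" "n \<in> F'" using F n by (auto simp: F'_def)
      have nonneg: "0 \<le> v k / (cmod (l n - \<gamma> k))\<^sup>2" if "k \<in> {1..}" for k using v_pos[of k] that by simp
      have "(\<Sum>k\<in>F. v k / (cmod (l n - \<gamma> k))\<^sup>2) \<le> (\<Sum>k\<in>F'. v k / (cmod (l n - \<gamma> k))\<^sup>2)"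
        using F' nonneg by (intro sum_mono2) (auto simp: F'_def)
      also have "\<dots> = 1 / u n + (\<Sum>k\<in>F' - {n}. v k / (cmod (l n - \<gamma> k))\<^sup>2)"
        using F' n by (subst sum.remove[of F' n]) (auto simp: u_def d_def vh_def)
      also have "(\<Sum>k\<in>F' - {n}. v k / (cmod (l n - \<gamma> k))\<^sup>2) \<le> (\<Sum>k\<in>F' - {n}. v k / (c * max (s n) (s k))\<^sup>2)"
      proof (rule sum_mono)
        fix k assume k: "k \<in> F' - {n}"
        hence k1: "k \<ge> 1" using F' by auto
        have "0 < c * max (s n) (s k)" using c(1) s_pos[of n] by simp
        thus "v k / (cmod (l n - \<gamma> k))\<^sup>2 \<le> v k / (c * max (s n) (s k))\<^sup>2"
          using c(2)[of n k] n n0 k k1 v_pos[OF k1] by (intro divide_sq_mono) auto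
      qed
      also have "\<dots> \<le> (\<Sum>k\<in>{1..n}. v k / (c * s n)\<^sup>2) + (\<Sum>k\<in>F' \<inter> {n<..}. v k / (c * s k)\<^sup>2)"
      proof -
        have "(\<Sum>k\<in>F' - {n}. v k / (c * max (s n) (s k))\<^sup>2)
            = (\<Sum>k\<in>F' \<inter> {..<n}. v k / (c * max (s n) (s k))\<^sup>2) + (\<Sum>k\<in>F' \<inter> {n<..}. v k / (c * max (s n) (s k))\<^sup>2)"
          using F' by (subst sum.union_disjoint[symmetric]) (auto intro!: sum.cong)
        also have "(\<Sum>k\<in>F' \<inter> {..<n}. v k / (c * max (s n) (s k))\<^sup>2) = (\<Sum>k\<in>F' \<inter> {..<n}. v k / (c * s n)\<^sup>2)"
        proof (intro sum.cong refl)
          fix k assume "k \<in> F' \<inter> {..<n}"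
          hence "s k \<le> s n" using F' by (intro s_mono) auto
          thus "v k / (c * max (s n) (s k))\<^sup>2 = v k / (c * s n)\<^sup>2" by (simp add: max_def)
        qed
        also have "\<dots> \<le> (\<Sum>k\<in>{1..n}. v k / (c * s n)\<^sup>2)"
          using F' v_pos by (intro sum_mono2) (auto intro!: divide_nonneg_nonneg less_imp_le[OF v_pos])
        also have "(\<Sum>k\<in>F' \<inter> {n<..}. v k / (c * max (s n) (s k))\<^sup>2) = (\<Sum>k\<in>F' \<inter> {n<..}. v k / (c * s k)\<^sup>2)"
        proof (intro sum.cong refl)
          fix k assume "k \<in> F' \<inter> {n<..}"
          hence "s n \<le> s k" using n by (intro s_mono) auto
          thus "v k / (c * max (s n) (s k))\<^sup>2 = v k / (c * s k)\<^sup>2" by (simp add: max_def)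
        qed
        finally show ?thesis by simp
      qed
      also have "(\<Sum>k\<in>{1..n}. v k / (c * s n)\<^sup>2) \<le> D / c\<^sup>2 * Pt n"
      proof -
        have "(\<Sum>k\<in>{1..n}. v k) \<le> D * (Pt n * (s n)\<^sup>2)"
          using D(2)[of n] mult_pos_pos[OF Pt_pos[of n] zero_less_power[OF s_pos[of n], of 2]]
          by (simp only: pos_divide_le_eq)
        hence "(\<Sum>k\<in>{1..n}. v k) / (c * s n)\<^sup>2 \<le> D * (Pt n * (s n)\<^sup>2) / (c * s n)\<^sup>2" by (intro divide_right_mono) auto
        also have "\<dots> = D / c\<^sup>2 * Pt n" using s_pos[of n] by (simp add: power_mult_distrib)
        finally show ?thesis by (simp add: sum_divide_distrib)
      qed
      also have "(\<Sum>k\<in>F' \<inter> {n<..}. v k / (c * s k)\<^sup>2) \<le> 1 / c\<^sup>2 * Pt n"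
      proof -
        have "(\<Sum>k\<in>F' \<inter> {n<..}. v k / (c * s k)\<^sup>2) = 1 / c\<^sup>2 * (\<Sum>k\<in>F' \<inter> {n<..}. p k)"
          unfolding sum_distrib_left using n by (intro sum.cong) (auto simp: s_eq power_mult_distrib)
        also have "(\<Sum>k\<in>F' \<inter> {n<..}. p k) \<le> Pt n"
          unfolding P_def using F' by (intro finite_sum_le_infsum p_summable') (auto intro!: divide_nonneg_nonneg less_imp_le[OF v_pos])
        finally show ?thesis using c(1) by (simp add: divide_right_mono)
      qed
      finally have "(\<Sum>k\<in>F. v k / (cmod (l n - \<gamma> k))\<^sup>2) \<le> 1 / u n + (D + 1) / c\<^sup>2 * Pt n"
        by (simp add: add_divide_distrib distrib_right)
      also have "(D + 1) / c\<^sup>2 * Pt n \<le> (D + 1) / c\<^sup>2 * (M / u n)"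
        using u_le[OF n] D c u_pos[of n] Pt_pos[of n] by (intro mult_left_mono) (auto simp: field_simps)
      finally show "(\<Sum>k\<in>F. v k / (cmod (l n - \<gamma> k))\<^sup>2) \<le> C / u n"
        by (simp add: C_def add_divide_distrib)
    qed (use v_pos in \<open>auto intro!: divide_nonneg_nonneg less_imp_le[OF v_pos]\<close>)
    thus ?thesis using kernel_pos[OF l_notin'[OF n]] u_pos[of n] by (simp add: w_eq field_simps)
  qed
  \<comment> \<open>Enlarged so that the comparison includes index 0, where \<open>u 0 = 1\<close>
    by convention.\<close>
  define C' where "C' = C + w (l 0) + 1 / w (l 0)"
  show thesis
  proof (cases "n0 = 0")
    case False
    hence n1: "n \<ge> 1" if "n \<ge> n0" for n using that by simp
    show thesis
    proof (rule that[of C])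
      show "C > 0" using C1 by linarith
      fix n assume n: "n \<ge> n0"
      have "1 * u n \<le> C * u n" using C1 u_pos[of n] by (intro mult_right_mono) auto
      thus "w (l n) \<le> C * u n" using up[OF n1[OF n]] by simp
      show "u n \<le> C * w (l n)" by (rule low[OF n1[OF n]])
    qed
  next
    case True
    have w0: "w (l 0) > 0" by (rule w_pos[OF l_notin]) (use True in simp)
    have u0: "u 0 = 1" by (simp add: u_def d_def vh_def)
    have C': "C \<le> C'" "w (l 0) \<le> C'" "1 / w (l 0) \<le> C'" using w0 C1 by (auto simp: C'_def)
    show thesis
    proof (rule that[of C'])
      show "C' > 0" using C' C1 by linarith
      fix n
      show "w (l n) \<le> C' * u n"
      proof (cases "n = 0")
        case False
        have "1 * u n \<le> C' * u n" using C1 C' u_pos[of n] by (intro mult_right_mono) auto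
        thus ?thesis using up[of n] False by simp
      qed (use C' u0 in simp)
      show "u n \<le> C' * w (l n)"
      proof (cases "n = 0")
        case False
        have "C * w (l n) \<le> C' * w (l n)" using C' w_pos[OF l_notin'[of n]] False by (intro mult_right_mono) auto
        thus ?thesis using low[of n] False by simp
      next
        case True
        have "1 / w (l 0) * w (l 0) \<le> C' * w (l 0)" using C' w0 by (intro mult_right_mono) auto
        thus ?thesis using True u0 w0 by simp
      qed
    qed
  qed
qed

text \<open>The squared moduli of \<gamma> and \<lambda> differ by at most O(|\<gamma>|) times the
  distance d, and d / |\<gamma>| is exactly \<open>sqrt (u p)\<close>. This is the hypothesis
  \<open>r_diff\<close> of the power-law lemmas for r = \<open>h^2\<close>.\<close>

lemma h_sq_diff:
  obtains C where "C > 0" "\<And>n. \<bar>(h (Suc n))\<^sup>2 - (h n)\<^sup>2\<bar> \<le> C * (h (Suc n))\<^sup>2 * sqrt (u (Suc n) * p (Suc n))"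
proof -
  obtain C where C: "C > 0" "\<And>n. n \<ge> n0 \<Longrightarrow> cmod (l n) \<le> C * s n" using comparable by metis
  show thesis
  proof (rule that[of "1 + C"])
    fix n
    define G where "G = g (Suc n)"
    define Q where "Q = cmod (l (Suc n))"
    define H where "H = h (Suc n)"
    have pos: "G > 0" "Q > 0" "d (Suc n) > 0" using g_pos[of "Suc n"] l_nz[of "Suc n"] n0 d_pos by (auto simp: G_def Q_def)
    have "H = h n * (G / Q)" by (simp add: H_def G_def Q_def h_Suc)
    hence hn: "h n = H * Q / G" using pos by (simp add: field_simps)
    have "\<bar>G - Q\<bar> \<le> d (Suc n)" using norm_triangle_ineq3[of "\<gamma> (Suc n)" "l (Suc n)"]
      by (simp add: G_def Q_def d_def norm_minus_commute)
    moreover have "G + Q \<le> (1 + C) * G" using C(2)[of "Suc n"] n0 by (simp add: G_def Q_def s_eq algebra_simps)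
    ultimately have "\<bar>G - Q\<bar> * (G + Q) \<le> d (Suc n) * ((1 + C) * G)" using pos by (intro mult_mono) auto
    moreover have "\<bar>G\<^sup>2 - Q\<^sup>2\<bar> = \<bar>G - Q\<bar> * (G + Q)" using pos by (simp add: power2_eq_square square_diff_square_factored abs_mult mult.commute)
    ultimately have GQ: "\<bar>G\<^sup>2 - Q\<^sup>2\<bar> \<le> (1 + C) * d (Suc n) * G" by (simp add: mult_ac)
    have sq: "sqrt (u (Suc n) * p (Suc n)) = d (Suc n) / G"
    proof -
      have "u (Suc n) * p (Suc n) = (d (Suc n) / G)\<^sup>2" using v_pos[of "Suc n"] by (simp add: u_def vh_def G_def power_divide)
      thus ?thesis using pos by simp
    qed
    have "H\<^sup>2 - (h n)\<^sup>2 = (H / G)\<^sup>2 * (G\<^sup>2 - Q\<^sup>2)"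
      unfolding hn using pos by (simp add: power_divide power_mult_distrib right_diff_distrib)
    hence "\<bar>H\<^sup>2 - (h n)\<^sup>2\<bar> = (H / G)\<^sup>2 * \<bar>G\<^sup>2 - Q\<^sup>2\<bar>" by (simp add: abs_mult)
    also have "\<dots> \<le> (H / G)\<^sup>2 * ((1 + C) * d (Suc n) * G)" by (intro mult_left_mono GQ) auto
    also have "\<dots> = (1 + C) * H\<^sup>2 * (d (Suc n) / G)" using pos by (simp add: power_divide power2_eq_square)
    finally show "\<bar>(h (Suc n))\<^sup>2 - (h n)\<^sup>2\<bar> \<le> (1 + C) * (h (Suc n))\<^sup>2 * sqrt (u (Suc n) * p (Suc n))"
      by (simp only: sq H_def)
  qed (use C in simp)
qed

text \<open>The ratio of consecutive values is |\<gamma>| / |\<lambda>|, which tends to 1, so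
  \<open>h\<close> varies subexponentially in both directions.\<close>

lemma h_ratio:
  assumes "\<eta> > 1"
  shows "\<forall>\<^sub>F n in sequentially. h n \<le> \<eta> * h (Suc n)" "\<forall>\<^sub>F n in sequentially. h (Suc n) \<le> \<eta> * h n"
proof -
  have "\<forall>\<^sub>F n in sequentially. cmod (l (Suc n) - \<gamma> (Suc n)) \<le> (\<eta> - 1) * g (Suc n)"
    using d_small[of "\<eta> - 1"] assms by (subst eventually_sequentially_Suc) auto
  thus "\<forall>\<^sub>F n in sequentially. h n \<le> \<eta> * h (Suc n)"
  proof eventually_elim
    case (elim n)
    have pos: "g (Suc n) > 0" "cmod (l (Suc n)) > 0" using g_pos[of "Suc n"] l_nz[of "Suc n"] n0 by auto
    have "cmod (l (Suc n)) \<le> \<eta> * g (Suc n)"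
      using elim norm_triangle_ineq2[of "l (Suc n)" "\<gamma> (Suc n)"] by (simp add: algebra_simps)
    hence "1 \<le> \<eta> * (g (Suc n) / cmod (l (Suc n)))" using pos by (simp add: pos_le_divide_eq)
    hence "h n * 1 \<le> h n * (\<eta> * (g (Suc n) / cmod (l (Suc n))))" using h_pos[of n] by (intro mult_left_mono) auto
    thus ?case by (simp add: h_Suc mult_ac)
  qed
  have "\<forall>\<^sub>F n in sequentially. cmod (l (Suc n) - \<gamma> (Suc n)) \<le> (1 - 1 / \<eta>) * g (Suc n)"
    using d_small[of "1 - 1 / \<eta>"] assms by (subst eventually_sequentially_Suc) auto
  thus "\<forall>\<^sub>F n in sequentially. h (Suc n) \<le> \<eta> * h n"
  proof eventually_elim
    case (elim n)
    have pos: "g (Suc n) > 0" "cmod (l (Suc n)) > 0" using g_pos[of "Suc n"] l_nz[of "Suc n"] n0 by auto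
    have "g (Suc n) \<le> cmod (l (Suc n)) + (1 - 1 / \<eta>) * g (Suc n)"
      using elim norm_triangle_ineq2[of "\<gamma> (Suc n)" "l (Suc n)"] by (simp add: norm_minus_commute)
    hence "g (Suc n) \<le> \<eta> * cmod (l (Suc n))" using assms by (simp add: field_simps)
    hence "g (Suc n) / cmod (l (Suc n)) \<le> \<eta>" using pos by (simp add: pos_divide_le_eq)
    hence "h n * (g (Suc n) / cmod (l (Suc n))) \<le> h n * \<eta>" using h_pos[of n] by (intro mult_left_mono) auto
    thus ?case by (simp add: h_Suc mult.commute)
  qed
qed

end

section \<open>Necessity\<close>

lemma sq_sum_le: "(a + b)\<^sup>2 \<le> 2 * a\<^sup>2 + 2 * b\<^sup>2" for a b :: real
  using sum_squares_bound[of a b] by (simp add: power2_eq_square algebra_simps)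

lemma norm_prod_one_plus_minus_one_le:
  fixes x :: "nat \<Rightarrow> complex"
  assumes "finite J" "(\<Sum>j\<in>J. cmod (x j)) \<le> S"
  shows "cmod ((\<Prod>j\<in>J. 1 + x j) - 1) \<le> S * exp S"
proof -
  have "cmod ((\<Prod>j\<in>J. 1 + x j) - 1) \<le> (\<Prod>j\<in>J. 1 + cmod (x j)) - 1"
    by (rule norm_prod_minus1_le_prod_minus1)
  also have "(\<Prod>j\<in>J. 1 + cmod (x j)) \<le> exp (\<Sum>j\<in>J. cmod (x j))" by (rule prod_le_exp_sum) auto
  also have "\<dots> \<le> exp S" using assms by simp
  also have "exp S - 1 \<le> S * exp S"
  proof -
    have "exp S * (1 - S) \<le> exp S * exp (- S)" using exp_ge_add_one_self[of "- S"] by (intro mult_left_mono) auto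
    thus ?thesis by (simp add: exp_minus algebra_simps)
  qed
  finally show ?thesis by simp
qed

context sparse_weights
begin

lemma l2_tail:
  assumes "a \<in> \<H>"
  shows "(\<lambda>k. if k > N then a k else 0) \<in> \<H>"
    and "nsq v (\<lambda>k. if k > N then a k else 0) = nsq v a - (\<Sum>k\<in>{1..N}. (cmod (a k))\<^sup>2 * v k)"
proof -
  define a' where "a' k = (if k > N then a k else 0)" for k
  have sm: "(\<lambda>k. (cmod (a k))\<^sup>2 * v k) summable_on {1..}" using assms by (simp add: l2_iff)
  have sm': "(\<lambda>k. (cmod (a k))\<^sup>2 * v k) summable_on {N<..}" by (rule summable_on_subset[OF sm]) auto
  have "(\<lambda>k. (cmod (a' k))\<^sup>2 * v k) summable_on {1..} \<longleftrightarrow> (\<lambda>k. (cmod (a k))\<^sup>2 * v k) summable_on {N<..}"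
    by (intro summable_on_cong_neutral) (auto simp: a'_def)
  hence 1: "a' \<in> \<H>" using sm' by (simp add: l2_iff a'_def)
  have "nsq v a' = infsum (\<lambda>k. (cmod (a k))\<^sup>2 * v k) {N<..}"
    unfolding nsq_def by (intro infsum_cong_neutral) (auto simp: a'_def)
  moreover have "nsq v a = infsum (\<lambda>k. (cmod (a k))\<^sup>2 * v k) ({1..N} \<union> {N<..})"
  proof -
    have "{1::nat..} = {1..N} \<union> {N<..}" by auto
    thus ?thesis by (simp add: nsq_def)
  qed
  moreover have "\<dots> = infsum (\<lambda>k. (cmod (a k))\<^sup>2 * v k) {1..N} + infsum (\<lambda>k. (cmod (a k))\<^sup>2 * v k) {N<..}"
    by (intro infsum_Un_disjoint sm') auto
  ultimately have "nsq v a' = nsq v a - (\<Sum>k\<in>{1..N}. (cmod (a k))\<^sup>2 * v k)" by simp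
  with 1 show "(\<lambda>k. if k > N then a k else 0) \<in> \<H>"
    "nsq v (\<lambda>k. if k > N then a k else 0) = nsq v a - (\<Sum>k\<in>{1..N}. (cmod (a k))\<^sup>2 * v k)"
    by (simp_all only: a'_def[abs_def])
qed

lemma nsq_tail_tendsto_0:
  assumes "a \<in> \<H>"
  shows "(\<lambda>N. nsq v (\<lambda>k. if k > N then a k else 0)) \<longlonglongrightarrow> 0"
proof -
  have "(\<lambda>N. \<Sum>k\<in>{1..N}. (cmod (a k))\<^sup>2 * v k) \<longlonglongrightarrow> nsq v a"
    unfolding nsq_def using assms by (intro sum_tendsto_infsum) (simp add: l2_iff)
  hence "(\<lambda>N. nsq v a - (\<Sum>k\<in>{1..N}. (cmod (a k))\<^sup>2 * v k)) \<longlonglongrightarrow> nsq v a - nsq v a"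
    by (intro tendsto_intros)
  thus ?thesis by (simp add: l2_tail[OF assms])
qed

end

section \<open>Test functions built from quotients of products\<close>

context perturbed
begin

text \<open>Zero below \<open>n0\<close>, so that one sum over {..<n} represents W_n for both
  possible starts.\<close>

definition wt :: "nat \<Rightarrow> real" where "wt m = (if m < n0 then 0 else w (l m))"

lemma w_l_pos: "n \<ge> n0 \<Longrightarrow> w (l n) > 0"
  by (rule w_pos[OF l_notin])

lemma wt_nonneg: "wt m \<ge> 0"
  using w_l_pos[of m] by (cases "m < n0") (auto simp: wt_def not_less)

lemma disj_l: "l ` {n0..} \<inter> \<gamma> ` {1..} = {}"
  using l_notin by auto

text \<open>Eventually |\<lambda>_m| \<le> q |\<gamma>_m|, so for large n the points of index below
  n lie in the disc of radius \<open>g (Suc n)\<close>, to which \<open>w_sum_bound\<close>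
  applies.\<close>

lemma W_bound:
  assumes inv: "hilb_invertible_on \<gamma> v (l ` {n0..})"
  obtains B where "\<And>n. (\<Sum>m<n. wt m) * Pt n \<le> B"
proof -
  obtain C where C: "C > 0" "\<And>N F. finite F \<Longrightarrow> F \<subseteq> l ` {n0..} \<Longrightarrow> (\<And>z. z \<in> F \<Longrightarrow> cmod z \<le> g (Suc N)) \<Longrightarrow> (\<Sum>z\<in>F. w z) \<le> C / Pt N"
    using w_sum_bound[OF disj_l inv] by blast
  have "q - 1 > 0" using q by simp
  then obtain m1 where m1: "\<And>m. m \<ge> m1 \<Longrightarrow> cmod (l m - \<gamma> m) \<le> (q - 1) * g m"
    using d_small[OF \<open>q - 1 > 0\<close>] by (auto simp: eventually_sequentially)
  define S where "S = (\<Sum>m<max 1 m1. cmod (l m))"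
  obtain n1 where n1: "\<And>n. n \<ge> n1 \<Longrightarrow> g n \<ge> S" using g_unbounded[of S] by (auto simp: eventually_sequentially)
  have lm: "cmod (l m) \<le> g (Suc n)" if "m < n" "n \<ge> n1" for m n
  proof (cases "m < max 1 m1")
    case True
    have "cmod (l m) \<le> S" unfolding S_def using True by (intro member_le_sum) auto
    also have "\<dots> \<le> g (Suc n)" using n1[of "Suc n"] that by simp
    finally show ?thesis .
  next
    case False
    have "cmod (l m) \<le> g m + cmod (l m - \<gamma> m)" using norm_triangle_ineq2[of "l m" "\<gamma> m"] by simp
    also have "\<dots> \<le> q * g m" using m1[of m] False by (simp add: algebra_simps)
    also have "\<dots> \<le> g (Suc n)" using False that by (intro g_less) auto
    finally show ?thesis .
  qed
  show thesis
  proof (rule that[of "C + (\<Sum>m<n1. wt m) * Pt 0"])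
    fix n
    have S0: "(\<Sum>m<n1. wt m) * Pt 0 \<ge> 0" using wt_nonneg Pt_pos[of 0] by (intro mult_nonneg_nonneg sum_nonneg) auto
    show "(\<Sum>m<n. wt m) * Pt n \<le> C + (\<Sum>m<n1. wt m) * Pt 0"
    proof (cases "n \<ge> n1")
      case True
      have "(\<Sum>m<n. wt m) = (\<Sum>m\<in>{n0..<n}. w (l m))"
        unfolding wt_def by (intro sum.mono_neutral_cong_right) auto
      also have "\<dots> = (\<Sum>z\<in>l ` {n0..<n}. w z)"
        by (subst sum.reindex) (use l_inj in \<open>auto simp: inj_on_def\<close>)
      also have "\<dots> \<le> C / Pt n" using lm True by (intro C(2)) auto
      finally have "(\<Sum>m<n. wt m) * Pt n \<le> C" using Pt_pos[of n] by (simp only: pos_le_divide_eq)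
      thus ?thesis using S0 by linarith
    next
      case False
      have "(\<Sum>m<n. wt m) \<le> (\<Sum>m<n1. wt m)" using False wt_nonneg by (intro sum_mono2) auto
      hence "(\<Sum>m<n. wt m) * Pt n \<le> (\<Sum>m<n1. wt m) * Pt 0"
        using slow.P_antimono[of 0 n] Pt_pos[of n] wt_nonneg by (intro mult_mono sum_nonneg) auto
      thus ?thesis using C(1) by linarith
    qed
  qed
qed

lemma norm_prod_ratio: "cmod (\<Prod>j\<in>J. (x j :: complex) / y j) = (\<Prod>j\<in>J. cmod (x j) / cmod (y j))"
  by (simp add: prod_norm[symmetric] norm_divide)

text \<open>The test function is G - 1, with G the product of (z - \<lambda>_j) / (z - \<gamma>_j)
  over N < j \<le> M'. Its coefficients are residues, of size governed by \<open>h k / h M'\<close>,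
  and give the left side. At the points, G - 1 is at most 1 + O(h N / h M') in modulus for n \<le>
  N, equals -1 on the block, and is O(s M' / s n) beyond it. If N < n0, no point precedes the block
  and the term at N disappears; the exact case rests on this.\<close>

lemma interpolation_weights:
  assumes inv: "hilb_invertible_on \<gamma> v (l ` {n0..})"
  obtains C where "C > 0" "\<And>N M'. N < M' \<Longrightarrow> (\<Sum>k\<in>{N<..M'}. (h k)\<^sup>2 * u k)
    \<le> C * ((h M')\<^sup>2 / Pt M' + (if n0 \<le> N then (h N)\<^sup>2 / Pt N else 0))"
proof -
  interpret invertible_on \<gamma> v q "l ` {n0..}"
    by unfold_locales (rule disj_l, rule inv)
  obtain C0 where C0: "C0 > 0" "\<And>a B. a \<in> \<H> \<Longrightarrow> (\<And>F. finite F \<Longrightarrow> F \<subseteq> l ` {n0..} \<Longrightarrow> (\<Sum>z\<in>F. (cmod (f a z))\<^sup>2 * w z) \<le> B)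
      \<Longrightarrow> nsq v a \<le> C0 * B" using lower_bound_le by blast
  obtain B where B: "\<And>n. (\<Sum>m<n. wt m) * Pt n \<le> B" using W_bound[OF inv] by blast
  have B0: "B \<ge> 0" using B[of 0] by simp
  have W: "(\<Sum>m<Suc n. wt m) \<le> B * \<kappa> / Pt n" for n
  proof -
    have "(\<Sum>m<Suc n. wt m) \<le> B / Pt (Suc n)" using B[of "Suc n"] Pt_pos[of "Suc n"] by (simp only: pos_le_divide_eq)
    also have "\<dots> \<le> B * \<kappa> / Pt n" using slow.P_slow[of n] Pt_pos[of n] Pt_pos[of "Suc n"] B0
      by (simp add: field_simps mult_left_mono)
    finally show ?thesis .
  qed
  obtain A where A: "A > 0"
    "\<And>z k J. finite J \<Longrightarrow> J \<subseteq> {1..} \<Longrightarrow> k \<notin> J \<Longrightarrow> (z = \<gamma> k \<and> 1 \<le> k) \<or> (z = l k \<and> n0 \<le> k) \<Longrightarrow>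
      (\<Prod>j\<in>J. cmod (z - l j) / cmod (z - \<gamma> j)) \<le> A * (\<Prod>j\<in>{j\<in>J. k < j}. cmod (l j) / g j)"
    "\<And>z k J. finite J \<Longrightarrow> J \<subseteq> {1..} \<Longrightarrow> k \<notin> J \<Longrightarrow> (z = \<gamma> k \<and> 1 \<le> k) \<or> (z = l k \<and> n0 \<le> k) \<Longrightarrow>
      (\<Prod>j\<in>J. cmod (z - \<gamma> j) / cmod (z - l j)) \<le> A * (\<Prod>j\<in>{j\<in>J. k < j}. g j / cmod (l j))"
    using prod_estimate by blast
  obtain Cw where Cw: "Cw > 0" "\<And>n. n \<ge> n0 \<Longrightarrow> w (l n) \<le> Cw * u n" "\<And>n. n \<ge> n0 \<Longrightarrow> u n \<le> Cw * w (l n)"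
    using weight_comparable by blast
  obtain Cd where Cd: "Cd > 0" "\<And>n. n \<ge> 1 \<Longrightarrow> d n \<le> Cd * s n" using comparable by metis
  obtain c where c: "c > 0" "\<And>k j. n0 \<le> k \<Longrightarrow> 1 \<le> j \<Longrightarrow> k \<noteq> j \<Longrightarrow> c * max (s k) (s j) \<le> cmod (l k - \<gamma> j)"
    using sep by metis
  obtain Cs where Cs: "Cs > 0" "\<And>j k. j \<le> k \<Longrightarrow> s j / s k \<le> Cs * (1 / q) ^ (k - j)"
    using s_ratio by blast
  obtain Cp where Cp: "Cp > 0" "\<And>m n. m \<le> n \<Longrightarrow> 1 / (Pt n * (s n)\<^sup>2) \<le> Cp * (1 / q) ^ (n - m) * (1 / (Pt m * (s m)\<^sup>2))"
    using geometric_Ps by blast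
  define Q where "Q = 2 / (1 - 1 / q)"
  have Q: "Q > 0" using q by (simp add: Q_def)
  \<comment> \<open>\<open>S0\<close> bounds the sum of the deviations of the factors from 1 beyond
    the block, and \<open>S1\<close> the resulting value of |G - 1|, both relative to s M' / s
    n.\<close>
  define S0 where "S0 = Cd / c * Cs * Q"
  have S0: "S0 > 0" using Cd c Cs Q by (simp add: S0_def)
  define S1 where "S1 = S0 * exp S0"
  have S1: "S1 > 0" using S0 by (simp add: S1_def)
  define B1 where "B1 = B * \<kappa>"
  have B1: "B1 \<ge> 0" using B0 slow.kappa_ge1 by (simp add: B1_def)
  define D1 where "D1 = B1 + 2 * B1 + S1\<^sup>2 * (Cw * M * Cp * Q)"
  define D2 where "D2 = 2 * A\<^sup>2 * B1"
  have D1: "D1 > 0" unfolding D1_def using B1 S1 Cw M_pos Cp Q by (intro add_nonneg_pos) auto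
  have D2: "D2 \<ge> 0" unfolding D2_def using B1 by simp
  define C where "C = A\<^sup>2 * C0 * (D1 + D2)"
  show thesis
  proof (rule that[of C])
    show "C > 0" unfolding C_def using A(1) C0 D1 D2 by (intro mult_pos_pos add_pos_nonneg zero_less_power)
    fix N M' :: nat assume NM: "N < M'"
    define J where "J = {N<..M'}"
    have J: "finite J" "J \<subseteq> {1..}" by (auto simp: J_def)
    have gJ: "inj_on \<gamma> J" using J gamma_inj inj_on_subset by blast
    define r where "r k = (\<Prod>j\<in>J. \<gamma> k - l j) / (\<Prod>j\<in>J - {k}. \<gamma> k - \<gamma> j)" for k
    define G where "G z = (\<Prod>j\<in>J. (z - l j) / (z - \<gamma> j))" for z
    define a where "a k = (if k \<in> J then r k / of_real (v k) else 0)" for k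
    have a0: "a k = 0" if "k \<notin> {1..M'}" for k using that by (auto simp: a_def J_def)
    have fs: "a \<in> \<H>" "nsq v a = (\<Sum>k\<in>{1..M'}. (cmod (a k))\<^sup>2 * v k)"
        "f a z = (\<Sum>k\<in>{1..M'}. a k * of_real (v k) / (z - \<gamma> k))" for z
      by (rule finite_support, rule a0, assumption)+
    have fa: "f a z = G z - 1" if z: "z \<notin> \<gamma> ` {1..}" for z
    proof -
      have "G z = (\<Prod>j\<in>J. z - l j) / (\<Prod>j\<in>J. z - \<gamma> j)" by (simp add: G_def prod_dividef)
      also have "\<dots> = 1 + (\<Sum>k\<in>J. r k / (z - \<gamma> k))"
        using partial_fractions[OF J(1) J(1) gJ, of z l] z J by (force simp: r_def)
      also have "(\<Sum>k\<in>J. r k / (z - \<gamma> k)) = (\<Sum>k\<in>J. a k * of_real (v k) / (z - \<gamma> k))"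
      proof (rule sum.cong[OF refl])
        fix k assume "k \<in> J"
        thus "r k / (z - \<gamma> k) = a k * of_real (v k) / (z - \<gamma> k)"
          using v_pos[of k] J by (auto simp: a_def)
      qed
      also have "\<dots> = f a z" unfolding fs(3)
        by (intro sum.mono_neutral_left) (auto simp: J_def a_def)
      finally show ?thesis by simp
    qed
    have lower: "(\<Sum>k\<in>J. (h k)\<^sup>2 * u k) / (A\<^sup>2 * (h M')\<^sup>2) \<le> nsq v a"
    proof -
      have "(\<Sum>k\<in>J. (h k)\<^sup>2 * u k) / (A\<^sup>2 * (h M')\<^sup>2) = (\<Sum>k\<in>J. (h k)\<^sup>2 * u k / (A\<^sup>2 * (h M')\<^sup>2))"
        by (rule sum_divide_distrib)
      also have "\<dots> \<le> (\<Sum>k\<in>J. (cmod (a k))\<^sup>2 * v k)"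
      proof (rule sum_mono)
        fix k assume k: "k \<in> J"
        hence k1: "k \<ge> 1" "k \<ge> n0" "k \<le> M'" using J n0 by (auto simp: J_def)
        have vk: "v k > 0" by (rule v_pos[OF k1(1)])
        define R where "R = (\<Prod>j\<in>J - {k}. cmod (\<gamma> k - l j) / cmod (\<gamma> k - \<gamma> j))"
        \<comment> \<open>\<open>prod_estimate\<close> provides upper bounds only, so the residue is
          bounded below through the reciprocal product.\<close>
        have "(\<Prod>j\<in>J - {k}. cmod (\<gamma> k - \<gamma> j) / cmod (\<gamma> k - l j)) \<le> A * (\<Prod>j\<in>{j\<in>J - {k}. k < j}. g j / cmod (l j))"
          using J k1 by (intro A(3)) auto
        also have "{j\<in>J - {k}. k < j} = {k<..M'}" using k by (auto simp: J_def)
        also have "(\<Prod>j\<in>{k<..M'}. g j / cmod (l j)) = h M' / h k" by (rule prod_h[OF k1(3)])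
        also have "(\<Prod>j\<in>J - {k}. cmod (\<gamma> k - \<gamma> j) / cmod (\<gamma> k - l j)) = inverse R"
          unfolding R_def by (simp flip: prod_inversef)
        finally have iR: "inverse R \<le> A * (h M' / h k)" .
        have R0: "R > 0" unfolding R_def
        proof (intro prod_pos ballI divide_pos_pos)
          fix j assume j: "j \<in> J - {k}"
          hence "j \<ge> 1" using J by auto
          thus "0 < cmod (\<gamma> k - l j)" "0 < cmod (\<gamma> k - \<gamma> j)"
            using l_disj[of j k] gamma_neq[of k j] k1 n0 j by auto
        qed
        have RA: "h k / (A * h M') \<le> R"
        proof -
          have "1 \<le> A * (h M' / h k) * R" using mult_right_mono[OF iR, of R] R0 by simp
          thus ?thesis using A(1) h_pos[of k] h_pos[of M'] by (simp add: field_simps)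
        qed
        have rk: "cmod (r k) = d k * R"
        proof -
          have "r k = (\<gamma> k - l k) * (\<Prod>j\<in>J - {k}. (\<gamma> k - l j) / (\<gamma> k - \<gamma> j))"
            using J(1) k by (simp add: r_def prod.remove prod_dividef)
          thus ?thesis using k1 by (simp add: norm_mult norm_prod_ratio R_def d_def norm_minus_commute)
        qed
        have "(h k)\<^sup>2 * u k / (A\<^sup>2 * (h M')\<^sup>2) = (d k * (h k / (A * h M')))\<^sup>2 / v k"
          using k1 by (simp add: u_def vh_def power_mult_distrib power_divide mult_ac)
        also have "\<dots> \<le> (d k * R)\<^sup>2 / v k"
          using RA d_pos[of k] h_pos[of k] h_pos[of M'] A(1) vk
          by (intro divide_right_mono power_mono mult_left_mono mult_nonneg_nonneg) auto
        also have "\<dots> = (cmod (a k))\<^sup>2 * v k"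
          using k vk by (simp add: a_def rk norm_divide power_divide power2_eq_square)
        finally show "(h k)\<^sup>2 * u k / (A\<^sup>2 * (h M')\<^sup>2) \<le> (cmod (a k))\<^sup>2 * v k" .
      qed
      also have "\<dots> = nsq v a" unfolding fs(2)
        by (intro sum.mono_neutral_left) (auto simp: J_def a_def)
      finally show ?thesis .
    qed
    define X where "X = D1 / Pt M' + (if n0 \<le> N then D2 * (h N)\<^sup>2 / ((h M')\<^sup>2 * Pt N) else 0)"
    have upper: "nsq v a \<le> C0 * X"
    proof (rule C0(2)[OF fs(1)])
      fix F assume F: "finite F" "F \<subseteq> l ` {n0..}"
      then obtain K where K: "K \<subseteq> {n0..}" "finite K" "F = l ` K" using finite_subset_image by blast
      define e where "e n = (cmod (f a (l n)))\<^sup>2 * w (l n)" for n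
      have eq: "(\<Sum>z\<in>F. (cmod (f a z))\<^sup>2 * w z) = (\<Sum>n\<in>K. e n)"
        unfolding K(3) e_def by (subst sum.reindex) (use l_inj K(1) inj_on_subset in auto)
      have K3: "K = (K \<inter> {..N}) \<union> (K \<inter> J) \<union> (K \<inter> {M'<..})" using NM by (auto simp: J_def)
      have "(\<Sum>n\<in>K. e n) = (\<Sum>n\<in>K \<inter> {..N}. e n) + (\<Sum>n\<in>K \<inter> J. e n) + (\<Sum>n\<in>K \<inter> {M'<..}. e n)"
      proof -
        have "(\<Sum>n\<in>K. e n) = (\<Sum>n\<in>(K \<inter> {..N}) \<union> (K \<inter> J) \<union> (K \<inter> {M'<..}). e n)" using K3 by simp
        also have "\<dots> = (\<Sum>n\<in>(K \<inter> {..N}) \<union> (K \<inter> J). e n) + (\<Sum>n\<in>K \<inter> {M'<..}. e n)"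
          using K(2) NM by (intro sum.union_disjoint) (auto simp: J_def)
        also have "(\<Sum>n\<in>(K \<inter> {..N}) \<union> (K \<inter> J). e n) = (\<Sum>n\<in>K \<inter> {..N}. e n) + (\<Sum>n\<in>K \<inter> J. e n)"
          using K(2) by (intro sum.union_disjoint) (auto simp: J_def)
        finally show ?thesis .
      qed
      also have "(\<Sum>n\<in>K \<inter> {..N}. e n) \<le> 2 * B1 / Pt M' + (if n0 \<le> N then D2 * (h N)\<^sup>2 / ((h M')\<^sup>2 * Pt N) else 0)"
      proof (cases "n0 \<le> N")
        case True
        define H where "H = A * (h N / h M')"
        have "(\<Sum>n\<in>K \<inter> {..N}. e n) \<le> (\<Sum>n\<in>K \<inter> {..N}. (2 * H\<^sup>2 + 2) * wt n)"
        proof (rule sum_mono)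
          fix n assume "n \<in> K \<inter> {..N}"
          hence n: "n \<ge> n0" "n \<le> N" using K by auto
          have "cmod (G (l n)) = (\<Prod>j\<in>J. cmod (l n - l j) / cmod (l n - \<gamma> j))" by (simp only: G_def norm_prod_ratio)
          also have "\<dots> \<le> A * (\<Prod>j\<in>{j\<in>J. n < j}. cmod (l j) / g j)"
            using n J by (intro A(2)) (auto simp: J_def)
          also have "{j\<in>J. n < j} = {N<..M'}" using n by (auto simp: J_def)
          also have "(\<Prod>j\<in>{N<..M'}. cmod (l j) / g j) = h N / h M'" using NM by (intro prod_h) simp
          finally have GH: "cmod (G (l n)) \<le> H" by (simp add: H_def)
          have "cmod (f a (l n)) \<le> H + 1"
            using norm_triangle_ineq4[of "G (l n)" 1] GH fa[OF l_notin[OF n(1)]] by simp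
          hence "(cmod (f a (l n)))\<^sup>2 \<le> (H + 1)\<^sup>2" by (intro power_mono) auto
          also have "\<dots> \<le> 2 * H\<^sup>2 + 2" using sq_sum_le[of H 1] by simp
          finally show "e n \<le> (2 * H\<^sup>2 + 2) * wt n"
            using w_l_pos[OF n(1)] n(1) by (simp add: e_def wt_def mult_right_mono)
        qed
        also have "\<dots> = (2 * H\<^sup>2 + 2) * (\<Sum>n\<in>K \<inter> {..N}. wt n)" by (simp add: sum_distrib_left)
        also have "\<dots> \<le> (2 * H\<^sup>2 + 2) * (\<Sum>n<Suc N. wt n)"
          using wt_nonneg by (intro mult_left_mono sum_mono2) auto
        also have "\<dots> \<le> (2 * H\<^sup>2 + 2) * (B1 / Pt N)"
          using W[of N] by (intro mult_left_mono) (auto simp: B1_def)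
        also have "\<dots> = 2 * H\<^sup>2 * (B1 / Pt N) + 2 * B1 / Pt N" by (simp add: algebra_simps add_divide_distrib)
        also have "2 * H\<^sup>2 * (B1 / Pt N) = D2 * (h N)\<^sup>2 / ((h M')\<^sup>2 * Pt N)"
          by (simp add: H_def D2_def power_mult_distrib power_divide)
        also have "2 * B1 / Pt N \<le> 2 * B1 / Pt M'"
          using slow.P_antimono[of N M'] NM Pt_pos B1 by (intro divide_left_mono mult_pos_pos) auto
        finally show ?thesis using True by simp
      next
        case False
        hence "K \<inter> {..N} = {}" using K by auto
        thus ?thesis using False B1 Pt_pos[of M'] by simp
      qed
      also have "(\<Sum>n\<in>K \<inter> J. e n) \<le> B1 / Pt M'"
      proof -
        have "(\<Sum>n\<in>K \<inter> J. e n) \<le> (\<Sum>n\<in>K \<inter> J. wt n)"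
        proof (rule sum_mono)
          fix n assume n: "n \<in> K \<inter> J"
          hence n0': "n \<ge> n0" using K by auto
          have "(l n - l n) / (l n - \<gamma> n) = 0" by simp
          hence "G (l n) = 0" unfolding G_def using J n by (intro prod_zero) auto
          hence "f a (l n) = - 1" using fa[OF l_notin[OF n0']] by simp
          thus "e n \<le> wt n" using n0' by (simp add: e_def wt_def)
        qed
        also have "\<dots> \<le> (\<Sum>n<Suc M'. wt n)"
          using wt_nonneg by (intro sum_mono2) (auto simp: J_def)
        also have "\<dots> \<le> B1 / Pt M'" using W[of M'] by (simp add: B1_def)
        finally show ?thesis .
      qed
      also have "(\<Sum>n\<in>K \<inter> {M'<..}. e n) \<le> S1\<^sup>2 * (Cw * M * Cp * Q) / Pt M'"
      proof -
        have sM: "s M' > 0" by (rule s_pos)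
        have "(\<Sum>n\<in>K \<inter> {M'<..}. e n)
            \<le> (\<Sum>n\<in>K \<inter> {M'<..}. S1\<^sup>2 * (s M')\<^sup>2 * (Cw * M) * (Cp * (1 / q) ^ ((n - M') + (M' - n)) * (1 / (Pt M' * (s M')\<^sup>2))))"
        proof (rule sum_mono)
          fix n assume "n \<in> K \<inter> {M'<..}"
          hence n: "n > M'" "n \<ge> n0" "n \<ge> 1" using K by auto
          have sn: "s n > 0" by (rule s_pos)
          \<comment> \<open>Beyond the block every factor of G is 1 + \<open>x j\<close>. The sum of
            the |\<open>x j\<close>| is dominated by the indices near M', whence the factor s M' / s
            n.\<close>
          define x where "x j = (\<gamma> j - l j) / (l n - \<gamma> j)" for j
          have "(l n - l j) / (l n - \<gamma> j) = 1 + x j" if "j \<in> J" for j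
          proof -
            have "l n \<noteq> \<gamma> j" using l_disj[OF n(2), of j] that J by auto
            thus ?thesis by (simp add: x_def field_simps)
          qed
          hence Gx: "G (l n) = (\<Prod>j\<in>J. 1 + x j)" unfolding G_def by (intro prod.cong) auto
          have "(\<Sum>j\<in>J. cmod (x j)) \<le> (\<Sum>j\<in>J. Cd / c * Cs * (s M' / s n) * (1 / q) ^ ((j - M') + (M' - j)))"
          proof (rule sum_mono)
            fix j assume "j \<in> J"
            hence j: "j \<ge> 1" "j \<le> M'" "n \<noteq> j" using n by (auto simp: J_def)
            have "c * s n \<le> c * max (s n) (s j)" using c by (intro mult_left_mono) auto
            also have "\<dots> \<le> cmod (l n - \<gamma> j)" using j n by (intro c(2)) auto
            finally have "cmod (x j) \<le> (Cd * s j) / (c * s n)"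
              using Cd(2)[OF j(1)] j(1) c sn s_pos[of j] Cd(1)
              by (auto simp: x_def norm_divide d_def norm_minus_commute[of "\<gamma> j"] intro!: frac_le)
            also have "\<dots> = Cd / c * (s M' / s n) * (s j / s M')" using sM by (simp add: field_simps)
            also have "\<dots> \<le> Cd / c * (s M' / s n) * (Cs * (1 / q) ^ (M' - j))"
              using j Cd c sM sn by (intro mult_left_mono Cs) auto
            finally show "cmod (x j) \<le> Cd / c * Cs * (s M' / s n) * (1 / q) ^ ((j - M') + (M' - j))"
              using j by (simp add: mult_ac)
          qed
          also have "\<dots> = Cd / c * Cs * (s M' / s n) * (\<Sum>j\<in>J. (1 / q) ^ ((j - M') + (M' - j)))"
            by (simp add: sum_distrib_left)
          also have "\<dots> \<le> Cd / c * Cs * (s M' / s n) * Q"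
            unfolding Q_def using J q Cd c Cs sM sn by (intro mult_left_mono sum_power_distance_le) auto
          also have "\<dots> = S0 * (s M' / s n)" by (simp add: S0_def)
          finally have "(\<Sum>j\<in>J. cmod (x j)) \<le> S0 * (s M' / s n)" .
          hence "cmod (G (l n) - 1) \<le> S0 * (s M' / s n) * exp (S0 * (s M' / s n))"
            unfolding Gx by (rule norm_prod_one_plus_minus_one_le[OF J(1)])
          also have "\<dots> \<le> S0 * (s M' / s n) * exp S0"
          proof -
            have "s M' \<le> s n" using n NM by (intro s_mono) auto
            hence "S0 * (s M' / s n) \<le> S0 * 1" using S0 sn by (intro mult_left_mono) auto
            thus ?thesis using S0 sM sn by (intro mult_left_mono) auto
          qed
          also have "\<dots> = S1 * (s M' / s n)" by (simp add: S1_def)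
          finally have "cmod (f a (l n)) \<le> S1 * (s M' / s n)" using fa[OF l_notin[OF n(2)]] by simp
          hence "(cmod (f a (l n)))\<^sup>2 \<le> (S1 * (s M' / s n))\<^sup>2" by (intro power_mono) auto
          hence "e n \<le> (S1 * (s M' / s n))\<^sup>2 * (Cw * (M / Pt n))"
          proof -
            have "w (l n) \<le> Cw * u n" by (rule Cw(2)[OF n(2)])
            also have "\<dots> \<le> Cw * (M / Pt n)" using u_le[OF n(3)] Cw by (intro mult_left_mono) auto
            finally have "w (l n) \<le> Cw * (M / Pt n)" .
            thus ?thesis unfolding e_def using \<open>(cmod (f a (l n)))\<^sup>2 \<le> _\<close> w_l_pos[OF n(2)]
              by (intro mult_mono) auto
          qed
          also have "\<dots> = S1\<^sup>2 * (s M')\<^sup>2 * (Cw * M) * (1 / (Pt n * (s n)\<^sup>2))"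
            by (simp add: power_mult_distrib power_divide)
          also have "\<dots> \<le> S1\<^sup>2 * (s M')\<^sup>2 * (Cw * M) * (Cp * (1 / q) ^ (n - M') * (1 / (Pt M' * (s M')\<^sup>2)))"
            using n Cw M_pos by (intro mult_left_mono Cp(2)) auto
          finally show "e n \<le> S1\<^sup>2 * (s M')\<^sup>2 * (Cw * M) * (Cp * (1 / q) ^ ((n - M') + (M' - n)) * (1 / (Pt M' * (s M')\<^sup>2)))"
            using n by simp
        qed
        also have "\<dots> = S1\<^sup>2 * (Cw * M * Cp) / Pt M' * (\<Sum>n\<in>K \<inter> {M'<..}. (1 / q) ^ ((n - M') + (M' - n)))"
          unfolding sum_distrib_left using sM by (intro sum.cong) auto
        also have "\<dots> \<le> S1\<^sup>2 * (Cw * M * Cp) / Pt M' * Q"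
          unfolding Q_def using K q Cw M_pos Cp Pt_pos[of M'] by (intro mult_left_mono sum_power_distance_le) auto
        finally show ?thesis by (simp add: mult_ac)
      qed
      finally have "(\<Sum>n\<in>K. e n) \<le> (2 * B1 / Pt M' + (if n0 \<le> N then D2 * (h N)\<^sup>2 / ((h M')\<^sup>2 * Pt N) else 0))
          + B1 / Pt M' + S1\<^sup>2 * (Cw * M * Cp * Q) / Pt M'" by simp
      also have "\<dots> = X" unfolding X_def D1_def by (simp add: add_divide_distrib)
      finally show "(\<Sum>z\<in>F. (cmod (f a z))\<^sup>2 * w z) \<le> X" unfolding eq .
    qed
    have hM: "h M' > 0" by (rule h_pos)
    have "(\<Sum>k\<in>J. (h k)\<^sup>2 * u k) / (A\<^sup>2 * (h M')\<^sup>2) \<le> C0 * X" using lower upper by linarith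
    moreover have "A\<^sup>2 * (h M')\<^sup>2 > 0" using A(1) hM by simp
    ultimately have "(\<Sum>k\<in>J. (h k)\<^sup>2 * u k) \<le> C0 * X * (A\<^sup>2 * (h M')\<^sup>2)" by (simp only: pos_divide_le_eq)
    also have "\<dots> = A\<^sup>2 * C0 * (D1 * ((h M')\<^sup>2 / Pt M') + D2 * (if n0 \<le> N then (h N)\<^sup>2 / Pt N else 0))"
      using hM by (simp add: X_def field_simps)
    also have "\<dots> \<le> A\<^sup>2 * C0 * ((D1 + D2) * ((h M')\<^sup>2 / Pt M') + (D1 + D2) * (if n0 \<le> N then (h N)\<^sup>2 / Pt N else 0))"
      using C0 D1 D2 Pt_pos by (intro mult_left_mono add_mono mult_right_mono) (auto intro!: divide_nonneg_pos)
    also have "\<dots> = C * ((h M')\<^sup>2 / Pt M' + (if n0 \<le> N then (h N)\<^sup>2 / Pt N else 0))"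
      by (simp add: C_def algebra_simps add_divide_distrib)
    finally show "(\<Sum>k\<in>{N<..M'}. (h k)\<^sup>2 * u k)
      \<le> C * ((h M')\<^sup>2 / Pt M' + (if n0 \<le> N then (h N)\<^sup>2 / Pt N else 0))" by (simp add: J_def)
  qed
qed

text \<open>Surjectivity gives \<open>a\<close> with transform 1 at \<lambda>_0 and 0 at the other
  points. It is paired with the partial fractions of \<open>r\<close>, the product of the z -
  \<gamma>_j, 1 \<le> j \<le> M', over that of the z - \<lambda>_j, 0 \<le> j \<le> M'. This
  isolates the residue at \<lambda>_0, of modulus at least h M' / A, and involves only coordinates
  of \<open>a\<close> beyond M', because \<open>r\<close> vanishes at \<gamma>_1, ..., \<gamma>_M'.
  The tail of \<open>a\<close> tends to 0, and the values of \<open>r\<close> beyond M' have squared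
  norm O(P_M').\<close>

lemma h_sq_over_P_tendsto_0:
  assumes inv: "hilb_invertible_on \<gamma> v (l ` {n0..})" and n00: "n0 = 0"
  shows "(\<lambda>n. (h n)\<^sup>2 / Pt n) \<longlonglongrightarrow> 0"
proof -
  interpret invertible_on \<gamma> v q "l ` {n0..}"
    by unfold_locales (rule disj_l, rule inv)
  obtain A where A: "A > 0"
    "\<And>z k J. finite J \<Longrightarrow> J \<subseteq> {1..} \<Longrightarrow> k \<notin> J \<Longrightarrow> (z = \<gamma> k \<and> 1 \<le> k) \<or> (z = l k \<and> n0 \<le> k) \<Longrightarrow>
      (\<Prod>j\<in>J. cmod (z - l j) / cmod (z - \<gamma> j)) \<le> A * (\<Prod>j\<in>{j\<in>J. k < j}. cmod (l j) / g j)"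
    "\<And>z k J. finite J \<Longrightarrow> J \<subseteq> {1..} \<Longrightarrow> k \<notin> J \<Longrightarrow> (z = \<gamma> k \<and> 1 \<le> k) \<or> (z = l k \<and> n0 \<le> k) \<Longrightarrow>
      (\<Prod>j\<in>J. cmod (z - \<gamma> j) / cmod (z - l j)) \<le> A * (\<Prod>j\<in>{j\<in>J. k < j}. g j / cmod (l j))"
    using prod_estimate by blast
  obtain c where c: "c > 0" "\<And>k j. 1 \<le> k \<Longrightarrow> n0 \<le> j \<Longrightarrow> k \<noteq> j \<Longrightarrow> c * max (s k) (s j) \<le> cmod (\<gamma> k - l j)"
    using sep by metis
  obtain a where a: "a \<in> \<H>" "\<And>z. z \<in> {l 0} \<Longrightarrow> f a z = 1" "\<And>z. z \<in> l ` {n0..} - {l 0} \<Longrightarrow> f a z = 0"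
    using interpolate[of "{l 0}" "\<lambda>_. 1"] n00 by auto
  define a' where "a' M' k = (if k > M' then a k else 0)" for M' k
  have h0: "h 0 = 1" by (simp add: h_def)
  have tail: "a' M' \<in> \<H> \<and> nsq v (a' M') = nsq v a - (\<Sum>k\<in>{1..M'}. (cmod (a k))\<^sup>2 * v k)" for M'
    unfolding a'_def using l2_tail[OF a(1)] by blast
  define C where "C = A\<^sup>2 * (A / c)\<^sup>2"
  have bound: "(h M')\<^sup>2 / Pt M' \<le> C * nsq v (a' M')" for M'
  proof -
    define I where "I = {0..M'}"
    have lI: "inj_on l I" using l_inj n00 inj_on_subset by blast
    define \<delta> where "\<delta> i = (\<Prod>j\<in>{1..M'}. l i - \<gamma> j) / (\<Prod>j\<in>I - {i}. l i - l j)" for i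
    define r where "r z = (\<Prod>j\<in>{1..M'}. z - \<gamma> j) / (\<Prod>j\<in>I. z - l j)" for z
    have r: "r z = (\<Sum>i\<in>I. \<delta> i / (z - l i))" if "z \<notin> l ` I" for z
      using partial_fractions[OF _ _ lI, of "{1..M'}" z \<gamma>] that by (simp add: I_def r_def \<delta>_def)
    have \<gamma>l: "\<gamma> k \<notin> l ` I" if "k \<ge> 1" for k using l_disj[of _ k] that n00 by (metis imageE le0)
    \<comment> \<open>The residues, transported from indices to points, since
      \<open>hilb_finite_combination\<close> sums over points.\<close>
    define cc where "cc z = \<delta> (the_inv_into I l z)" for z
    have cc: "cc (l i) = \<delta> i" if "i \<in> I" for i using that by (simp add: cc_def the_inv_into_f_f[OF lI])
    have "((\<lambda>k. a k * of_real (v k) * (\<Sum>z\<in>l ` I. cc z / (z - \<gamma> k))) has_sum (\<Sum>z\<in>l ` I. cc z * f a z)) {1..}"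
    proof (rule hilb_finite_combination[OF a(1)])
      show "l ` I \<inter> \<gamma> ` {1..} = {}" using disj_l n00 by auto
    qed (simp add: I_def)
    also have "(\<Sum>z\<in>l ` I. cc z * f a z) = \<delta> 0"
    proof -
      have "(\<Sum>z\<in>l ` I. cc z * f a z) = (\<Sum>i\<in>I. cc (l i) * f a (l i))" by (subst sum.reindex[OF lI]) simp
      also have "\<dots> = (\<Sum>i\<in>{0}. cc (l i) * f a (l i))"
      proof (rule sum.mono_neutral_right)
        show "\<forall>i\<in>I - {0}. cc (l i) * f a (l i) = 0"
        proof
          fix i assume "i \<in> I - {0}"
          hence "l i \<in> l ` {n0..} - {l 0}" using l_neq[of i 0] n00 by auto
          thus "cc (l i) * f a (l i) = 0" using a(3) by simp
        qed
      qed (auto simp: I_def)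
      finally show ?thesis using a(2) cc[of 0] by (simp add: I_def)
    qed
    also have "(\<lambda>k. a k * of_real (v k) * (\<Sum>z\<in>l ` I. cc z / (z - \<gamma> k))) =
        (\<lambda>k. a k * of_real (v k) * (\<Sum>i\<in>I. \<delta> i / (l i - \<gamma> k)))"
      by (intro ext arg_cong2[where f = "(*)"] refl, subst sum.reindex[OF lI]) (auto intro!: sum.cong simp: cc)
    finally have hs: "((\<lambda>k. a k * of_real (v k) * (\<Sum>i\<in>I. \<delta> i / (l i - \<gamma> k))) has_sum \<delta> 0) {1..}" .
    define b where "b k = (if k > M' then - r (\<gamma> k) else 0)" for k
    have rk: "(\<Sum>i\<in>I. \<delta> i / (l i - \<gamma> k)) = - r (\<gamma> k)" if "k \<ge> 1" for k
    proof -
      have "(\<Sum>i\<in>I. \<delta> i / (l i - \<gamma> k)) = (\<Sum>i\<in>I. - (\<delta> i / (\<gamma> k - l i)))"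
        by (intro sum.cong refl) (metis minus_diff_eq divide_minus_right)
      thus ?thesis unfolding r[OF \<gamma>l[OF that]] by (simp add: sum_negf)
    qed
    have r0: "r (\<gamma> k) = 0" if "k \<in> {1..M'}" for k
    proof -
      have "(\<Prod>j\<in>{1..M'}. \<gamma> k - \<gamma> j) = 0" using that by (intro prod_zero) auto
      thus ?thesis by (simp add: r_def)
    qed
    have "((\<lambda>k. a' M' k * of_real (v k) * b k) has_sum \<delta> 0) {1..}"
    proof -
      have "((\<lambda>k. a k * of_real (v k) * (\<Sum>i\<in>I. \<delta> i / (l i - \<gamma> k))) has_sum \<delta> 0) {1..} \<longleftrightarrow>
          ((\<lambda>k. a' M' k * of_real (v k) * b k) has_sum \<delta> 0) {1..}"
        by (rule has_sum_cong) (use rk r0 in \<open>auto simp: a'_def b_def\<close>)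
      thus ?thesis using hs by blast
    qed
    hence d0: "\<delta> 0 = (\<Sum>\<^sub>\<infinity>k\<in>{1..}. a' M' k * of_real (v k) * b k)" by (rule infsumI[symmetric])
    have bk: "(cmod (b k))\<^sup>2 * v k \<le> (A / c)\<^sup>2 * p k" if k: "k > M'" for k
    proof -
      have k1: "k \<ge> 1" using k by simp
      have gk: "g k > 0" by (rule g_pos[OF k1])
      have I: "I = insert 0 {1..M'}" by (auto simp: I_def)
      have "r (\<gamma> k) = (\<Prod>j\<in>{1..M'}. (\<gamma> k - \<gamma> j) / (\<gamma> k - l j)) / (\<gamma> k - l 0)"
        by (simp add: r_def I prod_dividef)
      hence "cmod (b k) = (\<Prod>j\<in>{1..M'}. cmod (\<gamma> k - \<gamma> j) / cmod (\<gamma> k - l j)) / cmod (\<gamma> k - l 0)"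
        using k by (simp add: b_def norm_divide norm_prod_ratio)
      also have "\<dots> \<le> A / (c * g k)"
      proof (rule frac_le)
        have "(\<Prod>j\<in>{1..M'}. cmod (\<gamma> k - \<gamma> j) / cmod (\<gamma> k - l j)) \<le> A * (\<Prod>j\<in>{j\<in>{1..M'}. k < j}. g j / cmod (l j))"
          using k by (intro A(3)) auto
        also have "{j\<in>{1..M'}. k < j} = {}" using k by auto
        finally show "(\<Prod>j\<in>{1..M'}. cmod (\<gamma> k - \<gamma> j) / cmod (\<gamma> k - l j)) \<le> A" by simp
        show "0 < c * g k" using c gk by (intro mult_pos_pos)
        have "c * g k \<le> c * max (s k) (s 0)" using c k1 by (intro mult_left_mono) (auto simp: s_eq)
        also have "\<dots> \<le> cmod (\<gamma> k - l 0)" using n00 k1 by (intro c(2)) auto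
        finally show "c * g k \<le> cmod (\<gamma> k - l 0)" .
      qed (use A(1) in simp)
      finally have "(cmod (b k))\<^sup>2 \<le> (A / (c * g k))\<^sup>2" by (intro power_mono) auto
      hence "(cmod (b k))\<^sup>2 * v k \<le> (A / (c * g k))\<^sup>2 * v k" using v_pos[OF k1] by (intro mult_right_mono) auto
      thus ?thesis by (simp add: power_mult_distrib power_divide)
    qed
    have bsm: "(\<lambda>k. (cmod (b k))\<^sup>2 * v k) summable_on {1..}" "(\<Sum>\<^sub>\<infinity>k\<in>{1..}. (cmod (b k))\<^sup>2 * v k) \<le> (A / c)\<^sup>2 * Pt M'"
    proof -
      have fin: "(\<Sum>k\<in>F. (cmod (b k))\<^sup>2 * v k) \<le> (A / c)\<^sup>2 * Pt M'" if F: "finite F" "F \<subseteq> {1..}" for F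
      proof -
        have "(\<Sum>k\<in>F. (cmod (b k))\<^sup>2 * v k) = (\<Sum>k\<in>F \<inter> {M'<..}. (cmod (b k))\<^sup>2 * v k)"
          using F by (intro sum.mono_neutral_right) (auto simp: b_def)
        also have "\<dots> \<le> (\<Sum>k\<in>F \<inter> {M'<..}. (A / c)\<^sup>2 * p k)" by (intro sum_mono bk) auto
        also have "\<dots> = (A / c)\<^sup>2 * (\<Sum>k\<in>F \<inter> {M'<..}. p k)" by (rule sum_distrib_left[symmetric])
        also have "(\<Sum>k\<in>F \<inter> {M'<..}. p k) \<le> Pt M'"
          unfolding P_def using F by (intro finite_sum_le_infsum p_summable') (auto intro!: divide_nonneg_nonneg less_imp_le[OF v_pos])
        finally show ?thesis by (simp add: mult_left_mono)
      qed
      show "(\<lambda>k. (cmod (b k))\<^sup>2 * v k) summable_on {1..}" "(\<Sum>\<^sub>\<infinity>k\<in>{1..}. (cmod (b k))\<^sup>2 * v k) \<le> (A / c)\<^sup>2 * Pt M'"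
        using sum_le_bound_summable[of "{1..}" "\<lambda>k. (cmod (b k))\<^sup>2 * v k" "(A / c)\<^sup>2 * Pt M'"] l2_term_nonneg[of _ b] fin by blast+
    qed
    have "(cmod (\<delta> 0))\<^sup>2 \<le> nsq v (a' M') * (\<Sum>\<^sub>\<infinity>k\<in>{1..}. (cmod (b k))\<^sup>2 * v k)"
      unfolding d0 using tail[of M'] by (intro cauchy_schwarz_H bsm) auto
    also have "\<dots> \<le> nsq v (a' M') * ((A / c)\<^sup>2 * Pt M')" by (intro mult_left_mono bsm nsq_nonneg)
    finally have d0le: "(cmod (\<delta> 0))\<^sup>2 \<le> nsq v (a' M') * ((A / c)\<^sup>2 * Pt M')" .
    have hle: "h M' \<le> A * cmod (\<delta> 0)"
    proof -
      define R where "R = (\<Prod>j\<in>{1..M'}. cmod (l 0 - l j) / cmod (l 0 - \<gamma> j))"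
      have I: "I - {0} = {1..M'}" by (auto simp: I_def)
      have "\<delta> 0 = (\<Prod>j\<in>{1..M'}. (l 0 - \<gamma> j) / (l 0 - l j))" unfolding \<delta>_def I by (simp add: prod_dividef)
      hence "cmod (\<delta> 0) = (\<Prod>j\<in>{1..M'}. cmod (l 0 - \<gamma> j) / cmod (l 0 - l j))" by (simp only: norm_prod_ratio)
      also have "\<dots> = inverse R" unfolding R_def by (simp flip: prod_inversef)
      finally have dR: "cmod (\<delta> 0) = inverse R" .
      have "R \<le> A * (\<Prod>j\<in>{j\<in>{1..M'}. 0 < j}. cmod (l j) / g j)"
        unfolding R_def using n00 by (intro A(2)) auto
      also have "{j\<in>{1..M'}. 0 < j} = {0<..M'}" by auto
      also have "(\<Prod>j\<in>{0<..M'}. cmod (l j) / g j) = h 0 / h M'" by (rule prod_h) simp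
      finally have RA: "R \<le> A / h M'" by (simp add: h0)
      have "R > 0" unfolding R_def
      proof (intro prod_pos ballI divide_pos_pos)
        fix j assume "j \<in> {1..M'}"
        thus "0 < cmod (l 0 - l j)" "0 < cmod (l 0 - \<gamma> j)" using l_neq[of 0 j] l_disj[of 0 j] n00 by auto
      qed
      thus ?thesis using RA h_pos[of M'] by (simp add: dR field_simps)
    qed
    have "(h M')\<^sup>2 \<le> (A * cmod (\<delta> 0))\<^sup>2" using hle h_pos[of M'] by (intro power_mono) auto
    also have "\<dots> = A\<^sup>2 * (cmod (\<delta> 0))\<^sup>2" by (simp add: power_mult_distrib)
    also have "\<dots> \<le> A\<^sup>2 * (nsq v (a' M') * ((A / c)\<^sup>2 * Pt M'))" by (intro mult_left_mono d0le) auto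
    also have "\<dots> = C * nsq v (a' M') * Pt M'" by (simp add: C_def)
    finally show ?thesis using Pt_pos[of M'] by (simp only: pos_divide_le_eq)
  qed
  have "(\<lambda>M'. C * nsq v (a' M')) \<longlonglongrightarrow> C * 0"
    unfolding a'_def by (intro tendsto_intros nsq_tail_tendsto_0 a)
  hence lim: "(\<lambda>M'. C * nsq v (a' M')) \<longlonglongrightarrow> 0" by simp
  show ?thesis
  proof (rule tendsto_sandwich[OF _ _ tendsto_const lim])
    show "\<forall>\<^sub>F n in sequentially. 0 \<le> (h n)\<^sup>2 / Pt n"
      using Pt_pos by (intro always_eventually allI divide_nonneg_pos) auto
    show "\<forall>\<^sub>F n in sequentially. (h n)\<^sup>2 / Pt n \<le> C * nsq v (a' n)"
      using bound by (intro always_eventually) auto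
  qed
qed

lemma necessary_exact:
  assumes inv: "hilb_invertible_on \<gamma> v (l ` {n0..})" and n01: "n0 = 1"
  shows "\<exists>C>0. \<exists>\<delta>>0. \<forall>m n. 1 \<le> n \<longrightarrow> n < m \<longrightarrow> (h m)\<^sup>2 / (h n)\<^sup>2 \<ge> C * (Pt m / Pt n) powr (1 - \<delta>)"
proof -
  obtain C where C: "C > 0" "\<And>N M'. N < M' \<Longrightarrow> (\<Sum>k\<in>{N<..M'}. (h k)\<^sup>2 * u k)
    \<le> C * ((h M')\<^sup>2 / Pt M' + (if n0 \<le> N then (h N)\<^sup>2 / Pt N else 0))" using interpolation_weights[OF inv] by blast
  obtain C1 where C1: "C1 > 0" "\<And>n. \<bar>(h (Suc n))\<^sup>2 - (h n)\<^sup>2\<bar> \<le> C1 * (h (Suc n))\<^sup>2 * sqrt (u (Suc n) * p (Suc n))"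
    using h_sq_diff by blast
  show ?thesis
  proof (rule slow.powr_lower_bound[of "\<lambda>n. (h n)\<^sup>2" u C1 C])
    \<comment> \<open>For N = 0 < n0 the second term of the weight inequality is absent.\<close>
    show "(\<Sum>k\<in>{0<..m}. (h k)\<^sup>2 * u k) \<le> C * ((h m)\<^sup>2 / Pt m)" if "1 \<le> m" for m
      using C(2)[of 0 m] that n01 by simp
    show "0 < (h n)\<^sup>2" for n by (rule zero_less_power[OF h_pos])
    show "0 \<le> u n" for n by (rule less_imp_le[OF u_pos])
    show "0 \<le> C1" using C1(1) by simp
  qed (rule C1(2))
qed

text \<open>The term at N is now present; the decay of \<open>h^2 / Pt\<close> is what allows
  summation to infinity instead.\<close>

lemma necessary_excess:
  assumes inv: "hilb_invertible_on \<gamma> v (l ` {n0..})" and n00: "n0 = 0"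
  shows "\<exists>C>0. \<exists>\<delta>>0. \<forall>m n. n < m \<longrightarrow> (h m)\<^sup>2 / (h n)\<^sup>2 \<le> C * (Pt m / Pt n) powr (1 + \<delta>)"
proof -
  obtain C where C: "C > 0" "\<And>N M'. N < M' \<Longrightarrow> (\<Sum>k\<in>{N<..M'}. (h k)\<^sup>2 * u k)
    \<le> C * ((h M')\<^sup>2 / Pt M' + (if n0 \<le> N then (h N)\<^sup>2 / Pt N else 0))" using interpolation_weights[OF inv] by blast
  obtain C1 where C1: "C1 > 0" "\<And>n. \<bar>(h (Suc n))\<^sup>2 - (h n)\<^sup>2\<bar> \<le> C1 * (h (Suc n))\<^sup>2 * sqrt (u (Suc n) * p (Suc n))"
    using h_sq_diff by blast
  have "\<forall>\<^sub>F n in sequentially. (h n / h (Suc n))\<^sup>2 \<le> 4"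
  proof -
    have "(1::real) < 2" by simp
    from h_ratio(1)[OF this] show ?thesis
    proof eventually_elim
      case (elim n)
      have "h n / h (Suc n) \<le> 2" using elim h_pos[of "Suc n"] by (simp only: pos_divide_le_eq)
      hence "(h n / h (Suc n))\<^sup>2 \<le> 2\<^sup>2" using h_pos[of n] h_pos[of "Suc n"] by (intro power_mono) auto
      thus ?case by simp
    qed
  qed
  then obtain K where K: "\<And>n. (h n / h (Suc n))\<^sup>2 \<le> K" using eventually_le_imp_bounded[of "\<lambda>n. (h n / h (Suc n))\<^sup>2" 4] by blast
  show ?thesis
  proof (rule slow.powr_upper_bound[of "\<lambda>n. (h n)\<^sup>2" u C1 C K])
    show "(\<Sum>k\<in>{N<..m}. (h k)\<^sup>2 * u k) \<le> C * ((h m)\<^sup>2 / Pt m + (h N)\<^sup>2 / Pt N)" if "N \<le> m" for N m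
    proof (cases "N = m")
      case True
      have "0 \<le> C * ((h m)\<^sup>2 / Pt m + (h m)\<^sup>2 / Pt m)"
        using C(1) Pt_pos[of m] by (intro mult_nonneg_nonneg add_nonneg_nonneg divide_nonneg_pos) auto
      moreover have "{m<..m} = {}" by simp
      ultimately show ?thesis unfolding True by (simp only: sum.empty)
    next
      case False
      thus ?thesis using C(2)[of N m] that n00 by simp
    qed
    show "(\<lambda>n. (h n)\<^sup>2 / Pt n) \<longlonglongrightarrow> 0" by (rule h_sq_over_P_tendsto_0[OF inv n00])
    show "(h n)\<^sup>2 \<le> K * (h (Suc n))\<^sup>2" for n
      using K[of n] h_pos[of "Suc n"] by (simp add: power_divide pos_divide_le_eq)
    show "0 < (h n)\<^sup>2" for n by (rule zero_less_power[OF h_pos])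
    show "0 \<le> u n" for n by (rule less_imp_le[OF u_pos])
    show "0 \<le> C1" using C1(1) by simp
  qed (rule C1(2))
qed

end

section \<open>Sufficiency: inverse matrices\<close>

context sparse_weights
begin

text \<open>Bounded and coordinatewise convergent means weakly convergent, and evaluation at z is
  the pairing with a fixed square-summable kernel: the tail is small uniformly in i, the head is a
  finite sum.\<close>

lemma weak_limit:
  fixes D :: real
  assumes X: "\<And>i. X i \<in> \<H>" and D: "\<And>i. nsq v (X i) \<le> D" and lim: "\<And>k. (\<lambda>i. X i k) \<longlonglongrightarrow> x k"
  shows "x \<in> \<H>" "nsq v x \<le> D"
    "\<And>z. z \<notin> \<gamma> ` {1..} \<Longrightarrow> (\<lambda>i. f (X i) z) \<longlonglongrightarrow> f x z"
proof -
  have x0: "x 0 = 0"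
  proof (rule LIMSEQ_unique[OF lim])
    have "X i 0 = 0" for i using X[of i] by (simp add: l2_iff)
    thus "(\<lambda>i. X i 0) \<longlonglongrightarrow> 0" by simp
  qed
  have fin: "(\<Sum>k\<in>{1..N}. (cmod (x k))\<^sup>2 * v k) \<le> D" for N
  proof (rule LIMSEQ_le_const2)
    show "(\<lambda>i. \<Sum>k\<in>{1..N}. (cmod (X i k))\<^sup>2 * v k) \<longlonglongrightarrow> (\<Sum>k\<in>{1..N}. (cmod (x k))\<^sup>2 * v k)"
      by (intro tendsto_intros lim)
    show "\<exists>M. \<forall>i\<ge>M. (\<Sum>k\<in>{1..N}. (cmod (X i k))\<^sup>2 * v k) \<le> D"
      using order_trans[OF nsq_ge_sum[OF X] D] by auto
  qed
  show x: "x \<in> \<H>" and nx: "nsq v x \<le> D" by (rule nsq_leI[OF x0 fin])+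
  fix z assume z: "z \<notin> \<gamma> ` {1..}"
  define y where "y i k = X i k - x k" for i k
  have y: "y i \<in> \<H>" for i unfolding y_def by (rule l2_diff[OF X x])
  have D0: "D \<ge> 0" using nsq_nonneg[of x] nx by linarith
  have ny: "nsq v (y i) \<le> 4 * D" for i
  proof -
    have "nrm (\<lambda>k. X i k + (-1) * x k) \<le> nrm (X i) + nrm (\<lambda>k. (-1) * x k)"
      by (intro nrm_triangle X nrm_scale x)
    also have "nrm (\<lambda>k. (-1) * x k) = nrm x" by (subst nrm_scale[OF x]) simp
    also have "nrm (X i) + nrm x \<le> sqrt D + sqrt D" by (intro add_mono real_sqrt_le_mono D nx)
    finally have "nrm (y i) \<le> 2 * sqrt D" by (simp add: y_def[abs_def])
    hence "(nrm (y i))\<^sup>2 \<le> (2 * sqrt D)\<^sup>2" using nsq_nonneg by (intro power_mono) auto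
    thus ?thesis using D0 nsq_nonneg by (simp add: power_mult_distrib)
  qed
  define b where "b k = (if k \<ge> 1 then 1 / (z - \<gamma> k) else 0)" for k
  have b: "b \<in> \<H>"
  proof -
    have "(\<lambda>k. (cmod (b k))\<^sup>2 * v k) summable_on {1..} \<longleftrightarrow> (\<lambda>k. v k / (cmod (z - \<gamma> k))\<^sup>2) summable_on {1..}"
      by (intro summable_on_cong) (simp add: b_def norm_divide power_divide)
    thus ?thesis using kernel_summable[OF z] by (simp add: l2_iff b_def)
  qed
  have "(\<lambda>i. f (y i) z) \<longlonglongrightarrow> 0"
  proof (rule LIMSEQ_I)
    fix e :: real assume e: "e > 0"
    have "(\<lambda>K. 4 * D * nsq v (\<lambda>k. if k > K then b k else 0)) \<longlonglongrightarrow> 4 * D * 0"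
      by (intro tendsto_intros nsq_tail_tendsto_0 b)
    moreover have "4 * D * 0 < (e / 2)\<^sup>2" using e by simp
    ultimately have "\<forall>\<^sub>F K in sequentially. 4 * D * nsq v (\<lambda>k. if k > K then b k else 0) < (e / 2)\<^sup>2"
      by (rule order_tendstoD(2))
    then obtain K where K: "4 * D * nsq v (\<lambda>k. if k > K then b k else 0) < (e / 2)\<^sup>2"
      by (auto simp: eventually_sequentially)
    define y1 where "y1 i k = (if k \<in> {1..K} then y i k else 0)" for i k
    define y2 where "y2 i k = (if k > K then y i k else 0)" for i k
    have y1: "y1 i \<in> \<H>" "f (y1 i) z = (\<Sum>k\<in>{1..K}. y1 i k * of_real (v k) / (z - \<gamma> k))" for i
    proof -
      have "y1 i k = 0" if "k \<notin> {1..K}" for i k unfolding y1_def using that by (rule if_not_P)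
      note finite_support[of K "y1 i", OF this]
      thus "y1 i \<in> \<H>" "f (y1 i) z = (\<Sum>k\<in>{1..K}. y1 i k * of_real (v k) / (z - \<gamma> k))" by blast+
    qed
    have y2: "y2 i \<in> \<H>" "nsq v (y2 i) \<le> 4 * D" for i
    proof -
      show "y2 i \<in> \<H>" unfolding y2_def by (rule l2_tail[OF y])
      have "nsq v (y2 i) = nsq v (y i) - (\<Sum>k\<in>{1..K}. (cmod (y i k))\<^sup>2 * v k)"
        unfolding y2_def by (rule l2_tail[OF y])
      moreover have "(\<Sum>k\<in>{1..K}. (cmod (y i k))\<^sup>2 * v k) \<ge> 0" by (intro sum_nonneg l2_term_nonneg) auto
      ultimately show "nsq v (y2 i) \<le> 4 * D" using ny[of i] by linarith
    qed
    have "y i = (\<lambda>k. y1 i k + y2 i k)" for i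
    proof
      fix k
      show "y i k = y1 i k + y2 i k"
        using y[of i] by (cases "k = 0") (auto simp: y1_def y2_def l2_iff)
    qed
    hence split: "f (y i) z = f (y1 i) z + f (y2 i) z" for i
      using hilb_add[OF y1(1)[of i] y2(1)[of i] z] by simp
    have small: "cmod (f (y2 i) z) < e / 2" for i
    proof -
      have "f (y2 i) z = (\<Sum>\<^sub>\<infinity>k\<in>{1..}. y2 i k * of_real (v k) * (if k > K then b k else 0))"
        unfolding Hilb_def by (intro infsum_cong) (auto simp: y2_def b_def)
      also have "(cmod \<dots>)\<^sup>2 \<le> nsq v (y2 i) * nsq v (\<lambda>k. if k > K then b k else 0)"
        unfolding nsq_def[of v "\<lambda>k. if k > K then b k else 0"] using l2_tail(1)[OF b, of K]
        by (intro cauchy_schwarz_H y2) (simp add: l2_iff)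
      also have "\<dots> \<le> 4 * D * nsq v (\<lambda>k. if k > K then b k else 0)"
        by (intro mult_right_mono y2 nsq_nonneg)
      also have "\<dots> < (e / 2)\<^sup>2" by (rule K)
      finally show ?thesis by (rule power2_less_imp_less) (use e in simp)
    qed
    have "(\<lambda>i. y i k) \<longlonglongrightarrow> x k - x k" for k unfolding y_def by (intro tendsto_intros lim)
    hence "(\<lambda>i. y1 i k) \<longlonglongrightarrow> 0" for k by (cases "k \<in> {1..K}") (auto simp: y1_def)
    hence "(\<lambda>i. \<Sum>k\<in>{1..K}. y1 i k * (of_real (v k) / (z - \<gamma> k))) \<longlonglongrightarrow> (\<Sum>k\<in>{1..K}. 0 * (of_real (v k) / (z - \<gamma> k)))"
      by (intro tendsto_sum tendsto_mult tendsto_const)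
    hence "(\<lambda>i. f (y1 i) z) \<longlonglongrightarrow> 0" by (simp add: y1)
    from LIMSEQ_D[OF this half_gt_zero[OF e]] obtain i0 where i0: "\<And>i. i \<ge> i0 \<Longrightarrow> cmod (f (y1 i) z) < e / 2" by auto
    show "\<exists>i0. \<forall>i\<ge>i0. norm (f (y i) z - 0) < e"
    proof (intro exI allI impI)
      fix i assume "i \<ge> i0"
      have "norm (f (y i) z - 0) \<le> cmod (f (y1 i) z) + cmod (f (y2 i) z)"
        unfolding split by (simp add: norm_triangle_ineq)
      thus "norm (f (y i) z - 0) < e" using i0[OF \<open>i \<ge> i0\<close>] small[of i] by simp
    qed
  qed
  hence "(\<lambda>i. f (y i) z + f x z) \<longlonglongrightarrow> 0 + f x z" by (intro tendsto_intros)
  moreover have "f (y i) z + f x z = f (X i) z" for i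
    unfolding y_def using hilb_diff[OF X x z] by simp
  ultimately show "(\<lambda>i. f (X i) z) \<longlonglongrightarrow> f x z" by simp
qed

end

section \<open>Finite sections: Cauchy matrices and their inverses\<close>

context perturbed
begin

text \<open>The derivative at \<lambda>_n of the product of the z - \<lambda>_j, n0 \<le> j \<le> N,
  over the product of the z - \<gamma>_j, 1 \<le> j \<le> N; its reciprocal normalizes the
  interpolating function at \<lambda>_n.\<close>

definition nodal :: "nat \<Rightarrow> nat \<Rightarrow> complex" where
  "nodal N n = (\<Prod>j\<in>{n0..N} - {n}. l n - l j) / (\<Prod>j\<in>{1..N}. l n - \<gamma> j)"

text \<open>Up to sign the inverse of the Cauchy matrix 1 / (\<lambda>_n - \<gamma>_k) when
  \<open>n0 = 1\<close>. When \<open>n0 = 0\<close> that matrix has one more row than columns, and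
  this is a left inverse.\<close>

definition Tm :: "nat \<Rightarrow> nat \<Rightarrow> nat \<Rightarrow> complex" where
  "Tm N k n = ((\<Prod>j\<in>{1..N} - {k}. l n - \<gamma> j) / (\<Prod>j\<in>{n0..N} - {n}. l n - l j)) *
     ((\<Prod>j\<in>{n0..N}. \<gamma> k - l j) / (\<Prod>j\<in>{1..N} - {k}. \<gamma> k - \<gamma> j))"

lemma inj_l: "inj_on l {n0..N}"
  using l_inj by (rule inj_on_subset) auto

lemma inj_gamma: "inj_on \<gamma> {1..N}"
  using gamma_inj by (rule inj_on_subset) auto

lemma nodal_nz: "n \<in> {n0..N} \<Longrightarrow> nodal N n \<noteq> 0"
  using l_neq l_disj by (auto simp: nodal_def)

text \<open>The rational function \<phi> has poles at the \<lambda>_n and zeros at all \<gamma>_j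
  with j \<noteq> k. Summing the transform against its residues therefore leaves only the k-th
  coordinate.\<close>

lemma left_inverse:
  assumes a: "\<And>j. j \<notin> {1..N} \<Longrightarrow> a j = 0" and k: "k \<in> {1..N}"
  shows "a k * of_real (v k) = - (\<Sum>n\<in>{n0..N}. Tm N k n * f a (l n))"
proof -
  define \<delta> where "\<delta> n = (\<Prod>j\<in>{1..N} - {k}. l n - \<gamma> j) / (\<Prod>j\<in>{n0..N} - {n}. l n - l j)" for n
  define \<phi> where "\<phi> z = (\<Prod>j\<in>{1..N} - {k}. z - \<gamma> j) / (\<Prod>j\<in>{n0..N}. z - l j)" for z
  have \<phi>: "\<phi> z = (\<Sum>n\<in>{n0..N}. \<delta> n / (z - l n))" if "z \<notin> l ` {n0..N}" for z
  proof -
    have cl: "card ({1..N} - {k}) < card {n0..N}" using k n0 by (cases "n0 = 0") auto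
    show ?thesis
      using partial_fractions[OF _ _ inj_l less_imp_le[OF cl] that, of \<gamma>] cl by (simp add: \<phi>_def \<delta>_def)
  qed
  have \<gamma>l: "\<gamma> j \<notin> l ` {n0..N}" if "j \<ge> 1" for j
  proof
    assume "\<gamma> j \<in> l ` {n0..N}"
    then obtain n where "n \<ge> n0" "\<gamma> j = l n" by auto
    thus False using l_disj[of n j] that by simp
  qed
  have \<phi>0: "\<phi> (\<gamma> j) = 0" if "j \<in> {1..N} - {k}" for j
  proof -
    have "(\<Prod>i\<in>{1..N} - {k}. \<gamma> j - \<gamma> i) = 0" using that by (intro prod_zero) auto
    thus ?thesis by (simp add: \<phi>_def)
  qed
  have sum_neg: "(\<Sum>n\<in>{n0..N}. \<delta> n / (l n - \<gamma> j)) = - \<phi> (\<gamma> j)" if "j \<ge> 1" for j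
  proof -
    have "(\<Sum>n\<in>{n0..N}. \<delta> n / (l n - \<gamma> j)) = (\<Sum>n\<in>{n0..N}. - (\<delta> n / (\<gamma> j - l n)))"
      by (intro sum.cong refl) (metis minus_diff_eq divide_minus_right)
    thus ?thesis unfolding \<phi>[OF \<gamma>l[OF that]] by (simp add: sum_negf)
  qed
  have fs: "f a u = (\<Sum>k\<in>{1..N}. a k * of_real (v k) / (u - \<gamma> k))" for u
    by (rule finite_support, rule a, assumption)
  have "(\<Sum>n\<in>{n0..N}. \<delta> n * f a (l n)) = (\<Sum>j\<in>{1..N}. a j * of_real (v j) * (\<Sum>n\<in>{n0..N}. \<delta> n / (l n - \<gamma> j)))"
  proof -
    have "(\<Sum>n\<in>{n0..N}. \<delta> n * f a (l n)) = (\<Sum>n\<in>{n0..N}. \<Sum>j\<in>{1..N}. a j * of_real (v j) * (\<delta> n / (l n - \<gamma> j)))"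
      unfolding fs sum_distrib_left by (intro sum.cong refl) simp
    also have "\<dots> = (\<Sum>j\<in>{1..N}. \<Sum>n\<in>{n0..N}. a j * of_real (v j) * (\<delta> n / (l n - \<gamma> j)))"
      by (rule sum.swap)
    finally show ?thesis by (simp only: sum_distrib_left)
  qed
  also have "\<dots> = (\<Sum>j\<in>{1..N}. - (a j * of_real (v j) * \<phi> (\<gamma> j)))"
    by (intro sum.cong refl) (simp add: sum_neg)
  also have "\<dots> = (\<Sum>j\<in>{k}. - (a j * of_real (v j) * \<phi> (\<gamma> j)))"
    using k \<phi>0 by (intro sum.mono_neutral_right) auto
  finally have main: "(\<Sum>n\<in>{n0..N}. \<delta> n * f a (l n)) = - (a k * of_real (v k) * \<phi> (\<gamma> k))" by simp
  have \<phi>nz: "\<phi> (\<gamma> k) \<noteq> 0"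
  proof -
    have "(\<Prod>j\<in>{1..N} - {k}. \<gamma> k - \<gamma> j) \<noteq> 0" using k gamma_neq[of k] by auto
    moreover have "(\<Prod>j\<in>{n0..N}. \<gamma> k - l j) \<noteq> 0" using k \<gamma>l[of k] by auto
    ultimately show ?thesis by (simp add: \<phi>_def)
  qed
  have "Tm N k n = \<delta> n * inverse (\<phi> (\<gamma> k))" for n
    by (simp add: Tm_def \<delta>_def \<phi>_def)
  hence "(\<Sum>n\<in>{n0..N}. Tm N k n * f a (l n)) = (\<Sum>n\<in>{n0..N}. inverse (\<phi> (\<gamma> k)) * (\<delta> n * f a (l n)))"
    by (intro sum.cong refl) simp
  also have "\<dots> = inverse (\<phi> (\<gamma> k)) * (\<Sum>n\<in>{n0..N}. \<delta> n * f a (l n))"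
    by (rule sum_distrib_left[symmetric])
  also have "\<dots> = - (a k * of_real (v k))" unfolding main using \<phi>nz by simp
  finally show ?thesis by simp
qed

text \<open>The function with zeros at all \<lambda>_j, j \<noteq> n, and poles at the \<gamma>_k is
  expanded in partial fractions and evaluated at \<lambda>_m. If \<open>n0 = 0\<close> it has as
  many zeros as poles, and the constant of the expansion becomes the second sum: the system is then
  solved up to an additive constant.\<close>

lemma right_inverse:
  assumes m: "m \<in> {n0..N}"
  shows "(\<Sum>k\<in>{1..N}. - (\<Sum>n\<in>{n0..N}. Tm N k n * b n) / (l m - \<gamma> k)) +
    (if n0 = 0 then (\<Sum>n\<in>{n0..N}. b n / nodal N n) else 0) = b m"
proof -
  define \<epsilon> :: complex where "\<epsilon> = (if n0 = 0 then 1 else 0)"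
  define r where "r n k = (\<Prod>j\<in>{n0..N} - {n}. \<gamma> k - l j) / (\<Prod>j\<in>{1..N} - {k}. \<gamma> k - \<gamma> j)" for n k
  have lm: "l m \<notin> \<gamma> ` {1..N}" using l_disj m by auto
  have pf: "(if n = m then nodal N n else 0) = \<epsilon> + (\<Sum>k\<in>{1..N}. r n k / (l m - \<gamma> k))" if n: "n \<in> {n0..N}" for n
  proof -
    have card: "card ({n0..N} - {n}) = N - n0" using n by simp
    have eps: "(if card ({n0..N} - {n}) = card {1..N} then 1 else 0) = \<epsilon>"
    proof (cases "n0 = 0")
      case False
      hence "n0 = 1" "N \<ge> 1" using n n0 by auto
      hence "N - n0 \<noteq> N" by simp
      thus ?thesis using False card by (simp add: \<epsilon>_def)
    qed (use card in \<open>simp add: \<epsilon>_def\<close>)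
    have "(\<Prod>j\<in>{n0..N} - {n}. l m - l j) / (\<Prod>j\<in>{1..N}. l m - \<gamma> j) = \<epsilon> + (\<Sum>k\<in>{1..N}. r n k / (l m - \<gamma> k))"
      unfolding r_def eps[symmetric] using card lm by (intro partial_fractions inj_gamma) auto
    moreover have "(\<Prod>j\<in>{n0..N} - {n}. l m - l j) / (\<Prod>j\<in>{1..N}. l m - \<gamma> j) = (if n = m then nodal N n else 0)"
    proof (cases "n = m")
      case False
      have "(\<Prod>j\<in>{n0..N} - {n}. l m - l j) = 0" using False m by (intro prod_zero) auto
      thus ?thesis using False by simp
    qed (simp add: nodal_def)
    ultimately show ?thesis by simp
  qed
  have Tr: "r n k / nodal N n = - Tm N k n" if n: "n \<in> {n0..N}" and k: "k \<in> {1..N}" for n k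
  proof -
    have 1: "(\<Prod>j\<in>{n0..N}. \<gamma> k - l j) = - (l n - \<gamma> k) * (\<Prod>j\<in>{n0..N} - {n}. \<gamma> k - l j)"
      using n by (simp add: prod.remove)
    have 2: "(\<Prod>j\<in>{1..N}. l n - \<gamma> j) = (l n - \<gamma> k) * (\<Prod>j\<in>{1..N} - {k}. l n - \<gamma> j)"
      using k by (simp add: prod.remove)
    have "A / D1 / (D2 / (x * E)) = - (E / D2 * (- x * A / D1))" for A D1 D2 E x :: complex by (simp add: mult_ac)
    thus ?thesis unfolding Tm_def r_def nodal_def 1 2 by blast
  qed
  have "b m = (\<Sum>n\<in>{n0..N}. b n / nodal N n * (if n = m then nodal N n else 0))"
    using m nodal_nz[OF m] by (simp add: sum.delta if_distrib cong: if_cong)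
  also have "\<dots> = (\<Sum>n\<in>{n0..N}. b n / nodal N n * (\<epsilon> + (\<Sum>k\<in>{1..N}. r n k / (l m - \<gamma> k))))"
    by (intro sum.cong refl) (simp only: pf)
  also have "\<dots> = (\<Sum>n\<in>{n0..N}. b n / nodal N n * \<epsilon>) + (\<Sum>n\<in>{n0..N}. \<Sum>k\<in>{1..N}. b n * (r n k / nodal N n) / (l m - \<gamma> k))"
    by (simp add: distrib_left sum.distrib sum_distrib_left mult_ac)
  also have "(\<Sum>n\<in>{n0..N}. \<Sum>k\<in>{1..N}. b n * (r n k / nodal N n) / (l m - \<gamma> k))
      = (\<Sum>n\<in>{n0..N}. \<Sum>k\<in>{1..N}. b n * (- Tm N k n) / (l m - \<gamma> k))"
    by (intro sum.cong refl) (simp only: Tr)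
  also have "\<dots> = (\<Sum>k\<in>{1..N}. - (\<Sum>n\<in>{n0..N}. Tm N k n * b n) / (l m - \<gamma> k))"
    by (subst sum.swap) (simp add: sum_divide_distrib sum_negf mult_ac)
  finally show ?thesis by (simp add: \<epsilon>_def)
qed

text \<open>\<open>MB\<close> bounds the inverse sections, \<open>FB\<close> the transform, and
  \<open>CL\<close> the constant left over when \<open>n0 = 0\<close>. The left inverse requires
  finite support, so the lower bound is proved for truncations and \<open>FB\<close> removes the
  tails. For surjectivity, \<open>MB\<close> bounds the solutions of the finite systems and a weak
  limit solves the full one.\<close>

lemma sufficient_core:
  assumes MB: "\<And>N x. (\<And>n. x n \<ge> 0) \<Longrightarrow>
      (\<Sum>k\<in>{1..N}. (\<Sum>n\<in>{n0..N}. cmod (Tm N k n) * x n)\<^sup>2 / v k) \<le> C * (\<Sum>n\<in>{n0..N}. (x n)\<^sup>2 * w (l n))"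
    and FB: "\<And>N a. a \<in> \<H> \<Longrightarrow> (\<Sum>n\<in>{n0..N}. (cmod (f a (l n)))\<^sup>2 * w (l n)) \<le> C' * nsq v a"
    and CL: "n0 = 0 \<Longrightarrow> (\<lambda>N. \<Sum>n\<in>{n0..N}. 1 / ((cmod (nodal N n))\<^sup>2 * w (l n))) \<longlonglongrightarrow> 0"
    and C: "C \<ge> 0"
  shows "hilb_invertible_on \<gamma> v (l ` {n0..})"
proof -
  define L where "L = l ` {n0..}"
  have fin_sub: "\<exists>N. F \<subseteq> l ` {n0..N}" if F: "finite F" "F \<subseteq> L" for F
  proof -
    obtain K where K: "K \<subseteq> {n0..}" "finite K" "F = l ` K"
      using finite_subset_image[OF F(1) F(2)[unfolded L_def]] by blast
    have "K \<subseteq> {n0..Max (insert 0 K)}" using K by auto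
    hence "F \<subseteq> l ` {n0..Max (insert 0 K)}" unfolding K(3) by (rule image_mono)
    thus ?thesis by blast
  qed
  have wL: "w z \<ge> 0" if z: "z \<in> L" for z
  proof -
    obtain n where "n \<ge> n0" "z = l n" using z by (auto simp: L_def)
    thus ?thesis using w_l_pos[of n] by simp
  qed
  have sum_l: "(\<Sum>z\<in>l ` {n0..N}. e z) = (\<Sum>n\<in>{n0..N}. e (l n))" for e :: "complex \<Rightarrow> real" and N
    by (subst sum.reindex[OF inj_l]) simp
  have lower_sum: "(\<Sum>n\<in>{n0..N}. e (l n)) \<le> infsum e L" if "e summable_on L" "\<And>z. z \<in> L \<Longrightarrow> e z \<ge> 0" for e :: "complex \<Rightarrow> real" and N
    unfolding sum_l[symmetric] using that by (intro finite_sum_le_infsum) (auto simp: L_def)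
  have Asum: "(\<lambda>z. (cmod (f a z))\<^sup>2 * w z) summable_on L" if a: "a \<in> \<H>" for a
  proof (rule sum_le_bound_summable(1))
    fix F assume F: "finite F" "F \<subseteq> L"
    obtain N where N: "F \<subseteq> l ` {n0..N}" using fin_sub[OF F] by blast
    have "(\<Sum>z\<in>F. (cmod (f a z))\<^sup>2 * w z) \<le> (\<Sum>z\<in>l ` {n0..N}. (cmod (f a z))\<^sup>2 * w z)"
      using N wL by (intro sum_mono2) (auto simp: L_def)
    also have "\<dots> \<le> C' * nsq v a" unfolding sum_l by (rule FB[OF a])
    finally show "(\<Sum>z\<in>F. (cmod (f a z))\<^sup>2 * w z) \<le> C' * nsq v a" .
  qed (use wL in auto)
  have below: "nsq v a \<le> 2 * C * (\<Sum>\<^sub>\<infinity>z\<in>L. (cmod (f a z))\<^sup>2 * w z)" if a: "a \<in> \<H>" for a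
  proof -
    define I where "I = (\<Sum>\<^sub>\<infinity>z\<in>L. (cmod (f a z))\<^sup>2 * w z)"
    define t where "t N k = (if k > N then a k else 0)" for N k
    have t: "t N \<in> \<H>" for N unfolding t_def by (rule l2_tail[OF a])
    have "nsq v a - nsq v (t N) \<le> 2 * C * I + 2 * C * (C' * nsq v (t N))" for N
    proof -
      define a' where "a' k = (if k \<in> {1..N} then a k else 0)" for k
      have a'0: "a' k = 0" if "k \<notin> {1..N}" for k unfolding a'_def using that by (rule if_not_P)
      have at: "a' = (\<lambda>k. a k - t N k)"
      proof
        fix k
        show "a' k = a k - t N k" using a by (cases "k = 0") (auto simp: a'_def t_def l2_iff)
      qed
      have "nsq v a - nsq v (t N) = (\<Sum>k\<in>{1..N}. (cmod (a k))\<^sup>2 * v k)"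
        using l2_tail(2)[OF a, of N] by (simp add: t_def[abs_def])
      also have "\<dots> \<le> (\<Sum>k\<in>{1..N}. (\<Sum>n\<in>{n0..N}. cmod (Tm N k n) * cmod (f a' (l n)))\<^sup>2 / v k)"
      proof (rule sum_mono)
        fix k assume k: "k \<in> {1..N}"
        have vk: "v k > 0" using v_pos k by simp
        have li: "a' k * of_real (v k) = - (\<Sum>n\<in>{n0..N}. Tm N k n * f a' (l n))"
          by (rule left_inverse[OF _ k], rule a'0)
        have "cmod (a' k * of_real (v k)) \<le> (\<Sum>n\<in>{n0..N}. cmod (Tm N k n) * cmod (f a' (l n)))"
          unfolding li norm_minus_cancel norm_mult[symmetric] by (rule norm_sum)
        hence "(cmod (a' k * of_real (v k)))\<^sup>2 \<le> (\<Sum>n\<in>{n0..N}. cmod (Tm N k n) * cmod (f a' (l n)))\<^sup>2"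
          by (intro power_mono) auto
        hence "(cmod (a' k * of_real (v k)))\<^sup>2 / v k \<le> (\<Sum>n\<in>{n0..N}. cmod (Tm N k n) * cmod (f a' (l n)))\<^sup>2 / v k"
          using vk by (intro divide_right_mono) auto
        thus "(cmod (a k))\<^sup>2 * v k \<le> (\<Sum>n\<in>{n0..N}. cmod (Tm N k n) * cmod (f a' (l n)))\<^sup>2 / v k"
          using vk k by (simp add: a'_def norm_mult power_mult_distrib power2_eq_square)
      qed
      also have "\<dots> \<le> C * (\<Sum>n\<in>{n0..N}. (cmod (f a' (l n)))\<^sup>2 * w (l n))" by (rule MB) simp
      also have "\<dots> \<le> C * (\<Sum>n\<in>{n0..N}. 2 * ((cmod (f a (l n)))\<^sup>2 * w (l n)) + 2 * ((cmod (f (t N) (l n)))\<^sup>2 * w (l n)))"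
      proof (intro mult_left_mono C sum_mono)
        fix n assume n: "n \<in> {n0..N}"
        have "f a' (l n) = f a (l n) - f (t N) (l n)"
          unfolding at using n l_notin by (intro hilb_diff a t) auto
        hence "cmod (f a' (l n)) \<le> cmod (f a (l n)) + cmod (f (t N) (l n))" by (simp add: norm_triangle_ineq4)
        hence "(cmod (f a' (l n)))\<^sup>2 \<le> (cmod (f a (l n)) + cmod (f (t N) (l n)))\<^sup>2" by (intro power_mono) auto
        also have "\<dots> \<le> 2 * (cmod (f a (l n)))\<^sup>2 + 2 * (cmod (f (t N) (l n)))\<^sup>2" by (rule sq_sum_le)
        finally have "(cmod (f a' (l n)))\<^sup>2 * w (l n) \<le> (2 * (cmod (f a (l n)))\<^sup>2 + 2 * (cmod (f (t N) (l n)))\<^sup>2) * w (l n)"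
          using w_l_pos[of n] n by (intro mult_right_mono) auto
        thus "(cmod (f a' (l n)))\<^sup>2 * w (l n) \<le> 2 * ((cmod (f a (l n)))\<^sup>2 * w (l n)) + 2 * ((cmod (f (t N) (l n)))\<^sup>2 * w (l n))"
          by (simp add: algebra_simps)
      qed
      also have "\<dots> = 2 * C * (\<Sum>n\<in>{n0..N}. (cmod (f a (l n)))\<^sup>2 * w (l n)) + 2 * C * (\<Sum>n\<in>{n0..N}. (cmod (f (t N) (l n)))\<^sup>2 * w (l n))"
        by (simp add: sum.distrib sum_distrib_left[symmetric] algebra_simps)
      also have "\<dots> \<le> 2 * C * I + 2 * C * (C' * nsq v (t N))"
      proof (intro add_mono mult_left_mono FB t)
        show "(\<Sum>n\<in>{n0..N}. (cmod (f a (l n)))\<^sup>2 * w (l n)) \<le> I"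
          unfolding I_def by (rule lower_sum[OF Asum[OF a]]) (use wL in auto)
      qed (use C in auto)
      finally show ?thesis .
    qed
    moreover have "(\<lambda>N. nsq v a - nsq v (t N)) \<longlonglongrightarrow> nsq v a - 0"
      unfolding t_def by (intro tendsto_intros nsq_tail_tendsto_0 a)
    moreover have "(\<lambda>N. 2 * C * I + 2 * C * (C' * nsq v (t N))) \<longlonglongrightarrow> 2 * C * I + 2 * C * (C' * 0)"
      unfolding t_def by (intro tendsto_intros nsq_tail_tendsto_0 a)
    ultimately have "nsq v a - 0 \<le> 2 * C * I + 2 * C * (C' * 0)"
      by (intro LIMSEQ_le) auto
    thus ?thesis by (simp add: I_def)
  qed
  have surj: "\<exists>a\<in>\<H>. \<forall>z\<in>L. f a z = b z" if b: "(\<lambda>z. (cmod (b z))\<^sup>2 * w z) summable_on L" for b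
  proof -
    define I where "I = (\<Sum>\<^sub>\<infinity>z\<in>L. (cmod (b z))\<^sup>2 * w z)"
    have bI: "(\<Sum>n\<in>{n0..N}. (cmod (b (l n)))\<^sup>2 * w (l n)) \<le> I" for N
      unfolding I_def by (rule lower_sum[OF b]) (use wL in auto)
    define X where "X N k = (if k \<in> {1..N} then - (\<Sum>n\<in>{n0..N}. Tm N k n * b (l n)) / of_real (v k) else 0)" for N k
    have X0: "X N k = 0" if "k \<notin> {1..N}" for N k unfolding X_def using that by (rule if_not_P)
    have X: "X N \<in> \<H>" "nsq v (X N) = (\<Sum>k\<in>{1..N}. (cmod (X N k))\<^sup>2 * v k)"
      "f (X N) u = (\<Sum>k\<in>{1..N}. X N k * of_real (v k) / (u - \<gamma> k))" for N u
      by (rule finite_support, rule X0, assumption)+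
    have nX: "nsq v (X N) \<le> C * I" for N
    proof -
      have "nsq v (X N) \<le> (\<Sum>k\<in>{1..N}. (\<Sum>n\<in>{n0..N}. cmod (Tm N k n) * cmod (b (l n)))\<^sup>2 / v k)"
        unfolding X(2)
      proof (rule sum_mono)
        fix k assume k: "k \<in> {1..N}"
        have vk: "v k > 0" using v_pos k by simp
        have "cmod (\<Sum>n\<in>{n0..N}. Tm N k n * b (l n)) \<le> (\<Sum>n\<in>{n0..N}. cmod (Tm N k n) * cmod (b (l n)))"
          unfolding norm_mult[symmetric] by (rule norm_sum)
        hence "(cmod (\<Sum>n\<in>{n0..N}. Tm N k n * b (l n)))\<^sup>2 / v k \<le> (\<Sum>n\<in>{n0..N}. cmod (Tm N k n) * cmod (b (l n)))\<^sup>2 / v k"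
          using vk by (intro divide_right_mono power_mono) auto
        moreover have "(cmod (X N k))\<^sup>2 * v k = (cmod (\<Sum>n\<in>{n0..N}. Tm N k n * b (l n)))\<^sup>2 / v k"
          using k vk by (simp add: X_def norm_divide power_divide power2_eq_square)
        ultimately show "(cmod (X N k))\<^sup>2 * v k \<le> (\<Sum>n\<in>{n0..N}. cmod (Tm N k n) * cmod (b (l n)))\<^sup>2 / v k" by simp
      qed
      also have "\<dots> \<le> C * (\<Sum>n\<in>{n0..N}. (cmod (b (l n)))\<^sup>2 * w (l n))" by (rule MB) simp
      also have "\<dots> \<le> C * I" by (intro mult_left_mono bI C)
      finally show ?thesis .
    qed
    define cN where "cN N = (if n0 = 0 then (\<Sum>n\<in>{n0..N}. b (l n) / nodal N n) else 0)" for N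
    have fX: "f (X N) (l m) + cN N = b (l m)" if m: "m \<in> {n0..N}" for N m
    proof -
      have "f (X N) (l m) = (\<Sum>k\<in>{1..N}. - (\<Sum>n\<in>{n0..N}. Tm N k n * b (l n)) / (l m - \<gamma> k))"
        unfolding X(3)
      proof (rule sum.cong[OF refl])
        fix k assume k: "k \<in> {1..N}"
        hence "of_real (v k) \<noteq> (0 :: complex)" using v_pos[of k] by simp
        thus "X N k * of_real (v k) / (l m - \<gamma> k) = - (\<Sum>n\<in>{n0..N}. Tm N k n * b (l n)) / (l m - \<gamma> k)"
          using k by (simp add: X_def)
      qed
      thus ?thesis using right_inverse[OF m, of "\<lambda>n. b (l n)"] by (simp add: cN_def)
    qed
    \<comment> \<open>Cauchy-Schwarz separates the data, of finite energy, from the reciprocals of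
      \<open>nodal\<close>, whose energy tends to 0 by \<open>CL\<close>.\<close>
    have cN0: "cN \<longlonglongrightarrow> 0"
    proof (cases "n0 = 0")
      case True
      have "norm (cN N) \<le> sqrt (I * (\<Sum>n\<in>{n0..N}. 1 / ((cmod (nodal N n))\<^sup>2 * w (l n))))" for N
      proof -
        have "norm (cN N) \<le> (\<Sum>n\<in>{n0..N}. cmod (b (l n) / nodal N n))"
          using True by (simp add: cN_def norm_sum)
        also have "\<dots> = (\<Sum>n\<in>{n0..N}. \<bar>(cmod (b (l n)) * sqrt (w (l n))) * (1 / (cmod (nodal N n) * sqrt (w (l n))))\<bar>)"
          using w_l_pos by (intro sum.cong refl) (auto simp: norm_divide abs_mult less_imp_neq[THEN not_sym])
        also have "\<dots> \<le> sqrt (\<Sum>n\<in>{n0..N}. (cmod (b (l n)) * sqrt (w (l n)))\<^sup>2) * sqrt (\<Sum>n\<in>{n0..N}. (1 / (cmod (nodal N n) * sqrt (w (l n))))\<^sup>2)"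
          by (rule cauchy_schwarz_finite)
        also have "(\<Sum>n\<in>{n0..N}. (cmod (b (l n)) * sqrt (w (l n)))\<^sup>2) = (\<Sum>n\<in>{n0..N}. (cmod (b (l n)))\<^sup>2 * w (l n))"
          using w_l_pos by (intro sum.cong refl) (auto simp: power_mult_distrib less_imp_le)
        also have "(\<Sum>n\<in>{n0..N}. (1 / (cmod (nodal N n) * sqrt (w (l n))))\<^sup>2) = (\<Sum>n\<in>{n0..N}. 1 / ((cmod (nodal N n))\<^sup>2 * w (l n)))"
          using w_l_pos by (intro sum.cong refl) (auto simp: power_mult_distrib power_divide less_imp_le)
        also have "sqrt (\<Sum>n\<in>{n0..N}. (cmod (b (l n)))\<^sup>2 * w (l n)) * sqrt (\<Sum>n\<in>{n0..N}. 1 / ((cmod (nodal N n))\<^sup>2 * w (l n)))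
            \<le> sqrt I * sqrt (\<Sum>n\<in>{n0..N}. 1 / ((cmod (nodal N n))\<^sup>2 * w (l n)))"
          by (intro mult_right_mono real_sqrt_le_mono bI real_sqrt_ge_zero sum_nonneg)
            (auto intro!: divide_nonneg_nonneg mult_nonneg_nonneg less_imp_le[OF w_l_pos])
        finally show ?thesis by (simp add: real_sqrt_mult)
      qed
      moreover have "(\<lambda>N. sqrt (I * (\<Sum>n\<in>{n0..N}. 1 / ((cmod (nodal N n))\<^sup>2 * w (l n))))) \<longlonglongrightarrow> sqrt (I * 0)"
        by (intro tendsto_intros CL True)
      ultimately show ?thesis by (intro Lim_null_comparison[of cN]) (auto intro: always_eventually)
    next
      case False
      hence "cN = (\<lambda>_. 0)" by (simp add: cN_def fun_eq_iff)
      thus ?thesis by simp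
    qed
    \<comment> \<open>The factor \<open>sqrt (v k)\<close> gives all coordinates a common bound, as
      the diagonal extraction of a convergent subsequence requires.\<close>
    have bnd: "norm (of_real (sqrt (v k)) * X N k) \<le> sqrt (C * I)" if "k \<in> {1..}" for N k
    proof -
      have "(cmod (X N k))\<^sup>2 * v k \<le> nsq v (X N)" using nsq_ge_sum[OF X(1), of "{k}" N] that by simp
      hence "(cmod (X N k))\<^sup>2 * v k \<le> C * I" using nX[of N] by linarith
      hence "sqrt ((cmod (X N k))\<^sup>2 * v k) \<le> sqrt (C * I)" by (rule real_sqrt_le_mono)
      thus ?thesis using v_pos[of k] that by (simp add: norm_mult real_sqrt_mult mult.commute)
    qed
    obtain \<sigma> where \<sigma>: "strict_mono (\<sigma> :: nat \<Rightarrow> nat)" "\<And>k. k \<in> {1..} \<Longrightarrow> \<exists>y. (\<lambda>i. of_real (sqrt (v k)) * X (\<sigma> i) k) \<longlonglongrightarrow> y"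
      using function_convergent_subsequence[of "{1::nat..}" "\<lambda>N k. of_real (sqrt (v k)) * X N k" "sqrt (C * I)"] bnd by auto
    have "\<exists>y. (\<lambda>i. X (\<sigma> i) k) \<longlonglongrightarrow> y" for k
    proof (cases "k \<ge> 1")
      case True
      then obtain y where "(\<lambda>i. of_real (sqrt (v k)) * X (\<sigma> i) k) \<longlonglongrightarrow> y" using \<sigma>(2)[of k] by auto
      hence "(\<lambda>i. of_real (sqrt (v k)) * X (\<sigma> i) k / of_real (sqrt (v k))) \<longlonglongrightarrow> y / of_real (sqrt (v k))"
        using v_pos[OF True] by (intro tendsto_intros) auto
      thus ?thesis using v_pos[OF True] by auto
    next
      case False
      thus ?thesis using X0 by (intro exI[of _ 0]) simp
    qed
    then obtain x where x: "\<And>k. (\<lambda>i. X (\<sigma> i) k) \<longlonglongrightarrow> x k" by metis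
    note wl = weak_limit[of "\<lambda>i. X (\<sigma> i)", OF X(1) nX x]
    have "f x z = b z" if z: "z \<in> L" for z
    proof -
      obtain m where m: "m \<ge> n0" "z = l m" using z by (auto simp: L_def)
      have "(\<lambda>i. f (X (\<sigma> i)) z + cN (\<sigma> i)) \<longlonglongrightarrow> f x z + 0"
        using wl(3)[of z] l_notin[OF m(1)] m(2) LIMSEQ_subseq_LIMSEQ[OF cN0 \<sigma>(1)]
        by (intro tendsto_intros) (auto simp: o_def)
      moreover have "\<forall>\<^sub>F i in sequentially. f (X (\<sigma> i)) z + cN (\<sigma> i) = b z"
        using eventually_ge_at_top[of m]
      proof eventually_elim
        case (elim i)
        hence "m \<le> \<sigma> i" using seq_suble[OF \<sigma>(1), of i] by linarith
        thus ?case using fX[of m "\<sigma> i"] m by simp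
      qed
      hence "(\<lambda>i. f (X (\<sigma> i)) z + cN (\<sigma> i)) \<longlonglongrightarrow> b z" by (rule tendsto_eventually)
      ultimately show ?thesis using LIMSEQ_unique by fastforce
    qed
    thus ?thesis using wl(1) by blast
  qed
  show ?thesis
    unfolding hilb_invertible_on_def L_def[symmetric] using Asum below surj by blast
qed

end

section \<open>Sufficiency: norm bounds\<close>

lemma schur_geometric:
  fixes \<theta> :: real
  assumes th: "0 \<le> \<theta>" "\<theta> < 1" and fin: "finite I" "finite J"
  shows "(\<Sum>i\<in>I. (\<Sum>j\<in>J. \<theta> ^ ((i - j) + (j - i)) * x j)\<^sup>2) \<le> (2 / (1 - \<theta>))\<^sup>2 * (\<Sum>j\<in>J. (x j)\<^sup>2)"
proof -
  have "(\<Sum>i\<in>I. (\<Sum>j\<in>J. \<theta> ^ ((i - j) + (j - i)) * x j)\<^sup>2)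
      \<le> (2 / (1 - \<theta>)) * (2 / (1 - \<theta>)) * (\<Sum>j\<in>J. (x j)\<^sup>2)"
  proof (rule schur_test[of I J _ "\<lambda>_. 1" "\<lambda>_. 1"])
    show "(\<Sum>j\<in>J. \<theta> ^ ((i - j) + (j - i)) * 1) \<le> 2 / (1 - \<theta>) * 1" for i
      using sum_power_distance_le[OF th fin(2), of i] by (simp add: add.commute)
    show "(\<Sum>i\<in>I. \<theta> ^ ((i - j) + (j - i)) * 1) \<le> 2 / (1 - \<theta>) * 1" for j
      using sum_power_distance_le[OF th fin(1), of j] by simp
  qed (use fin th in auto)
  thus ?thesis by (simp add: power2_eq_square)
qed

text \<open>The geometric part depends on the distance of the indices alone and is bounded once and
  for all; a kernel in \<open>P\<close> and \<open>w\<close> has to be tested only on the side where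
  nothing decays geometrically.\<close>

lemma schur_combine:
  fixes \<theta> :: real
  assumes th: "0 \<le> \<theta>" "\<theta> < 1" and fin: "finite I" "finite J"
    and T: "\<And>i j. i \<in> I \<Longrightarrow> j \<in> J \<Longrightarrow> 0 \<le> T i j"
      "\<And>i j. i \<in> I \<Longrightarrow> j \<in> J \<Longrightarrow> T i j \<le> A * (\<theta> ^ ((i - j) + (j - i)) + U i j)"
    and U: "(\<Sum>i\<in>I. (\<Sum>j\<in>J. U i j * x j)\<^sup>2) \<le> C * (\<Sum>j\<in>J. (x j)\<^sup>2)"
    and x: "\<And>j. j \<in> J \<Longrightarrow> x j \<ge> 0"
  shows "(\<Sum>i\<in>I. (\<Sum>j\<in>J. T i j * x j)\<^sup>2) \<le> 2 * A\<^sup>2 * ((2 / (1 - \<theta>))\<^sup>2 + C) * (\<Sum>j\<in>J. (x j)\<^sup>2)"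
proof -
  have "(\<Sum>i\<in>I. (\<Sum>j\<in>J. T i j * x j)\<^sup>2)
      \<le> (\<Sum>i\<in>I. A\<^sup>2 * (2 * (\<Sum>j\<in>J. \<theta> ^ ((i - j) + (j - i)) * x j)\<^sup>2 + 2 * (\<Sum>j\<in>J. U i j * x j)\<^sup>2))"
  proof (rule sum_mono)
    fix i assume i: "i \<in> I"
    have "(\<Sum>j\<in>J. T i j * x j) \<le> (\<Sum>j\<in>J. A * (\<theta> ^ ((i - j) + (j - i)) + U i j) * x j)"
      using i T x by (intro sum_mono mult_right_mono) auto
    also have "\<dots> = A * ((\<Sum>j\<in>J. \<theta> ^ ((i - j) + (j - i)) * x j) + (\<Sum>j\<in>J. U i j * x j))"
      unfolding sum.distrib[symmetric] sum_distrib_left by (intro sum.cong refl) (simp add: algebra_simps)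
    finally have "(\<Sum>j\<in>J. T i j * x j)\<^sup>2 \<le> (A * ((\<Sum>j\<in>J. \<theta> ^ ((i - j) + (j - i)) * x j) + (\<Sum>j\<in>J. U i j * x j)))\<^sup>2"
      using i T x by (intro power_mono sum_nonneg mult_nonneg_nonneg) auto
    also have "\<dots> = A\<^sup>2 * ((\<Sum>j\<in>J. \<theta> ^ ((i - j) + (j - i)) * x j) + (\<Sum>j\<in>J. U i j * x j))\<^sup>2"
      by (rule power_mult_distrib)
    also have "\<dots> \<le> A\<^sup>2 * (2 * (\<Sum>j\<in>J. \<theta> ^ ((i - j) + (j - i)) * x j)\<^sup>2 + 2 * (\<Sum>j\<in>J. U i j * x j)\<^sup>2)"
      by (intro mult_left_mono sq_sum_le) auto
    finally show "(\<Sum>j\<in>J. T i j * x j)\<^sup>2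
        \<le> A\<^sup>2 * (2 * (\<Sum>j\<in>J. \<theta> ^ ((i - j) + (j - i)) * x j)\<^sup>2 + 2 * (\<Sum>j\<in>J. U i j * x j)\<^sup>2)" .
  qed
  also have "\<dots> = A\<^sup>2 * (2 * (\<Sum>i\<in>I. (\<Sum>j\<in>J. \<theta> ^ ((i - j) + (j - i)) * x j)\<^sup>2) + 2 * (\<Sum>i\<in>I. (\<Sum>j\<in>J. U i j * x j)\<^sup>2))"
    unfolding sum_distrib_left sum.distrib[symmetric] distrib_left ..
  also have "\<dots> \<le> A\<^sup>2 * (2 * ((2 / (1 - \<theta>))\<^sup>2 * (\<Sum>j\<in>J. (x j)\<^sup>2)) + 2 * (C * (\<Sum>j\<in>J. (x j)\<^sup>2)))"
    by (intro mult_left_mono add_mono schur_geometric th fin U) auto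
  also have "\<dots> = 2 * A\<^sup>2 * ((2 / (1 - \<theta>))\<^sup>2 + C) * (\<Sum>j\<in>J. (x j)\<^sup>2)"
    by (simp add: algebra_simps)
  finally show ?thesis .
qed

section \<open>Size of the matrix entries and Schur bounds\<close>

context perturbed
begin

text \<open>Extends \<open>p\<close> to index 0 by the value 1.\<close>

definition ph :: "nat \<Rightarrow> real" where "ph n = vh n / (s n)\<^sup>2"

lemma ph_pos: "ph n > 0"
  unfolding ph_def by (intro divide_pos_pos zero_less_power vh_pos s_pos)

lemma ph_eq: "n \<ge> 1 \<Longrightarrow> ph n = p n"
  by (simp add: ph_def vh_def scale_def)

lemma wt_pos: "n \<ge> n0 \<Longrightarrow> wt n > 0"
  using w_l_pos by (simp add: wt_def)

lemma wt_eq: "n \<ge> n0 \<Longrightarrow> wt n = w (l n)"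
  by (simp add: wt_def)

lemma ph_le:
  obtains C where "C > 0" "\<And>n. ph n \<le> C * Pt n"
proof -
  have "\<forall>\<^sub>F n in sequentially. ph n / Pt n \<le> 1"
    using p_small[OF zero_less_one] eventually_ge_at_top[of 1]
  proof eventually_elim
    case (elim n)
    hence "p n / Pt n \<le> 1" using Pt_pos[of n] by (simp only: pos_divide_le_eq)
    thus ?case unfolding ph_eq[OF elim(2)] .
  qed
  then obtain C where C: "C > 0" "\<And>n. ph n / Pt n \<le> C" using eventually_le_imp_bounded[of "\<lambda>n. ph n / Pt n" 1] by blast
  have "ph n \<le> C * Pt n" for n using C(2)[of n] Pt_pos[of n] by (simp only: pos_divide_le_eq)
  thus thesis using that C(1) by blast
qed

text \<open>The term at index 0 lies outside the telescoping sum; it is absorbed because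
  \<open>Pt N powr (- t)\<close> is at least its value at N = 0.\<close>

lemma sum_ph_powr:
  assumes t: "0 < t"
  obtains C where "C > 0" "\<And>N J. J \<subseteq> {..N} \<Longrightarrow> (\<Sum>n\<in>J. ph n * Pt n powr (- 1 - t)) \<le> C * Pt N powr (- t)"
proof -
  define C1 where "C1 = \<kappa> / t * \<kappa> powr t"
  have C1: "C1 \<ge> 0" using t slow.kappa_ge1 by (simp add: C1_def)
  define C where "C = ph 0 / Pt 0 + C1"
  have C: "C > 0" unfolding C_def using ph_pos[of 0] Pt_pos[of 0] C1 by (intro add_pos_nonneg divide_pos_pos)
  have "(\<Sum>n\<in>J. ph n * Pt n powr (- 1 - t)) \<le> C * Pt N powr (- t)" if J: "J \<subseteq> {..N}" for N J
  proof -
    have nn: "0 \<le> ph n * Pt n powr (- 1 - t)" for n using ph_pos[of n] by simp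
    have "(\<Sum>n\<in>J. ph n * Pt n powr (- 1 - t)) \<le> (\<Sum>n\<in>insert 0 {0<..N}. ph n * Pt n powr (- 1 - t))"
    proof (rule sum_mono2)
      show "J \<subseteq> insert 0 {0<..N}"
      proof
        fix n assume "n \<in> J"
        thus "n \<in> insert 0 {0<..N}" using J by (cases "n = 0") auto
      qed
    qed (rule finite.insertI[OF finite_greaterThanAtMost] nn)+
    also have "\<dots> = ph 0 * Pt 0 powr (- 1 - t) + (\<Sum>n\<in>{0<..N}. ph n * Pt n powr (- 1 - t))" by simp
    also have "(\<Sum>n\<in>{0<..N}. ph n * Pt n powr (- 1 - t)) = (\<Sum>n\<in>{0<..N}. p n * Pt n powr (- 1 - t))"
      by (intro sum.cong refl) (simp add: ph_eq)
    also have "\<dots> \<le> C1 * Pt N powr (- t)" unfolding C1_def by (rule slow.sum_p_powr_init[OF t])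
    also have "ph 0 * Pt 0 powr (- 1 - t) \<le> ph 0 / Pt 0 * Pt N powr (- t)"
    proof -
      have "Pt 0 powr (- t) \<le> Pt N powr (- t)"
        using slow.P_antimono[of 0 N] Pt_pos[of N] t by (intro powr_mono2') auto
      hence "ph 0 / Pt 0 * Pt 0 powr (- t) \<le> ph 0 / Pt 0 * Pt N powr (- t)"
        using ph_pos[of 0] Pt_pos[of 0] by (intro mult_left_mono) auto
      moreover have "Pt 0 powr (- 1 - t) = Pt 0 powr (- t) / Pt 0"
        using Pt_pos[of 0] by (simp add: powr_diff powr_minus field_simps)
      ultimately show ?thesis by simp
    qed
    finally show ?thesis by (simp add: C_def algebra_simps)
  qed
  thus thesis using that C by blast
qed

text \<open>With test functions \<open>sqrt (wt k) * Pt k powr (1 / 2)\<close> and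
  \<open>sqrt (p n) * Pt n powr (- 1 / 2)\<close> the square roots pair up: rows become sums of p_n
  P_n^(t - 1) over n > k, columns sums of w_k P_k^(1 - t) over k < n. For 0 < t < 1 both have the
  size of one end.\<close>

lemma schur_up:
  assumes W: "\<And>n. (\<Sum>m<n. wt m) * Pt n \<le> B" and t: "0 < t" "t < 1"
  obtains C where "C \<ge> 0" "\<And>I J x. finite I \<Longrightarrow> finite J \<Longrightarrow> I \<subseteq> {n0..} \<Longrightarrow> J \<subseteq> {1..} \<Longrightarrow>
    (\<Sum>k\<in>I. (\<Sum>n\<in>J. (if k < n then sqrt (wt k) * Pt k powr (1 / 2 - t) * (sqrt (p n) * Pt n powr (t - 1 / 2)) else 0) * x n)\<^sup>2)
      \<le> C * (\<Sum>n\<in>J. (x n)\<^sup>2)"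
proof -
  define A where "A = \<kappa> / t"
  have A: "A \<ge> 0" using t slow.kappa_ge1 by (simp add: A_def)
  define E where "E = B + B * (\<kappa> / t * \<kappa> powr t)"
  have B0: "B \<ge> 0" using W[of 0] by simp
  have E: "E \<ge> 0" unfolding E_def using B0 t slow.kappa_ge1 by simp
  show thesis
  proof (rule that[of "A * E"])
    show "A * E \<ge> 0" using A E by simp
    fix I J :: "nat set" and x :: "nat \<Rightarrow> real"
    assume fin: "finite I" "finite J" and IJ: "I \<subseteq> {n0..}" "J \<subseteq> {1..}"
    have wI: "wt k > 0" if "k \<in> I" for k using wt_pos that IJ by auto
    have pJ: "p n > 0" if "n \<in> J" for n using p_pos that IJ by auto
    show "(\<Sum>k\<in>I. (\<Sum>n\<in>J. (if k < n then sqrt (wt k) * Pt k powr (1 / 2 - t) * (sqrt (p n) * Pt n powr (t - 1 / 2)) else 0) * x n)\<^sup>2)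
      \<le> A * E * (\<Sum>n\<in>J. (x n)\<^sup>2)"
    proof (rule schur_test[of I J _ "\<lambda>k. sqrt (wt k) * Pt k powr (1 / 2)" "\<lambda>n. sqrt (p n) * Pt n powr (- 1 / 2)"])
      show "0 \<le> (if k < n then sqrt (wt k) * Pt k powr (1 / 2 - t) * (sqrt (p n) * Pt n powr (t - 1 / 2)) else 0)"
        if "k \<in> I" "n \<in> J" for k n using less_imp_le[OF wI[OF that(1)]] less_imp_le[OF pJ[OF that(2)]] by simp
      show "0 < sqrt (wt k) * Pt k powr (1 / 2)" if "k \<in> I" for k using wI[OF that] Pt_pos[of k] by simp
      show "0 < sqrt (p n) * Pt n powr (- 1 / 2)" if "n \<in> J" for n
        using pJ[OF that] Pt_pos[of n] by (intro mult_pos_pos) auto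
      show "A \<ge> 0" by (rule A)
      show "(\<Sum>n\<in>J. (if k < n then sqrt (wt k) * Pt k powr (1 / 2 - t) * (sqrt (p n) * Pt n powr (t - 1 / 2)) else 0)
          * (sqrt (p n) * Pt n powr (- 1 / 2))) \<le> A * (sqrt (wt k) * Pt k powr (1 / 2))" if k: "k \<in> I" for k
      proof -
        have "(\<Sum>n\<in>J. (if k < n then sqrt (wt k) * Pt k powr (1 / 2 - t) * (sqrt (p n) * Pt n powr (t - 1 / 2)) else 0)
            * (sqrt (p n) * Pt n powr (- 1 / 2)))
            = (\<Sum>n\<in>J \<inter> {k<..}. sqrt (wt k) * Pt k powr (1 / 2 - t) * (p n * Pt n powr (t - 1)))"
        proof (rule sum.mono_neutral_cong_right)
          fix n assume n: "n \<in> J \<inter> {k<..}"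
          have "Pt n powr (t - 1 / 2) * Pt n powr (- 1 / 2) = Pt n powr (t - 1)" by (simp flip: powr_add)
          moreover have "sqrt (p n) * sqrt (p n) = p n" by (rule real_sqrt_mult_self[THEN trans, OF abs_of_pos[OF pJ]]) (use n in blast)
          moreover have "(a * b) * (c * e) = x * y" if "b * e = y" "a * c = x" for a b c e x y :: real
            using that by (auto simp: mult_ac)
          ultimately have "(sqrt (p n) * Pt n powr (t - 1 / 2)) * (sqrt (p n) * Pt n powr (- 1 / 2)) = p n * Pt n powr (t - 1)"
            by blast
          thus "(if k < n then sqrt (wt k) * Pt k powr (1 / 2 - t) * (sqrt (p n) * Pt n powr (t - 1 / 2)) else 0)
              * (sqrt (p n) * Pt n powr (- 1 / 2)) = sqrt (wt k) * Pt k powr (1 / 2 - t) * (p n * Pt n powr (t - 1))"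
            using n by (simp only: mult.assoc if_True Int_iff greaterThan_iff)
        qed (use fin in auto)
        also have "\<dots> = sqrt (wt k) * Pt k powr (1 / 2 - t) * (\<Sum>n\<in>J \<inter> {k<..}. p n * Pt n powr (t - 1))"
          by (rule sum_distrib_left[symmetric])
        also have "(\<Sum>n\<in>J \<inter> {k<..}. p n * Pt n powr (t - 1)) \<le> (\<Sum>n\<in>{k<..Max (insert k J)}. p n * Pt n powr (t - 1))"
        proof (rule sum_mono2)
          show "J \<inter> {k<..} \<subseteq> {k<..Max (insert k J)}" using fin by (auto intro: Max_ge)
          fix n assume "n \<in> {k<..Max (insert k J)} - J \<inter> {k<..}"
          thus "0 \<le> p n * Pt n powr (t - 1)" using p_pos[of n] by (intro mult_nonneg_nonneg) auto
        qed simp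
        also have "\<dots> \<le> \<kappa> / t * Pt k powr t" using fin by (intro slow.sum_p_powr_tail t) auto
        finally have "(\<Sum>n\<in>J. (if k < n then sqrt (wt k) * Pt k powr (1 / 2 - t) * (sqrt (p n) * Pt n powr (t - 1 / 2)) else 0)
            * (sqrt (p n) * Pt n powr (- 1 / 2))) \<le> sqrt (wt k) * Pt k powr (1 / 2 - t) * (A * Pt k powr t)"
          using wI[OF k] by (simp add: A_def mult_left_mono)
        also have "\<dots> = A * (sqrt (wt k) * (Pt k powr (1 / 2 - t) * Pt k powr t))" by (simp only: mult_ac)
        also have "Pt k powr (1 / 2 - t) * Pt k powr t = Pt k powr (1 / 2)" by (simp flip: powr_add)
        finally show ?thesis .
      qed
      show "(\<Sum>k\<in>I. (if k < n then sqrt (wt k) * Pt k powr (1 / 2 - t) * (sqrt (p n) * Pt n powr (t - 1 / 2)) else 0)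
          * (sqrt (wt k) * Pt k powr (1 / 2))) \<le> E * (sqrt (p n) * Pt n powr (- 1 / 2))" if n: "n \<in> J" for n
      proof -
        have "(\<Sum>k\<in>I. (if k < n then sqrt (wt k) * Pt k powr (1 / 2 - t) * (sqrt (p n) * Pt n powr (t - 1 / 2)) else 0)
            * (sqrt (wt k) * Pt k powr (1 / 2)))
            = (\<Sum>k\<in>I \<inter> {..<n}. sqrt (p n) * Pt n powr (t - 1 / 2) * (wt k * Pt k powr (1 - t)))"
        proof (rule sum.mono_neutral_cong_right)
          fix k assume k: "k \<in> I \<inter> {..<n}"
          have "Pt k powr (1 / 2 - t) * Pt k powr (1 / 2) = Pt k powr (1 - t)" by (simp flip: powr_add)
          moreover have "sqrt (wt k) * sqrt (wt k) = wt k" using wI[of k] k by simp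
          moreover have "(a * b) * (c * e) = x * y" if "b * e = y" "a * c = x" for a b c e x y :: real
            using that by (auto simp: mult_ac)
          ultimately have "(sqrt (wt k) * Pt k powr (1 / 2 - t)) * (sqrt (wt k) * Pt k powr (1 / 2)) = wt k * Pt k powr (1 - t)"
            by blast
          moreover have "a * b * c = b * d" if "a * c = d" for a b c d :: real using that by (auto simp: mult_ac)
          moreover have "(if k < n then X else 0) * Y = Z" if "X * Y = Z" for X Y Z :: real using k that by simp
          ultimately show "(if k < n then sqrt (wt k) * Pt k powr (1 / 2 - t) * (sqrt (p n) * Pt n powr (t - 1 / 2)) else 0)
              * (sqrt (wt k) * Pt k powr (1 / 2)) = sqrt (p n) * Pt n powr (t - 1 / 2) * (wt k * Pt k powr (1 - t))"
            by blast
        qed (use fin in auto)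
        also have "\<dots> = sqrt (p n) * Pt n powr (t - 1 / 2) * (\<Sum>k\<in>I \<inter> {..<n}. wt k * Pt k powr (1 - t))"
          by (rule sum_distrib_left[symmetric])
        also have "(\<Sum>k\<in>I \<inter> {..<n}. wt k * Pt k powr (1 - t)) \<le> (\<Sum>k<n. wt k * Pt k powr (1 - t))"
          using wt_nonneg by (intro sum_mono2) auto
        also have "\<dots> \<le> E * Pt n powr (- t)" unfolding E_def by (rule slow.sum_w_powr_init[OF wt_nonneg W t])
        finally have "(\<Sum>k\<in>I. (if k < n then sqrt (wt k) * Pt k powr (1 / 2 - t) * (sqrt (p n) * Pt n powr (t - 1 / 2)) else 0)
            * (sqrt (wt k) * Pt k powr (1 / 2))) \<le> sqrt (p n) * Pt n powr (t - 1 / 2) * (E * Pt n powr (- t))"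
          using less_imp_le[OF pJ[OF n]] by (simp add: mult_left_mono)
        also have "\<dots> = E * (sqrt (p n) * (Pt n powr (t - 1 / 2) * Pt n powr (- t)))" by (simp only: mult_ac)
        also have "Pt n powr (t - 1 / 2) * Pt n powr (- t) = Pt n powr (- 1 / 2)" by (simp flip: powr_add)
        finally show ?thesis .
      qed
    qed
  qed
qed

text \<open>The mirror image of \<open>schur_up\<close>: rows become sums of ph_n P_n^(- 1 - t) over
  n < k, columns sums of w_k P_k^(1 + t) over k > n. The index n may be 0, which is why
  \<open>ph\<close> replaces \<open>p\<close>.\<close>

lemma schur_down:
  assumes W: "\<And>n. (\<Sum>m<n. wt m) * Pt n \<le> B" and t: "0 < t"
  obtains C where "C \<ge> 0" "\<And>I J x. finite I \<Longrightarrow> finite J \<Longrightarrow> I \<subseteq> {n0..} \<Longrightarrow>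
    (\<Sum>k\<in>I. (\<Sum>n\<in>J. (if n < k then sqrt (wt k) * Pt k powr (1 / 2 + t) * (sqrt (ph n) * Pt n powr (- 1 / 2 - t)) else 0) * x n)\<^sup>2)
      \<le> C * (\<Sum>n\<in>J. (x n)\<^sup>2)"
proof -
  obtain A where A: "A > 0" "\<And>N J. J \<subseteq> {..N} \<Longrightarrow> (\<Sum>n\<in>J. ph n * Pt n powr (- 1 - t)) \<le> A * Pt N powr (- t)"
    using sum_ph_powr[OF t] by blast
  define E where "E = B * (2 * \<kappa> + \<kappa> * \<kappa> / t)"
  have B0: "B \<ge> 0" using W[of 0] by simp
  have E: "E \<ge> 0" unfolding E_def using B0 t slow.kappa_ge1 by simp
  show thesis
  proof (rule that[of "A * E"])
    show "A * E \<ge> 0" using A E by simp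
    fix I J :: "nat set" and x :: "nat \<Rightarrow> real"
    assume fin: "finite I" "finite J" and I: "I \<subseteq> {n0..}"
    have wI: "wt k > 0" if "k \<in> I" for k using wt_pos that I by auto
    show "(\<Sum>k\<in>I. (\<Sum>n\<in>J. (if n < k then sqrt (wt k) * Pt k powr (1 / 2 + t) * (sqrt (ph n) * Pt n powr (- 1 / 2 - t)) else 0) * x n)\<^sup>2)
      \<le> A * E * (\<Sum>n\<in>J. (x n)\<^sup>2)"
    proof (rule schur_test[of I J _ "\<lambda>k. sqrt (wt k) * Pt k powr (1 / 2)" "\<lambda>n. sqrt (ph n) * Pt n powr (- 1 / 2)"])
      show "0 \<le> (if n < k then sqrt (wt k) * Pt k powr (1 / 2 + t) * (sqrt (ph n) * Pt n powr (- 1 / 2 - t)) else 0)"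
        for k n using wt_nonneg[of k] less_imp_le[OF ph_pos[of n]] by simp
      show "0 < sqrt (wt k) * Pt k powr (1 / 2)" if "k \<in> I" for k using wI[OF that] Pt_pos[of k] by simp
      show "0 < sqrt (ph n) * Pt n powr (- 1 / 2)" for n
        using ph_pos[of n] Pt_pos[of n] by (intro mult_pos_pos) auto
      show "A \<ge> 0" using A(1) by simp
      show "(\<Sum>n\<in>J. (if n < k then sqrt (wt k) * Pt k powr (1 / 2 + t) * (sqrt (ph n) * Pt n powr (- 1 / 2 - t)) else 0)
          * (sqrt (ph n) * Pt n powr (- 1 / 2))) \<le> A * (sqrt (wt k) * Pt k powr (1 / 2))" for k
      proof -
        have "(\<Sum>n\<in>J. (if n < k then sqrt (wt k) * Pt k powr (1 / 2 + t) * (sqrt (ph n) * Pt n powr (- 1 / 2 - t)) else 0)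
            * (sqrt (ph n) * Pt n powr (- 1 / 2)))
            = (\<Sum>n\<in>J \<inter> {..<k}. sqrt (wt k) * Pt k powr (1 / 2 + t) * (ph n * Pt n powr (- 1 - t)))"
        proof (rule sum.mono_neutral_cong_right)
          fix n assume n: "n \<in> J \<inter> {..<k}"
          have "Pt n powr (- 1 / 2 - t) * Pt n powr (- 1 / 2) = Pt n powr (- 1 - t)" by (simp flip: powr_add)
          moreover have "sqrt (ph n) * sqrt (ph n) = ph n" using ph_pos[of n] by simp
          moreover have "(a * b) * (c * e) = x * y" if "b * e = y" "a * c = x" for a b c e x y :: real
            using that by (auto simp: mult_ac)
          ultimately have "(sqrt (ph n) * Pt n powr (- 1 / 2 - t)) * (sqrt (ph n) * Pt n powr (- 1 / 2)) = ph n * Pt n powr (- 1 - t)"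
            by blast
          thus "(if n < k then sqrt (wt k) * Pt k powr (1 / 2 + t) * (sqrt (ph n) * Pt n powr (- 1 / 2 - t)) else 0)
              * (sqrt (ph n) * Pt n powr (- 1 / 2)) = sqrt (wt k) * Pt k powr (1 / 2 + t) * (ph n * Pt n powr (- 1 - t))"
            using n by (simp add: mult.assoc)
        qed (use fin in auto)
        also have "\<dots> = sqrt (wt k) * Pt k powr (1 / 2 + t) * (\<Sum>n\<in>J \<inter> {..<k}. ph n * Pt n powr (- 1 - t))"
          by (rule sum_distrib_left[symmetric])
        also have "\<dots> \<le> sqrt (wt k) * Pt k powr (1 / 2 + t) * (A * Pt k powr (- t))"
          using wt_nonneg[of k] by (intro mult_left_mono A(2)) auto
        also have "\<dots> = A * (sqrt (wt k) * (Pt k powr (1 / 2 + t) * Pt k powr (- t)))" by (simp only: mult_ac)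
        also have "Pt k powr (1 / 2 + t) * Pt k powr (- t) = Pt k powr (1 / 2)" by (simp flip: powr_add)
        finally show ?thesis .
      qed
      show "(\<Sum>k\<in>I. (if n < k then sqrt (wt k) * Pt k powr (1 / 2 + t) * (sqrt (ph n) * Pt n powr (- 1 / 2 - t)) else 0)
          * (sqrt (wt k) * Pt k powr (1 / 2))) \<le> E * (sqrt (ph n) * Pt n powr (- 1 / 2))" for n
      proof -
        have "(\<Sum>k\<in>I. (if n < k then sqrt (wt k) * Pt k powr (1 / 2 + t) * (sqrt (ph n) * Pt n powr (- 1 / 2 - t)) else 0)
            * (sqrt (wt k) * Pt k powr (1 / 2)))
            = (\<Sum>k\<in>I \<inter> {n<..}. sqrt (ph n) * Pt n powr (- 1 / 2 - t) * (wt k * Pt k powr (1 + t)))"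
        proof (rule sum.mono_neutral_cong_right)
          fix k assume k: "k \<in> I \<inter> {n<..}"
          have "Pt k powr (1 / 2 + t) * Pt k powr (1 / 2) = Pt k powr (1 + t)" by (simp flip: powr_add)
          moreover have "sqrt (wt k) * sqrt (wt k) = wt k" using wI[of k] k by simp
          moreover have "(a * b) * (c * e) = x * y" if "b * e = y" "a * c = x" for a b c e x y :: real
            using that by (auto simp: mult_ac)
          ultimately have "(sqrt (wt k) * Pt k powr (1 / 2 + t)) * (sqrt (wt k) * Pt k powr (1 / 2)) = wt k * Pt k powr (1 + t)"
            by blast
          moreover have "a * b * c = b * d" if "a * c = d" for a b c d :: real using that by (auto simp: mult_ac)
          moreover have "(if n < k then X else 0) * Y = Z" if "X * Y = Z" for X Y Z :: real using k that by simp
          ultimately show "(if n < k then sqrt (wt k) * Pt k powr (1 / 2 + t) * (sqrt (ph n) * Pt n powr (- 1 / 2 - t)) else 0)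
              * (sqrt (wt k) * Pt k powr (1 / 2)) = sqrt (ph n) * Pt n powr (- 1 / 2 - t) * (wt k * Pt k powr (1 + t))"
            by blast
        qed (use fin in auto)
        also have "\<dots> = sqrt (ph n) * Pt n powr (- 1 / 2 - t) * (\<Sum>k\<in>I \<inter> {n<..}. wt k * Pt k powr (1 + t))"
          by (rule sum_distrib_left[symmetric])
        also have "(\<Sum>k\<in>I \<inter> {n<..}. wt k * Pt k powr (1 + t)) \<le> (\<Sum>k\<in>{n<..Max (insert n I)}. wt k * Pt k powr (1 + t))"
          using fin wt_nonneg by (intro sum_mono2) (auto intro: Max_ge)
        also have "\<dots> \<le> E * Pt n powr t" unfolding E_def using fin by (intro slow.sum_w_powr_tail wt_nonneg W t) auto
        finally have "(\<Sum>k\<in>I. (if n < k then sqrt (wt k) * Pt k powr (1 / 2 + t) * (sqrt (ph n) * Pt n powr (- 1 / 2 - t)) else 0)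
            * (sqrt (wt k) * Pt k powr (1 / 2))) \<le> sqrt (ph n) * Pt n powr (- 1 / 2 - t) * (E * Pt n powr t)"
          using less_imp_le[OF ph_pos[of n]] by (simp add: mult_left_mono)
        also have "\<dots> = E * (sqrt (ph n) * (Pt n powr (- 1 / 2 - t) * Pt n powr t))" by (simp only: mult_ac)
        also have "Pt n powr (- 1 / 2 - t) * Pt n powr t = Pt n powr (- 1 / 2)" by (simp flip: powr_add)
        finally show ?thesis .
      qed
    qed
  qed
qed

text \<open>Since \<open>P\<close> and \<open>h\<close> vary subexponentially while \<open>s\<close> grows geometrically, these three
  sequences decay geometrically.\<close>

lemma geometric_ratios:
  obtains C \<theta> where "C > 0" "0 < \<theta>" "\<theta> < 1"
    "\<And>m n. m \<le> n \<Longrightarrow> h n / (sqrt (Pt n) * s n) \<le> C * \<theta> ^ (n - m) * (h m / (sqrt (Pt m) * s m))"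
    "\<And>m n. m \<le> n \<Longrightarrow> sqrt (Pt n) / (h n * s n) \<le> C * \<theta> ^ (n - m) * (sqrt (Pt m) / (h m * s m))"
    "\<And>m n. m \<le> n \<Longrightarrow> 1 / (sqrt (Pt n) * s n) \<le> C * \<theta> ^ (n - m) * (1 / (sqrt (Pt m) * s m))"
proof -
  \<comment> \<open>Eventually \<open>h\<close> and \<open>sqrt P\<close> each change by a factor at
    most \<eta> = q^(1/4) per step, while \<open>s\<close> gains \<eta>^4; this leaves \<theta> =
    \<eta>^(- 2).\<close>
  define \<eta> where "\<eta> = sqrt (sqrt q)"
  have \<eta>: "\<eta> > 1" using q by (simp add: \<eta>_def)
  have \<eta>4: "(\<eta> * \<eta>) * (\<eta> * \<eta>) = q" using q by (simp add: \<eta>_def)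
  have \<eta>2: "\<eta>\<^sup>2 > 1" using \<eta> by simp
  define \<theta> where "\<theta> = \<eta> * \<eta> / q"
  have \<eta>\<eta>: "\<eta> * \<eta> > 1" using \<eta>2 by (simp add: power2_eq_square)
  have th: "0 < \<theta>" "\<theta> < 1"
  proof -
    have "\<theta> = 1 / (\<eta> * \<eta>)" unfolding \<theta>_def \<eta>4[symmetric] using \<eta> by simp
    thus "0 < \<theta>" "\<theta> < 1" using \<eta>\<eta> by auto
  qed
  have pos: "sqrt (Pt n) > 0" "s n > 0" "h n > 0" for n using Pt_pos s_pos h_pos by auto
  have ev: "\<forall>\<^sub>F n in sequentially. n \<ge> 1 \<and> h (Suc n) * sqrt (Pt n) \<le> \<eta> * \<eta> * (h n * sqrt (Pt (Suc n)))
      \<and> sqrt (Pt (Suc n)) * h n \<le> \<eta> * \<eta> * (sqrt (Pt n) * h (Suc n))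
      \<and> 1 * sqrt (Pt n) \<le> \<eta> * \<eta> * (1 * sqrt (Pt (Suc n)))"
    using h_ratio[OF \<eta>] Pt_ratio[OF \<eta>2] eventually_ge_at_top[of 1]
  proof eventually_elim
    case (elim n)
    have "sqrt (Pt n) \<le> sqrt (\<eta>\<^sup>2 * Pt (Suc n))" by (rule real_sqrt_le_mono[OF elim(3)])
    hence sP: "sqrt (Pt n) \<le> \<eta> * sqrt (Pt (Suc n))" using \<eta> by (simp add: real_sqrt_mult)
    have sP': "sqrt (Pt (Suc n)) \<le> sqrt (Pt n)" using slow.P_antimono[of n "Suc n"] by simp
    have "h (Suc n) * sqrt (Pt n) \<le> (\<eta> * h n) * (\<eta> * sqrt (Pt (Suc n)))"
      using elim sP pos(1)[of n] pos(3)[of n] \<eta> by (intro mult_mono) auto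
    moreover have "sqrt (Pt (Suc n)) * h n \<le> sqrt (Pt n) * (\<eta> * h (Suc n))"
      using elim sP' pos(1)[of n] pos(3)[of n] by (intro mult_mono) auto
    moreover have "1 * (sqrt (Pt n) * (\<eta> * h (Suc n))) \<le> \<eta> * (sqrt (Pt n) * (\<eta> * h (Suc n)))"
      using \<eta> pos(1)[of n] pos(3)[of "Suc n"] by (intro mult_right_mono mult_nonneg_nonneg) auto
    moreover have "1 * (\<eta> * sqrt (Pt (Suc n))) \<le> \<eta> * (\<eta> * sqrt (Pt (Suc n)))"
      using \<eta> pos(1)[of "Suc n"] by (intro mult_right_mono mult_nonneg_nonneg) auto
    ultimately show ?case using elim(4) sP by (simp add: mult_ac)
  qed
  have key: "a' / (b' * s (Suc n)) \<le> \<theta> * (a / (b * s n))"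
    if n: "n \<ge> 1" and ab: "a' * b \<le> \<eta> * \<eta> * (a * b')" "a > 0" "b > 0" "b' > 0" for n and a a' b b' :: real
  proof -
    have "q * s n \<le> s (Suc n)" using lac n by (simp add: s_eq)
    hence "1 / s (Suc n) \<le> 1 / (q * s n)" using q s_pos by (intro divide_left_mono) auto
    moreover have "a' / b' \<le> \<eta> * \<eta> * (a / b)" using ab by (simp add: field_simps)
    ultimately have "a' / b' * (1 / s (Suc n)) \<le> \<eta> * \<eta> * (a / b) * (1 / (q * s n))"
      using ab(2,3) \<eta> s_pos[of "Suc n"] by (intro mult_mono) auto
    thus ?thesis by (simp add: \<theta>_def mult_ac)
  qed
  have e1: "\<forall>\<^sub>F n in sequentially. h (Suc n) / (sqrt (Pt (Suc n)) * s (Suc n)) \<le> \<theta> * (h n / (sqrt (Pt n) * s n))"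
    using ev by eventually_elim (rule key, use pos in auto)
  have e2: "\<forall>\<^sub>F n in sequentially. sqrt (Pt (Suc n)) / (h (Suc n) * s (Suc n)) \<le> \<theta> * (sqrt (Pt n) / (h n * s n))"
    using ev by eventually_elim (rule key, use pos in auto)
  have e3: "\<forall>\<^sub>F n in sequentially. 1 / (sqrt (Pt (Suc n)) * s (Suc n)) \<le> \<theta> * (1 / (sqrt (Pt n) * s n))"
    using ev by eventually_elim (rule key, use pos in auto)
  have p1: "0 < h n / (sqrt (Pt n) * s n)" and p2: "0 < sqrt (Pt n) / (h n * s n)" and p3: "0 < 1 / (sqrt (Pt n) * s n)" for n
    by (intro divide_pos_pos mult_pos_pos pos zero_less_one)+
  obtain C1 where C1: "C1 > 0" "\<And>m n. m \<le> n \<Longrightarrow> h n / (sqrt (Pt n) * s n) \<le> C1 * \<theta> ^ (n - m) * (h m / (sqrt (Pt m) * s m))"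
    using geometric_bound[of "\<lambda>n. h n / (sqrt (Pt n) * s n)" \<theta>, OF p1 th(1) e1] by blast
  obtain C2 where C2: "C2 > 0" "\<And>m n. m \<le> n \<Longrightarrow> sqrt (Pt n) / (h n * s n) \<le> C2 * \<theta> ^ (n - m) * (sqrt (Pt m) / (h m * s m))"
    using geometric_bound[of "\<lambda>n. sqrt (Pt n) / (h n * s n)" \<theta>, OF p2 th(1) e2] by blast
  obtain C3 where C3: "C3 > 0" "\<And>m n. m \<le> n \<Longrightarrow> 1 / (sqrt (Pt n) * s n) \<le> C3 * \<theta> ^ (n - m) * (1 / (sqrt (Pt m) * s m))"
    using geometric_bound[of "\<lambda>n. 1 / (sqrt (Pt n) * s n)" \<theta>, OF p3 th(1) e3] by blast
  define C where "C = max C1 (max C2 C3)"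
  have le: "C1 \<le> C" "C2 \<le> C" "C3 \<le> C" by (auto simp: C_def)
  have up: "c * \<theta> ^ i * y \<le> C * \<theta> ^ i * y" if "c \<le> C" "y > 0" for c i y
    using that th by (intro mult_right_mono) auto
  show thesis
  proof (rule that[of C \<theta>])
    show "C > 0" using C1 le by linarith
    fix m n :: nat assume mn: "m \<le> n"
    show "h n / (sqrt (Pt n) * s n) \<le> C * \<theta> ^ (n - m) * (h m / (sqrt (Pt m) * s m))"
      by (rule order_trans[OF C1(2)[OF mn] up[OF le(1) p1]])
    show "sqrt (Pt n) / (h n * s n) \<le> C * \<theta> ^ (n - m) * (sqrt (Pt m) / (h m * s m))"
      by (rule order_trans[OF C2(2)[OF mn] up[OF le(2) p2]])
    show "1 / (sqrt (Pt n) * s n) \<le> C * \<theta> ^ (n - m) * (1 / (sqrt (Pt m) * s m))"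
      by (rule order_trans[OF C3(2)[OF mn] up[OF le(3) p3]])
  qed (use th in auto)
qed

text \<open>The additional factor due to an extra point \<lambda>_0: for n \<ge> 1 a point at level
  n has distance of order \<open>s n\<close> from it. In the exact case there is no such
  factor.\<close>

definition se :: "nat \<Rightarrow> real" where "se n = (if n0 = 0 then s n else 1)"

lemma se_pos: "se n > 0"
  using s_pos by (simp add: se_def)

text \<open>A lower bound for |nodal|, stated for the reciprocal, which is what occurs later. Three
  kinds of factor are separated: the near one, \<open>d n\<close>; the one with the extra point, of
  order \<open>se n\<close>; and all others, by \<open>prod_estimate\<close>.\<close>

lemma nodal_lower:
  obtains C where "C > 0" "\<And>N n. n \<in> {n0..N} \<Longrightarrow> 1 / cmod (nodal N n) \<le> C * (d n / se n) * (h N / h n)"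
proof -
  obtain A where A: "A > 0"
    "\<And>z k J. finite J \<Longrightarrow> J \<subseteq> {1..} \<Longrightarrow> k \<notin> J \<Longrightarrow> (z = \<gamma> k \<and> 1 \<le> k) \<or> (z = l k \<and> n0 \<le> k) \<Longrightarrow>
      (\<Prod>j\<in>J. cmod (z - l j) / cmod (z - \<gamma> j)) \<le> A * (\<Prod>j\<in>{j\<in>J. k < j}. cmod (l j) / g j)"
    "\<And>z k J. finite J \<Longrightarrow> J \<subseteq> {1..} \<Longrightarrow> k \<notin> J \<Longrightarrow> (z = \<gamma> k \<and> 1 \<le> k) \<or> (z = l k \<and> n0 \<le> k) \<Longrightarrow>
      (\<Prod>j\<in>J. cmod (z - \<gamma> j) / cmod (z - l j)) \<le> A * (\<Prod>j\<in>{j\<in>J. k < j}. g j / cmod (l j))"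
    using prod_estimate by blast
  obtain c where c: "c > 0"
    "\<And>k j. 1 \<le> k \<Longrightarrow> 1 \<le> j \<Longrightarrow> k \<noteq> j \<Longrightarrow> c * max (s k) (s j) \<le> cmod (\<gamma> k - \<gamma> j)"
    "\<And>k j. 1 \<le> k \<Longrightarrow> n0 \<le> j \<Longrightarrow> k \<noteq> j \<Longrightarrow> c * max (s k) (s j) \<le> cmod (\<gamma> k - l j)"
    "\<And>k j. n0 \<le> k \<Longrightarrow> 1 \<le> j \<Longrightarrow> k \<noteq> j \<Longrightarrow> c * max (s k) (s j) \<le> cmod (l k - \<gamma> j)"
    "\<And>k j. n0 \<le> k \<Longrightarrow> n0 \<le> j \<Longrightarrow> k \<noteq> j \<Longrightarrow> c * max (s k) (s j) \<le> cmod (l k - l j)"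
    using sep by blast
  define c' where "c' = min 1 c"
  have c': "c' > 0" "c' \<le> 1" "c' \<le> c" using c(1) by (auto simp: c'_def)
  show thesis
  proof (rule that[of "A / c'"])
    show "A / c' > 0" using A c' by simp
    fix N n assume n: "n \<in> {n0..N}"
    define J where "J = {1..N} - {n}"
    have J: "finite J" "J \<subseteq> {1..}" "n \<notin> J" by (auto simp: J_def)
    define e where "e = (if n0 = 0 \<and> n \<noteq> 0 then cmod (l n - l 0) else 1)"
    have ebound: "c' * se n \<le> e"
    proof (cases "n0 = 0 \<and> n \<noteq> 0")
      case True
      have "c' * s n \<le> c * max (s n) (s 0)" using c' c(1) s_pos[of n] by (intro mult_mono) auto
      also have "\<dots> \<le> cmod (l n - l 0)" using True by (intro c(5)) auto
      finally show ?thesis unfolding e_def se_def using True by simp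
    next
      case False
      hence "se n = 1" unfolding se_def using n by (auto simp: scale_def)
      thus ?thesis using False c' by (simp only: e_def if_False mult_1_right)
    qed
    have e0: "e > 0" using ebound mult_pos_pos[OF c'(1) se_pos[of n]] by linarith
    have num: "(\<Prod>j\<in>{1..N}. cmod (l n - \<gamma> j)) = d n * (\<Prod>j\<in>J. cmod (l n - \<gamma> j))"
    proof (cases "n = 0")
      case True
      thus ?thesis by (simp add: d_def J_def)
    next
      case False
      hence "{1..N} = insert n J" using n by (auto simp: J_def)
      thus ?thesis using J False by (simp add: d_def)
    qed
    have den: "(\<Prod>j\<in>{n0..N} - {n}. cmod (l n - l j)) = e * (\<Prod>j\<in>J. cmod (l n - l j))"
    proof (cases "n0 = 0 \<and> n \<noteq> 0")
      case True
      hence "{n0..N} - {n} = insert 0 J" "0 \<notin> J" by (auto simp: J_def)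
      thus ?thesis using J True by (simp add: e_def)
    next
      case False
      hence "{n0..N} - {n} = J" using n n0 by (auto simp: J_def)
      thus ?thesis unfolding e_def if_not_P[OF False] by simp
    qed
    have Jn: "{j \<in> J. n < j} = {n<..N}" using n by (auto simp: J_def)
    have "1 / cmod (nodal N n) = (\<Prod>j\<in>{1..N}. cmod (l n - \<gamma> j)) / (\<Prod>j\<in>{n0..N} - {n}. cmod (l n - l j))"
      by (simp add: nodal_def norm_divide prod_norm)
    also have "\<dots> = d n / e * (\<Prod>j\<in>J. cmod (l n - \<gamma> j) / cmod (l n - l j))"
      unfolding num den prod_dividef by simp
    also have "\<dots> \<le> d n / (c' * se n) * (A * (\<Prod>j\<in>{j\<in>J. n < j}. g j / cmod (l j)))"
      using d_pos[of n] c'(1) se_pos[of n] e0 ebound n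
      by (intro mult_mono frac_le A(3) J prod_nonneg mult_pos_pos) auto
    also have "\<dots> = A / c' * (d n / se n) * (h N / h n)"
      unfolding Jn using prod_h(2)[of n N] n by simp
    finally show "1 / cmod (nodal N n) \<le> A / c' * (d n / se n) * (h N / h n)" .
  qed
qed

text \<open>The entry is 1 / nodal times 1 / (\<lambda>_n - \<gamma>_k) times a product at
  \<gamma>_k. The two product estimates carry h N / h n and h k / h N, so \<open>h N\<close> cancels
  and the bound is uniform in the section.\<close>

lemma Tm_upper:
  obtains C where "C > 0" "\<And>N k n. k \<in> {1..N} \<Longrightarrow> n \<in> {n0..N} \<Longrightarrow>
    cmod (Tm N k n) \<le> C * (se k / se n * (d k * d n * (h k / h n)) / cmod (l n - \<gamma> k))"
proof -
  obtain A where A: "A > 0"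
    "\<And>z k J. finite J \<Longrightarrow> J \<subseteq> {1..} \<Longrightarrow> k \<notin> J \<Longrightarrow> (z = \<gamma> k \<and> 1 \<le> k) \<or> (z = l k \<and> n0 \<le> k) \<Longrightarrow>
      (\<Prod>j\<in>J. cmod (z - l j) / cmod (z - \<gamma> j)) \<le> A * (\<Prod>j\<in>{j\<in>J. k < j}. cmod (l j) / g j)"
    "\<And>z k J. finite J \<Longrightarrow> J \<subseteq> {1..} \<Longrightarrow> k \<notin> J \<Longrightarrow> (z = \<gamma> k \<and> 1 \<le> k) \<or> (z = l k \<and> n0 \<le> k) \<Longrightarrow>
      (\<Prod>j\<in>J. cmod (z - \<gamma> j) / cmod (z - l j)) \<le> A * (\<Prod>j\<in>{j\<in>J. k < j}. g j / cmod (l j))"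
    using prod_estimate by blast
  obtain C1 where C1: "C1 > 0" "\<And>N n. n \<in> {n0..N} \<Longrightarrow> 1 / cmod (nodal N n) \<le> C1 * (d n / se n) * (h N / h n)"
    using nodal_lower by blast
  \<comment> \<open>From |\<gamma>_k - \<lambda>_0| \<le> s k + |\<lambda>_0| and
    \<open>s 1 \<le> s k\<close>.\<close>
  define C2 where "C2 = 1 + cmod (l 0) / s 1"
  have C2: "C2 \<ge> 1" using s_pos[of 1] by (simp add: C2_def)
  show thesis
  proof (rule that[of "C1 * (C2 * A)"])
    show "C1 * (C2 * A) > 0" using C1 C2 A by simp
    fix N k n :: nat assume k: "k \<in> {1..N}" and n: "n \<in> {n0..N}"
    define J where "J = {1..N} - {k}"
    have J: "finite J" "J \<subseteq> {1..}" "k \<notin> J" by (auto simp: J_def)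
    define e where "e = (if n0 = 0 then cmod (\<gamma> k - l 0) else 1)"
    have ebound: "e \<le> C2 * se k"
    proof (cases "n0 = 0")
      case True
      have "cmod (\<gamma> k - l 0) \<le> s k + cmod (l 0) * 1" using norm_triangle_ineq4[of "\<gamma> k" "l 0"] k by (simp add: s_eq)
      also have "\<dots> \<le> s k + cmod (l 0) * (s k / s 1)"
        using s_mono[of 1 k] k s_pos[of 1] by (intro add_left_mono mult_left_mono) auto
      finally show ?thesis unfolding e_def se_def C2_def using True by (simp add: algebra_simps)
    next
      case False
      thus ?thesis unfolding e_def se_def using C2 by simp
    qed
    have e0: "e \<ge> 0" by (simp add: e_def)
    have num: "(\<Prod>j\<in>{n0..N}. cmod (\<gamma> k - l j)) = d k * e * (\<Prod>j\<in>J. cmod (\<gamma> k - l j))"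
    proof -
      have "(\<Prod>j\<in>{1..N}. cmod (\<gamma> k - l j)) = d k * (\<Prod>j\<in>J. cmod (\<gamma> k - l j))"
      proof -
        have "{1..N} = insert k J" "k \<noteq> 0" using k by (auto simp: J_def)
        thus ?thesis using J by (simp add: d_def norm_minus_commute)
      qed
      moreover have "(\<Prod>j\<in>{n0..N}. cmod (\<gamma> k - l j)) = e * (\<Prod>j\<in>{1..N}. cmod (\<gamma> k - l j))"
      proof (cases "n0 = 0")
        case True
        hence "{n0..N} = insert 0 {1..N}" by auto
        thus ?thesis using True by (simp add: e_def)
      next
        case False
        hence "n0 = 1" using n0 by simp
        thus ?thesis by (simp add: e_def)
      qed
      ultimately show ?thesis by simp
    qed
    have Jk: "{j \<in> J. k < j} = {k<..N}" using k by (auto simp: J_def)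
    have "cmod ((\<Prod>j\<in>{n0..N}. \<gamma> k - l j) / (\<Prod>j\<in>{1..N} - {k}. \<gamma> k - \<gamma> j))
        = d k * e * (\<Prod>j\<in>J. cmod (\<gamma> k - l j) / cmod (\<gamma> k - \<gamma> j))"
      unfolding norm_divide prod_norm[symmetric] num J_def[symmetric] prod_dividef by simp
    also have "\<dots> \<le> d k * (C2 * se k) * (A * (\<Prod>j\<in>{j\<in>J. k < j}. cmod (l j) / g j))"
      using d_pos[of k] e0 ebound k by (intro mult_mono A(2) J prod_nonneg) auto
    also have "\<dots> = d k * (C2 * se k) * (A * (h k / h N))"
      unfolding Jk using prod_h(1)[of k N] k by simp
    finally have 2: "cmod ((\<Prod>j\<in>{n0..N}. \<gamma> k - l j) / (\<Prod>j\<in>{1..N} - {k}. \<gamma> k - \<gamma> j)) \<le> d k * (C2 * se k) * (A * (h k / h N))" .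
    have "l n - \<gamma> k \<noteq> 0" using l_disj[of n k] k n by simp
    hence 1: "(\<Prod>j\<in>{1..N} - {k}. l n - \<gamma> j) / (\<Prod>j\<in>{n0..N} - {n}. l n - l j) = 1 / nodal N n / (l n - \<gamma> k)"
      unfolding nodal_def prod.remove[OF finite_atLeastAtMost k] by simp
    have "cmod (Tm N k n) = 1 / cmod (nodal N n) / cmod (l n - \<gamma> k)
        * cmod ((\<Prod>j\<in>{n0..N}. \<gamma> k - l j) / (\<Prod>j\<in>{1..N} - {k}. \<gamma> k - \<gamma> j))"
      unfolding Tm_def 1 norm_mult norm_divide norm_one ..
    also have "\<dots> \<le> (C1 * (d n / se n) * (h N / h n)) / cmod (l n - \<gamma> k) * (d k * (C2 * se k) * (A * (h k / h N)))"
      using C1 d_pos[of n] d_pos[of k] se_pos[of n] h_pos[of n] h_pos[of N]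
      by (intro mult_mono divide_right_mono C1(2) n 2 mult_nonneg_nonneg divide_nonneg_nonneg) auto
    also have "\<dots> = C1 * (C2 * A) * (se k / se n * (d k * d n * (h k / h n)) / cmod (l n - \<gamma> k))"
      using h_pos[of N] by (simp add: mult_ac)
    finally show "cmod (Tm N k n) \<le> C1 * (C2 * A) * (se k / se n * (d k * d n * (h k / h n)) / cmod (l n - \<gamma> k))" .
  qed
qed

lemma d_eq: "d n = sqrt (u n) * sqrt (vh n)" "d n = sqrt (u n) * (sqrt (ph n) * s n)"
proof -
  show 1: "d n = sqrt (u n) * sqrt (vh n)"
    unfolding u_def real_sqrt_mult[symmetric] using d_pos[of n] vh_pos[of n] by simp
  have "sqrt (vh n) = sqrt (ph n) * s n"
    unfolding ph_def using s_pos[of n] by (simp add: real_sqrt_divide)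
  thus "d n = sqrt (u n) * (sqrt (ph n) * s n)" using 1 by simp
qed

text \<open>Splitting off \<open>sqrt (v k) * sqrt (wt n)\<close> passes from the weighted spaces to
  plain square sums. The diagonal is kept apart because there the denominator is \<open>d k\<close>
  itself and cancels one of the two factors \<open>d\<close>; off it the separation of levels
  applies.\<close>

lemma Tm_kernel:
  obtains C where "C > 0" "\<And>N k. k \<in> {1..N} \<Longrightarrow> cmod (Tm N k k) \<le> C * (sqrt (v k) * sqrt (wt k))"
    "\<And>N k n. k \<in> {1..N} \<Longrightarrow> n \<in> {n0..N} \<Longrightarrow> k \<noteq> n \<Longrightarrow>
      cmod (Tm N k n) \<le> C * (se k / se n * (h k / h n) * (sqrt (u k) * sqrt (ph n)) * (s n / max (s k) (s n))) * (sqrt (v k) * sqrt (wt n))"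
proof -
  obtain C1 where C1: "C1 > 0" "\<And>N k n. k \<in> {1..N} \<Longrightarrow> n \<in> {n0..N} \<Longrightarrow>
    cmod (Tm N k n) \<le> C1 * (se k / se n * (d k * d n * (h k / h n)) / cmod (l n - \<gamma> k))"
    using Tm_upper by blast
  obtain Cw where Cw: "Cw > 0" "\<And>n. n \<ge> n0 \<Longrightarrow> w (l n) \<le> Cw * u n" "\<And>n. n \<ge> n0 \<Longrightarrow> u n \<le> Cw * w (l n)"
    using weight_comparable by blast
  obtain c where c: "c > 0"
    "\<And>k j. 1 \<le> k \<Longrightarrow> 1 \<le> j \<Longrightarrow> k \<noteq> j \<Longrightarrow> c * max (s k) (s j) \<le> cmod (\<gamma> k - \<gamma> j)"
    "\<And>k j. 1 \<le> k \<Longrightarrow> n0 \<le> j \<Longrightarrow> k \<noteq> j \<Longrightarrow> c * max (s k) (s j) \<le> cmod (\<gamma> k - l j)"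
    "\<And>k j. n0 \<le> k \<Longrightarrow> 1 \<le> j \<Longrightarrow> k \<noteq> j \<Longrightarrow> c * max (s k) (s j) \<le> cmod (l k - \<gamma> j)"
    "\<And>k j. n0 \<le> k \<Longrightarrow> n0 \<le> j \<Longrightarrow> k \<noteq> j \<Longrightarrow> c * max (s k) (s j) \<le> cmod (l k - l j)"
    using sep by blast
  have uw: "sqrt (u n) \<le> sqrt Cw * sqrt (wt n)" if "n \<ge> n0" for n
    using real_sqrt_le_mono[OF Cw(3)[OF that]] by (simp add: real_sqrt_mult wt_eq[OF that])
  have sC: "sqrt Cw > 0" using Cw by simp
  define C where "C = C1 * sqrt Cw + C1 * sqrt Cw / c"
  have C: "C1 * sqrt Cw \<le> C" "C1 * sqrt Cw / c \<le> C" using C1(1) sC c(1) by (auto simp: C_def)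
  show thesis
  proof (rule that[of C])
    show "C > 0" using C1(1) sC c(1) by (simp add: C_def add_pos_pos)
    fix N k :: nat assume k: "k \<in> {1..N}"
    have kn: "k \<in> {n0..N}" using k n0 by auto
    have dk: "cmod (l k - \<gamma> k) = d k" using k by (simp add: d_def)
    have "cmod (Tm N k k) \<le> C1 * (se k / se k * (d k * d k * (h k / h k)) / d k)" using C1(2)[OF k kn] unfolding dk .
    also have "\<dots> = C1 * d k" using se_pos[of k] h_pos[of k] d_pos[of k] by simp
    also have "d k = sqrt (u k) * sqrt (v k)" using d_eq(1)[of k] k by (simp add: vh_def)
    also have "C1 * (sqrt (u k) * sqrt (v k)) \<le> C1 * ((sqrt Cw * sqrt (wt k)) * sqrt (v k))"
      using C1(1) uw[of k] kn v_pos[of k] k by (intro mult_left_mono mult_right_mono) auto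
    also have "\<dots> = C1 * sqrt Cw * (sqrt (v k) * sqrt (wt k))" by simp
    also have "\<dots> \<le> C * (sqrt (v k) * sqrt (wt k))"
      using C(1) v_pos[of k] k wt_nonneg[of k] by (intro mult_right_mono mult_nonneg_nonneg) auto
    finally show "cmod (Tm N k k) \<le> C * (sqrt (v k) * sqrt (wt k))" .
  next
    fix N k n :: nat assume k: "k \<in> {1..N}" and n: "n \<in> {n0..N}" and kn: "k \<noteq> n"
    have mx: "max (s k) (s n) > 0" using s_pos[of k] by simp
    have dist: "c * max (s k) (s n) \<le> cmod (l n - \<gamma> k)"
      using c(4)[of n k] k n kn by (simp add: max.commute)
    have "cmod (Tm N k n) \<le> C1 * (se k / se n * (d k * d n * (h k / h n)) / cmod (l n - \<gamma> k))" by (rule C1(2)[OF k n])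
    also have "\<dots> \<le> C1 * (se k / se n * (d k * (sqrt Cw * sqrt (wt n) * (sqrt (ph n) * s n)) * (h k / h n)) / (c * max (s k) (s n)))"
    proof (intro mult_left_mono frac_le mult_right_mono)
      show "d n \<le> sqrt Cw * sqrt (wt n) * (sqrt (ph n) * s n)"
        unfolding d_eq(2)[of n] using uw[of n] n ph_pos[of n] s_pos[of n] by (intro mult_right_mono mult_nonneg_nonneg) auto
      show "0 \<le> se k / se n * (d k * (sqrt Cw * sqrt (wt n) * (sqrt (ph n) * s n)) * (h k / h n))"
        using se_pos[of k] se_pos[of n] d_pos[of k] sC wt_nonneg[of n] ph_pos[of n] s_pos[of n] h_pos[of k] h_pos[of n]
        by (intro mult_nonneg_nonneg divide_nonneg_nonneg) auto
    qed (use se_pos[of k] se_pos[of n] d_pos[of k] h_pos[of k] h_pos[of n] C1(1) dist c(1) mx in \<open>auto intro: less_imp_le\<close>)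
    also have "\<dots> = C1 * sqrt Cw / c * ((se k / se n * (h k / h n) * (sqrt (u k) * sqrt (ph n)) * (s n / max (s k) (s n))) * (sqrt (v k) * sqrt (wt n)))"
    proof -
      have "d k = sqrt (u k) * sqrt (v k)" using d_eq(1)[of k] k by (simp add: vh_def)
      thus ?thesis by (simp only: times_divide_eq_left times_divide_eq_right divide_divide_eq_left mult_ac)
    qed
    also have "\<dots> \<le> C * ((se k / se n * (h k / h n) * (sqrt (u k) * sqrt (ph n)) * (s n / max (s k) (s n))) * (sqrt (v k) * sqrt (wt n)))"
    proof (rule mult_right_mono[OF C(2)])
      show "0 \<le> (se k / se n * (h k / h n) * (sqrt (u k) * sqrt (ph n)) * (s n / max (s k) (s n))) * (sqrt (v k) * sqrt (wt n))"
        using less_imp_le[OF se_pos[of k]] less_imp_le[OF se_pos[of n]] less_imp_le[OF h_pos[of k]] less_imp_le[OF h_pos[of n]]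
          less_imp_le[OF u_pos[of k]] less_imp_le[OF ph_pos[of n]] less_imp_le[OF s_pos[of n]] less_imp_le[OF mx]
          v_pos[of k] k wt_nonneg[of n]
        by (intro mult_nonneg_nonneg divide_nonneg_nonneg real_sqrt_ge_zero) auto
    qed
    finally show "cmod (Tm N k n) \<le> C * (se k / se n * (h k / h n) * (sqrt (u k) * sqrt (ph n)) * (s n / max (s k) (s n))) * (sqrt (v k) * sqrt (wt n))"
      by (simp only: mult.assoc)
  qed
qed

lemma Tm_bounded:
  assumes \<theta>: "0 \<le> \<theta>" "\<theta> < 1" and A: "A \<ge> 0" and U: "\<And>k n. U k n \<ge> 0"
    and T: "\<And>N k n. k \<in> {1..N} \<Longrightarrow> n \<in> {n0..N} \<Longrightarrow>
      cmod (Tm N k n) \<le> A * (\<theta> ^ ((k - n) + (n - k)) + U k n) * (sqrt (v k) * sqrt (wt n))"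
    and S: "\<And>N x. (\<Sum>k\<in>{1..N}. (\<Sum>n\<in>{n0..N}. U k n * x n)\<^sup>2) \<le> C * (\<Sum>n\<in>{n0..N}. (x n)\<^sup>2)"
    and x: "\<And>n. x n \<ge> 0"
  shows "(\<Sum>k\<in>{1..N}. (\<Sum>n\<in>{n0..N}. cmod (Tm N k n) * x n)\<^sup>2 / v k)
    \<le> 2 * A\<^sup>2 * ((2 / (1 - \<theta>))\<^sup>2 + C) * (\<Sum>n\<in>{n0..N}. (x n)\<^sup>2 * w (l n))"
proof -
  have "(\<Sum>k\<in>{1..N}. (\<Sum>n\<in>{n0..N}. cmod (Tm N k n) * x n)\<^sup>2 / v k)
      = (\<Sum>k\<in>{1..N}. (\<Sum>n\<in>{n0..N}. cmod (Tm N k n) / (sqrt (v k) * sqrt (wt n)) * (x n * sqrt (wt n)))\<^sup>2)"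
  proof (rule sum.cong[OF refl])
    fix k assume k: "k \<in> {1..N}"
    have vk: "v k > 0" using v_pos k by simp
    have "(\<Sum>n\<in>{n0..N}. cmod (Tm N k n) / (sqrt (v k) * sqrt (wt n)) * (x n * sqrt (wt n)))
        = (\<Sum>n\<in>{n0..N}. cmod (Tm N k n) * x n / sqrt (v k))"
    proof (rule sum.cong[OF refl])
      fix n assume "n \<in> {n0..N}"
      hence "sqrt (wt n) > 0" using wt_pos by simp
      thus "cmod (Tm N k n) / (sqrt (v k) * sqrt (wt n)) * (x n * sqrt (wt n)) = cmod (Tm N k n) * x n / sqrt (v k)" by simp
    qed
    also have "\<dots> = (\<Sum>n\<in>{n0..N}. cmod (Tm N k n) * x n) / sqrt (v k)" by (rule sum_divide_distrib[symmetric])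
    finally show "(\<Sum>n\<in>{n0..N}. cmod (Tm N k n) * x n)\<^sup>2 / v k
        = (\<Sum>n\<in>{n0..N}. cmod (Tm N k n) / (sqrt (v k) * sqrt (wt n)) * (x n * sqrt (wt n)))\<^sup>2"
      using vk by (simp add: power_divide)
  qed
  also have "\<dots> \<le> 2 * A\<^sup>2 * ((2 / (1 - \<theta>))\<^sup>2 + C) * (\<Sum>n\<in>{n0..N}. (x n * sqrt (wt n))\<^sup>2)"
  proof (rule schur_combine[OF \<theta> finite_atLeastAtMost finite_atLeastAtMost _ _ S])
    fix k n assume k: "k \<in> {1..N}" and n: "n \<in> {n0..N}"
    have "sqrt (v k) * sqrt (wt n) > 0" using v_pos[of k] k wt_pos[of n] n by simp
    thus "0 \<le> cmod (Tm N k n) / (sqrt (v k) * sqrt (wt n))"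
      "cmod (Tm N k n) / (sqrt (v k) * sqrt (wt n)) \<le> A * (\<theta> ^ (k - n + (n - k)) + U k n)"
      using T[OF k n] by (simp_all only: pos_divide_le_eq divide_nonneg_pos norm_ge_zero)
  next
    fix n show "x n * sqrt (wt n) \<ge> 0" using x wt_nonneg by simp
  qed
  also have "(\<Sum>n\<in>{n0..N}. (x n * sqrt (wt n))\<^sup>2) = (\<Sum>n\<in>{n0..N}. (x n)\<^sup>2 * w (l n))"
    using wt_nonneg by (intro sum.cong refl) (simp add: power_mult_distrib flip: wt_eq)
  finally show ?thesis .
qed

lemma sqrt_u_le:
  obtains C where "C > 0" "\<And>n. n \<ge> n0 \<Longrightarrow> sqrt (u n) \<le> C * sqrt (wt n)" "\<And>n. n \<ge> n0 \<Longrightarrow> sqrt (wt n) \<le> C * sqrt (u n)"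
proof -
  obtain C where C: "C > 0" "\<And>n. n \<ge> n0 \<Longrightarrow> w (l n) \<le> C * u n" "\<And>n. n \<ge> n0 \<Longrightarrow> u n \<le> C * w (l n)"
    using weight_comparable by blast
  show thesis
  proof (rule that[of "sqrt C"])
    show "sqrt C > 0" using C by simp
    fix n assume n: "n \<ge> n0"
    show "sqrt (u n) \<le> sqrt C * sqrt (wt n)" "sqrt (wt n) \<le> sqrt C * sqrt (u n)"
      using real_sqrt_le_mono[OF C(3)[OF n]] real_sqrt_le_mono[OF C(2)[OF n]] by (simp_all add: real_sqrt_mult wt_eq[OF n])
  qed
qed

text \<open>From u_k \<le> M / P_k and ph_n \<le> C P_n. The finer information in \<open>u\<close>
  and \<open>p\<close> is lost, so this serves the entries for which geometric decay
  compensates.\<close>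

lemma sqrt_u_ph_le:
  obtains C where "C > 0" "\<And>k n. k \<ge> 1 \<Longrightarrow> sqrt (u k) * sqrt (ph n) \<le> C * (sqrt (Pt n) / sqrt (Pt k))"
proof -
  obtain C where C: "C > 0" "\<And>n. ph n \<le> C * Pt n" using ph_le by blast
  show thesis
  proof (rule that[of "sqrt M * sqrt C"])
    show "sqrt M * sqrt C > 0" using M_pos C by simp
    fix k n :: nat assume k: "k \<ge> 1"
    have "sqrt (u k) * sqrt (ph n) \<le> sqrt (M / Pt k) * sqrt (C * Pt n)"
      using real_sqrt_le_mono[OF u_le[OF k]] real_sqrt_le_mono[OF C(2)[of n]] ph_pos[of n] M_pos Pt_pos[of k]
      by (intro mult_mono) auto
    thus "sqrt (u k) * sqrt (ph n) \<le> sqrt M * sqrt C * (sqrt (Pt n) / sqrt (Pt k))"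
      by (simp add: real_sqrt_mult real_sqrt_divide)
  qed
qed

text \<open>The normalized entries \<open>sqrt (wt n) * sqrt (v k) / cmod (l n - \<gamma> k)\<close>
  are at most 1 for n = k by the definition of the weight, decay geometrically for n > k, and for n
  < k are at most a multiple of \<open>sqrt (wt n * p k)\<close>, the kernel of
  \<open>schur_up\<close> with t = 1/2.\<close>

lemma Hilb_bounded:
  assumes W: "\<And>n. (\<Sum>m<n. wt m) * Pt n \<le> B"
  obtains C where "\<And>N a. a \<in> \<H> \<Longrightarrow> (\<Sum>n\<in>{n0..N}. (cmod (f a (l n)))\<^sup>2 * w (l n)) \<le> C * nsq v a"
proof -
  obtain Cu where Cu: "Cu > 0" "\<And>n. n \<ge> n0 \<Longrightarrow> sqrt (u n) \<le> Cu * sqrt (wt n)" "\<And>n. n \<ge> n0 \<Longrightarrow> sqrt (wt n) \<le> Cu * sqrt (u n)"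
    using sqrt_u_le by blast
  obtain Cp where Cp: "Cp > 0" "\<And>k n. k \<ge> 1 \<Longrightarrow> sqrt (u k) * sqrt (ph n) \<le> Cp * (sqrt (Pt n) / sqrt (Pt k))"
    using sqrt_u_ph_le by blast
  obtain Cg \<theta> where \<theta>: "Cg > 0" "0 < \<theta>" "\<theta> < 1"
    "\<And>m n. m \<le> n \<Longrightarrow> h n / (sqrt (Pt n) * s n) \<le> Cg * \<theta> ^ (n - m) * (h m / (sqrt (Pt m) * s m))"
    "\<And>m n. m \<le> n \<Longrightarrow> sqrt (Pt n) / (h n * s n) \<le> Cg * \<theta> ^ (n - m) * (sqrt (Pt m) / (h m * s m))"
    "\<And>m n. m \<le> n \<Longrightarrow> 1 / (sqrt (Pt n) * s n) \<le> Cg * \<theta> ^ (n - m) * (1 / (sqrt (Pt m) * s m))"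
    using geometric_ratios by blast
  obtain c where c: "c > 0"
    "\<And>k j. 1 \<le> k \<Longrightarrow> 1 \<le> j \<Longrightarrow> k \<noteq> j \<Longrightarrow> c * max (s k) (s j) \<le> cmod (\<gamma> k - \<gamma> j)"
    "\<And>k j. 1 \<le> k \<Longrightarrow> n0 \<le> j \<Longrightarrow> k \<noteq> j \<Longrightarrow> c * max (s k) (s j) \<le> cmod (\<gamma> k - l j)"
    "\<And>k j. n0 \<le> k \<Longrightarrow> 1 \<le> j \<Longrightarrow> k \<noteq> j \<Longrightarrow> c * max (s k) (s j) \<le> cmod (l k - \<gamma> j)"
    "\<And>k j. n0 \<le> k \<Longrightarrow> n0 \<le> j \<Longrightarrow> k \<noteq> j \<Longrightarrow> c * max (s k) (s j) \<le> cmod (l k - l j)"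
    using sep by blast
  \<comment> \<open>The exponents stay in the form \<open>1 / 2 - 1 / 2\<close> so that this is
    literally an instance of the kernel in \<open>schur_up\<close>.\<close>
  define U where "U k n = (if k < n then sqrt (wt k) * Pt k powr (1 / 2 - 1 / 2) * (sqrt (p n) * Pt n powr (1 / 2 - 1 / 2)) else 0)" for k n
  obtain S where S: "S \<ge> 0" "\<And>I J x. finite I \<Longrightarrow> finite J \<Longrightarrow> I \<subseteq> {n0..} \<Longrightarrow> J \<subseteq> {1..} \<Longrightarrow>
      (\<Sum>k\<in>I. (\<Sum>n\<in>J. U k n * x n)\<^sup>2) \<le> S * (\<Sum>n\<in>J. (x n)\<^sup>2)"
    using schur_up[OF W half_gt_zero[OF zero_less_one], folded U_def] by auto
  define A where "A = 1 + 1 / c + Cu * Cp * Cg / c"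
  have pos: "Cu * Cp * Cg / c > 0" using Cu(1) Cp(1) \<theta>(1) c(1) by simp
  have A: "1 \<le> A" "1 / c \<le> A" "Cu * Cp * Cg / c \<le> A" using pos c(1) by (auto simp: A_def)
  have U0: "U n k \<ge> 0" if "k \<ge> 1" for n k
    unfolding U_def using wt_nonneg[of n] less_imp_le[OF p_pos[OF that]] by (auto intro!: mult_nonneg_nonneg)
  have T: "sqrt (wt n) * sqrt (v k) / cmod (l n - \<gamma> k) \<le> A * (\<theta> ^ ((n - k) + (k - n)) + U n k)"
    if n: "n \<ge> n0" and k: "k \<ge> 1" for n k
  proof -
    have th0: "\<theta> ^ ((n - k) + (k - n)) \<ge> 0" using \<theta> by simp
    have dist0: "cmod (l n - \<gamma> k) > 0" using l_disj[OF n k] by simp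
    have svk: "sqrt (v k) = sqrt (ph k) * s k"
      using s_pos[of k] k by (simp add: ph_def vh_def real_sqrt_divide)
    have mx: "max (s n) (s k) \<ge> s n" "max (s n) (s k) \<ge> s k" by auto
    have num0: "sqrt (wt n) * sqrt (v k) \<ge> 0" using wt_nonneg v_pos[OF k] by (intro mult_nonneg_nonneg) auto
    show ?thesis
    proof (cases n k rule: linorder_cases)
      case equal
      have "w (l n) \<le> (cmod (l n - \<gamma> k))\<^sup>2 / v k" using w_le_term[OF l_notin[OF n] k] v_pos[OF k] by (simp only: pos_le_divide_eq)
      hence "sqrt (w (l n)) \<le> sqrt ((cmod (l n - \<gamma> k))\<^sup>2 / v k)" by (rule real_sqrt_le_mono)
      hence "sqrt (wt n) \<le> cmod (l n - \<gamma> k) / sqrt (v k)" by (simp add: real_sqrt_divide wt_eq[OF n])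
      hence "sqrt (wt n) * sqrt (v k) \<le> cmod (l n - \<gamma> k)" using v_pos[OF k] by (simp add: pos_le_divide_eq)
      hence "sqrt (wt n) * sqrt (v k) / cmod (l n - \<gamma> k) \<le> 1" using dist0 by (simp only: pos_divide_le_eq mult_1)
      also have "1 \<le> A * (\<theta> ^ ((n - k) + (k - n)) + U n k)" using equal A(1) by (simp add: U_def)
      finally show ?thesis .
    next
      case less
      have "sqrt (wt n) * sqrt (v k) / cmod (l n - \<gamma> k) \<le> sqrt (wt n) * sqrt (v k) / (c * s k)"
      proof (intro divide_left_mono num0 mult_pos_pos)
        have "c * s k \<le> c * max (s n) (s k)" using mx c(1) by (intro mult_left_mono) auto
        thus "c * s k \<le> cmod (l n - \<gamma> k)" using c(4)[OF n k] less by simp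
      qed (use dist0 c(1) s_pos in auto)
      also have "\<dots> = 1 / c * (sqrt (wt n) * sqrt (ph k))" unfolding svk using s_pos[of k] by simp
      also have "\<dots> = 1 / c * U n k"
        unfolding U_def ph_eq[OF k] if_P[OF less] using Pt_pos[of n] Pt_pos[of k] by simp
      also have "\<dots> \<le> A * (\<theta> ^ ((n - k) + (k - n)) + U n k)"
        using A U0[OF k, of n] th0 by (intro mult_mono) auto
      finally show ?thesis .
    next
      case greater
      have n1: "n \<ge> 1" using greater k by simp
      have U: "U n k = 0" using greater by (simp add: U_def)
      have "sqrt (wt n) * sqrt (v k) / cmod (l n - \<gamma> k) \<le> sqrt (wt n) * sqrt (v k) / (c * s n)"
      proof (intro divide_left_mono num0 mult_pos_pos)
        have "c * s n \<le> c * max (s n) (s k)" using mx c(1) by (intro mult_left_mono) auto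
        thus "c * s n \<le> cmod (l n - \<gamma> k)" using c(4)[OF n k] greater by simp
      qed (use dist0 c(1) s_pos in auto)
      also have "\<dots> \<le> (Cu * sqrt (u n)) * (sqrt (ph k) * s k) / (c * s n)"
        unfolding svk using Cu(3)[OF n] ph_pos[of k] s_pos[of k] s_pos[of n] c(1)
        by (intro divide_right_mono mult_right_mono mult_nonneg_nonneg) (auto intro: less_imp_le)
      also have "\<dots> = Cu / c * (sqrt (u n) * sqrt (ph k)) * (s k / s n)" by simp
      also have "\<dots> \<le> Cu / c * (Cp * (sqrt (Pt k) / sqrt (Pt n))) * (s k / s n)"
        using Cp(2)[OF n1, of k] Cu(1) c(1) s_pos[of k] s_pos[of n] by (intro mult_right_mono mult_left_mono) auto
      also have "\<dots> = Cu * Cp / c * ((1 / (sqrt (Pt n) * s n)) / (1 / (sqrt (Pt k) * s k)))" by (simp add: mult_ac)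
      also have "\<dots> \<le> Cu * Cp / c * (Cg * \<theta> ^ (n - k))"
      proof (rule mult_left_mono)
        have "1 / (sqrt (Pt k) * s k) > 0" using Pt_pos[of k] s_pos[of k] by simp
        thus "(1 / (sqrt (Pt n) * s n)) / (1 / (sqrt (Pt k) * s k)) \<le> Cg * \<theta> ^ (n - k)"
          using \<theta>(6)[of k n] greater by (simp only: pos_divide_le_eq less_imp_le)
      qed (use Cu(1) Cp(1) c(1) in simp)
      also have "\<dots> = Cu * Cp * Cg / c * \<theta> ^ (n - k)" by simp
      also have "\<dots> \<le> A * \<theta> ^ (n - k)" using A(3) \<theta> by (intro mult_right_mono) auto
      finally show ?thesis unfolding U using greater by simp
    qed
  qed
  define C where "C = 2 * A\<^sup>2 * ((2 / (1 - \<theta>))\<^sup>2 + S)"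
  have C0: "C \<ge> 0" unfolding C_def using S(1) by (intro mult_nonneg_nonneg add_nonneg_nonneg) auto
  have fin: "(\<Sum>n\<in>{n0..N}. (cmod (\<Sum>k\<in>{1..K}. a k * of_real (v k) / (l n - \<gamma> k)))\<^sup>2 * w (l n)) \<le> C * nsq v a"
    if a: "a \<in> \<H>" for N K a
  proof -
    have "(\<Sum>n\<in>{n0..N}. (cmod (\<Sum>k\<in>{1..K}. a k * of_real (v k) / (l n - \<gamma> k)))\<^sup>2 * w (l n))
        \<le> (\<Sum>n\<in>{n0..N}. (\<Sum>k\<in>{1..K}. sqrt (wt n) * sqrt (v k) / cmod (l n - \<gamma> k) * (cmod (a k) * sqrt (v k)))\<^sup>2)"
    proof (rule sum_mono)
      fix n assume n: "n \<in> {n0..N}"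
      have "cmod (\<Sum>k\<in>{1..K}. a k * of_real (v k) / (l n - \<gamma> k)) * sqrt (wt n)
          \<le> (\<Sum>k\<in>{1..K}. cmod (a k * of_real (v k) / (l n - \<gamma> k))) * sqrt (wt n)"
        using wt_nonneg by (intro mult_right_mono norm_sum) auto
      also have "\<dots> = (\<Sum>k\<in>{1..K}. sqrt (wt n) * sqrt (v k) / cmod (l n - \<gamma> k) * (cmod (a k) * sqrt (v k)))"
        unfolding sum_distrib_right
      proof (rule sum.cong[OF refl])
        fix k assume "k \<in> {1..K}"
        hence vk: "v k > 0" using v_pos by simp
        have "cmod (a k * of_real (v k) / (l n - \<gamma> k)) = cmod (a k) * v k / cmod (l n - \<gamma> k)"
          using vk by (simp add: norm_mult norm_divide)
        moreover have "v k = sqrt (v k) * sqrt (v k)" using vk by simp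
        moreover have "b * x / e * y = y * z / e * (b * z)" if "x = z * z" for b x e y z :: real using that by simp
        ultimately show "cmod (a k * of_real (v k) / (l n - \<gamma> k)) * sqrt (wt n)
            = sqrt (wt n) * sqrt (v k) / cmod (l n - \<gamma> k) * (cmod (a k) * sqrt (v k))" by metis
      qed
      finally have "(cmod (\<Sum>k\<in>{1..K}. a k * of_real (v k) / (l n - \<gamma> k)) * sqrt (wt n))\<^sup>2
          \<le> (\<Sum>k\<in>{1..K}. sqrt (wt n) * sqrt (v k) / cmod (l n - \<gamma> k) * (cmod (a k) * sqrt (v k)))\<^sup>2"
        using wt_nonneg by (intro power_mono) auto
      moreover have "(sqrt (wt n))\<^sup>2 = w (l n)" using wt_nonneg[of n] n by (simp flip: wt_eq)
      ultimately show "(cmod (\<Sum>k\<in>{1..K}. a k * of_real (v k) / (l n - \<gamma> k)))\<^sup>2 * w (l n)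
          \<le> (\<Sum>k\<in>{1..K}. sqrt (wt n) * sqrt (v k) / cmod (l n - \<gamma> k) * (cmod (a k) * sqrt (v k)))\<^sup>2"
        by (simp only: power_mult_distrib)
    qed
    also have "\<dots> \<le> C * (\<Sum>k\<in>{1..K}. (cmod (a k) * sqrt (v k))\<^sup>2)"
      unfolding C_def
    proof (rule schur_combine[OF less_imp_le[OF \<theta>(2)] \<theta>(3) finite_atLeastAtMost finite_atLeastAtMost _ _ S(2)])
      fix n k assume n: "n \<in> {n0..N}" and k: "k \<in> {1..K}"
      show "0 \<le> sqrt (wt n) * sqrt (v k) / cmod (l n - \<gamma> k)"
        using wt_nonneg[of n] v_pos[of k] k by (intro divide_nonneg_nonneg mult_nonneg_nonneg) auto
      show "sqrt (wt n) * sqrt (v k) / cmod (l n - \<gamma> k) \<le> A * (\<theta> ^ (n - k + (k - n)) + U n k)"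
        using n k by (intro T) auto
    next
      fix k assume "k \<in> {1..K}"
      thus "0 \<le> cmod (a k) * sqrt (v k)" using v_pos[of k] by simp
    qed auto
    also have "(\<Sum>k\<in>{1..K}. (cmod (a k) * sqrt (v k))\<^sup>2) = (\<Sum>k\<in>{1..K}. (cmod (a k))\<^sup>2 * v k)"
      using v_pos by (intro sum.cong refl) (simp add: power_mult_distrib less_imp_le)
    also have "C * (\<Sum>k\<in>{1..K}. (cmod (a k))\<^sup>2 * v k) \<le> C * nsq v a"
      using nsq_ge_sum[OF a, of "{1..K}"] by (intro mult_left_mono C0) auto
    finally show ?thesis .
  qed
  show thesis
  proof (rule that[of C])
    fix N a assume a: "a \<in> \<H>"
    have lim: "(\<lambda>K. \<Sum>k\<in>{1..K}. a k * of_real (v k) / (l n - \<gamma> k)) \<longlonglongrightarrow> f a (l n)" if "n \<in> {n0..N}" for n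
      unfolding Hilb_def using l_notin[of n] that by (intro sum_tendsto_infsum hilb_summable a) auto
    have "(\<lambda>K. \<Sum>n\<in>{n0..N}. (cmod (\<Sum>k\<in>{1..K}. a k * of_real (v k) / (l n - \<gamma> k)))\<^sup>2 * w (l n))
        \<longlonglongrightarrow> (\<Sum>n\<in>{n0..N}. (cmod (f a (l n)))\<^sup>2 * w (l n))"
      by (intro tendsto_intros lim)
    thus "(\<Sum>n\<in>{n0..N}. (cmod (f a (l n)))\<^sup>2 * w (l n)) \<le> C * nsq v a"
      using fin[OF a] by (intro LIMSEQ_le_const2) auto
  qed
qed

lemma sufficient_of_kernel:
  assumes W: "\<And>n. (\<Sum>m<n. wt m) * Pt n \<le> B"
    and \<theta>: "0 \<le> \<theta>" "\<theta> < 1" and A: "A \<ge> 1" and S0: "S \<ge> 0" and U0: "\<And>k n. U k n \<ge> 0"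
    and S: "\<And>N x. (\<Sum>k\<in>{1..N}. (\<Sum>n\<in>{n0..N}. U k n * x n)\<^sup>2) \<le> S * (\<Sum>n\<in>{n0..N}. (x n)\<^sup>2)"
    and K: "\<And>k n. k \<ge> 1 \<Longrightarrow> n \<ge> n0 \<Longrightarrow> k \<noteq> n \<Longrightarrow>
      se k / se n * (h k / h n) * (sqrt (u k) * sqrt (ph n)) * (s n / max (s k) (s n)) \<le> A * (\<theta> ^ ((k - n) + (n - k)) + U k n)"
    and CL: "n0 = 0 \<Longrightarrow> (\<lambda>N. \<Sum>n\<in>{n0..N}. 1 / ((cmod (nodal N n))\<^sup>2 * w (l n))) \<longlonglongrightarrow> 0"
  shows "hilb_invertible_on \<gamma> v (l ` {n0..})"
proof -
  obtain C where C: "C > 0" "\<And>N k. k \<in> {1..N} \<Longrightarrow> cmod (Tm N k k) \<le> C * (sqrt (v k) * sqrt (wt k))"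
    "\<And>N k n. k \<in> {1..N} \<Longrightarrow> n \<in> {n0..N} \<Longrightarrow> k \<noteq> n \<Longrightarrow>
      cmod (Tm N k n) \<le> C * (se k / se n * (h k / h n) * (sqrt (u k) * sqrt (ph n)) * (s n / max (s k) (s n))) * (sqrt (v k) * sqrt (wt n))"
    using Tm_kernel by blast
  have T: "cmod (Tm N k n) \<le> C * A * (\<theta> ^ ((k - n) + (n - k)) + U k n) * (sqrt (v k) * sqrt (wt n))"
    if k: "k \<in> {1..N}" and n: "n \<in> {n0..N}" for N k n
  proof -
    have Y: "sqrt (v k) * sqrt (wt n) \<ge> 0" using v_pos[of k] k wt_nonneg[of n] by (intro mult_nonneg_nonneg) auto
    show ?thesis
    proof (cases "k = n")
      case True
      \<comment> \<open>On the diagonal the geometric term is \<theta>^0 = 1, so A \<ge> 1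
        suffices.\<close>
      have AU: "1 \<le> A * (\<theta> ^ ((k - n) + (n - k)) + U k n)"
        using mult_mono[OF A, of 1 "1 + U k n"] True A U0[of k n] by simp
      have "cmod (Tm N k n) \<le> C * 1 * (sqrt (v k) * sqrt (wt n))" using C(2)[OF k] True by simp
      also have "\<dots> \<le> C * (A * (\<theta> ^ ((k - n) + (n - k)) + U k n)) * (sqrt (v k) * sqrt (wt n))"
        using C(1) by (intro mult_right_mono[OF _ Y] mult_left_mono[OF AU]) simp
      finally show ?thesis by (simp only: mult.assoc)
    next
      case False
      have "cmod (Tm N k n) \<le> C * (se k / se n * (h k / h n) * (sqrt (u k) * sqrt (ph n)) * (s n / max (s k) (s n))) * (sqrt (v k) * sqrt (wt n))"
        by (rule C(3)[OF k n False])
      also have "\<dots> \<le> C * (A * (\<theta> ^ ((k - n) + (n - k)) + U k n)) * (sqrt (v k) * sqrt (wt n))"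
        using C(1) k n False Y by (intro mult_right_mono mult_left_mono K) auto
      finally show ?thesis by (simp only: mult.assoc)
    qed
  qed
  obtain C' where C': "\<And>N a. a \<in> \<H> \<Longrightarrow> (\<Sum>n\<in>{n0..N}. (cmod (f a (l n)))\<^sup>2 * w (l n)) \<le> C' * nsq v a"
    using Hilb_bounded[OF W] by blast
  show ?thesis
  proof (rule sufficient_core[OF _ C' CL])
    fix N and x :: "nat \<Rightarrow> real" assume x: "\<And>n. x n \<ge> 0"
    show "(\<Sum>k\<in>{1..N}. (\<Sum>n\<in>{n0..N}. cmod (Tm N k n) * x n)\<^sup>2 / v k)
        \<le> 2 * (C * A)\<^sup>2 * ((2 / (1 - \<theta>))\<^sup>2 + S) * (\<Sum>n\<in>{n0..N}. (x n)\<^sup>2 * w (l n))"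
      using C(1) A by (intro Tm_bounded[of \<theta> "C * A" U] \<theta> U0 T S x) auto
  next
    show "2 * (C * A)\<^sup>2 * ((2 / (1 - \<theta>))\<^sup>2 + S) \<ge> 0" using S0 by (intro mult_nonneg_nonneg add_nonneg_nonneg) auto
  qed
qed

text \<open>With \<open>se\<close> equal to 1 the factor \<open>s n / max (s k) (s n)\<close> gives
  geometric decay for k > n, where \<open>h\<close> and \<open>P\<close> vary too slowly to spoil
  it. For k < n there is no decay, and the power law bounds h k / h n by the powers of
  \<open>P\<close> in the kernel of \<open>schur_up\<close>.\<close>

lemma sufficient_exact:
  assumes W: "\<And>n. (\<Sum>m<n. wt m) * Pt n \<le> B" and n01: "n0 = 1" and C0: "C0 > 0" and \<delta>: "\<delta> > 0"
    and rho: "\<And>m n. 1 \<le> n \<Longrightarrow> n < m \<Longrightarrow> (h m)\<^sup>2 / (h n)\<^sup>2 \<ge> C0 * (Pt m / Pt n) powr (1 - \<delta>)"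
  shows "hilb_invertible_on \<gamma> v (l ` {n0..})"
proof -
  \<comment> \<open>Half of \<delta>, because the law concerns \<open>h^2\<close>; the cap at 1
    keeps t below 1. Reducing \<delta> weakens the law, since
    \<open>Pt n / Pt k \<le> 1\<close>.\<close>
  define t where "t = min \<delta> 1 / 2"
  have t: "0 < t" "t < 1" "2 * t \<le> \<delta>" using \<delta> by (auto simp: t_def)
  obtain Cu where Cu: "Cu > 0" "\<And>n. n \<ge> n0 \<Longrightarrow> sqrt (u n) \<le> Cu * sqrt (wt n)" "\<And>n. n \<ge> n0 \<Longrightarrow> sqrt (wt n) \<le> Cu * sqrt (u n)"
    using sqrt_u_le by blast
  obtain Cp where Cp: "Cp > 0" "\<And>k n. k \<ge> 1 \<Longrightarrow> sqrt (u k) * sqrt (ph n) \<le> Cp * (sqrt (Pt n) / sqrt (Pt k))"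
    using sqrt_u_ph_le by blast
  obtain Cg \<theta> where \<theta>: "Cg > 0" "0 < \<theta>" "\<theta> < 1"
    "\<And>m n. m \<le> n \<Longrightarrow> h n / (sqrt (Pt n) * s n) \<le> Cg * \<theta> ^ (n - m) * (h m / (sqrt (Pt m) * s m))"
    "\<And>m n. m \<le> n \<Longrightarrow> sqrt (Pt n) / (h n * s n) \<le> Cg * \<theta> ^ (n - m) * (sqrt (Pt m) / (h m * s m))"
    "\<And>m n. m \<le> n \<Longrightarrow> 1 / (sqrt (Pt n) * s n) \<le> Cg * \<theta> ^ (n - m) * (1 / (sqrt (Pt m) * s m))"
    using geometric_ratios by blast
  have se1: "se n = 1" for n unfolding se_def using n01 by simp
  define Ch where "Ch = 1 / sqrt C0"
  have Ch: "Ch > 0" using C0 by (simp add: Ch_def)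
  have hk: "h k / h n \<le> Ch * (Pt k powr (1 / 2 - t) * Pt n powr (t - 1 / 2))" if k: "1 \<le> k" "k < n" for k n
  proof -
    define x where "x = Pt n / Pt k"
    have x: "0 < x" "x \<le> 1" using Pt_pos slow.P_antimono[of k n] k by (simp_all add: x_def)
    have "C0 * x powr (1 - 2 * t) \<le> C0 * x powr (1 - \<delta>)"
      using C0 t x by (intro mult_left_mono powr_mono') auto
    also have "\<dots> \<le> (h n / h k)\<^sup>2" using rho[OF k] by (simp add: x_def power_divide)
    finally have "sqrt (C0 * x powr (1 - 2 * t)) \<le> sqrt ((h n / h k)\<^sup>2)" by (rule real_sqrt_le_mono)
    moreover have "sqrt (x powr (1 - 2 * t)) = x powr (1 / 2 - t)"
      using powr_half_sqrt_powr[of x "1 - 2 * t"] x by (simp add: diff_divide_distrib)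
    ultimately have "sqrt C0 * x powr (1 / 2 - t) \<le> h n / h k"
      using h_pos[of n] h_pos[of k] by (simp add: real_sqrt_mult)
    hence "1 / (h n / h k) \<le> 1 / (sqrt C0 * x powr (1 / 2 - t))"
      using C0 x h_pos[of n] h_pos[of k] by (intro divide_left_mono mult_pos_pos) auto
    also have "\<dots> = Ch * (Pt k powr (1 / 2 - t) * Pt n powr (t - 1 / 2))"
    proof -
      have "x powr (1 / 2 - t) = Pt n powr (1 / 2 - t) / Pt k powr (1 / 2 - t)"
        unfolding x_def using Pt_pos[of n] Pt_pos[of k] by (simp add: powr_divide)
      moreover have "Pt n powr (t - 1 / 2) = 1 / Pt n powr (1 / 2 - t)"
        using powr_minus_divide[of "Pt n" "1 / 2 - t"] by simp
      ultimately show ?thesis using Pt_pos[of n] by (simp add: Ch_def)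
    qed
    finally show ?thesis by simp
  qed
  define U where "U k n = (if k < n then sqrt (wt k) * Pt k powr (1 / 2 - t) * (sqrt (p n) * Pt n powr (t - 1 / 2)) else 0)" for k n
  obtain S where S: "S \<ge> 0" "\<And>I J x. finite I \<Longrightarrow> finite J \<Longrightarrow> I \<subseteq> {n0..} \<Longrightarrow> J \<subseteq> {1..} \<Longrightarrow>
      (\<Sum>k\<in>I. (\<Sum>n\<in>J. U k n * x n)\<^sup>2) \<le> S * (\<Sum>n\<in>J. (x n)\<^sup>2)"
    using schur_up[OF W t(1,2), folded U_def] by auto
  have U0: "U k n \<ge> 0" for k n
  proof (cases "k < n")
    case True
    hence "p n > 0" using p_pos[of n] by linarith
    from less_imp_le[OF this] show ?thesis unfolding U_def using wt_nonneg[of k] by (auto intro!: mult_nonneg_nonneg)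
  qed (simp add: U_def)
  define A where "A = 1 + Cp * Cg + Ch * Cu"
  have A: "1 \<le> A" "Cp * Cg \<le> A" "Ch * Cu \<le> A" using Cp(1) \<theta>(1) Ch Cu(1) by (auto simp: A_def)
  have K: "se k / se n * (h k / h n) * (sqrt (u k) * sqrt (ph n)) * (s n / max (s k) (s n)) \<le> A * (\<theta> ^ ((k - n) + (n - k)) + U k n)"
    if k: "k \<ge> 1" and n: "n \<ge> 1" and "k \<noteq> n" for k n
  proof -
    have th0: "\<theta> ^ ((k - n) + (n - k)) \<ge> 0" using \<theta> by simp
    have mx: "max (s k) (s n) > 0" using s_pos[of k] by simp
    have hh: "h k / h n \<ge> 0" using h_pos[of k] h_pos[of n] by simp
    show ?thesis
    proof (cases "k < n")
      case True
      have "(h k / h n) * (sqrt (u k) * sqrt (ph n)) * (s n / max (s k) (s n))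
          \<le> (Ch * (Pt k powr (1 / 2 - t) * Pt n powr (t - 1 / 2))) * ((Cu * sqrt (wt k)) * sqrt (ph n)) * 1"
      proof (intro mult_mono mult_nonneg_nonneg)
        show "h k / h n \<le> Ch * (Pt k powr (1 / 2 - t) * Pt n powr (t - 1 / 2))" by (rule hk[OF k True])
        show "sqrt (u k) \<le> Cu * sqrt (wt k)" using k n01 by (intro Cu(2)) simp
        show "s n / max (s k) (s n) \<le> 1" using mx by simp
        show "0 \<le> s n / max (s k) (s n)" using mx s_pos[of n] by simp
      qed (use Ch Cu(1) wt_nonneg[of k] less_imp_le[OF ph_pos[of n]] less_imp_le[OF u_pos[of k]] in auto)
      also have "\<dots> = Ch * Cu * U k n"
        unfolding U_def if_P[OF True] ph_eq[OF n] by (simp only: mult_ac mult_1_right mult_1_left)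
      also have "\<dots> \<le> A * (\<theta> ^ ((k - n) + (n - k)) + U k n)"
        using A th0 U0[of k n] by (intro mult_mono) auto
      finally show ?thesis unfolding se1 by simp
    next
      case False
      hence nk: "n \<le> k" by simp
      have U: "U k n = 0" using False by (simp add: U_def)
      have "(h k / h n) * (sqrt (u k) * sqrt (ph n)) * (s n / max (s k) (s n))
          \<le> (h k / h n) * (Cp * (sqrt (Pt n) / sqrt (Pt k))) * (s n / s k)"
      proof (rule mult_mono[OF mult_left_mono[OF Cp(2)[OF k] hh]])
        show "s n / max (s k) (s n) \<le> s n / s k" using s_pos[of n] s_pos[of k] by (intro divide_left_mono) auto
        show "0 \<le> s n / max (s k) (s n)" using mx s_pos[of n] by simp
        show "0 \<le> h k / h n * (Cp * (sqrt (Pt n) / sqrt (Pt k)))"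
          using hh Cp(1) less_imp_le[OF Pt_pos[of n]] less_imp_le[OF Pt_pos[of k]]
          by (intro mult_nonneg_nonneg[OF hh]) auto
      qed
      also have "\<dots> = Cp * ((h k / (sqrt (Pt k) * s k)) / (h n / (sqrt (Pt n) * s n)))" by (simp add: mult_ac)
      also have "\<dots> \<le> Cp * (Cg * \<theta> ^ (k - n))"
      proof (rule mult_left_mono)
        have "h n / (sqrt (Pt n) * s n) > 0" using h_pos[of n] Pt_pos[of n] s_pos[of n] by simp
        thus "(h k / (sqrt (Pt k) * s k)) / (h n / (sqrt (Pt n) * s n)) \<le> Cg * \<theta> ^ (k - n)"
          using \<theta>(4)[OF nk] by (simp only: pos_divide_le_eq)
      qed (use Cp(1) in simp)
      also have "\<dots> = Cp * Cg * \<theta> ^ (k - n)" by simp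
      also have "\<dots> \<le> A * \<theta> ^ (k - n)" using A \<theta> by (intro mult_right_mono) auto
      finally show ?thesis unfolding U se1 using nk by simp
    qed
  qed
  show ?thesis
  proof (rule sufficient_of_kernel[OF W less_imp_le[OF \<theta>(2)] \<theta>(3) A(1) S(1) U0])
    show "(\<Sum>k\<in>{1..N}. (\<Sum>n\<in>{n0..N}. U k n * x n)\<^sup>2) \<le> S * (\<Sum>n\<in>{n0..N}. (x n)\<^sup>2)" for N x
      using n01 by (intro S(2)) auto
  qed (use K n01 in auto)
qed

text \<open>The factor \<open>se k / se n\<close> is now s k / s n and replaces \<open>s n\<close>
  by \<open>s k\<close> in the numerator: geometric decay occurs for k < n, and the power law, an
  upper bound this time, serves k > n through \<open>schur_down\<close>.\<close>

lemma sufficient_excess: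
  assumes W: "\<And>n. (\<Sum>m<n. wt m) * Pt n \<le> B" and n00: "n0 = 0" and C0: "C0 > 0" and \<delta>: "\<delta> > 0"
    and rho: "\<And>m n. 1 \<le> n \<Longrightarrow> n < m \<Longrightarrow> (h m)\<^sup>2 / (h n)\<^sup>2 \<le> C0 * (Pt m / Pt n) powr (1 + \<delta>)"
  shows "hilb_invertible_on \<gamma> v (l ` {n0..})"
proof -
  define t where "t = \<delta> / 2"
  have t: "0 < t" using \<delta> by (simp add: t_def)
  obtain Cu where Cu: "Cu > 0" "\<And>n. n \<ge> n0 \<Longrightarrow> sqrt (u n) \<le> Cu * sqrt (wt n)" "\<And>n. n \<ge> n0 \<Longrightarrow> sqrt (wt n) \<le> Cu * sqrt (u n)"
    using sqrt_u_le by blast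
  obtain Cp where Cp: "Cp > 0" "\<And>k n. k \<ge> 1 \<Longrightarrow> sqrt (u k) * sqrt (ph n) \<le> Cp * (sqrt (Pt n) / sqrt (Pt k))"
    using sqrt_u_ph_le by blast
  obtain Cg \<theta> where \<theta>: "Cg > 0" "0 < \<theta>" "\<theta> < 1"
    "\<And>m n. m \<le> n \<Longrightarrow> h n / (sqrt (Pt n) * s n) \<le> Cg * \<theta> ^ (n - m) * (h m / (sqrt (Pt m) * s m))"
    "\<And>m n. m \<le> n \<Longrightarrow> sqrt (Pt n) / (h n * s n) \<le> Cg * \<theta> ^ (n - m) * (sqrt (Pt m) / (h m * s m))"
    "\<And>m n. m \<le> n \<Longrightarrow> 1 / (sqrt (Pt n) * s n) \<le> Cg * \<theta> ^ (n - m) * (1 / (sqrt (Pt m) * s m))"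
    using geometric_ratios by blast
  have ses: "se n = s n" for n unfolding se_def using n00 by simp
  \<comment> \<open>The hypothesis starts at index 1, but the kernel also involves the extra point
    at index 0, where \<open>h 0 = 1\<close>; this constant extends the law to n = 0.\<close>
  define E where "E = (h 1)\<^sup>2 * (Pt 0 / Pt 1) powr (1 + \<delta>)"
  have E0: "E > 0" unfolding E_def using h_pos[of 1] Pt_pos[of 0] Pt_pos[of 1] by simp
  define C1 where "C1 = 1 + C0 + E + C0 * E"
  have CE: "C0 * E > 0" using C0 E0 by simp
  have C1: "C1 > 0" "1 \<le> C1" "C0 \<le> C1" "E \<le> C1" "C0 * E \<le> C1" unfolding C1_def using C0 E0 CE by linarith+
  have hsq: "(h m)\<^sup>2 / (h n)\<^sup>2 \<le> C1 * (Pt m / Pt n) powr (1 + \<delta>)" if nm: "n \<le> m" for m n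
  proof -
    have x0: "(Pt m / Pt n) powr (1 + \<delta>) \<ge> 0" by simp
    consider "n = m" | "n \<ge> 1" "n < m" | "n = 0" "m = 1" | "n = 0" "m > 1" using nm by linarith
    thus ?thesis
    proof cases
      case 1
      thus ?thesis using h_pos[of m] Pt_pos[of m] C1(2) by simp
    next
      case 2
      show ?thesis by (rule order_trans[OF rho[OF 2] mult_right_mono[OF C1(3) x0]])
    next
      case 3
      have "(h 1)\<^sup>2 = E * (Pt 1 / Pt 0) powr (1 + \<delta>)"
        using Pt_pos[of 0] Pt_pos[of 1] by (simp add: E_def powr_divide)
      thus ?thesis using mult_right_mono[OF C1(4) x0] 3 by (simp add: h_def)
    next
      case 4
      have "(h m)\<^sup>2 / (h 1)\<^sup>2 \<le> C0 * (Pt m / Pt 1) powr (1 + \<delta>)" using rho[of 1 m] 4 by simp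
      hence "(h m)\<^sup>2 \<le> C0 * (Pt m / Pt 1) powr (1 + \<delta>) * (h 1)\<^sup>2" using h_pos[of 1] by (simp only: pos_divide_le_eq zero_less_power)
      also have "\<dots> = C0 * E * (Pt m / Pt 0) powr (1 + \<delta>)"
        using Pt_pos[of 0] Pt_pos[of 1] Pt_pos[of m] by (simp add: E_def powr_divide)
      also have "\<dots> \<le> C1 * (Pt m / Pt n) powr (1 + \<delta>)" using mult_right_mono[OF C1(5) x0] 4 by simp
      finally show ?thesis using 4 by (simp add: h_def)
    qed
  qed
  define Ch where "Ch = sqrt C1"
  have Ch: "Ch > 0" using C1 by (simp add: Ch_def)
  have hk: "h k / h n \<le> Ch * (Pt k powr (1 / 2 + t) * Pt n powr (- 1 / 2 - t))" if k: "n < k" for k n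
  proof -
    define x where "x = Pt k / Pt n"
    have x: "0 < x" using Pt_pos by (simp add: x_def)
    have "(h k / h n)\<^sup>2 \<le> C1 * x powr (1 + \<delta>)" using hsq[of n k] k by (simp add: x_def power_divide)
    hence "sqrt ((h k / h n)\<^sup>2) \<le> sqrt (C1 * x powr (1 + \<delta>))" by (rule real_sqrt_le_mono)
    moreover have "sqrt (x powr (1 + \<delta>)) = x powr (1 / 2 + t)"
      using powr_half_sqrt_powr[of x "1 + \<delta>"] x by (simp add: add_divide_distrib t_def)
    ultimately have "h k / h n \<le> Ch * x powr (1 / 2 + t)"
      using h_pos[of n] h_pos[of k] by (simp add: real_sqrt_mult Ch_def)
    moreover have "x powr (1 / 2 + t) = Pt k powr (1 / 2 + t) * Pt n powr (- 1 / 2 - t)"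
    proof -
      have "x powr (1 / 2 + t) = Pt k powr (1 / 2 + t) / Pt n powr (1 / 2 + t)"
        unfolding x_def using Pt_pos[of n] Pt_pos[of k] by (simp add: powr_divide)
      moreover have "Pt n powr (- 1 / 2 - t) = 1 / Pt n powr (1 / 2 + t)"
        using powr_minus_divide[of "Pt n" "1 / 2 + t"] by simp
      ultimately show ?thesis by simp
    qed
    ultimately show ?thesis by simp
  qed
  define U where "U k n = (if n < k then sqrt (wt k) * Pt k powr (1 / 2 + t) * (sqrt (ph n) * Pt n powr (- 1 / 2 - t)) else 0)" for k n
  obtain S where S: "S \<ge> 0" "\<And>I J x. finite I \<Longrightarrow> finite J \<Longrightarrow> I \<subseteq> {n0..} \<Longrightarrow>
      (\<Sum>k\<in>I. (\<Sum>n\<in>J. U k n * x n)\<^sup>2) \<le> S * (\<Sum>n\<in>J. (x n)\<^sup>2)"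
    using schur_down[OF W t, folded U_def] by auto
  have U0: "U k n \<ge> 0" for k n
    unfolding U_def using wt_nonneg[of k] less_imp_le[OF ph_pos[of n]] by (auto intro!: mult_nonneg_nonneg)
  define A where "A = 1 + Cp * Cg + Ch * Cu"
  have A: "1 \<le> A" "Cp * Cg \<le> A" "Ch * Cu \<le> A" using Cp(1) \<theta>(1) Ch Cu(1) by (auto simp: A_def)
  have K: "se k / se n * (h k / h n) * (sqrt (u k) * sqrt (ph n)) * (s n / max (s k) (s n)) \<le> A * (\<theta> ^ ((k - n) + (n - k)) + U k n)"
    if k: "k \<ge> 1" and kn: "k \<noteq> n" for k n
  proof -
    have th0: "\<theta> ^ ((k - n) + (n - k)) \<ge> 0" using \<theta> by simp
    have mx: "max (s k) (s n) > 0" using s_pos[of k] by simp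
    have hh: "h k / h n \<ge> 0" using h_pos[of k] h_pos[of n] by simp
    have split: "se k / se n * (h k / h n) * (sqrt (u k) * sqrt (ph n)) * (s n / max (s k) (s n))
        = (h k / h n) * (sqrt (u k) * sqrt (ph n)) * (s k / max (s k) (s n))"
      unfolding ses using s_pos[of n] by simp
    show ?thesis
    proof (cases "n < k")
      case True
      have "(h k / h n) * (sqrt (u k) * sqrt (ph n)) * (s k / max (s k) (s n))
          \<le> (Ch * (Pt k powr (1 / 2 + t) * Pt n powr (- 1 / 2 - t))) * ((Cu * sqrt (wt k)) * sqrt (ph n)) * 1"
      proof (intro mult_mono mult_nonneg_nonneg)
        show "h k / h n \<le> Ch * (Pt k powr (1 / 2 + t) * Pt n powr (- 1 / 2 - t))" by (rule hk[OF True])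
        show "sqrt (u k) \<le> Cu * sqrt (wt k)" using n00 by (intro Cu(2)) simp
        show "s k / max (s k) (s n) \<le> 1" using mx by simp
        show "0 \<le> s k / max (s k) (s n)" using mx s_pos[of k] by simp
      qed (use Ch Cu(1) wt_nonneg[of k] less_imp_le[OF ph_pos[of n]] less_imp_le[OF u_pos[of k]] in auto)
      also have "\<dots> = Ch * Cu * U k n"
        unfolding U_def if_P[OF True] by (simp only: mult_ac mult_1_right mult_1_left)
      also have "\<dots> \<le> A * (\<theta> ^ ((k - n) + (n - k)) + U k n)"
        using A th0 U0[of k n] by (intro mult_mono) auto
      finally show ?thesis unfolding split .
    next
      case False
      hence kn: "k \<le> n" by simp
      have U: "U k n = 0" using False by (simp add: U_def)
      have "(h k / h n) * (sqrt (u k) * sqrt (ph n)) * (s k / max (s k) (s n))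
          \<le> (h k / h n) * (Cp * (sqrt (Pt n) / sqrt (Pt k))) * (s k / s n)"
      proof (rule mult_mono[OF mult_left_mono[OF Cp(2)[OF k] hh]])
        show "s k / max (s k) (s n) \<le> s k / s n" using s_pos[of n] s_pos[of k] by (intro divide_left_mono) auto
        show "0 \<le> s k / max (s k) (s n)" using mx s_pos[of k] by simp
        show "0 \<le> h k / h n * (Cp * (sqrt (Pt n) / sqrt (Pt k)))"
          using hh Cp(1) less_imp_le[OF Pt_pos[of n]] less_imp_le[OF Pt_pos[of k]]
          by (intro mult_nonneg_nonneg[OF hh]) auto
      qed
      also have "\<dots> = Cp * ((sqrt (Pt n) / (h n * s n)) / (sqrt (Pt k) / (h k * s k)))" by (simp add: mult_ac)
      also have "\<dots> \<le> Cp * (Cg * \<theta> ^ (n - k))"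
      proof (rule mult_left_mono)
        have "sqrt (Pt k) / (h k * s k) > 0" using h_pos[of k] Pt_pos[of k] s_pos[of k] by simp
        thus "(sqrt (Pt n) / (h n * s n)) / (sqrt (Pt k) / (h k * s k)) \<le> Cg * \<theta> ^ (n - k)"
          using \<theta>(5)[OF kn] by (simp only: pos_divide_le_eq)
      qed (use Cp(1) in simp)
      also have "\<dots> = Cp * Cg * \<theta> ^ (n - k)" by simp
      also have "\<dots> \<le> A * \<theta> ^ (n - k)" using A \<theta> by (intro mult_right_mono) auto
      finally show ?thesis unfolding U split using kn by simp
    qed
  qed
  \<comment> \<open>By the power law each summand is at most a multiple of \<open>Pt N powr (1 +
    \<delta>) * (ph n * Pt n powr (- 1 - \<delta>))\<close>. The sum over n costs
    \<open>Pt N powr (- \<delta>)\<close>, so O(P_N) remains.\<close>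
  have CL: "(\<lambda>N. \<Sum>n\<in>{n0..N}. 1 / ((cmod (nodal N n))\<^sup>2 * w (l n))) \<longlonglongrightarrow> 0"
  proof -
    obtain C2 where C2: "C2 > 0" "\<And>N n. n \<in> {n0..N} \<Longrightarrow> 1 / cmod (nodal N n) \<le> C2 * (d n / se n) * (h N / h n)"
      using nodal_lower by blast
    obtain C3 where C3: "C3 > 0" "\<And>n. n \<ge> n0 \<Longrightarrow> w (l n) \<le> C3 * u n" "\<And>n. n \<ge> n0 \<Longrightarrow> u n \<le> C3 * w (l n)"
      using weight_comparable by blast
    obtain C4 where C4: "C4 > 0" "\<And>N J. J \<subseteq> {..N} \<Longrightarrow> (\<Sum>n\<in>J. ph n * Pt n powr (- 1 - \<delta>)) \<le> C4 * Pt N powr (- \<delta>)"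
      using sum_ph_powr[OF \<delta>] by blast
    have summand: "1 / ((cmod (nodal N n))\<^sup>2 * w (l n)) \<le> C2\<^sup>2 * C3 * C1 * Pt N powr (1 + \<delta>) * (ph n * Pt n powr (- 1 - \<delta>))"
      if n: "n \<in> {n0..N}" for N n
    proof -
      have wl: "w (l n) > 0" using w_l_pos n by simp
      have "1 / w (l n) \<le> C3 / u n" using C3(3)[of n] n u_pos[of n] wl by (simp add: pos_le_divide_eq pos_divide_le_eq mult.commute)
      also have "\<dots> = C3 * (vh n / (d n)\<^sup>2)" by (simp add: u_def)
      finally have iw: "1 / w (l n) \<le> C3 * (vh n / (d n)\<^sup>2)" .
      have "1 / ((cmod (nodal N n))\<^sup>2 * w (l n)) = (1 / cmod (nodal N n))\<^sup>2 * (1 / w (l n))"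
        by (simp add: power_divide)
      also have "\<dots> \<le> (C2 * (d n / se n) * (h N / h n))\<^sup>2 * (C3 * (vh n / (d n)\<^sup>2))"
        using wl by (intro mult_mono power_mono C2(2) n iw) auto
      also have "\<dots> = C2\<^sup>2 * C3 * ph n * ((h N)\<^sup>2 / (h n)\<^sup>2)"
        unfolding ses ph_def power_mult_distrib power_divide using d_pos[of n] by simp
      also have "\<dots> \<le> C2\<^sup>2 * C3 * ph n * (C1 * (Pt N / Pt n) powr (1 + \<delta>))"
        using C3(1) ph_pos[of n] n by (intro mult_left_mono hsq mult_nonneg_nonneg) auto
      also have "(Pt N / Pt n) powr (1 + \<delta>) = Pt N powr (1 + \<delta>) * Pt n powr (- 1 - \<delta>)"
      proof -
        have "Pt n powr (- 1 - \<delta>) = 1 / Pt n powr (1 + \<delta>)"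
          using powr_minus_divide[of "Pt n" "1 + \<delta>"] by simp
        thus ?thesis using Pt_pos[of n] Pt_pos[of N] by (simp add: powr_divide)
      qed
      finally show ?thesis by (simp add: mult_ac)
    qed
    have le: "(\<Sum>n\<in>{n0..N}. 1 / ((cmod (nodal N n))\<^sup>2 * w (l n))) \<le> C2\<^sup>2 * C3 * C1 * C4 * Pt N" for N
    proof -
      have "(\<Sum>n\<in>{n0..N}. 1 / ((cmod (nodal N n))\<^sup>2 * w (l n)))
          \<le> C2\<^sup>2 * C3 * C1 * Pt N powr (1 + \<delta>) * (\<Sum>n\<in>{n0..N}. ph n * Pt n powr (- 1 - \<delta>))"
        unfolding sum_distrib_left by (rule sum_mono[OF summand])
      also have "\<dots> \<le> C2\<^sup>2 * C3 * C1 * Pt N powr (1 + \<delta>) * (C4 * Pt N powr (- \<delta>))"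
        using C3(1) C1(1) by (intro mult_left_mono C4(2)) auto
      also have "\<dots> = C2\<^sup>2 * C3 * C1 * C4 * (Pt N powr (1 + \<delta>) * Pt N powr (- \<delta>))" by (simp only: mult_ac)
      also have "Pt N powr (1 + \<delta>) * Pt N powr (- \<delta>) = Pt N" using Pt_pos[of N] by (simp flip: powr_add)
      finally show ?thesis .
    qed
    have "(\<lambda>N. C2\<^sup>2 * C3 * C1 * C4 * Pt N) \<longlonglongrightarrow> C2\<^sup>2 * C3 * C1 * C4 * 0"
      by (intro tendsto_intros Pt_tendsto_0)
    hence lim: "(\<lambda>N. C2\<^sup>2 * C3 * C1 * C4 * Pt N) \<longlonglongrightarrow> 0" by simp
    have nonneg: "0 \<le> (\<Sum>n\<in>{n0..N}. 1 / ((cmod (nodal N n))\<^sup>2 * w (l n)))" for N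
      using less_imp_le[OF w_l_pos] by (intro sum_nonneg divide_nonneg_nonneg mult_nonneg_nonneg) auto
    show ?thesis
      by (rule tendsto_sandwich[OF always_eventually[OF allI[OF nonneg]] always_eventually[OF allI[OF le]] tendsto_const lim])
  qed
  show ?thesis
  proof (rule sufficient_of_kernel[OF W less_imp_le[OF \<theta>(2)] \<theta>(3) A(1) S(1) U0])
    show "(\<Sum>k\<in>{1..N}. (\<Sum>n\<in>{n0..N}. U k n * x n)\<^sup>2) \<le> S * (\<Sum>n\<in>{n0..N}. (x n)\<^sup>2)" for N x
      using n00 by (intro S(2)) auto
  qed (rule K CL; assumption)+
qed

end

section \<open>Indexing by integers\<close>

text \<open>Determines the indices of the points in a disc from their number alone; they are
  downward closed because the moduli increase with the index.\<close>

lemma down_closed_int_eq: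
  fixes a :: int
  assumes fin: "finite I" and sub: "I \<subseteq> {a..}" and down: "\<And>i j. j \<in> I \<Longrightarrow> a \<le> i \<Longrightarrow> i \<le> j \<Longrightarrow> i \<in> I"
  shows "I = {a..<a + int (card I)}"
proof (cases "I = {}")
  case False
  define m where "m = Max I"
  have m: "m \<in> I" using fin False by (simp add: m_def)
  have "I = {a..m}"
  proof
    show "I \<subseteq> {a..m}" using sub fin by (auto simp: m_def)
    show "{a..m} \<subseteq> I" using down[OF m] by auto
  qed
  moreover have "a \<le> m" using m sub by auto
  ultimately show ?thesis by auto
qed simp

lemma image_int_atLeast: "(\<lambda>n. F (int n)) ` {k..} = F ` {int k..}"
proof
  show "F ` {int k..} \<subseteq> (\<lambda>n. F (int n)) ` {k..}"
  proof
    fix y assume "y \<in> F ` {int k..}"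
    then obtain i where i: "i \<ge> int k" "y = F i" by auto
    hence "nat i \<in> {k..}" "y = F (int (nat i))" by auto
    thus "y \<in> (\<lambda>n. F (int n)) ` {k..}" by blast
  qed
qed auto

context perturbed
begin

text \<open>Since \<open>n0 \<le> 1\<close>, the product defining \<open>rho\<close> starts at 1 for
  both possible starts.\<close>

lemma rho_eq:
  assumes "\<And>n. l n = lam (int n)"
  shows "rho \<gamma> lam (int n0) (int n) = (h n)\<^sup>2"
proof -
  have "{max 1 (int n0)..int n} = int ` {1..n}" using n0 by (auto simp: image_int_atLeastAtMost)
  hence "rho \<gamma> lam (int n0) (int n) = (\<Prod>m\<in>{1..n}. (g m)\<^sup>2 / (cmod (l m))\<^sup>2)"
    unfolding rho_def by (simp add: prod.reindex assms)
  thus ?thesis by (simp add: h_def prod_dividef prod_power_distrib power_divide)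
qed

lemma W_eq:
  assumes "\<And>n. l n = lam (int n)"
  shows "W \<gamma> v lam (int n0) (int n) = (\<Sum>m<n. wt m)"
proof -
  have "W \<gamma> v lam (int n0) (int n) = (\<Sum>m\<in>{n0..<n}. w (l m))"
    unfolding W_def image_int_atLeastLessThan[symmetric] by (simp add: sum.reindex assms)
  also have "\<dots> = (\<Sum>m<n. wt m)"
    unfolding wt_def by (intro sum.mono_neutral_cong_left) auto
  finally show ?thesis .
qed

lemma necessary:
  assumes lam: "\<And>n. l n = lam (int n)" and inv: "hilb_invertible_on \<gamma> v (l ` {n0..})"
  shows "\<exists>B. \<forall>n\<ge>max 1 (int n0). W \<gamma> v lam (int n0) n * Pt (nat n) \<le> B"
    and "n0 = 1 \<Longrightarrow> \<exists>C>0. \<exists>\<delta>>0. \<forall>m n. max 1 (int n0) \<le> n \<longrightarrow> n < m \<longrightarrow>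
      rho \<gamma> lam (int n0) m / rho \<gamma> lam (int n0) n \<ge> C * (Pt (nat m) / Pt (nat n)) powr (1 - \<delta>)"
    and "n0 = 0 \<Longrightarrow> \<exists>C>0. \<exists>\<delta>>0. \<forall>m n. max 1 (int n0) \<le> n \<longrightarrow> n < m \<longrightarrow>
      rho \<gamma> lam (int n0) m / rho \<gamma> lam (int n0) n \<le> C * (Pt (nat m) / Pt (nat n)) powr (1 + \<delta>)"
proof -
  have nat: "\<exists>k. n = int k \<and> k \<ge> 1" if "max 1 (int n0) \<le> n" for n
    using that by (intro exI[of _ "nat n"]) auto
  obtain B where B: "\<And>n. (\<Sum>m<n. wt m) * Pt n \<le> B" using W_bound[OF inv] by blast
  show "\<exists>B. \<forall>n\<ge>max 1 (int n0). W \<gamma> v lam (int n0) n * Pt (nat n) \<le> B"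
  proof (intro exI allI impI)
    fix n :: int assume "max 1 (int n0) \<le> n"
    then obtain k where k: "n = int k" using nat by blast
    show "W \<gamma> v lam (int n0) n * Pt (nat n) \<le> B" unfolding k W_eq[OF lam] nat_int by (rule B)
  qed
  \<comment> \<open>Both power laws are relations \<open>R\<close> between the same two ratios, so
    one passage from naturals to integers serves both.\<close>
  have transfer: "R (rho \<gamma> lam (int n0) m / rho \<gamma> lam (int n0) n) (Pt (nat m) / Pt (nat n))"
    if R: "\<And>m n. 1 \<le> n \<Longrightarrow> n < m \<Longrightarrow> R ((h m)\<^sup>2 / (h n)\<^sup>2) (Pt m / Pt n)" and n: "max 1 (int n0) \<le> n" and m: "n < m"
    for R :: "real \<Rightarrow> real \<Rightarrow> bool" and m n
  proof -
    obtain k where k: "n = int k" "k \<ge> 1" using nat[OF n] by blast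
    have "max 1 (int n0) \<le> m" using n m by linarith
    then obtain j where j: "m = int j" "j \<ge> 1" using nat by blast
    show ?thesis unfolding k(1) j(1) rho_eq[OF lam] nat_int using R[of k j] k j m by simp
  qed
  show "\<exists>C>0. \<exists>\<delta>>0. \<forall>m n. max 1 (int n0) \<le> n \<longrightarrow> n < m \<longrightarrow>
      rho \<gamma> lam (int n0) m / rho \<gamma> lam (int n0) n \<ge> C * (Pt (nat m) / Pt (nat n)) powr (1 - \<delta>)" if n01: "n0 = 1"
  proof -
    obtain C \<delta> where C: "C > 0" "\<delta> > 0" "\<And>m n. 1 \<le> n \<Longrightarrow> n < m \<Longrightarrow> (h m)\<^sup>2 / (h n)\<^sup>2 \<ge> C * (Pt m / Pt n) powr (1 - \<delta>)"
      using necessary_exact[OF inv n01] by blast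
    show ?thesis
    proof (intro exI conjI allI impI)
      fix m n assume "max 1 (int n0) \<le> n" "n < m"
      thus "rho \<gamma> lam (int n0) m / rho \<gamma> lam (int n0) n \<ge> C * (Pt (nat m) / Pt (nat n)) powr (1 - \<delta>)"
        by (intro transfer[of "\<lambda>x y. x \<ge> C * y powr (1 - \<delta>)"] C(3))
    qed (rule C(1,2))+
  qed
  show "\<exists>C>0. \<exists>\<delta>>0. \<forall>m n. max 1 (int n0) \<le> n \<longrightarrow> n < m \<longrightarrow>
      rho \<gamma> lam (int n0) m / rho \<gamma> lam (int n0) n \<le> C * (Pt (nat m) / Pt (nat n)) powr (1 + \<delta>)" if n00: "n0 = 0"
  proof -
    obtain C \<delta> where C: "C > 0" "\<delta> > 0" "\<And>m n. n < m \<Longrightarrow> (h m)\<^sup>2 / (h n)\<^sup>2 \<le> C * (Pt m / Pt n) powr (1 + \<delta>)"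
      using necessary_excess[OF inv n00] by blast
    show ?thesis
    proof (intro exI conjI allI impI)
      fix m n assume "max 1 (int n0) \<le> n" "n < m"
      thus "rho \<gamma> lam (int n0) m / rho \<gamma> lam (int n0) n \<le> C * (Pt (nat m) / Pt (nat n)) powr (1 + \<delta>)"
        by (intro transfer[of "\<lambda>x y. x \<le> C * y powr (1 + \<delta>)"] C(3))
    qed (rule C(1,2))+
  qed
qed

lemma sufficient:
  assumes lam: "\<And>n. l n = lam (int n)"
    and W: "\<And>n. n \<ge> max 1 (int n0) \<Longrightarrow> W \<gamma> v lam (int n0) n * Pt (nat n) \<le> B"
    and C: "C > 0" "\<delta> > 0"
    and rho: "n0 = 1 \<and> (\<forall>m n. max 1 (int n0) \<le> n \<longrightarrow> n < m \<longrightarrow>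
        rho \<gamma> lam (int n0) m / rho \<gamma> lam (int n0) n \<ge> C * (Pt (nat m) / Pt (nat n)) powr (1 - \<delta>)) \<or>
      n0 = 0 \<and> (\<forall>m n. max 1 (int n0) \<le> n \<longrightarrow> n < m \<longrightarrow>
        rho \<gamma> lam (int n0) m / rho \<gamma> lam (int n0) n \<le> C * (Pt (nat m) / Pt (nat n)) powr (1 + \<delta>))"
  shows "hilb_invertible_on \<gamma> v (l ` {n0..})"
proof -
  have nat: "max 1 (int n0) \<le> int n" if "n \<ge> 1" for n using that n0 by auto
  \<comment> \<open>The maximum with 0 covers n = 0, where the sum is empty.\<close>
  have W': "(\<Sum>m<n. wt m) * Pt n \<le> max 0 B" for n
  proof (cases "n = 0")
    case False
    thus ?thesis using W[OF nat, of n] by (simp add: W_eq[OF lam])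
  qed simp
  from rho show ?thesis
  proof (elim disjE conjE)
    assume n01: "n0 = 1" and r: "\<forall>m n. max 1 (int n0) \<le> n \<longrightarrow> n < m \<longrightarrow>
        rho \<gamma> lam (int n0) m / rho \<gamma> lam (int n0) n \<ge> C * (Pt (nat m) / Pt (nat n)) powr (1 - \<delta>)"
    show ?thesis
    proof (rule sufficient_exact[OF W' n01 C])
      fix m n :: nat assume "1 \<le> n" "n < m"
      thus "(h m)\<^sup>2 / (h n)\<^sup>2 \<ge> C * (Pt m / Pt n) powr (1 - \<delta>)"
        using r[rule_format, OF nat, of n "int m"] by (simp add: rho_eq[OF lam])
    qed
  next
    assume n00: "n0 = 0" and r: "\<forall>m n. max 1 (int n0) \<le> n \<longrightarrow> n < m \<longrightarrow>
        rho \<gamma> lam (int n0) m / rho \<gamma> lam (int n0) n \<le> C * (Pt (nat m) / Pt (nat n)) powr (1 + \<delta>)"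
    show ?thesis
    proof (rule sufficient_excess[OF W' n00 C])
      fix m n :: nat assume "1 \<le> n" "n < m"
      thus "(h m)\<^sup>2 / (h n)\<^sup>2 \<le> C * (Pt m / Pt n) powr (1 + \<delta>)"
        using r[rule_format, OF nat, of n "int m"] by (simp add: rho_eq[OF lam])
    qed
  qed
qed

end

section \<open>Choosing the indexing\<close>

context sparse_weights
begin

text \<open>Membership in \<open>D\<close> bounds |\<lambda>_n - \<gamma>_n|^2 P_n / v_n for large
  n; enlarging the bound covers the finitely many remaining indices.\<close>

lemma perturbed_if_v_perturbation:
  assumes n0: "n0 \<le> 1" and inj: "inj_on lam {int n0..}" and nz: "0 \<notin> lam ` {int n0..}"
    and disj: "lam ` {int n0..} \<inter> \<gamma> ` {1..} = {}" and pert: "v_perturbation \<gamma> v lam (int n0)"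
  obtains M where "perturbed \<gamma> v q (\<lambda>n. lam (int n)) n0 M"
proof -
  obtain M where M: "\<forall>\<^sub>F n in at_top. 1 \<le> n \<and> lam n \<in> D \<gamma> v M (nat n)" using pert by (auto simp: v_perturbation_def)
  have ne: "lam (int n) \<noteq> \<gamma> k" if "n \<ge> n0" "k \<ge> 1" for n k
  proof
    assume "lam (int n) = \<gamma> k"
    moreover have "lam (int n) \<in> lam ` {int n0..}" "\<gamma> k \<in> \<gamma> ` {1..}" using that by auto
    ultimately show False using disj by auto
  qed
  define x where "x n = (cmod (lam (int n) - \<gamma> n))\<^sup>2 * Pt n / v n" for n
  have "\<forall>\<^sub>F n in sequentially. 1 \<le> int n \<and> lam (int n) \<in> D \<gamma> v M (nat (int n))"
    using filterlim_int_sequentially M by (rule eventually_compose_filterlim[rotated])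
  hence "\<forall>\<^sub>F n in sequentially. x n \<le> M"
  proof eventually_elim
    case (elim n)
    hence n: "n \<ge> 1" by simp
    have d: "(cmod (lam (int n) - \<gamma> n))\<^sup>2 > 0" using ne[of n n] n n0 by simp
    have "Pt n \<le> M * v n / (cmod (lam (int n) - \<gamma> n))\<^sup>2" using elim by (simp add: D_def)
    hence "Pt n * (cmod (lam (int n) - \<gamma> n))\<^sup>2 \<le> M * v n" using d by (simp only: pos_le_divide_eq)
    thus ?case unfolding x_def using v_pos[OF n] by (simp only: pos_divide_le_eq mult.commute)
  qed
  then obtain M' where M': "\<And>n. x n \<le> M'" using eventually_le_imp_bounded[of x M] by blast
  show thesis
  proof (rule that[of M'], unfold_locales)
    show "n0 \<le> 1" by (rule n0)
    show "inj_on (\<lambda>n. lam (int n)) {n0..}" using inj_onD[OF inj] by (intro inj_onI) force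
    show "lam (int n) \<noteq> 0" if "n \<ge> n0" for n
    proof
      assume "lam (int n) = 0"
      moreover have "lam (int n) \<in> lam ` {int n0..}" using that by auto
      ultimately show False using nz by simp
    qed
    show "lam (int n) \<noteq> \<gamma> k" if "n \<ge> n0" "k \<ge> 1" for n k by (rule ne[OF that])
    show "(cmod (lam (int n) - \<gamma> n))\<^sup>2 * Pt n \<le> M' * v n" if "n \<ge> 1" for n
      using M'[of n] v_pos[OF that] unfolding x_def by (simp only: pos_divide_le_eq)
  qed
qed

text \<open>The N-th disc eventually contains N + e points, so numbering from 1 - e makes them
  exactly those of index at most N. The N-th annulus then contains \<lambda>_N alone, and the point
  found there by the unit vectors must be \<lambda>_N.\<close>

lemma v_perturbation_if_invertible:
  assumes idx: "is_indexing L lam n0" and disj: "L \<inter> \<gamma> ` {1..} = {}" and inv: "hilb_invertible_on \<gamma> v L"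
  obtains lam' and n0' :: nat where "is_indexing L lam' (int n0')" "n0' \<le> 1" "v_perturbation \<gamma> v lam' (int n0')"
proof -
  interpret L: invertible_on \<gamma> v q L by unfold_locales (rule disj inv)+
  obtain e N1 :: nat and c :: real where e: "e \<le> 1" and c: "c > 0" and N1: "N1 \<ge> 2"
    and fin: "\<And>N. N \<ge> N1 \<Longrightarrow> finite {z\<in>L. cmod z < radius N}"
    and card: "\<And>N. N \<ge> N1 \<Longrightarrow> card {z\<in>L. cmod z < radius N} = N + e"
    and ann: "\<And>N. N \<ge> N1 \<Longrightarrow> \<exists>z\<in>L. radius (N - 1) \<le> cmod z \<and> cmod z < radius N \<and> c \<le> w z * v N / (cmod (z - \<gamma> N))\<^sup>2"
  proof (rule L.eventually_one_per_annulus, goal_cases)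
    case (1 e N1 c)
    show ?case by (rule that) (rule 1; assumption)+
  qed
  define n0' where "n0' = 1 - e"
  define lam' where "lam' n = lam (n + (n0 - int n0'))" for n
  have inj: "inj_on lam {n0..}" and im: "lam ` {n0..} = L" and mono: "\<And>n m. n0 \<le> n \<Longrightarrow> n \<le> m \<Longrightarrow> cmod (lam n) \<le> cmod (lam m)"
    using idx by (auto simp: is_indexing_def)
  have idx': "is_indexing L lam' (int n0')"
    unfolding is_indexing_def
  proof (intro conjI allI impI)
    show "inj_on lam' {int n0'..}"
    proof (rule inj_onI)
      fix x y assume "x \<in> {int n0'..}" "y \<in> {int n0'..}" "lam' x = lam' y"
      thus "x = y" using inj_onD[OF inj, of "x + (n0 - int n0')" "y + (n0 - int n0')"] by (simp add: lam'_def)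
    qed
    have "(\<lambda>n. n + (n0 - int n0')) ` {int n0'..} = {n0..}"
    proof
      show "{n0..} \<subseteq> (\<lambda>n. n + (n0 - int n0')) ` {int n0'..}"
      proof
        fix i assume "i \<in> {n0..}"
        hence "i - (n0 - int n0') \<in> {int n0'..}" "i = (i - (n0 - int n0')) + (n0 - int n0')" by auto
        thus "i \<in> (\<lambda>n. n + (n0 - int n0')) ` {int n0'..}" by blast
      qed
    qed auto
    thus "lam' ` {int n0'..} = L" unfolding lam'_def im[symmetric] by (metis image_image)
    show "cmod (lam' n) \<le> cmod (lam' m)" if "int n0' \<le> n" "n \<le> m" for n m
      unfolding lam'_def using that by (intro mono) auto
  qed
  have inj': "inj_on lam' {int n0'..}" and im': "lam' ` {int n0'..} = L"
    and mono': "\<And>n m. int n0' \<le> n \<Longrightarrow> n \<le> m \<Longrightarrow> cmod (lam' n) \<le> cmod (lam' m)"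
    using idx' by (auto simp: is_indexing_def)
  have below: "cmod (lam' n) < radius N \<longleftrightarrow> n \<le> int N" if N: "N \<ge> N1" and n: "int n0' \<le> n" for n N
  proof -
    define I where "I = {n. int n0' \<le> n \<and> cmod (lam' n) < radius N}"
    have imI: "lam' ` I = {z\<in>L. cmod z < radius N}" unfolding I_def im'[symmetric] by auto
    have injI: "inj_on lam' I" using inj' by (rule inj_on_subset) (auto simp: I_def)
    have finI: "finite I" using fin[OF N] injI unfolding imI[symmetric] by (rule finite_imageD)
    have cardI: "card I = N + e" using card[OF N] card_image[OF injI] unfolding imI by simp
    have "I = {int n0'..<int n0' + int (card I)}"
    proof (rule down_closed_int_eq[OF finI])
      show "I \<subseteq> {int n0'..}" by (auto simp: I_def)
      show "i \<in> I" if "j \<in> I" "int n0' \<le> i" "i \<le> j" for i j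
        using that mono'[of i j] by (auto simp: I_def)
    qed
    hence "I = {int n0'..int N}" unfolding cardI using e by (auto simp: n0'_def)
    hence "n \<in> I \<longleftrightarrow> n \<le> int N" using n by simp
    thus ?thesis using n by (simp add: I_def)
  qed
  \<comment> \<open>One index later than \<open>N1\<close>, because the discs N - 1 and N are both
    used.\<close>
  have inD: "1 \<le> n \<and> lam' n \<in> D \<gamma> v (4 / c) (nat n)" if n: "n \<ge> int (Suc N1)" for n
  proof -
    define N where "N = nat n"
    have N: "n = int N" "N \<ge> Suc N1" using n by (auto simp: N_def)
    obtain z where z: "z \<in> L" "radius (N - 1) \<le> cmod z" "cmod z < radius N" "c \<le> w z * v N / (cmod (z - \<gamma> N))\<^sup>2"
      using ann[of N] N by auto
    obtain k where k: "int n0' \<le> k" "z = lam' k" using z(1) im' by auto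
    have "k \<le> int N" using below[of N k] k z(3) N by simp
    moreover have "\<not> k \<le> int (N - 1)" using below[of "N - 1" k] k z(2) N by simp
    ultimately have kN: "k = n" using N by simp
    have "z \<in> D \<gamma> v (4 / c) N" using N N1 z disj by (intro in_D c) auto
    thus ?thesis using k(2) kN N by simp
  qed
  have "v_perturbation \<gamma> v lam' (int n0')"
    unfolding v_perturbation_def using inD by (intro exI[of _ "4 / c"] eventually_at_top_linorderI[of "int (Suc N1)"])
  thus thesis using that[OF idx'] by (simp add: n0'_def)
qed

end

text \<open>The right-hand side quantifies over reindexings because the excess, the perturbation
  property and the products \<rho> refer to a suitably chosen start, whereas invertibility and the
  Bessel weights depend on the point set alone.\<close>

theorem theorem6:
  fixes \<gamma> :: "nat \<Rightarrow> complex" and v :: "nat \<Rightarrow> real"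
    and lam :: "int \<Rightarrow> complex" and n0 :: int
  assumes gamma_inj: "inj_on \<gamma> {1..}"
    and gamma_nz: "\<forall>n\<ge>1. \<gamma> n \<noteq> 0"
    and gamma_lac: "\<exists>q>1. \<forall>n\<ge>1. cmod (\<gamma> (n + 1)) \<ge> q * cmod (\<gamma> n)"
    and v_pos: "\<forall>n\<ge>1. v n > 0"
    and v_sum: "(\<lambda>n. v n / (1 + (cmod (\<gamma> n))\<^sup>2)) summable_on {1..}"
    and lam_idx: "is_indexing (lam ` {n0..}) lam n0"
    and lam_nz: "\<forall>n\<ge>n0. lam n \<noteq> 0"
    and lam_disj: "lam ` {n0..} \<inter> \<gamma> ` {1..} = {}"
    and small: "(\<lambda>n. v n / (cmod (\<gamma> n))\<^sup>2) \<in> o(\<lambda>n. P \<gamma> v n)"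
  shows "Hdisc_invertible \<gamma> v lam n0 (\<lambda>n. bessel_weight \<gamma> v (lam n)) \<longleftrightarrow>
    (\<exists>lam' n0'. is_indexing (lam ` {n0..}) lam' n0' \<and>
       (\<exists>B. \<forall>n\<ge>max 1 n0'. W \<gamma> v lam' n0' n * P \<gamma> v (nat n) \<le> B) \<and>
       ((n0' = 1 \<and> v_perturbation \<gamma> v lam' n0' \<and>
          (\<exists>C>0. \<exists>\<delta>>0. \<forall>m n. max 1 n0' \<le> n \<longrightarrow> n < m \<longrightarrow>
             rho \<gamma> lam' n0' m / rho \<gamma> lam' n0' n
               \<ge> C * (P \<gamma> v (nat m) / P \<gamma> v (nat n)) powr (1 - \<delta>)))
        \<or>
        (n0' = 0 \<and> v_perturbation \<gamma> v lam' n0' \<and>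
          (\<exists>C>0. \<exists>\<delta>>0. \<forall>m n. max 1 n0' \<le> n \<longrightarrow> n < m \<longrightarrow>
             rho \<gamma> lam' n0' m / rho \<gamma> lam' n0' n
               \<le> C * (P \<gamma> v (nat m) / P \<gamma> v (nat n)) powr (1 + \<delta>)))))"
    (is "?inv \<longleftrightarrow> (\<exists>lam' n0'. ?R lam' n0')")
proof -
  obtain q where q: "q > 1" "\<And>n. n \<ge> 1 \<Longrightarrow> q * cmod (\<gamma> n) \<le> cmod (\<gamma> (Suc n))" using gamma_lac by auto
  interpret sparse_weights \<gamma> v q
    by unfold_locales (use gamma_inj gamma_nz q v_pos v_sum small in blast)+
  define L where "L = lam ` {n0..}"
  have nz: "0 \<notin> L" using lam_nz by (force simp: L_def)
  have disj: "L \<inter> \<gamma> ` {1..} = {}" using lam_disj by (simp add: L_def)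
  have idx: "is_indexing L lam n0" using lam_idx by (simp add: L_def)
  have inv_iff: "?inv \<longleftrightarrow> hilb_invertible_on \<gamma> v L"
    unfolding L_def by (rule Hdisc_invertible_iff) (use lam_idx lam_disj in \<open>auto simp: is_indexing_def\<close>)
  have pert: "\<exists>M. perturbed \<gamma> v q (\<lambda>n. lam' (int n)) n0' M" "(\<lambda>n. lam' (int n)) ` {n0'..} = L"
    if "is_indexing L lam' (int n0')" "n0' \<le> 1" "v_perturbation \<gamma> v lam' (int n0')" for lam' and n0' :: nat
  proof -
    have 1: "inj_on lam' {int n0'..}" "lam' ` {int n0'..} = L" using that(1) by (auto simp: is_indexing_def)
    show "(\<lambda>n. lam' (int n)) ` {n0'..} = L" unfolding image_int_atLeast by (rule 1)
    show "\<exists>M. perturbed \<gamma> v q (\<lambda>n. lam' (int n)) n0' M"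
      using perturbed_if_v_perturbation[OF that(2) 1(1) _ _ that(3)] nz disj unfolding 1(2) by blast
  qed
  show ?thesis
  proof
    assume ?inv
    hence inv: "hilb_invertible_on \<gamma> v L" by (simp only: inv_iff)
    obtain lam' and n0' :: nat where l: "is_indexing L lam' (int n0')" "n0' \<le> 1" "v_perturbation \<gamma> v lam' (int n0')"
      using v_perturbation_if_invertible[OF idx disj inv] by blast
    obtain M where "perturbed \<gamma> v q (\<lambda>n. lam' (int n)) n0' M" using pert(1)[OF l] by blast
    then interpret perturbed \<gamma> v q "\<lambda>n. lam' (int n)" n0' M .
    have inv': "hilb_invertible_on \<gamma> v ((\<lambda>n. lam' (int n)) ` {n0'..})" unfolding pert(2)[OF l] by (rule inv)
    have "?R lam' (int n0')"
    proof (intro conjI)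
      show "is_indexing (lam ` {n0..}) lam' (int n0')" using l(1) by (simp add: L_def)
      show "\<exists>B. \<forall>n\<ge>max 1 (int n0'). W \<gamma> v lam' (int n0') n * P \<gamma> v (nat n) \<le> B" by (rule necessary(1)[OF refl inv'])
      consider "n0' = 1" | "n0' = 0" using l(2) by linarith
      thus "int n0' = 1 \<and> v_perturbation \<gamma> v lam' (int n0') \<and>
          (\<exists>C>0. \<exists>\<delta>>0. \<forall>m n. max 1 (int n0') \<le> n \<longrightarrow> n < m \<longrightarrow>
             rho \<gamma> lam' (int n0') m / rho \<gamma> lam' (int n0') n \<ge> C * (P \<gamma> v (nat m) / P \<gamma> v (nat n)) powr (1 - \<delta>)) \<or>
        int n0' = 0 \<and> v_perturbation \<gamma> v lam' (int n0') \<and>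
          (\<exists>C>0. \<exists>\<delta>>0. \<forall>m n. max 1 (int n0') \<le> n \<longrightarrow> n < m \<longrightarrow>
             rho \<gamma> lam' (int n0') m / rho \<gamma> lam' (int n0') n \<le> C * (P \<gamma> v (nat m) / P \<gamma> v (nat n)) powr (1 + \<delta>))"
      proof cases
        case 1
        show ?thesis by (intro disjI1 conjI necessary(2)[OF refl inv' 1] l(3)) (simp add: 1)
      next
        case 2
        show ?thesis by (intro disjI2 conjI necessary(3)[OF refl inv' 2] l(3)) (simp add: 2)
      qed
    qed
    thus "\<exists>lam' n0'. ?R lam' n0'" by blast
  next
    assume "\<exists>lam' n0'. ?R lam' n0'"
    then obtain lam' i where R: "?R lam' i" by blast
    \<comment> \<open>The two alternatives leave only the starts 1 and 0, so the integer start is a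
      natural number at most 1, as \<open>perturbed\<close> requires.\<close>
    hence i: "i = 0 \<or> i = 1" and pi: "v_perturbation \<gamma> v lam' i" by blast+
    define n0' where "n0' = nat i"
    have n0': "i = int n0'" "n0' \<le> 1" using i by (auto simp: n0'_def)
    have l: "is_indexing L lam' (int n0')" "n0' \<le> 1" "v_perturbation \<gamma> v lam' (int n0')"
      using R pi n0' by (auto simp: L_def)
    obtain M where "perturbed \<gamma> v q (\<lambda>n. lam' (int n)) n0' M" using pert(1)[OF l] by blast
    then interpret perturbed \<gamma> v q "\<lambda>n. lam' (int n)" n0' M .
    obtain B where B: "\<And>n. n \<ge> max 1 (int n0') \<Longrightarrow> W \<gamma> v lam' (int n0') n * P \<gamma> v (nat n) \<le> B"
      using R unfolding n0'(1) by blast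
    obtain C \<delta> where C: "C > 0" "\<delta> > 0"
      and rho: "n0' = 1 \<and> (\<forall>m n. max 1 (int n0') \<le> n \<longrightarrow> n < m \<longrightarrow>
             rho \<gamma> lam' (int n0') m / rho \<gamma> lam' (int n0') n \<ge> C * (P \<gamma> v (nat m) / P \<gamma> v (nat n)) powr (1 - \<delta>)) \<or>
        n0' = 0 \<and> (\<forall>m n. max 1 (int n0') \<le> n \<longrightarrow> n < m \<longrightarrow>
             rho \<gamma> lam' (int n0') m / rho \<gamma> lam' (int n0') n \<le> C * (P \<gamma> v (nat m) / P \<gamma> v (nat n)) powr (1 + \<delta>))"
      using R unfolding n0'(1) of_nat_eq_1_iff of_nat_eq_0_iff by blast
    have "hilb_invertible_on \<gamma> v ((\<lambda>n. lam' (int n)) ` {n0'..})" by (rule sufficient[OF refl B C rho])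
    thus ?inv unfolding pert(2)[OF l] by (simp only: inv_iff)
  qed
qed

end
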